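(* Let $(X,r)$ be a finite quantum binomial quadratic set satisfying condition lri, let $n=|X|$, let $\mathbf{k}$ be a field, and let $S=S(X,r)$ be the associated monoid. The following conditions are equivalent: (1) $S$ is a regular Garside monoid. (2) $S$ is a regular quantum monoid. (3) $S$ is a monoid of skew-polynomial type (with respect to some appropriate enumeration of $X$), or equivalently, $\mathcal{A}(\mathbf{k},X,r)$ is a binomial skew-polynomial ring. (4) $(X,r)$ is a set-theoretic solution of the Yang-Baxter equation. Each of these conditions implies that there is a Garside element $\Delta\in S$ such that $(S,\Delta)$ is a comprehensive Garside monoid, and that the group of fractions of $S$ is isomorphic to the group $G=G(X,r)$ (with the same generators and relations). In particular $(G,\Delta)$ is a Garside group.
   Context: **Quadratic sets.** A quadratic set $(X,r)$ is a nonempty set $X$ with a bijection $r:X\times X\to X\times X$, written $r(x,y)=({}^xy,x^y)$. Put $\mathcal{L}_x(y)={}^xy$ and $\mathcal{R}_y(x)=x^y$. The map $r$ is nondegenerate if all $\mathcal{L}_x$ and all $\mathcal{R}_x$ are bijections; involutive if $r^2=\mathrm{id}$; square-free if $r(x,x)=(x,x)$ for all $x$. $(X,r)$ is a quantum binomial set if it is nondegenerate, involutive and square-free. Condition lri: $({}^xy)^x=y={}^x(y^x)$ for all $x,y\in X$. $(X,r)$ is a set-theoretic solution of the Yang-Baxter equation if $r^{12}r^{23}r^{12}=r^{23}r^{12}r^{23}$ on $X^3$, where $r^{12}=r\times \mathrm{id}$, $r^{23}=\mathrm{id}\times r$. **Associated objects.** $\Re=\Re(r)$ is the set of relations $xy=y'x'$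 whenever $r(x,y)=(y',x')$ and $(x,y)\neq(y',x')$ (for involutive $r$ the relations $xy=y'x'$ and $y'x'=xy$ are regarded as one). $S(X,r)=\langle X;\Re(r)\rangle$ is the monoid and $G(X,r)$ the group with generators $X$ and relations $\Re(r)$. $\Re_0=\{xy-y'x' : (xy=y'x')\in\Re\}$ and $\mathcal{A}(\mathbf{k},X,r)=\mathbf{k}\langle X\rangle/(\Re_0)\cong \mathbf{k}S(X,r)$, for a field $\mathbf{k}$. Since the relations preserve length, elements of $S$ have a well-defined length. Write $\langle X\rangle$ for the free monoid on $X$ and identify $X^k$ with words of length $k$. The orbit $\mathcal{O}(\omega)$ of a word $\omega\in X^k$ is its orbit under the group generated by $r^{i\,i+1}=\mathrm{id}_{X^{i-1}}\times r\times \mathrm{id}_{X^{k-i-1}}$, $1\le i\le k-1$; it is the set of all words equal to $\omega$ in $S$. **Square-free and regular elements.** An element $\omega\in S$ is square-free if no word representing it has the form $axxb$ with $x\in X$, $a,b\in\langle X\rangle$. Let $n=|X|$ and let $\omega_0=x_1x_2\cdots x_n$ be a word with pairwise distinct $x_i\in X$ (so $X=\{x_1,\dots,x_n\}$) that represents a square-free element of $S$; order $\langle X\rangle$ by the degree-lexicographic order with $x_1<\cdots<x_n$. If $\omega_0$ is the minimal word in $\mathcal{O}(\omega_0)$, the element $\omega_0$ of $S$ is called regular, and $\omega=x_1\cdots x_n$ is called a regular presentation of any $\omega\in\mathcal{O}(\omega_0)$. **Garside monoids.** A pre-Garside monoid is a pair $(M,\Delta)$, $M$ a monoid, $\Delta\in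 M$, such that the set $\Sigma$ of left divisors of $\Delta$ satisfies: (a) $\Sigma$ is finite, generates $M$, and coincides with the set of right divisors of $\Delta$; (b) if $a,b\in\Sigma$ and $\Delta a=\Delta b$ or $a\Delta=b\Delta$, then $a=b$. $\Delta$ is called the Garside element. $(M,\Delta)$ is a Garside monoid if, in addition, $M$ is atomic and for any two atoms $s,t$ of $M$ the set $\{a\in\Sigma : s\preceq a,\ t\preceq a\}$ has a unique minimal element with respect to $\preceq$, where $s\preceq a$ means $a=s\alpha$ for some $\alpha\in M$. A Garside monoid embeds in its group of fractions, and this group of fractions is called a Garside group. A subset $\Sigma\subset M$ is comprehensive if $1\in\Sigma$ and $M$ has a presentation by generators and relations such that all generators and relators (the elements of $M$ represented by the sides of the defining relations) belong to $\Sigma$. A Garside monoid $(M,\Delta)$ is comprehensive if the set $\Sigma$ of divisors of $\Delta$ is comprehensive. **Regular Garside monoid.** The Garside monoid $S=S(X,r)$ is a regular Garside monoid if (i) $S$ has a Garside element $\Delta$ (so $(S,\Delta)$ is a Garside monoid) with a regular presentation $\Delta=x_1x_2\cdots x_n$, and (ii) every square-free $a\in S$ of length $\le n$ is a left and a right divisor of $\Delta$. **Regular quantum monoid.** Enumerate $X=\{x_1,\dots,x_n\}$. The Koszul dual $\mathcal{A}^!$ of $\mathcal{A}=\mathcal{A}(\mathbf{k},X,r)$ is the graded algebra generated by $\xi_1,\dots,\xi_n$ with relations $\xi_j\xi_i+\xi_{i'}\xi_{j'}=0$ whenever $x_jx_i-x_{i'}x_{j'}\in\Re_0$, and $\xi_i^2=0$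 for $1\le i\le n$. A graded algebra $A=\bigoplus_{i\ge0}A_i$ is Frobenius of dimension $n$ if $\dim A_n=1$, $A_i=0$ for $i>n$, and for all $0\le j\le n$ the multiplication map $A_j\otimes A_{n-j}\to A_n$ is a nondegenerate pairing. If $\mathcal{A}^!$ is Frobenius of dimension $n$, then $S$ contains a unique square-free element $W$ of length $n$, namely the one whose corresponding monomial in the $\xi_i$ spans the socle $\mathcal{A}^!_n$; $W$ is called the principal monomial of $S$. $S$ is a regular quantum monoid if $\mathcal{A}^!$ is Frobenius of dimension $n$ and $W$ has a regular presentation $W=x_1\cdots x_n$ (with respect to some enumeration of $X$). **Skew-polynomial type.** $S=\langle X;\Re\rangle$ is of skew-polynomial type with respect to the enumeration $x_1<\cdots<x_n$ of $X$ if $\Re$ consists of $\binom n2$ relations $x_jx_i=x_{i'}x_{j'}$ with $1\le i<j\le n$, $1\le i'<j'\le n$, such that (i) each monomial $xy$ with $x\ne y$ occurs in exactly one relation, and no $xx$ occurs; (ii) in each such relation $j>i'$; (iii) $\Re_0$ is a Gröbner basis of the ideal $(\Re_0)$ with respect to the degree-lexicographic order on $\langle X\rangle$. The algebra $\mathcal{A}(\mathbf{k},X,r)$ is a binomial skew-polynomial ring if, for some enumeration of $X$, its defining relations $\Re_0$ have the form $x_jx_i-x_{i'}x_{j'}$ satisfying these same conditions. *)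

theory Defs
  imports
    "HOL-Algebra.Algebraic_Closure_Type"
    "HOL-Algebra.Embedded_Algebras"
    "HOL-Algebra.QuotRing"
    "HOL-Library.Poly_Mapping"
begin

section \<open>Quadratic sets\<close>

text \<open>The underlying set of a quadratic set is the universe of the type \<open>'x\<close>, so it is
  automatically nonempty. With \<open>r (x, y) = (l_act r x y, r_act r y x)\<close>, \<open>l_act r x\<close> is the map
  $\mathcal{L}_x$ and \<open>r_act r y\<close> is the map $\mathcal{R}_y$.\<close>

type_synonym 'x quad_map = "'x \<times> 'x \<Rightarrow> 'x \<times> 'x"

definition l_act :: "'x quad_map \<Rightarrow> 'x \<Rightarrow> 'x \<Rightarrow> 'x" where
  "l_act r x y = fst (r (x, y))"

definition r_act :: "'x quad_map \<Rightarrow> 'x \<Rightarrow> 'x \<Rightarrow> 'x" where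
  "r_act r y x = snd (r (x, y))"

definition quadratic_set :: "'x quad_map \<Rightarrow> bool" where
  "quadratic_set r \<longleftrightarrow> bij r"

definition nondegenerate :: "'x quad_map \<Rightarrow> bool" where
  "nondegenerate r \<longleftrightarrow> (\<forall>x. bij (l_act r x) \<and> bij (r_act r x))"

definition involutive :: "'x quad_map \<Rightarrow> bool" where
  "involutive r \<longleftrightarrow> r \<circ> r = id"

definition square_free_map :: "'x quad_map \<Rightarrow> bool" where
  "square_free_map r \<longleftrightarrow> (\<forall>x. r (x, x) = (x, x))"

definition quantum_binomial_set :: "'x quad_map \<Rightarrow> bool" where
  "quantum_binomial_set r \<longleftrightarrow>
     quadratic_set r \<and> nondegenerate r \<and> involutive r \<and> square_free_map r"

definition lri :: "'x quad_map \<Rightarrow> bool" where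
  "lri r \<longleftrightarrow> (\<forall>x y. r_act r x (l_act r x y) = y \<and> l_act r x (r_act r x y) = y)"

definition r12 :: "'x quad_map \<Rightarrow> 'x \<times> 'x \<times> 'x \<Rightarrow> 'x \<times> 'x \<times> 'x" where
  "r12 r = (\<lambda>(x, y, z). let (a, b) = r (x, y) in (a, b, z))"

definition r23 :: "'x quad_map \<Rightarrow> 'x \<times> 'x \<times> 'x \<Rightarrow> 'x \<times> 'x \<times> 'x" where
  "r23 r = (\<lambda>(x, y, z). let (b, c) = r (y, z) in (x, b, c))"

definition yang_baxter :: "'x quad_map \<Rightarrow> bool" where
  "yang_baxter r \<longleftrightarrow> r12 r \<circ> r23 r \<circ> r12 r = r23 r \<circ> r12 r \<circ> r23 r"


section \<open>Monoids and groups given by generators and relations\<close>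

text \<open>The free monoid on \<open>'a\<close> is the set of words \<open>'a list\<close>; \<open>word_cong R\<close> is the least
  congruence on it containing \<open>R\<close>.\<close>

inductive word_cong :: "('a list \<times> 'a list) set \<Rightarrow> 'a list \<Rightarrow> 'a list \<Rightarrow> bool"
  for R :: "('a list \<times> 'a list) set" where
  rel: "(u, v) \<in> R \<Longrightarrow> word_cong R (a @ u @ b) (a @ v @ b)"
| refl: "word_cong R w w"
| sym: "word_cong R u v \<Longrightarrow> word_cong R v u"
| trans: "word_cong R u v \<Longrightarrow> word_cong R v w \<Longrightarrow> word_cong R u w"

definition word_class :: "('a list \<times> 'a list) set \<Rightarrow> 'a list \<Rightarrow> 'a list set" where
  "word_class R w = {v. word_cong R w v}"

definition presented_monoid :: "('a list \<times> 'a list) set \<Rightarrow> 'a list set monoid" where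
  "presented_monoid R =
     \<lparr>carrier = range (word_class R),
      monoid.mult = (\<lambda>A B. \<Union>u\<in>A. \<Union>v\<in>B. word_class R (u @ v)),
      one = word_class R []\<rparr>"

text \<open>The group with generators \<open>'a\<close> and relations \<open>R\<close>, as the monoid generated by letters
  \<open>Inl x\<close> (standing for \<open>x\<close>) and \<open>Inr x\<close> (standing for the inverse of \<open>x\<close>).\<close>

definition group_relations ::
    "('a list \<times> 'a list) set \<Rightarrow> (('a + 'a) list \<times> ('a + 'a) list) set" where
  "group_relations R =
     {(map Inl u, map Inl v) |u v. (u, v) \<in> R}
     \<union> {([Inl x, Inr x], []) |x. True} \<union> {([Inr x, Inl x], []) |x. True}"

definition presented_group :: "('a list \<times> 'a list) set \<Rightarrow> ('a + 'a) list set monoid" where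
  "presented_group R = presented_monoid (group_relations R)"

definition relations :: "'x quad_map \<Rightarrow> ('x list \<times> 'x list) set" where
  "relations r =
     {([x, y], [y', x']) |x y y' x'. r (x, y) = (y', x') \<and> (x, y) \<noteq> (y', x')}"

abbreviation S_monoid :: "'x quad_map \<Rightarrow> 'x list set monoid" where
  "S_monoid r \<equiv> presented_monoid (relations r)"

abbreviation G_group :: "'x quad_map \<Rightarrow> ('x + 'x) list set monoid" where
  "G_group r \<equiv> presented_group (relations r)"

text \<open>The canonical homomorphism from \<open>S_monoid r\<close> to \<open>G_group r\<close> that sends each generator to
  the generator of the same name; the union is over all representatives and
  all its members coincide.\<close>

definition S_to_G :: "'x quad_map \<Rightarrow> 'x list set \<Rightarrow> ('x + 'x) list set" where
  "S_to_G r a = (\<Union>w\<in>a. word_class (group_relations (relations r)) (map Inl w))"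


section \<open>Orbits, square-free and regular elements\<close>

text \<open>\<open>(u, v) \<in> braid_step r\<close> iff \<open>v\<close> is the image of \<open>u\<close> under some $r^{i\,i+1}$.\<close>

definition braid_step :: "'x quad_map \<Rightarrow> ('x list \<times> 'x list) set" where
  "braid_step r =
     {(a @ [x, y] @ b, a @ [y', x'] @ b) |a b x y y' x'. r (x, y) = (y', x')}"

definition word_orbit :: "'x quad_map \<Rightarrow> 'x list \<Rightarrow> 'x list set" where
  "word_orbit r w = {v. (w, v) \<in> (braid_step r \<union> (braid_step r)\<inverse>)\<^sup>*}"

text \<open>Elements of \<open>S_monoid r\<close> are the sets of words representing them; these words all have the
  same length.\<close>

definition S_length :: "'x list set \<Rightarrow> nat" where
  "S_length a = the_elem (length ` a)"

definition square_free_elem :: "'x list set \<Rightarrow> bool" where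
  "square_free_elem a \<longleftrightarrow> \<not> (\<exists>u x v. u @ [x, x] @ v \<in> a)"

definition enumeration :: "'x list \<Rightarrow> bool" where
  "enumeration xs \<longleftrightarrow> distinct xs \<and> set xs = UNIV"

text \<open>The strict degree-lexicographic order on words for \<open>xs ! 0 < xs ! 1 < \<dots>\<close>.\<close>

definition deglex :: "'x list \<Rightarrow> ('x list \<times> 'x list) set" where
  "deglex xs = lenlex {(xs ! i, xs ! j) |i j. i < j \<and> j < length xs}"

definition regular_presentation :: "'x quad_map \<Rightarrow> 'x list \<Rightarrow> 'x list set \<Rightarrow> bool" where
  "regular_presentation r xs a \<longleftrightarrow>
     enumeration xs \<and> a = word_class (relations r) xs \<and> square_free_elem a \<and>
     (\<forall>w\<in>word_orbit r xs. w = xs \<or> (xs, w) \<in> deglex xs)"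


section \<open>Garside monoids\<close>

definition left_divides :: "('m, 'b) monoid_scheme \<Rightarrow> 'm \<Rightarrow> 'm \<Rightarrow> bool" where
  "left_divides M s a \<longleftrightarrow> (\<exists>c\<in>carrier M. a = s \<otimes>\<^bsub>M\<^esub> c)"

definition right_divides :: "('m, 'b) monoid_scheme \<Rightarrow> 'm \<Rightarrow> 'm \<Rightarrow> bool" where
  "right_divides M s a \<longleftrightarrow> (\<exists>c\<in>carrier M. a = c \<otimes>\<^bsub>M\<^esub> s)"

definition left_divisors :: "('m, 'b) monoid_scheme \<Rightarrow> 'm \<Rightarrow> 'm set" where
  "left_divisors M a = {s \<in> carrier M. left_divides M s a}"

definition right_divisors :: "('m, 'b) monoid_scheme \<Rightarrow> 'm \<Rightarrow> 'm set" where
  "right_divisors M a = {s \<in> carrier M. right_divides M s a}"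

definition word_prod :: "('m, 'b) monoid_scheme \<Rightarrow> 'm list \<Rightarrow> 'm" where
  "word_prod M w = foldr (\<lambda>a b. a \<otimes>\<^bsub>M\<^esub> b) w \<one>\<^bsub>M\<^esub>"

definition generates_monoid :: "('m, 'b) monoid_scheme \<Rightarrow> 'm set \<Rightarrow> bool" where
  "generates_monoid M A \<longleftrightarrow> A \<subseteq> carrier M \<and> carrier M = word_prod M ` lists A"

definition pre_garside_monoid :: "('m, 'b) monoid_scheme \<Rightarrow> 'm \<Rightarrow> bool" where
  "pre_garside_monoid M \<Delta> \<longleftrightarrow>
     Group.monoid M \<and> \<Delta> \<in> carrier M \<and>
     (let \<Sigma> = left_divisors M \<Delta> in
        finite \<Sigma> \<and> generates_monoid M \<Sigma> \<and> \<Sigma> = right_divisors M \<Delta> \<and>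
        (\<forall>a\<in>\<Sigma>. \<forall>b\<in>\<Sigma>. \<Delta> \<otimes>\<^bsub>M\<^esub> a = \<Delta> \<otimes>\<^bsub>M\<^esub> b \<or> a \<otimes>\<^bsub>M\<^esub> \<Delta> = b \<otimes>\<^bsub>M\<^esub> \<Delta> \<longrightarrow> a = b))"

definition atoms :: "('m, 'b) monoid_scheme \<Rightarrow> 'm set" where
  "atoms M = {s \<in> carrier M. s \<noteq> \<one>\<^bsub>M\<^esub> \<and>
     (\<forall>b\<in>carrier M. \<forall>c\<in>carrier M. s = b \<otimes>\<^bsub>M\<^esub> c \<longrightarrow> b = \<one>\<^bsub>M\<^esub> \<or> c = \<one>\<^bsub>M\<^esub>)}"

text \<open>Atomic in the sense of Dehornoy and Paris: generated by the atoms, and for each element the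
  lengths of its decompositions into atoms are bounded.\<close>

definition atomic_monoid :: "('m, 'b) monoid_scheme \<Rightarrow> bool" where
  "atomic_monoid M \<longleftrightarrow>
     generates_monoid M (atoms M) \<and>
     (\<forall>a\<in>carrier M. \<exists>N. \<forall>w\<in>lists (atoms M). word_prod M w = a \<longrightarrow> length w \<le> N)"

definition garside_monoid :: "('m, 'b) monoid_scheme \<Rightarrow> 'm \<Rightarrow> bool" where
  "garside_monoid M \<Delta> \<longleftrightarrow>
     pre_garside_monoid M \<Delta> \<and> atomic_monoid M \<and>
     (\<forall>s\<in>atoms M. \<forall>t\<in>atoms M.
        let B = {a \<in> left_divisors M \<Delta>. left_divides M s a \<and> left_divides M t a}
        in \<exists>!m. m \<in> B \<and> (\<forall>b\<in>B. left_divides M b m \<longrightarrow> b = m))"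

definition is_presentation ::
    "('m, 'b) monoid_scheme \<Rightarrow> 'm set \<Rightarrow> ('m list \<times> 'm list) set \<Rightarrow> bool" where
  "is_presentation M A R \<longleftrightarrow>
     generates_monoid M A \<and> R \<subseteq> lists A \<times> lists A \<and>
     (\<forall>u\<in>lists A. \<forall>v\<in>lists A. word_prod M u = word_prod M v \<longleftrightarrow> word_cong R u v)"

definition comprehensive :: "('m, 'b) monoid_scheme \<Rightarrow> 'm set \<Rightarrow> bool" where
  "comprehensive M \<Sigma> \<longleftrightarrow>
     \<Sigma> \<subseteq> carrier M \<and> \<one>\<^bsub>M\<^esub> \<in> \<Sigma> \<and>
     (\<exists>A R. is_presentation M A R \<and> A \<subseteq> \<Sigma> \<and>
        (\<forall>(u, v)\<in>R. word_prod M u \<in> \<Sigma> \<and> word_prod M v \<in> \<Sigma>))"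

definition comprehensive_garside_monoid :: "('m, 'b) monoid_scheme \<Rightarrow> 'm \<Rightarrow> bool" where
  "comprehensive_garside_monoid M \<Delta> \<longleftrightarrow>
     garside_monoid M \<Delta> \<and> comprehensive M (left_divisors M \<Delta>)"

text \<open>\<open>H\<close> is a group of fractions of \<open>M\<close> via the embedding \<open>j\<close>; both left and right fractions
  exhaust \<open>H\<close>.\<close>

definition group_of_fractions ::
    "('m, 'b) monoid_scheme \<Rightarrow> ('h, 'c) monoid_scheme \<Rightarrow> ('m \<Rightarrow> 'h) \<Rightarrow> bool" where
  "group_of_fractions M H j \<longleftrightarrow>
     Group.group H \<and> j \<in> hom M H \<and> inj_on j (carrier M) \<and>
     carrier H = {j a \<otimes>\<^bsub>H\<^esub> inv\<^bsub>H\<^esub> (j b) |a b. a \<in> carrier M \<and> b \<in> carrier M} \<and>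
     carrier H = {inv\<^bsub>H\<^esub> (j a) \<otimes>\<^bsub>H\<^esub> j b |a b. a \<in> carrier M \<and> b \<in> carrier M}"

text \<open>\<open>(H, \<Delta>)\<close> is a Garside group: \<open>H\<close> is the group of fractions, via \<open>j\<close>, of the Garside monoid
  \<open>(M, \<Delta>)\<close>.\<close>

definition garside_group ::
    "('m, 'b) monoid_scheme \<Rightarrow> 'm \<Rightarrow> ('h, 'c) monoid_scheme \<Rightarrow> ('m \<Rightarrow> 'h) \<Rightarrow> bool" where
  "garside_group M \<Delta> H j \<longleftrightarrow> garside_monoid M \<Delta> \<and> group_of_fractions M H j"

definition regular_garside_monoid :: "'x quad_map \<Rightarrow> bool" where
  "regular_garside_monoid r \<longleftrightarrow>
     (\<exists>\<Delta>\<in>carrier (S_monoid r).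
        garside_monoid (S_monoid r) \<Delta> \<and> (\<exists>xs. regular_presentation r xs \<Delta>) \<and>
        (\<forall>a\<in>carrier (S_monoid r).
           square_free_elem a \<and> S_length a \<le> card (UNIV :: 'x set) \<longrightarrow>
           left_divides (S_monoid r) a \<Delta> \<and> right_divides (S_monoid r) a \<Delta>))"


section \<open>The free associative algebra and its quotients\<close>

text \<open>With concatenation as addition of exponents, \<open>'x list \<Rightarrow>\<^sub>0 'k\<close> is the free
  associative algebra on \<open>'x\<close> over \<open>'k\<close>.\<close>

instantiation list :: (type) monoid_add
begin

definition zero_list :: "'a list" where "zero_list = []"

definition plus_list :: "'a list \<Rightarrow> 'a list \<Rightarrow> 'a list" where "plus_list u v = u @ v"

instance by standard (simp_all add: zero_list_def plus_list_def)

end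

type_synonym ('x, 'k) free_alg = "'x list \<Rightarrow>\<^sub>0 'k"

abbreviation free_algebra :: "('x, 'k::field) free_alg ring" where
  "free_algebra \<equiv> ring_of_type_algebra"

definition word_monomial :: "'x list \<Rightarrow> ('x, 'k::field) free_alg" where
  "word_monomial w = Poly_Mapping.single w 1"

definition quotient_algebra :: "('x, 'k::field) free_alg set \<Rightarrow> ('x, 'k) free_alg set ring" where
  "quotient_algebra F = free_algebra Quot (Idl\<^bsub>free_algebra\<^esub> F)"

definition quotient_proj ::
    "('x, 'k::field) free_alg set \<Rightarrow> ('x, 'k) free_alg \<Rightarrow> ('x, 'k) free_alg set" where
  "quotient_proj F f = (Idl\<^bsub>free_algebra\<^esub> F) +>\<^bsub>free_algebra\<^esub> f"

definition quotient_scalars :: "('x, 'k::field) free_alg set \<Rightarrow> ('x, 'k) free_alg set set" where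
  "quotient_scalars F = quotient_proj F ` range (Poly_Mapping.single [])"

text \<open>Degree \<open>i\<close> component of the quotient, meaningful when \<open>F\<close> consists of homogeneous elements.\<close>

definition quotient_component ::
    "('x, 'k::field) free_alg set \<Rightarrow> nat \<Rightarrow> ('x, 'k) free_alg set set" where
  "quotient_component F i =
     quotient_proj F ` {f. \<forall>w\<in>Poly_Mapping.keys f. length w = i}"

text \<open>\<open>R\<close> is a ring containing the field of scalars \<open>K\<close>, with homogeneous components \<open>A i\<close>.\<close>

definition frobenius_graded :: "('a, 'b) ring_scheme \<Rightarrow> 'a set \<Rightarrow> (nat \<Rightarrow> 'a set) \<Rightarrow> nat \<Rightarrow> bool" where
  "frobenius_graded R K A n \<longleftrightarrow>
     ring.dimension R 1 K (A n) \<and> (\<forall>i>n. A i = {\<zero>\<^bsub>R\<^esub>}) \<and>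
     (\<forall>j\<le>n.
        (\<forall>a\<in>A j. (\<forall>b\<in>A (n - j). a \<otimes>\<^bsub>R\<^esub> b = \<zero>\<^bsub>R\<^esub>) \<longrightarrow> a = \<zero>\<^bsub>R\<^esub>) \<and>
        (\<forall>b\<in>A (n - j). (\<forall>a\<in>A j. a \<otimes>\<^bsub>R\<^esub> b = \<zero>\<^bsub>R\<^esub>) \<longrightarrow> b = \<zero>\<^bsub>R\<^esub>))"

text \<open>The defining relations $\Re_0$ of $\mathcal{A}(\mathbf{k},X,r)$. Since \<open>relations r\<close>
  consists of ordered pairs, for involutive \<open>r\<close> each relation contributes \<open>f\<close> and \<open>- f\<close>.\<close>

definition relations0 :: "'x quad_map \<Rightarrow> ('x, 'k::field) free_alg set" where
  "relations0 r = {word_monomial u - word_monomial v |u v. (u, v) \<in> relations r}"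

text \<open>Defining relations of the Koszul dual; the letter \<open>x\<close> now stands for the dual
  generator $\xi_x$.\<close>

definition koszul_relations :: "'x quad_map \<Rightarrow> ('x, 'k::field) free_alg set" where
  "koszul_relations r =
     {word_monomial u + word_monomial v |u v. (u, v) \<in> relations r} \<union> {word_monomial [x, x] |x. True}"

abbreviation koszul_dual :: "'x quad_map \<Rightarrow> ('x, 'k::field) free_alg set ring" where
  "koszul_dual r \<equiv> quotient_algebra (koszul_relations r)"

definition koszul_dual_frobenius :: "'k::field itself \<Rightarrow> 'x quad_map \<Rightarrow> nat \<Rightarrow> bool" where
  "koszul_dual_frobenius _ r n \<longleftrightarrow>
     (let F = (koszul_relations r :: ('x, 'k) free_alg set) in
      frobenius_graded (koszul_dual r) (quotient_scalars F) (quotient_component F) n)"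

definition principal_monomial :: "'k::field itself \<Rightarrow> 'x quad_map \<Rightarrow> 'x list set \<Rightarrow> bool" where
  "principal_monomial _ r W \<longleftrightarrow>
     (let F = (koszul_relations r :: ('x, 'k) free_alg set); n = card (UNIV :: 'x set) in
      W \<in> carrier (S_monoid r) \<and> square_free_elem W \<and> S_length W = n \<and>
      (\<forall>w\<in>W. ring.Span (koszul_dual r) (quotient_scalars F) [quotient_proj F (word_monomial w)]
               = quotient_component F n))"

definition regular_quantum_monoid :: "'k::field itself \<Rightarrow> 'x quad_map \<Rightarrow> bool" where
  "regular_quantum_monoid k r \<longleftrightarrow>
     koszul_dual_frobenius k r (card (UNIV :: 'x set)) \<and>
     (\<exists>W. principal_monomial k r W \<and> (\<exists>xs. regular_presentation r xs W))"


section \<open>Skew-polynomial type\<close>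

definition leading_monomial :: "'x list \<Rightarrow> ('x, 'k::field) free_alg \<Rightarrow> 'x list" where
  "leading_monomial xs f =
     (THE m. m \<in> Poly_Mapping.keys f \<and>
             (\<forall>u\<in>Poly_Mapping.keys f. u = m \<or> (u, m) \<in> deglex xs))"

text \<open>\<open>F\<close> is a Groebner basis of the two-sided ideal it generates.\<close>

definition groebner_basis :: "'x list \<Rightarrow> ('x, 'k::field) free_alg set \<Rightarrow> bool" where
  "groebner_basis xs F \<longleftrightarrow>
     (\<forall>f\<in>Idl\<^bsub>free_algebra\<^esub> F. f \<noteq> 0 \<longrightarrow>
        (\<exists>g\<in>F. g \<noteq> 0 \<and>
           (\<exists>a b. leading_monomial xs f = a @ leading_monomial xs g @ b)))"

text \<open>Relations \<open>u = v\<close> and \<open>v = u\<close> are regarded as one.\<close>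

definition unordered_relations :: "'x quad_map \<Rightarrow> 'x list set set" where
  "unordered_relations r = {{u, v} |u v. (u, v) \<in> relations r}"

definition skew_polynomial_type :: "'k::field itself \<Rightarrow> 'x quad_map \<Rightarrow> 'x list \<Rightarrow> bool" where
  "skew_polynomial_type _ r xs \<longleftrightarrow>
     enumeration xs \<and>
     card (unordered_relations r) = length xs choose 2 \<and>
     (\<forall>\<rho>\<in>unordered_relations r. \<exists>i j i' j'.
        i < j \<and> j < length xs \<and> i' < j' \<and> j' < length xs \<and>
        \<rho> = {[xs ! j, xs ! i], [xs ! i', xs ! j']} \<and> j > i') \<and>
     (\<forall>x y. x \<noteq> y \<longrightarrow> (\<exists>!\<rho>. \<rho> \<in> unordered_relations r \<and> [x, y] \<in> \<rho>)) \<and>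
     (\<forall>x. \<forall>\<rho>\<in>unordered_relations r. [x, x] \<notin> \<rho>) \<and>
     groebner_basis xs (relations0 r :: ('x, 'k) free_alg set)"

text \<open>The set \<open>F\<close> selects one sign for each of the defining relations.\<close>

definition binomial_skew_polynomial_ring :: "'k::field itself \<Rightarrow> 'x quad_map \<Rightarrow> bool" where
  "binomial_skew_polynomial_ring _ r \<longleftrightarrow>
     (\<exists>xs. enumeration xs \<and>
       (\<exists>F :: ('x, 'k) free_alg set.
         relations0 r = F \<union> uminus ` F \<and>
         card F = length xs choose 2 \<and>
         (\<forall>f\<in>F. \<exists>i j i' j'.
            i < j \<and> j < length xs \<and> i' < j' \<and> j' < length xs \<and>
            f = word_monomial [xs ! j, xs ! i] - word_monomial [xs ! i', xs ! j'] \<and> j > i') \<and>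
         (\<forall>x y. x \<noteq> y \<longrightarrow> (\<exists>!f. f \<in> F \<and> [x, y] \<in> Poly_Mapping.keys f)) \<and>
         (\<forall>x. \<forall>f\<in>F. [x, x] \<notin> Poly_Mapping.keys f) \<and>
         groebner_basis xs F))"

end

theory Submission
  imports Defs "Jordan_Normal_Form.Char_Poly" "HOL-Library.Function_Algebras" "HOL-Library.FuncSet"
    "HOL-Algebra.Sylow" "HOL-Number_Theory.Cong"
begin

text \<open>Under lri, \<open>r (x, y) = (L x y, (L y)\<inverse> x)\<close>. Each of (1)--(3) yields a square-free word of length
  $n$. The heads $L_{x_1} \cdots L_{x_{i-1}} x_i$ of the letters of a square-free word are distinct, so in a
  square-free word of length $n$ the first $n - 1$ heads determine the last one; comparing words that end
  in $xyz$ and in $r(x,y)z$ gives $L_x L_y = L_{x'} L_{y'}$ for $r(x,y) = (x',y')$, which is the braid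
  relation. For a solution, counting heads identifies $S$ with the functions from $X$ to the natural
  numbers; left divisibility becomes the pointwise order, the square-free elements are the functions with
  values in $\{0,1\}$, and $\Delta$ is the constant function 1. A defining relation interchanges two
  neighbouring heads, so the signs of the lists of heads produce functionals that detect a basis of the
  Koszul dual. The enumeration of $X$ needed for regularity and for the Groebner basis comes from Rump's
  theorem that a solution on which the maps $L_x$ generate a transitive group has one element: modulo
  $d$-th powers of the letters, $S$ becomes a finite group with a Hall subgroup for every set of primes, such
  a group is solvable (Wielandt's argument reduces this to Burnside's $p^a q^b$ theorem, proved with the
  group algebra), and its minimal transitive normal subgroups are trivial.\<close>

subsection \<open>Algebraic integers and roots of unity\<close>

text \<open>Once the braid relation holds, head counts settle divisibility, cancellation and the
  Koszul dual, but they produce no enumeration of X in which every relation rewrites a descending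
  pair into a smaller ascending one. Such an enumeration is found by cutting X into two pieces
  stable under the maps L_x, ordering each and concatenating; a cut fails only for a single orbit,
  which is where Rump's theorem enters. For it, d is chosen with L_x^d = id for all x. Then x^d acts
  trivially, and counts modulo d put a second group structure on (Z/d)^A. A product adds to one
  function a permuted copy of the other, so the functions divisible by the prime-to-pi part of d
  form a subgroup: the Hall subgroups are inherited from the additive structure. Solvability is used
  in the form that sections compatible with these subgroups are not perfect, the form that its
  induction on the index proves. Transitivity passes from M to a smaller normal subgroup N because a
  generator fixes its own letter: if it commutes with M modulo N, it moves each letter exactly as
  some element of N does.\<close>

lemma integer_matrix_eigenvalue:
  fixes x :: complex and v :: "'i \<Rightarrow> complex" and M :: "'i \<Rightarrow> 'i \<Rightarrow> int"
  assumes fin: "finite I" and nz: "i0 \<in> I" "v i0 \<noteq> 0"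
    and ev: "\<And>i. i \<in> I \<Longrightarrow> x * v i = (\<Sum>j\<in>I. of_int (M i j) * v j)"
  obtains F :: "int poly" where "monic F" "poly (of_int_poly F) x = 0"
    and "\<And>y::complex. poly (of_int_poly F) y = 0 \<Longrightarrow>
           \<exists>u. (\<exists>i\<in>I. u i \<noteq> 0) \<and> (\<forall>i\<in>I. y * u i = (\<Sum>j\<in>I. of_int (M i j) * u j))"
proof -
  define n where "n = card I"
  obtain e where bij: "bij_betw e {..<n} I"
    using ex_bij_betw_nat_finite[OF fin] by (auto simp: n_def atLeast0LessThan)
  define A where "A = mat n n (\<lambda>(a, b). M (e a) (e b))"
  have A: "A \<in> carrier_mat n n" by (simp add: A_def)
  define B :: "complex mat" where "B = map_mat of_int A"
  have B: "B \<in> carrier_mat n n" by (simp add: B_def A)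
  have act: "(B *\<^sub>v vec n (\<lambda>a. u (e a))) $ a = (\<Sum>j\<in>I. of_int (M (e a) j) * u j)" if a: "a < n" for a u
  by (use a B atLeast0LessThan sum.reindex_bij_betw bij in \<open>simp add: scalar_prod_def B_def A_def\<close>)
  have inI: "e a \<in> I" if "a < n" for a using that bij unfolding bij_betw_def by auto
  have onI: "\<exists>a<n. i = e a" if "i \<in> I" for i using that bij unfolding bij_betw_def by auto
  define w where "w = vec n (\<lambda>a. v (e a))"
  obtain a0 where a0: "a0 < n" "i0 = e a0" using onI[OF nz(1)] by auto
  have w0: "w \<noteq> 0\<^sub>v n"
  proof
    assume "w = 0\<^sub>v n"
    hence "w $ a0 = 0" using a0 by simp
    with a0 nz show False by (simp add: w_def)
  qed
  have "B *\<^sub>v w = x \<cdot>\<^sub>v w"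
  by (use eq_vecI B act ev inI in \<open>auto simp: w_def\<close>)
  hence "eigenvector B w x" using w0 B by (auto simp: eigenvector_def w_def)
  hence "eigenvalue B x" unfolding eigenvalue_def by blast
  hence *: "poly (char_poly B) x = 0" using eigenvalue_root_char_poly[OF B] by simp
  have **: "char_poly B = of_int_poly (char_poly A)"
    unfolding B_def using of_int_hom.char_poly_hom[OF A] by simp
  show ?thesis
  proof (rule that[of "char_poly A"])
    show "monic (char_poly A)" using degree_monic_char_poly[OF A] by simp
    show "poly (of_int_poly (char_poly A)) x = 0" using * ** by simp
    \<comment> \<open>Every root of the characteristic polynomial is again an eigenvalue of the same
      matrix, so a row-sum estimate bounds all conjugates of \<open>x\<close> at once.\<close>
    fix y :: complex assume "poly (of_int_poly (char_poly A)) y = 0"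
    hence "eigenvalue B y" using eigenvalue_root_char_poly[OF B] ** by simp
    then obtain z where z: "z \<in> carrier_vec n" "z \<noteq> 0\<^sub>v n" "B *\<^sub>v z = y \<cdot>\<^sub>v z"
      using B by (auto simp: eigenvalue_def eigenvector_def)
    define u where "u i = z $ (the_inv_into {..<n} e i)" for i
    have ue: "u (e a) = z $ a" if "a < n" for a
      using that bij by (simp add: u_def bij_betw_def the_inv_into_f_f)
    have zu: "z = vec n (\<lambda>a. u (e a))" using z(1) ue by (intro eq_vecI) auto
    obtain a where a: "a < n" "z $ a \<noteq> 0"
      using z(1,2) by (metis carrier_vecD eq_vecI index_zero_vec(1) index_zero_vec(2))
    have "\<exists>i\<in>I. u i \<noteq> 0" using a ue inI by (metis)
    moreover have "y * u i = (\<Sum>j\<in>I. of_int (M i j) * u j)" if iI: "i \<in> I" for i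
    proof -
      obtain b where b: "b < n" "i = e b" using onI[OF iI] by auto
      have "(B *\<^sub>v z) $ b = y * z $ b" unfolding z(3) using z(1) b(1) by simp
      hence "y * u i = (B *\<^sub>v z) $ b" using ue[OF b(1)] b(2) by simp
      also have "\<dots> = (\<Sum>j\<in>I. of_int (M i j) * u j)" unfolding b(2) act[OF b(1), of u, symmetric] using zu by simp
      finally show ?thesis .
    qed
    ultimately show "\<exists>u. (\<exists>i\<in>I. u i \<noteq> 0) \<and> (\<forall>i\<in>I. y * u i = (\<Sum>j\<in>I. of_int (M i j) * u j))"
      by blast
  qed
qed

lemma algebraic_int_eigenvalue:
  fixes x :: complex and v :: "'i \<Rightarrow> complex" and M :: "'i \<Rightarrow> 'i \<Rightarrow> int"
  assumes "finite I" "i0 \<in> I" "v i0 \<noteq> 0"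
    and "\<And>i. i \<in> I \<Longrightarrow> x * v i = (\<Sum>j\<in>I. of_int (M i j) * v j)"
  shows "algebraic_int x"
  using integer_matrix_eigenvalue[OF assms] unfolding algebraic_int_altdef_ipoly by metis

section \<open>Roots of unity and their averages\<close>

definition root1 :: "nat \<Rightarrow> complex" where
  "root1 m = cis (2 * pi / real m)"

lemma root1_pow: "m > 0 \<Longrightarrow> root1 m ^ m = 1"
  by (simp add: root1_def Complex.DeMoivre)

lemma root1_mod: "m > 0 \<Longrightarrow> root1 m ^ (k mod m) = root1 m ^ k"
  by (metis (no_types) mod_mult_div_eq mult.right_neutral power_add power_mult power_one root1_pow add.commute mult_1)

lemma norm_root1 [simp]: "cmod (root1 m ^ k) = 1"
  by (simp add: root1_def norm_power)

text \<open>Multiplication by a combination of powers of \<open>root1 m\<close> acts on the vector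
  of these powers through a circulant matrix; this regrouping by residues computes its rows.\<close>

lemma sum_group_mod:
  fixes h :: "nat \<Rightarrow> 'b::comm_monoid_add"
  assumes "m > 0"
  shows "(\<Sum>j<m. \<Sum>k | k < m \<and> (i + k) mod m = j. h k) = (\<Sum>k<m. h k)"
proof -
  have "(\<Sum>j<m. \<Sum>k | k \<in> {..<m} \<and> (i + k) mod m = j. h k) = (\<Sum>k<m. h k)"
    using assms by (intro sum.group) auto
  thus ?thesis by simp
qed

text \<open>Division with remainder over the integers works only up to the constant \<open>c\<close>
  of pseudo-division; minimality of the degree kills the remainder.\<close>

lemma int_poly_minimal_dvd:
  fixes p f :: "int poly" and x :: complex
  assumes p0: "p \<noteq> 0" and px: "poly (of_int_poly p) x = 0"
    and min: "\<And>q. q \<noteq> 0 \<Longrightarrow> poly (of_int_poly q) x = 0 \<Longrightarrow> Polynomial.degree p \<le> Polynomial.degree q"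
    and fx: "poly (of_int_poly f) x = 0"
  obtains c h where "c \<noteq> 0" "Polynomial.smult c f = p * h"
proof -
  obtain c q where c: "c \<noteq> 0" and e: "Polynomial.smult c f = p * q + pseudo_mod f p"
    and r: "pseudo_mod f p = 0 \<or> Polynomial.degree (pseudo_mod f p) < Polynomial.degree p"
    using pseudo_mod[OF p0, of f] by blast
  have "poly (of_int_poly (Polynomial.smult c f)) x = 0" using fx by (simp add: hom_distribs)
  hence "poly (of_int_poly (pseudo_mod f p)) x = 0"
    unfolding e using px by (simp add: hom_distribs)
  hence "pseudo_mod f p = 0" using min r by (metis not_le)
  thus ?thesis using that c e by simp
qed

text \<open>The norm argument: all conjugates of an average of roots of unity lie in the unit disc, so the
  constant term of its minimal polynomial is an integer of absolute value less than one.\<close>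

lemma average_of_roots_of_unity:
  fixes n :: "nat \<Rightarrow> nat" and a :: complex
  assumes m: "m > 0" and d: "d > 0" and sum_n: "(\<Sum>k<m. n k) = d"
    and a: "of_nat d * a = (\<Sum>k<m. of_nat (n k) * root1 m ^ k)"
    and alg: "algebraic_int a" and lt: "cmod a < 1"
  shows "a = 0"
proof -
  define P where "P q \<longleftrightarrow> q \<noteq> 0 \<and> poly (of_int_poly q) a = 0" for q :: "int poly"
  obtain f :: "int poly" where f: "monic f" "poly (of_int_poly f) a = 0"
    using alg unfolding algebraic_int_altdef_ipoly by auto
  have "P f" using f by (auto simp: P_def)
  then obtain p0 where p0: "P p0" and min0: "\<And>q. P q \<Longrightarrow> Polynomial.degree p0 \<le> Polynomial.degree q"
    using exists_least_iff[of "\<lambda>k. \<exists>q. P q \<and> Polynomial.degree q = k"] by (metis not_less)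
  obtain c0 h0 where c0: "c0 \<noteq> 0" "Polynomial.smult c0 f = p0 * h0"
    using int_poly_minimal_dvd[of p0 a f] p0 min0 f unfolding P_def by metis
  define p where "p = primitive_part p0"
  have p0eq: "p0 = Polynomial.smult (content p0) p" by (simp add: p_def)
  have cont0: "content p0 \<noteq> 0" using p0 by (simp add: P_def)
  have degp: "Polynomial.degree p = Polynomial.degree p0" by (simp add: p_def)
  have Pp: "P p"
  proof -
    have "poly (of_int_poly p0) a = of_int (content p0) * poly (of_int_poly p) a"
      by (subst p0eq) (simp only: of_int_hom.map_poly_hom_smult poly_smult)
    thus ?thesis using p0 cont0 by (auto simp: P_def p_def)
  qed
  have dvdp: "\<exists>c h. c \<noteq> 0 \<and> Polynomial.smult c g = p * h" if "poly (of_int_poly g) a = 0" for g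
    using int_poly_minimal_dvd[of p a g] Pp min0 that degp unfolding P_def by metis
  have contp: "content p = 1" using p0 by (simp add: p_def P_def)
  \<comment> \<open>Gauss's lemma: in \<open>smult c f = p * h\<close> both \<open>f\<close> and
    \<open>p\<close> have content 1, so \<open>h\<close> has the content of \<open>c\<close>, and
    comparing leading coefficients with the monic \<open>f\<close> makes that of \<open>p\<close> a
    unit.\<close>
  have "\<bar>lead_coeff p\<bar> = 1"
  proof -
    obtain c h where c: "c \<noteq> 0" "Polynomial.smult c f = p * h" using dvdp f by blast
    have contf: "content f = 1"
    by (metis content_dvd_coeff f is_unit_normalize normalize_content)
    have "content h = normalize c"
      using arg_cong[OF c(2), of content] contf contp by (simp add: content_mult)
    hence "h = Polynomial.smult (normalize c) (primitive_part h)" by (metis content_times_primitive_part)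
    hence "Polynomial.smult c f = Polynomial.smult (normalize c) (p * primitive_part h)"
      using c(2) by (metis mult_smult_right)
    hence E: "c * lead_coeff f = normalize c * (lead_coeff p * lead_coeff (primitive_part h))"
      by (metis lead_coeff_mult lead_coeff_smult)
    have "\<bar>c * lead_coeff f\<bar> = \<bar>normalize c * (lead_coeff p * lead_coeff (primitive_part h))\<bar>"
      by (simp only: E)
    hence "\<bar>c\<bar> * 1 = \<bar>c\<bar> * (\<bar>lead_coeff p\<bar> * \<bar>lead_coeff (primitive_part h)\<bar>)"
      unfolding abs_mult using f by simp
    hence "\<bar>lead_coeff p\<bar> * \<bar>lead_coeff (primitive_part h)\<bar> = 1"
      using c by (metis abs_eq_0_iff mult_cancel_left)
    hence "\<bar>lead_coeff p * lead_coeff (primitive_part h)\<bar> = 1" unfolding abs_mult .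
    thus ?thesis by (rule abs_zmult_eq_1)
  qed
  \<comment> \<open>The circulant matrix of multiplication by \<open>of_nat d * a\<close>. Its
    entries are nonnegative integers and every row sums to \<open>d\<close>.\<close>
  define N where "N i j = (\<Sum>k | k < m \<and> (i + k) mod m = j. n k)" for i j
  have rowsum: "(\<Sum>j<m. N i j) = d" for i
    unfolding N_def using sum_group_mod[OF m, of n i] sum_n by simp
  obtain F :: "int poly" where F: "monic F" "poly (of_int_poly F) (of_nat d * a) = 0"
    and Froots: "\<And>y::complex. poly (of_int_poly F) y = 0 \<Longrightarrow>
       \<exists>u. (\<exists>i\<in>{..<m}. u i \<noteq> 0) \<and>
           (\<forall>i\<in>{..<m}. y * u i = (\<Sum>j\<in>{..<m}. of_int (int (N i j)) * u j))"
  proof (rule integer_matrix_eigenvalue[of "{..<m}" 0 "\<lambda>t. root1 m ^ t" "of_nat d * a" "\<lambda>i j. int (N i j)"])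
    fix i assume i: "i \<in> {..<m}"
    have "(\<Sum>j<m. of_int (int (N i j)) * root1 m ^ j)
        = (\<Sum>j<m. \<Sum>k | k < m \<and> (i + k) mod m = j. of_nat (n k) * root1 m ^ ((i + k) mod m))"
      by (intro sum.cong refl) (auto simp: N_def sum_distrib_right intro!: sum.cong)
    also have "\<dots> = (\<Sum>k<m. of_nat (n k) * root1 m ^ ((i + k) mod m))"
      by (rule sum_group_mod[OF m])
    also have "\<dots> = (\<Sum>k<m. of_nat (n k) * root1 m ^ k) * root1 m ^ i"
      using m by (subst sum_distrib_right) (simp add: root1_mod power_add mult_ac)
    also have "\<dots> = of_nat d * a * root1 m ^ i" by (simp only: a)
    finally show "of_nat d * a * root1 m ^ i = (\<Sum>j<m. of_int (int (N i j)) * root1 m ^ j)" by simp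
  qed (use m in auto)
  have Fle: "cmod y \<le> d" if y: "poly (of_int_poly F) y = 0" for y
  proof -
    obtain u where u: "\<exists>i\<in>{..<m}. u i \<noteq> 0"
      and ev: "\<And>i. i < m \<Longrightarrow> y * u i = (\<Sum>j\<in>{..<m}. of_int (int (N i j)) * u j)"
      using Froots[OF y] by (metis lessThan_iff)
    \<comment> \<open>Row-sum estimate: the eigenvector equation is read at an entry of largest
      absolute value.\<close>
    have "(\<lambda>i. cmod (u i)) ` {..<m} \<noteq> {}" using m by auto
    hence "Max ((\<lambda>i. cmod (u i)) ` {..<m}) \<in> (\<lambda>i. cmod (u i)) ` {..<m}" by (intro Max_in) auto
    then obtain i where i: "i < m" "Max ((\<lambda>i. cmod (u i)) ` {..<m}) = cmod (u i)" by blast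
    have le: "cmod (u j) \<le> cmod (u i)" if "j < m" for j
      unfolding i(2)[symmetric] using that by (intro Max_ge) auto
    have pos: "cmod (u i) > 0" using u le by (metis lessThan_iff zero_less_norm_iff order_less_le_trans)
    have "cmod y * cmod (u i) = cmod (\<Sum>j\<in>{..<m}. of_int (int (N i j)) * u j)"
      using ev[OF i(1)] by (metis norm_mult)
    also have "\<dots> \<le> (\<Sum>j\<in>{..<m}. real (N i j) * cmod (u i))"
    proof (rule sum_norm_le)
      fix j assume j: "j \<in> {..<m}"
      have "cmod (of_int (int (N i j)) * u j) = real (N i j) * cmod (u j)" by (simp add: norm_mult)
      also have "\<dots> \<le> real (N i j) * cmod (u i)" using le j by (simp add: mult_left_mono)
      finally show "cmod (of_int (int (N i j)) * u j) \<le> real (N i j) * cmod (u i)" .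
    qed
    also have "\<dots> = real (\<Sum>j<m. N i j) * cmod (u i)" by (simp add: sum_distrib_right)
    finally show ?thesis using pos by (simp only: rowsum mult_le_cancel_right_pos)
  qed
  \<comment> \<open>The roots of \<open>F'\<close> are those of \<open>F\<close> divided by
    \<open>d\<close>. Since \<open>a\<close> is one of them, \<open>p\<close> divides a multiple of
    \<open>F'\<close>, and all conjugates of \<open>a\<close> lie in the closed unit disc.\<close>
  define F' where "F' = pcompose F [:0, int d:]"
  have F': "poly (of_int_poly F') y = poly (of_int_poly F) (of_nat d * y)" for y :: complex
    by (simp add: F'_def of_int_hom.map_poly_pcompose poly_pcompose mult.commute hom_distribs)
  obtain c h where c: "c \<noteq> 0" "Polynomial.smult c F' = p * h" using dvdp[of F'] F F' by auto
  have roots: "cmod y \<le> 1" if "poly (of_int_poly p) y = 0" for y :: complex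
  proof -
    have "poly (of_int_poly (Polynomial.smult c F')) y = 0" unfolding c using that by (simp add: hom_distribs)
    hence "of_int c * poly (of_int_poly F') y = 0"
      by (simp only: of_int_hom.map_poly_hom_smult poly_smult)
    hence "poly (of_int_poly F) (of_nat d * y) = 0" using c(1) F' by simp
    from Fle[OF this] show ?thesis using d by (simp add: norm_mult)
  qed
  obtain as where as: "of_int_poly p = Polynomial.smult (lead_coeff (of_int_poly p)) (\<Prod>b\<leftarrow>as. [:- b, 1:] :: complex poly)"
    using fundamental_theorem_algebra_factorized by metis
  have lc: "cmod (lead_coeff (of_int_poly p)) = 1"
    using \<open>\<bar>lead_coeff p\<bar> = 1\<close> by (simp add: norm_of_int flip: of_int_abs)
  have pol: "poly (of_int_poly p) y = lead_coeff (of_int_poly p) * (\<Prod>b\<leftarrow>as. y - b)" for y :: complex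
    by (subst as) (simp add: poly_prod_list o_def)
  have le1: "cmod b \<le> 1" if "b \<in> set as" for b
    using roots[of b] that pol[of b] by (force simp: prod_list_zero_iff)
  have ain: "a \<in> set as"
    using pol[of a] Pp lc by (force simp: P_def prod_list_zero_iff)
  have prodle: "cmod (\<Prod>b\<leftarrow>bs. 0 - b) \<le> 1" if "\<And>b. b \<in> set bs \<Longrightarrow> cmod b \<le> 1" for bs
    using that by (induction bs) (auto simp: norm_mult intro: mult_le_one)
  obtain bs cs where bc: "as = bs @ a # cs" using ain by (meson split_list)
  have "cmod (poly (of_int_poly p) 0) = cmod (\<Prod>b\<leftarrow>as. 0 - b)" using pol[of 0] lc by (simp add: norm_mult)
  also have "\<dots> = cmod a * (cmod (\<Prod>b\<leftarrow>bs. 0 - b) * cmod (\<Prod>b\<leftarrow>cs. 0 - b))"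
    by (simp add: bc norm_mult)
  also have "\<dots> \<le> cmod a * 1"
    using prodle[of bs] prodle[of cs] le1 bc by (intro mult_left_mono mult_le_one) auto
  also have "\<dots> < 1" using lt by simp
  finally have "\<bar>Polynomial.coeff p 0\<bar> < 1" by (simp add: poly_0_coeff_0 norm_of_int)
  hence p00: "Polynomial.coeff p 0 = 0" by simp
  \<comment> \<open>With constant term 0 the polynomial \<open>p\<close> is divisible by the
    variable; for nonzero \<open>a\<close> the cofactor would be a polynomial of smaller degree
    vanishing at \<open>a\<close>.\<close>
  show "a = 0"
  proof (rule ccontr)
    assume a0: "a \<noteq> 0"
    obtain q where q: "p = pCons 0 q" using p00 by (cases p) auto
    have "q \<noteq> 0" using Pp q by (auto simp: P_def)
    moreover have "poly (of_int_poly q) a = 0"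
      using Pp a0 unfolding P_def q by (simp add: of_int_hom.map_poly_pCons_hom)
    ultimately have "Polynomial.degree p0 \<le> Polynomial.degree q" using min0 P_def by blast
    thus False using degp q \<open>q \<noteq> 0\<close> by simp
  qed
qed

lemma root1_pow_neq_1:
  assumes "0 < t" "t < m"
  shows "root1 m ^ t \<noteq> 1"
proof
  assume "root1 m ^ t = 1"
  hence "cis (real t * (2 * pi / real m)) = 1" by (simp add: root1_def Complex.DeMoivre)
  hence "cos (real t * (2 * pi / real m)) = 1" by (metis cis.sel(1) one_complex.sel(1))
  then obtain i :: int where i: "real t * (2 * pi / real m) = of_int i * 2 * pi" by (auto simp: cos_one_2pi_int)
  hence "real t = of_int i * real m" using assms by (simp add: field_simps)
  hence "int t = i * int m" by (metis of_int_eq_iff of_int_mult of_int_of_nat_eq)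
  hence "int m dvd int t" by simp
  hence "m dvd t" by simp
  thus False using assms by (auto dest: dvd_imp_le)
qed

lemma root1_pow_inj:
  assumes "j < m" "k < m" "root1 m ^ j = root1 m ^ k"
  shows "j = k"
proof -
  have *: "a = b" if "a \<le> b" "b < m" "root1 m ^ a = root1 m ^ b" for a b
  proof (rule ccontr)
    assume "a \<noteq> b"
    have "root1 m ^ b = root1 m ^ a * root1 m ^ (b - a)" by (metis le_add_diff_inverse power_add that(1))
    moreover have "root1 m ^ a \<noteq> 0" by (metis norm_root1 norm_zero zero_neq_one)
    ultimately have "root1 m ^ (b - a) = 1" using that(3) by (metis mult_cancel_left mult.right_neutral)
    thus False using root1_pow_neq_1[of "b - a" m] that \<open>a \<noteq> b\<close> by simp
  qed
  show ?thesis using *[of j k] *[of k j] assms by (cases "j \<le> k") auto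
qed

text \<open>Equality in the triangle inequality forces all terms to have the same direction, and
  distinct powers of \<open>root1 m\<close> with exponent below \<open>m\<close> have different
  directions.\<close>

lemma root1_sum_extremal:
  assumes d: "(\<Sum>k<m. n k) = d" "d > 0"
    and ge: "cmod (\<Sum>k<m. of_nat (n k) * root1 m ^ k) \<ge> real d"
  obtains j where "j < m" "\<And>k. k < m \<Longrightarrow> k \<noteq> j \<Longrightarrow> n k = 0"
proof -
  obtain j where j: "j < m" "n j > 0" using d by (metis bot_nat_0.not_eq_extremum lessThan_iff less_irrefl sum.neutral)
  have "n k = 0" if k: "k < m" "k \<noteq> j" for k
  proof (rule ccontr)
    assume nk: "n k \<noteq> 0"
    define x where "x i = of_nat (n i) * root1 m ^ i" for i
    have nx: "cmod (x i) = real (n i)" for i by (simp add: x_def norm_mult)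
    let ?S = "{..<m} - {j, k}"
    have split: "(\<Sum>i<m. f i) = f j + f k + (\<Sum>i\<in>?S. f i)" for f :: "nat \<Rightarrow> 'z::comm_monoid_add"
    proof -
      have "{..<m} = insert j (insert k ?S)" using j k by auto
      hence "(\<Sum>i<m. f i) = sum f (insert j (insert k ?S))" by simp
      also have "\<dots> = f j + f k + (\<Sum>i\<in>?S. f i)" using k by (simp add: add.assoc)
      finally show ?thesis .
    qed
    have "real d \<le> cmod (x j + x k + (\<Sum>i\<in>?S. x i))" using ge split[of x] by (simp add: x_def)
    also have "\<dots> \<le> cmod (x j + x k) + (\<Sum>i\<in>?S. real (n i))"
      by (rule order_trans[OF norm_triangle_ineq]) (use sum_norm_le[of ?S x "\<lambda>i. real (n i)"] nx in simp)
    finally have "real (n j) + real (n k) \<le> cmod (x j + x k)"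
      using split[of n] d by simp
    \<comment> \<open>The ratio of the two directions. Rotating by \<open>cnj (root1 m ^ k)\<close>
      makes the second term real, and the squared estimate then gives \<open>Re w \<ge> 1\<close>,
      hence \<open>w = 1\<close>.\<close>
    moreover define w where "w = root1 m ^ j * cnj (root1 m ^ k)"
    have kk: "root1 m ^ k * cnj (root1 m ^ k) = 1"
      by (simp only: complex_norm_square[symmetric] norm_root1) simp
    have "(x j + x k) * cnj (root1 m ^ k) = of_nat (n j) * w + of_nat (n k) * (root1 m ^ k * cnj (root1 m ^ k))"
      by (simp add: x_def w_def algebra_simps)
    hence "cmod (x j + x k) * cmod (cnj (root1 m ^ k)) = cmod (of_nat (n j) * w + of_nat (n k))"
      unfolding kk by (metis mult.right_neutral norm_mult)
    hence "cmod (x j + x k) = cmod (of_nat (n j) * w + of_nat (n k))"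
      by (simp only: complex_mod_cnj norm_root1 mult_1_right)
    ultimately have "(real (n j) + real (n k))\<^sup>2 \<le> (cmod (of_nat (n j) * w + of_nat (n k)))\<^sup>2"
      by (intro power_mono) auto
    also have "\<dots> = (real (n j) * Re w + real (n k))\<^sup>2 + (real (n j) * Im w)\<^sup>2"
      by (simp add: cmod_power2)
    also have "\<dots> = (real (n j))\<^sup>2 * ((Re w)\<^sup>2 + (Im w)\<^sup>2) + 2 * real (n j) * real (n k) * Re w + (real (n k))\<^sup>2"
      by (simp add: power2_eq_square algebra_simps)
    also have wn: "(Re w)\<^sup>2 + (Im w)\<^sup>2 = 1"
    proof -
      have "cmod w = 1" by (simp only: w_def norm_mult complex_mod_cnj norm_root1 mult_1_right)
      thus ?thesis by (simp add: cmod_power2[symmetric])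
    qed
    finally have "2 * real (n j) * real (n k) * 1 \<le> 2 * real (n j) * real (n k) * Re w"
      by (simp add: power2_eq_square algebra_simps)
    moreover have "2 * real (n j) * real (n k) > 0" using j nk by simp
    ultimately have "Re w \<ge> 1" by (meson mult_le_cancel_left_pos)
    hence "(Re w)\<^sup>2 \<ge> 1" by (simp add: one_le_power)
    hence "(Im w)\<^sup>2 \<le> 0" using wn by linarith
    hence im: "Im w = 0" by simp
    hence "(Re w)\<^sup>2 = 1" using wn by simp
    hence "Re w = 1" using \<open>Re w \<ge> 1\<close> by (simp add: power2_eq_1_iff)
    hence w1: "w = 1" using im by (simp add: complex_eq_iff)
    have "root1 m ^ j = root1 m ^ j * (root1 m ^ k * cnj (root1 m ^ k))" by (simp only: kk mult_1_right)
    also have "\<dots> = w * root1 m ^ k"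
      by (simp only: w_def mult.assoc mult.commute[of "cnj (root1 m ^ k)"])
    finally have "root1 m ^ j = root1 m ^ k" unfolding w1 by simp
    thus False using root1_pow_inj j k by blast
  qed
  thus thesis using that j by blast
qed

subsection \<open>The group algebra\<close>

interpretation fv: vector_space "(\<lambda>c f x. c * f x) :: complex \<Rightarrow> ('a \<Rightarrow> complex) \<Rightarrow> 'a \<Rightarrow> complex"
  by unfold_locales (auto simp: fun_eq_iff algebra_simps)

interpretation fvp: vector_space_pair
  "(\<lambda>c f x. c * f x) :: complex \<Rightarrow> ('a \<Rightarrow> complex) \<Rightarrow> 'a \<Rightarrow> complex"
  "(\<lambda>c f x. c * f x) :: complex \<Rightarrow> ('a \<Rightarrow> complex) \<Rightarrow> 'a \<Rightarrow> complex"
  by unfold_locales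

lemma fun_sum_apply: "(\<Sum>i\<in>I. f i) x = (\<Sum>i\<in>I. f i x :: complex)"
  by (induction I rule: infinite_finite_induct) auto

lemma subspace_dim_psubset:
  fixes E K :: "('a \<Rightarrow> complex) set"
  assumes "fv.subspace E" "E \<subset> K" "K \<subseteq> fv.span T" "finite T"
  shows "fv.dim E < fv.dim K"
proof -
  obtain B where B: "B \<subseteq> E" "fv.independent B" "E \<subseteq> fv.span B" "card B = fv.dim E"
    by (rule fv.basis_exists)
  obtain C where C: "C \<subseteq> K" "fv.independent C" "K \<subseteq> fv.span C" "card C = fv.dim K"
    by (rule fv.basis_exists)
  obtain v where v: "v \<in> K" "v \<notin> E" using assms by auto
  have "fv.span B \<subseteq> E" using B(1) assms(1) by (simp add: fv.span_minimal)
  hence vB: "v \<notin> fv.span B" using v by auto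
  hence "fv.independent (insert v B)"
    using B(2) by (simp add: fv.independent_insert)
  have fC: "finite C" using fv.independent_span_bound[OF assms(4) C(2)] C(1) assms(3) by auto
  have "insert v B \<subseteq> fv.span C" using v B(1) C(3) assms(2) by auto
  from fv.independent_span_bound[OF fC \<open>fv.independent (insert v B)\<close> this]
  have "finite (insert v B)" "card (insert v B) \<le> card C" by auto
  moreover have "v \<notin> B" using vB fv.span_superset by blast
  ultimately show ?thesis using B C by simp
qed

locale finite_group = group G for G (structure) +
  assumes fin: "finite (carrier G)"
begin

text \<open>The complex group algebra, encoded by functions that vanish off the carrier so that
  equality is equality of functions; \<open>conv\<close> is its product and \<open>dl g\<close> the
  basis element belonging to \<open>g\<close>.\<close>

definition R :: "('a \<Rightarrow> complex) set" where
  "R = {f. \<forall>x. x \<notin> carrier G \<longrightarrow> f x = 0}"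

definition conv :: "('a \<Rightarrow> complex) \<Rightarrow> ('a \<Rightarrow> complex) \<Rightarrow> 'a \<Rightarrow> complex" (infixl "\<star>" 70) where
  "f \<star> g = (\<lambda>x. if x \<in> carrier G then (\<Sum>y\<in>carrier G. f y * g (inv y \<otimes> x)) else 0)"

definition dl :: "'a \<Rightarrow> 'a \<Rightarrow> complex" where
  "dl g = (\<lambda>x. if x = g then 1 else 0)"

lemma sum_left_translate:
  fixes F :: "'a \<Rightarrow> complex"
  assumes "z \<in> carrier G"
  shows "(\<Sum>y\<in>carrier G. F (z \<otimes> y)) = (\<Sum>y\<in>carrier G. F y)"
  by (rule sum.reindex_bij_witness[of _ "\<lambda>y. inv z \<otimes> y" "\<lambda>y. z \<otimes> y"])
    (use assms in \<open>auto simp: m_assoc[symmetric]\<close>)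

lemma sum_right_translate:
  fixes F :: "'a \<Rightarrow> complex"
  assumes "z \<in> carrier G"
  shows "(\<Sum>y\<in>carrier G. F (y \<otimes> z)) = (\<Sum>y\<in>carrier G. F y)"
  by (rule sum.reindex_bij_witness[of _ "\<lambda>y. y \<otimes> inv z" "\<lambda>y. y \<otimes> z"])
    (use assms in \<open>auto simp: m_assoc\<close>)

lemma conv_R [simp]: "f \<star> g \<in> R" by (simp add: R_def conv_def)

lemma dl_R [simp]: "g \<in> carrier G \<Longrightarrow> dl g \<in> R" by (auto simp: R_def dl_def)

lemma R_add [simp]: "f \<in> R \<Longrightarrow> g \<in> R \<Longrightarrow> f + g \<in> R" by (auto simp: R_def)
lemma R_diff [simp]: "f \<in> R \<Longrightarrow> g \<in> R \<Longrightarrow> f - g \<in> R" by (auto simp: R_def)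
lemma R_scale [simp]: "f \<in> R \<Longrightarrow> (\<lambda>x. c * f x) \<in> R" by (auto simp: R_def)
lemma R_zero [simp]: "0 \<in> R" by (auto simp: R_def)

lemma R_ext: "f \<in> R \<Longrightarrow> g \<in> R \<Longrightarrow> (\<And>x. x \<in> carrier G \<Longrightarrow> f x = g x) \<Longrightarrow> f = g"
  by (auto simp: R_def fun_eq_iff) (metis)

lemma conv_add_left: "(f + g) \<star> h = f \<star> h + g \<star> h"
  by (auto simp: conv_def fun_eq_iff algebra_simps sum.distrib)
lemma conv_add_right: "f \<star> (g + h) = f \<star> g + f \<star> h"
  by (auto simp: conv_def fun_eq_iff algebra_simps sum.distrib)
lemma conv_diff_left: "(f - g) \<star> h = f \<star> h - g \<star> h"
  by (auto simp: conv_def fun_eq_iff algebra_simps sum_subtractf)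
lemma conv_diff_right: "f \<star> (g - h) = f \<star> g - f \<star> h"
  by (auto simp: conv_def fun_eq_iff algebra_simps sum_subtractf)
lemma conv_scale_left: "(\<lambda>x. c * f x) \<star> h = (\<lambda>x. c * (f \<star> h) x)"
  by (auto simp: conv_def fun_eq_iff algebra_simps sum_distrib_left)
lemma conv_scale_right: "f \<star> (\<lambda>x. c * h x) = (\<lambda>x. c * (f \<star> h) x)"
  by (auto simp: conv_def fun_eq_iff algebra_simps sum_distrib_left)
lemma conv_zero_left [simp]: "0 \<star> h = 0" by (auto simp: conv_def fun_eq_iff)
lemma conv_zero_right [simp]: "h \<star> 0 = 0" by (auto simp: conv_def fun_eq_iff)
lemma conv_sum_left: "(\<Sum>i\<in>I. f i) \<star> h = (\<Sum>i\<in>I. f i \<star> h)"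
  by (induction I rule: infinite_finite_induct)
    (simp_all only: sum.infinite sum.empty sum.insert conv_zero_left conv_add_left not_False_eq_True)
lemma conv_sum_right: "h \<star> (\<Sum>i\<in>I. f i) = (\<Sum>i\<in>I. h \<star> f i)"
  by (induction I rule: infinite_finite_induct)
    (simp_all only: sum.infinite sum.empty sum.insert conv_zero_right conv_add_right not_False_eq_True)

lemma R_sum: "(\<And>i. i \<in> I \<Longrightarrow> f i \<in> R) \<Longrightarrow> (\<Sum>i\<in>I. f i) \<in> R"
  by (induction I rule: infinite_finite_induct)
    (simp_all only: sum.infinite sum.empty sum.insert R_zero not_False_eq_True, blast intro: R_add)

lemma conv_assoc: "(f \<star> g) \<star> h = f \<star> (g \<star> h)"
proof
  fix x
  show "((f \<star> g) \<star> h) x = (f \<star> (g \<star> h)) x"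
  proof (cases "x \<in> carrier G")
    case True
    have "((f \<star> g) \<star> h) x = (\<Sum>y\<in>carrier G. \<Sum>z\<in>carrier G. f z * g (inv z \<otimes> y) * h (inv y \<otimes> x))"
      using True by (simp add: conv_def sum_distrib_right)
    also have "\<dots> = (\<Sum>z\<in>carrier G. \<Sum>y\<in>carrier G. f z * g (inv z \<otimes> y) * h (inv y \<otimes> x))"
      by (rule sum.swap)
    also have "\<dots> = (\<Sum>z\<in>carrier G. \<Sum>w\<in>carrier G. f z * g (inv z \<otimes> (z \<otimes> w)) * h (inv (z \<otimes> w) \<otimes> x))"
      by (intro sum.cong HOL.refl sum_left_translate[symmetric])
    also have "\<dots> = (\<Sum>z\<in>carrier G. \<Sum>w\<in>carrier G. f z * (g w * h (inv w \<otimes> (inv z \<otimes> x))))"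
      using True by (intro sum.cong HOL.refl) (simp add: m_assoc[symmetric] inv_mult_group)
    also have "\<dots> = (f \<star> (g \<star> h)) x"
      using True by (simp add: conv_def sum_distrib_left)
    finally show ?thesis .
  qed (simp add: conv_def)
qed

lemma conv_dl_left: "g \<in> carrier G \<Longrightarrow> dl g \<star> f = (\<lambda>x. if x \<in> carrier G then f (inv g \<otimes> x) else 0)"
  by (auto simp: conv_def dl_def fun_eq_iff if_distrib[of "\<lambda>c. c * _"] sum.delta[OF fin] cong: if_cong)

lemma conv_dl_right: assumes "g \<in> carrier G"
  shows "f \<star> dl g = (\<lambda>x. if x \<in> carrier G then f (x \<otimes> inv g) else 0)"
proof
  fix x
  have eq: "inv y \<otimes> x = g \<longleftrightarrow> y = x \<otimes> inv g" if "x \<in> carrier G" "y \<in> carrier G" for y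
    using that assms by (metis inv_closed inv_inv inv_solve_left inv_solve_right m_closed inv_mult_group)
  show "(f \<star> dl g) x = (if x \<in> carrier G then f (x \<otimes> inv g) else 0)"
    using assms eq by (auto simp: conv_def dl_def if_distrib[of "\<lambda>c. _ * c"] sum.delta[OF fin] cong: if_cong sum.cong)
qed

lemma conv_dl_dl: assumes "g \<in> carrier G" "h \<in> carrier G" shows "dl g \<star> dl h = dl (g \<otimes> h)"
proof
  fix x
  have "inv g \<otimes> x = h \<longleftrightarrow> x = g \<otimes> h" if "x \<in> carrier G"
    using assms that by (metis inv_solve_left)
  thus "(dl g \<star> dl h) x = dl (g \<otimes> h) x"
    unfolding conv_dl_left[OF assms(1)] using assms by (auto simp: dl_def)
qed

lemma conv_one_left: "f \<in> R \<Longrightarrow> dl \<one> \<star> f = f"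
  by (rule R_ext[OF conv_R]) (auto simp: conv_dl_left)
lemma conv_one_right: "f \<in> R \<Longrightarrow> f \<star> dl \<one> = f"
  by (rule R_ext[OF conv_R]) (auto simp: conv_dl_right)

lemma R_expand: "f \<in> R \<Longrightarrow> f = (\<Sum>g\<in>carrier G. (\<lambda>x. f g * dl g x))"
  by (rule R_ext, assumption, intro R_sum R_scale dl_R)
    (auto simp: fun_sum_apply dl_def if_distrib[of "\<lambda>c. _ * c"] sum.delta'[OF fin] cong: if_cong)

lemma R_span: "R \<subseteq> fv.span (dl ` carrier G)"
proof
  fix f assume "f \<in> R"
  show "f \<in> fv.span (dl ` carrier G)"
    by (subst R_expand[OF \<open>f \<in> R\<close>]) (intro fv.span_sum fv.span_scale fv.span_base imageI)
qed

lemma finite_dl: "finite (dl ` carrier G)" using fin by simp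

definition right_ideal :: "('a \<Rightarrow> complex) set \<Rightarrow> bool" where
  "right_ideal K \<longleftrightarrow> fv.subspace K \<and> K \<subseteq> R \<and> (\<forall>k\<in>K. \<forall>a\<in>R. k \<star> a \<in> K)"

lemma card_pos: "card (carrier G) > 0" using fin by (auto simp: card_gt_0_iff)

text \<open>Maschke: averaging a linear projection onto a right ideal gives an idempotent generator.\<close>

lemma right_ideal_idempotent:
  assumes K: "right_ideal K"
  obtains f where "f \<in> K" "\<And>k. k \<in> K \<Longrightarrow> f \<star> k = k"
proof -
  have sub: "fv.subspace K" and KR: "K \<subseteq> R" and Kr: "\<And>k a. k \<in> K \<Longrightarrow> a \<in> R \<Longrightarrow> k \<star> a \<in> K"
    using K by (auto simp: right_ideal_def)
  have "Vector_Spaces.linear (\<lambda>c f x. c * f x) (\<lambda>c f x. c * f x) (id :: ('a \<Rightarrow> complex) \<Rightarrow> _)"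
    by (rule fv.linear_id)
  from fvp.linear_exists_left_inverse_on[OF this sub]
  obtain p where p: "p ` UNIV \<subseteq> K" "Vector_Spaces.linear (\<lambda>c f x. c * f x) (\<lambda>c f x. c * f x) p"
    "\<forall>v\<in>K. p (id v) = v" by auto
  interpret p: Vector_Spaces.linear "\<lambda>c f x. c * f x" "\<lambda>c f x. c * f x" p by (fact p(2))
  define N where "N = complex_of_nat (card (carrier G))"
  have N0: "N \<noteq> 0" using card_pos by (simp add: N_def)
  \<comment> \<open>The average of \<open>\<lambda>v. p (v \<star> dl h) \<star> dl (inv h)\<close>
    over \<open>h\<close> commutes with right multiplication, so it is left multiplication by its
    value at the unit, and that value is \<open>f\<close>.\<close>
  define f where "f = (\<lambda>x. (1 / N) * (\<Sum>h\<in>carrier G. p (dl h) \<star> dl (inv h)) x)"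
  have pK: "p v \<in> K" for v using p(1) by auto
  have fK: "f \<in> K" unfolding f_def
    by (intro fv.subspace_scale[OF sub] fv.subspace_sum[OF sub] Kr pK) auto
  have "f \<star> k = k" if k: "k \<in> K" for k
  proof -
    have kR: "k \<in> R" using k KR by auto
    have *: "k = (\<Sum>g\<in>carrier G. (\<lambda>x. k g * (p (dl (g \<otimes> h)) \<star> dl (inv h)) x))" if h: "h \<in> carrier G" for h
    proof -
      have "k \<star> dl h = (\<Sum>g\<in>carrier G. (\<lambda>x. k g * dl (g \<otimes> h) x))"
        by (subst R_expand[OF kR]) (use h in \<open>simp add: conv_sum_left conv_scale_left conv_dl_dl\<close>)
      moreover have "p (k \<star> dl h) = k \<star> dl h" using p(3) Kr[OF k] h by simp
      ultimately have "k \<star> dl h = (\<Sum>g\<in>carrier G. (\<lambda>x. k g * p (dl (g \<otimes> h)) x))"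
        by (simp add: p.sum p.scale)
      hence "(k \<star> dl h) \<star> dl (inv h) = (\<Sum>g\<in>carrier G. (\<lambda>x. k g * (p (dl (g \<otimes> h)) \<star> dl (inv h)) x))"
        by (simp add: conv_sum_left conv_scale_left)
      moreover have "(k \<star> dl h) \<star> dl (inv h) = k"
        using h kR by (simp add: conv_assoc conv_dl_dl conv_one_right)
      ultimately show ?thesis by simp
    qed
    have "(\<lambda>x. N * k x) = (\<Sum>h\<in>carrier G. k)" by (simp add: fun_eq_iff fun_sum_apply N_def)
    also have "\<dots> = (\<Sum>h\<in>carrier G. \<Sum>g\<in>carrier G. (\<lambda>x. k g * (p (dl (g \<otimes> h)) \<star> dl (inv h)) x))"
      using * by (rule sum.cong[OF HOL.refl])
    also have "\<dots> = (\<Sum>g\<in>carrier G. \<Sum>h\<in>carrier G. (\<lambda>x. k g * (p (dl (g \<otimes> h)) \<star> dl (inv h)) x))"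
      by (rule sum.swap)
    also have "\<dots> = (\<Sum>g\<in>carrier G. \<Sum>h\<in>carrier G. (\<lambda>x. k g * (p (dl h) \<star> dl (inv h) \<star> dl g) x))"
    proof (rule sum.cong[OF HOL.refl])
      fix g assume g: "g \<in> carrier G"
      show "(\<Sum>h\<in>carrier G. (\<lambda>x. k g * (p (dl (g \<otimes> h)) \<star> dl (inv h)) x)) =
            (\<Sum>h\<in>carrier G. (\<lambda>x. k g * (p (dl h) \<star> dl (inv h) \<star> dl g) x))"
        by (rule sum.reindex_bij_witness[of _ "\<lambda>h. inv g \<otimes> h" "\<lambda>h. g \<otimes> h"])
          (use g in \<open>auto simp: m_assoc[symmetric] conv_assoc conv_dl_dl inv_mult_group\<close>,
            simp add: m_assoc)
    qed
    also have "\<dots> = (\<Sum>h\<in>carrier G. p (dl h) \<star> dl (inv h)) \<star> k"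
      by (subst (2) R_expand[OF kR]) (simp add: conv_sum_right conv_sum_left conv_scale_right
          fun_eq_iff fun_sum_apply sum_distrib_left)
    also have "\<dots> = (\<lambda>x. N * (f \<star> k) x)"
      unfolding f_def conv_scale_left using N0 by simp
    finally show ?thesis using N0 by (auto simp: fun_eq_iff)
  qed
  with fK that show thesis by blast
qed

text \<open>The polynomial \<open>p\<close> in the operator \<open>T\<close>, applied to
  \<open>k\<close>. The bound \<open>n\<close> on the degree is a separate parameter so that sums
  for different polynomials run over the same range.\<close>

definition poly_at :: "(('a \<Rightarrow> complex) \<Rightarrow> 'a \<Rightarrow> complex) \<Rightarrow> nat \<Rightarrow> complex poly \<Rightarrow> ('a \<Rightarrow> complex) \<Rightarrow> 'a \<Rightarrow> complex"
  where "poly_at T n p k = (\<Sum>i\<le>n. (\<lambda>x. Polynomial.coeff p i * (T ^^ i) k x))"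

text \<open>Linear factors of an annihilating polynomial are peeled off: for
  \<open>p = (X - l) q\<close>, either \<open>q\<close> applied to \<open>k0\<close> is a nonzero
  eigenvector for \<open>l\<close>, or \<open>q\<close> is an annihilating polynomial of smaller
  degree.\<close>

lemma eigenvector_in_cyclic:
  assumes K: "fv.subspace K" and bK: "\<And>k. k \<in> K \<Longrightarrow> b \<star> k \<in> K"
    and k0: "k0 \<in> K" "k0 \<noteq> 0"
  shows "p \<noteq> 0 \<Longrightarrow> Polynomial.degree p \<le> n \<Longrightarrow> poly_at ((\<star>) b) n p k0 = 0 \<Longrightarrow>
    \<exists>l k. k \<in> K \<and> k \<noteq> 0 \<and> b \<star> k = (\<lambda>x. l * k x)"
proof (induction n arbitrary: p)
  case 0
  then obtain c where c: "p = [:c:]" "c \<noteq> 0" by (auto elim!: degree_eq_zeroE)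
  hence "k0 = 0" using 0(3) by (auto simp: poly_at_def fun_eq_iff)
  with k0 show ?case by simp
next
  case (Suc n)
  have TK: "(((\<star>) b) ^^ i) k0 \<in> K" for i by (induction i) (use k0 bK in auto)
  have pK: "poly_at ((\<star>) b) m q k0 \<in> K" for m q
    unfolding poly_at_def by (intro fv.subspace_sum[OF K] fv.subspace_scale[OF K] TK)
  show ?case
  proof (cases "Polynomial.degree p \<le> n")
    case True
    hence "poly_at ((\<star>) b) (Suc n) p k0 = poly_at ((\<star>) b) n p k0"
      by (simp add: poly_at_def coeff_eq_0 fun_eq_iff fun_sum_apply)
    thus ?thesis using Suc True by metis
  next
    case False
    hence deg: "Polynomial.degree p = Suc n" using Suc.prems by simp
    hence "\<not> constant (poly p)" by (simp add: constant_degree)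
    then obtain l where "poly p l = 0" using fundamental_theorem_of_algebra by blast
    then obtain q where q: "p = [:- l, 1:] * q" by (auto simp: poly_eq_0_iff_dvd dvd_def)
    have q0: "q \<noteq> 0" using Suc.prems q by auto
    hence dq: "Polynomial.degree q = n" using deg by (simp add: q degree_mult_eq del: mult_pCons_left)
    define y where "y = poly_at ((\<star>) b) n q k0"
    have "poly_at ((\<star>) b) (Suc n) p k0 = b \<star> y - (\<lambda>x. l * y x)"
    proof
      fix x
      have c0: "Polynomial.coeff p 0 = - l * Polynomial.coeff q 0" by (simp add: q)
      have cS: "Polynomial.coeff p (Suc i) = Polynomial.coeff q i - l * Polynomial.coeff q (Suc i)" for i
        by (simp add: q)
      have "poly_at ((\<star>) b) (Suc n) p k0 x = (\<Sum>i\<le>Suc n. Polynomial.coeff p i * (((\<star>) b) ^^ i) k0 x)"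
        by (simp only: poly_at_def fun_sum_apply)
      also have "\<dots> = (\<Sum>i\<le>n. Polynomial.coeff q i * (((\<star>) b) ^^ Suc i) k0 x)
          - l * (\<Sum>i\<le>Suc n. Polynomial.coeff q i * (((\<star>) b) ^^ i) k0 x)"
        unfolding sum.atMost_Suc_shift c0 cS
        by (simp add: algebra_simps sum_subtractf sum_distrib_left del: sum.atMost_Suc)
      also have "(\<Sum>i\<le>Suc n. Polynomial.coeff q i * (((\<star>) b) ^^ i) k0 x) = y x"
        using dq by (simp add: y_def poly_at_def fun_sum_apply coeff_eq_0)
      also have "(\<Sum>i\<le>n. Polynomial.coeff q i * (((\<star>) b) ^^ Suc i) k0 x) = (b \<star> y) x"
        by (simp add: y_def poly_at_def conv_sum_right conv_scale_right fun_sum_apply)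
      finally show "poly_at ((\<star>) b) (Suc n) p k0 x = (b \<star> y - (\<lambda>x. l * y x)) x" by simp
    qed
    hence "b \<star> y - (\<lambda>x. l * y x) = 0" using Suc.prems(3) by metis
    hence ev: "b \<star> y = (\<lambda>x. l * y x)" by (rule right_minus_eq[THEN iffD1])
    show ?thesis
    by (use Suc.IH q0 dq ev pK y_def in blast)
  qed
qed

lemma independent_sequence:
  fixes v :: "nat \<Rightarrow> 'a \<Rightarrow> complex"
  assumes "\<And>i. i \<le> n \<Longrightarrow> v i \<notin> fv.span (v ` {..<i})"
  shows "fv.independent (v ` {..n}) \<and> inj_on v {..n}"
  using assms
proof (induction n)
  case 0
  thus ?case by (auto simp: fv.dependent_single fv.span_empty)
next
  case (Suc n)
  have "v (Suc n) \<notin> fv.span (v ` {..n})" using Suc.prems[of "Suc n"] by (simp add: lessThan_Suc_atMost)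
  thus ?case using Suc fv.span_superset[of "v ` {..n}"]
    by (auto simp: atMost_Suc fv.independent_insert inj_on_insert)
qed

text \<open>The iterates of \<open>k0\<close> under left multiplication by \<open>b\<close> become
  linearly dependent, because the group algebra has finite dimension; the first dependency is a
  monic annihilating polynomial.\<close>

lemma eigenvector_exists:
  assumes K: "fv.subspace K" "K \<subseteq> R" and bK: "\<forall>k\<in>K. b \<star> k \<in> K"
    and k0: "k0 \<in> K" "k0 \<noteq> 0"
  obtains l k where "k \<in> K" "k \<noteq> 0" "b \<star> k = (\<lambda>x. l * k x)"
proof -
  define v where "v i = (((\<star>) b) ^^ i) k0" for i
  have vK: "v i \<in> K" for i unfolding v_def by (induction i) (use k0 bK in auto)
  have "\<exists>i. v i \<in> fv.span (v ` {..<i})"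
  proof (rule ccontr)
    define n where "n = card (carrier G)"
    assume "\<nexists>i. v i \<in> fv.span (v ` {..<i})"
    hence *: "fv.independent (v ` {..n})" "inj_on v {..n}"
      using independent_sequence[of n v] by auto
    have "v ` {..n} \<subseteq> fv.span (dl ` carrier G)" using vK K(2) R_span by auto
    from fv.independent_span_bound[OF finite_dl *(1) this]
    have "card {..n} \<le> card (dl ` carrier G)" using *(2) by (simp add: card_image)
    also have "\<dots> \<le> n" unfolding n_def using fin by (rule card_image_le)
    finally show False by simp
  qed
  then obtain m where m: "v m \<in> fv.span (v ` {..<m})" and mmin: "\<And>i. i < m \<Longrightarrow> v i \<notin> fv.span (v ` {..<i})"
    using exists_least_iff[of "\<lambda>i. v i \<in> fv.span (v ` {..<i})"] by auto
  have inj: "inj_on v {..<m}"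
    using independent_sequence[of "m - 1" v] mmin by (cases m) (auto simp: lessThan_Suc_atMost)
  obtain u where u: "v m = (\<Sum>w\<in>v ` {..<m}. (\<lambda>x. u w * w x))"
    using m by (subst (asm) fv.span_finite) auto
  have u': "v m = (\<Sum>i<m. (\<lambda>x. u (v i) * v i x))" by (subst u, subst sum.reindex[OF inj]) (simp only: o_def)
  define p where "p = Polynomial.monom 1 m - (\<Sum>i<m. Polynomial.monom (u (v i)) i)"
  have cp: "Polynomial.coeff p i = (if i = m then 1 else if i < m then - u (v i) else 0)" for i
  by (simp add: p_def coeff_sum sum.delta)
  have p0: "p \<noteq> 0" using cp[of m] by auto
  have deg: "Polynomial.degree p \<le> m" by (rule degree_le) (simp add: cp)
  have "poly_at ((\<star>) b) m p k0 = 0"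
  proof
    fix x
    have "poly_at ((\<star>) b) m p k0 x = (\<Sum>i\<le>m. Polynomial.coeff p i * v i x)"
      by (simp add: poly_at_def fun_sum_apply v_def)
    also have "\<dots> = v m x + (\<Sum>i<m. Polynomial.coeff p i * v i x)"
      by (simp add: lessThan_Suc_atMost[symmetric] cp)
    also have "\<dots> = 0" by (subst u') (simp add: cp fun_sum_apply sum_negf)
    finally show "poly_at ((\<star>) b) m p k0 x = 0 x" by simp
  qed
  hence "\<exists>l k. k \<in> K \<and> k \<noteq> 0 \<and> b \<star> k = (\<lambda>x. l * k x)"
    by (intro eigenvector_in_cyclic[OF K(1) _ k0 p0 deg] bK[rule_format])
  thus thesis by (elim exE conjE) (rule that)
qed

text \<open>Primitive idempotents in the form given by Schur's lemma over the complex numbers: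
  \<open>e R e\<close> consists of the multiples of \<open>e\<close>. All trace computations use
  primitivity through this scalar condition.\<close>

definition prim :: "('a \<Rightarrow> complex) \<Rightarrow> bool" where
  "prim e \<longleftrightarrow> e \<in> R \<and> e \<noteq> 0 \<and> e \<star> e = e \<and> (\<forall>a\<in>R. \<exists>c. e \<star> a \<star> e = (\<lambda>x. c * e x))"

lemma right_ideal_fixed:
  assumes "e \<in> R" shows "right_ideal {x \<in> R. e \<star> x = x}"
  unfolding right_ideal_def
proof (intro conjI ballI)
  show "fv.subspace {x \<in> R. e \<star> x = x}"
    by (rule fv.subspaceI) (auto simp: conv_add_right conv_scale_right)
  fix k a assume "k \<in> {x \<in> R. e \<star> x = x}" "a \<in> R"
  thus "k \<star> a \<in> {x \<in> R. e \<star> x = x}" by (simp add: conv_assoc[symmetric])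
qed auto

text \<open>A right ideal \<open>K\<close> of least dimension inside \<open>e R\<close> is minimal.
  Its idempotent generator satisfies the scalar condition by Schur's argument: an eigenspace of left
  multiplication by \<open>f a f\<close> on \<open>K\<close> is a nonzero right ideal, hence all of
  \<open>K\<close>.\<close>

lemma prim_exists:
  assumes e: "e \<in> R" "e \<star> e = e" "e \<noteq> 0"
  obtains f where "prim f" "e \<star> f = f" "f \<star> e = f"
proof -
  let ?P = "\<lambda>K. right_ideal K \<and> K \<noteq> {0} \<and> K \<subseteq> {x \<in> R. e \<star> x = x}"
  have "?P {x \<in> R. e \<star> x = x}" using right_ideal_fixed e by auto
  from ex_has_least_nat[of ?P, OF this, of fv.dim]
  obtain K where K: "?P K" and Kmin: "\<And>E. ?P E \<Longrightarrow> fv.dim K \<le> fv.dim E"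
    by blast
  have sub: "fv.subspace K" and KR: "K \<subseteq> R" and Kr: "\<And>k a. k \<in> K \<Longrightarrow> a \<in> R \<Longrightarrow> k \<star> a \<in> K"
    using K by (auto simp: right_ideal_def)
  have min: "E = K" if "?P E" "E \<subseteq> K" for E
  proof (rule ccontr)
    assume "E \<noteq> K"
    hence "fv.dim E < fv.dim K"
      using that KR R_span finite_dl by (intro subspace_dim_psubset[of E K "dl ` carrier G"]) (auto simp: right_ideal_def)
    thus False using Kmin[OF that(1)] by simp
  qed
  obtain f0 where f0: "f0 \<in> K" "\<And>k. k \<in> K \<Longrightarrow> f0 \<star> k = k"
    using right_ideal_idempotent K by blast
  have eK: "e \<star> k = k" if "k \<in> K" for k using K that by auto
  \<comment> \<open>The factor \<open>e\<close> on the right gives \<open>f \<star> e = f\<close>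
    besides \<open>e \<star> f = f\<close>; both are needed for \<open>e - f\<close> to be
    idempotent.\<close>
  define f where "f = f0 \<star> e"
  have fK: "f \<in> K" unfolding f_def using Kr f0 e by simp
  have fk: "f \<star> k = k" if "k \<in> K" for k using that f0 eK by (simp add: f_def conv_assoc)
  have "f \<noteq> 0"
  by (use fk K fv.subspace_0 sub in auto)
  moreover have "f \<star> f = f" using fk fK by simp
  moreover have "\<exists>c. f \<star> a \<star> f = (\<lambda>x. c * f x)" if "a \<in> R" for a
  proof -
    define b where "b = f \<star> a \<star> f"
    have bK: "\<forall>k\<in>K. b \<star> k \<in> K"
      unfolding b_def conv_assoc by (intro ballI Kr[OF fK]) simp
    obtain k0 where "k0 \<in> K" "k0 \<noteq> 0" using \<open>f \<noteq> 0\<close> fK by blast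
    then obtain l k where lk: "k \<in> K" "k \<noteq> 0" "b \<star> k = (\<lambda>x. l * k x)"
      by (rule eigenvector_exists[OF sub KR bK])
    define E where "E = {x \<in> K. b \<star> x = (\<lambda>y. l * x y)}"
    have "fv.subspace E"
    proof (rule fv.subspaceI)
      show "0 \<in> E" unfolding E_def using fv.subspace_0[OF sub] by (simp add: zero_fun_def[symmetric])
    next
      fix x y assume "x \<in> E" "y \<in> E"
      hence x: "x \<in> K" "b \<star> x = (\<lambda>z. l * x z)" and y: "y \<in> K" "b \<star> y = (\<lambda>z. l * y z)"
        by (auto simp: E_def)
      have "b \<star> (x + y) = (\<lambda>z. l * (x + y) z)"
        unfolding conv_add_right x(2) y(2) by (rule ext) (simp add: distrib_left)
      thus "x + y \<in> E" using fv.subspace_add[OF sub x(1) y(1)] unfolding E_def by blast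
    next
      fix c x assume "x \<in> E"
      hence x: "x \<in> K" "b \<star> x = (\<lambda>z. l * x z)" by (auto simp: E_def)
      have "b \<star> (\<lambda>z. c * x z) = (\<lambda>z. l * (c * x z))"
        unfolding conv_scale_right x(2) by (rule ext) simp
      thus "(\<lambda>z. c * x z) \<in> E" using fv.subspace_scale[OF sub x(1)] unfolding E_def by blast
    qed
    moreover have "k \<star> a \<in> E" if "k \<in> E" "a \<in> R" for k a
      using that Kr by (simp add: E_def conv_scale_left conv_assoc[symmetric])
    ultimately have "?P E" using K lk by (auto simp: E_def right_ideal_def)
    hence "E = K" by (rule min) (auto simp: E_def)
    hence "b \<star> f = (\<lambda>y. l * f y)" using fK by (auto simp: E_def)
    moreover have "b \<star> f = b" using \<open>f \<star> f = f\<close> by (simp add: b_def conv_assoc)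
    ultimately show ?thesis unfolding b_def[symmetric] by (intro exI[of _ l]) simp
  qed
  ultimately have "prim f" using fK KR by (auto simp: prim_def)
  moreover have "e \<star> f = f" using eK fK by simp
  moreover have "f \<star> e = f" using e by (simp add: f_def conv_assoc)
  ultimately show thesis using that by blast
qed

text \<open>Splitting off a primitive \<open>f\<close> leaves the idempotent \<open>e - f\<close>,
  whose right ideal is properly smaller because it no longer contains \<open>f\<close>.\<close>

lemma prim_decomposition:
  assumes "e \<in> R" "e \<star> e = e"
  shows "\<exists>(n::nat) p. (\<forall>i<n. prim (p i)) \<and> e = (\<Sum>i<n. p i) \<and> (\<forall>i<n. e \<star> p i = p i)"
  using assms
proof (induction "fv.dim {x \<in> R. e \<star> x = x}" arbitrary: e rule: less_induct)
  case less
  show ?case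
  proof (cases "e = 0")
    case True
    thus ?thesis by (intro exI[of _ 0]) simp
  next
    case False
    obtain f where f: "prim f" "e \<star> f = f" "f \<star> e = f" by (rule prim_exists[OF less.prems False])
    have fR: "f \<in> R" and ff: "f \<star> f = f" and f0: "f \<noteq> 0" using f(1) by (auto simp: prim_def)
    define d where "d = e - f"
    have dR: "d \<in> R" using less.prems fR by (simp add: d_def)
    have ed: "e \<star> d = d" unfolding d_def conv_diff_right f(2) less.prems(2) ..
    have "f \<star> d = 0" unfolding d_def conv_diff_right f(3) ff by simp
    hence dd: "d \<star> d = d" using ed conv_diff_left[of e f d] by (simp add: d_def[symmetric])
    have sub: "{x \<in> R. d \<star> x = x} \<subset> {x \<in> R. e \<star> x = x}"
    proof
      show "{x \<in> R. d \<star> x = x} \<subseteq> {x \<in> R. e \<star> x = x}"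
      proof safe
        fix x assume "d \<star> x = x"
        thus "e \<star> x = x" using conv_assoc[of e d x] ed by metis
      qed
      have "d \<star> f = 0" unfolding d_def conv_diff_left f(2) ff by simp
      hence "f \<notin> {x \<in> R. d \<star> x = x}" using f0 by simp
      moreover have "f \<in> {x \<in> R. e \<star> x = x}" using fR f(2) by simp
      ultimately show "{x \<in> R. d \<star> x = x} \<noteq> {x \<in> R. e \<star> x = x}" by blast
    qed
    have "fv.dim {x \<in> R. d \<star> x = x} < fv.dim {x \<in> R. e \<star> x = x}"
    by (use subspace_dim_psubset sub finite_dl right_ideal_fixed dR R_span right_ideal_def in blast)
    from less.hyps[OF this dR dd] obtain n :: nat and p where
      p: "\<forall>i<n. prim (p i)" "d = (\<Sum>i<n. p i)" "\<forall>i<n. d \<star> p i = p i" by (elim exE conjE)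
    define p' where "p' = p(n := f)"
    have "(\<Sum>i<Suc n. p' i) = (\<Sum>i<n. p i) + f" by (simp add: p'_def)
    moreover have "e = d + f" by (simp add: d_def)
    ultimately have "e = (\<Sum>i<Suc n. p' i)" using p(2) by metis
    moreover have "\<forall>i<Suc n. prim (p' i)" using p(1) f(1) by (auto simp: p'_def less_Suc_eq)
    moreover have "e \<star> p i = p i" if "i < n" for i using p(3) that conv_assoc[of e d "p i"] ed by metis
    hence "\<forall>i<Suc n. e \<star> p' i = p' i" using f(2) by (auto simp: p'_def less_Suc_eq)
    ultimately show ?thesis by (intro exI[of _ "Suc n"] exI[of _ p'] conjI)
  qed
qed

end

subsection \<open>Characters\<close>

context finite_group
begin

text \<open>The trace of the operator \<open>x \<mapsto> a \<star> x \<star> b\<close> on the group algebra.\<close>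

definition tr :: "('a \<Rightarrow> complex) \<Rightarrow> ('a \<Rightarrow> complex) \<Rightarrow> complex" where
  "tr a b = (\<Sum>h\<in>carrier G. (a \<star> dl h \<star> b) h)"

text \<open>The space \<open>p R q\<close> is the space of module homomorphisms between the ideals
  of \<open>q\<close> and \<open>p\<close>; for primitive idempotents it is nonzero exactly when
  they afford the same irreducible character.\<close>

definition linked :: "('a \<Rightarrow> complex) \<Rightarrow> ('a \<Rightarrow> complex) \<Rightarrow> bool" where
  "linked p q \<longleftrightarrow> (\<exists>a\<in>R. p \<star> a \<star> q \<noteq> 0)"

lemma tr_sum_left: "tr (\<Sum>i\<in>I. f i) b = (\<Sum>i\<in>I. tr (f i) b)"
  by (simp add: tr_def conv_sum_left fun_sum_apply) (rule sum.swap)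

lemma tr_scale_left: "tr (\<lambda>x. c * a x) b = c * tr a b"
  by (simp add: tr_def conv_scale_left sum_distrib_left)

text \<open>For a primitive idempotent \<open>b\<close> this number is the value at \<open>g\<close>
  of the character of the left module \<open>R b\<close>: the operator maps into \<open>R b\<close>
  and acts there as left multiplication by \<open>g\<close>. In particular
  \<open>tr (dl \<one>) b\<close> is the degree.\<close>

lemma tr_dl_left: assumes "g \<in> carrier G"
  shows "tr (dl g) b = (\<Sum>h\<in>carrier G. b (inv h \<otimes> inv g \<otimes> h))"
  unfolding tr_def
proof (rule sum.cong[OF HOL.refl])
  fix h assume h: "h \<in> carrier G"
  show "(dl g \<star> dl h \<star> b) h = b (inv h \<otimes> inv g \<otimes> h)"
    unfolding conv_dl_dl[OF assms h] conv_dl_left[OF m_closed[OF assms h]]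
    using h assms by (simp add: inv_mult_group)
qed

text \<open>The sum runs over conjugates of \<open>inv g\<close>, and pairing with a function that
  is constant on conjugacy classes does not distinguish \<open>a \<star> b\<close> from
  \<open>b \<star> a\<close>.\<close>

lemma tr_dl_trace: assumes g: "g \<in> carrier G"
  shows "tr (dl g) (a \<star> b) = tr (dl g) (b \<star> a)"
proof -
  let ?c = "\<lambda>h. inv h \<otimes> inv g \<otimes> h"
  have "tr (dl g) (a \<star> b) = (\<Sum>h\<in>carrier G. \<Sum>y\<in>carrier G. a y * b (inv y \<otimes> ?c h))"
    unfolding tr_dl_left[OF g] by (intro sum.cong HOL.refl) (use g in \<open>simp add: conv_def\<close>)
  also have "\<dots> = (\<Sum>y\<in>carrier G. \<Sum>h\<in>carrier G. a y * b (inv y \<otimes> ?c h))" by (rule sum.swap)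
  also have "\<dots> = (\<Sum>y\<in>carrier G. \<Sum>h\<in>carrier G. a y * b (?c h \<otimes> inv y))"
  proof (rule sum.cong[OF HOL.refl])
    fix y assume y: "y \<in> carrier G"
    have "(\<Sum>h\<in>carrier G. a y * b (inv y \<otimes> ?c h)) = (\<Sum>h\<in>carrier G. a y * b (inv y \<otimes> ?c (h \<otimes> inv y)))"
      using sum_right_translate[of "inv y" "\<lambda>h. a y * b (inv y \<otimes> ?c h)"] y by simp
    also have "\<dots> = (\<Sum>h\<in>carrier G. a y * b (?c h \<otimes> inv y))"
    proof (rule sum.cong[OF HOL.refl])
      fix h assume h: "h \<in> carrier G"
      have "inv y \<otimes> ?c (h \<otimes> inv y) = inv y \<otimes> (y \<otimes> (?c h \<otimes> inv y))"
        using y h g by (simp add: inv_mult_group m_assoc)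
      also have "\<dots> = ?c h \<otimes> inv y" using y h g by (simp add: m_assoc[symmetric])
      finally show "a y * b (inv y \<otimes> ?c (h \<otimes> inv y)) = a y * b (?c h \<otimes> inv y)" by simp
    qed
    finally show "(\<Sum>h\<in>carrier G. a y * b (inv y \<otimes> ?c h)) = (\<Sum>h\<in>carrier G. a y * b (?c h \<otimes> inv y))" .
  qed
  also have "\<dots> = (\<Sum>h\<in>carrier G. \<Sum>y\<in>carrier G. a y * b (?c h \<otimes> inv y))" by (rule sum.swap)
  also have "\<dots> = (\<Sum>h\<in>carrier G. \<Sum>z\<in>carrier G. b z * a (inv z \<otimes> ?c h))"
  proof (rule sum.cong[OF HOL.refl])
    fix h assume h: "h \<in> carrier G"
    show "(\<Sum>y\<in>carrier G. a y * b (?c h \<otimes> inv y)) = (\<Sum>z\<in>carrier G. b z * a (inv z \<otimes> ?c h))"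
      by (rule sum.reindex_bij_witness[of _ "\<lambda>z. inv z \<otimes> ?c h" "\<lambda>y. ?c h \<otimes> inv y"])
        (use g h in \<open>auto simp: inv_mult_group m_assoc\<close>, simp_all add: m_assoc[symmetric])
  qed
  also have "\<dots> = tr (dl g) (b \<star> a)"
    unfolding tr_dl_left[OF g] by (intro sum.cong HOL.refl) (use g in \<open>simp add: conv_def\<close>)
  finally show ?thesis .
qed

lemma prim_scalar:
  assumes "prim e" "a \<in> R" obtains c where "e \<star> a \<star> e = (\<lambda>x. c * e x)"
  using assms by (auto simp: prim_def)

text \<open>Linked primitive idempotents are equivalent. The idempotent generator of the right ideal
  of \<open>u\<close> has the form \<open>u w\<close>, so \<open>u w u = u\<close>; the scalar
  conditions then turn \<open>v = q w p\<close> into a two-sided partial inverse of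
  \<open>u\<close>.\<close>

lemma linkedE:
  assumes p: "prim p" and q: "prim q" and l: "linked p q"
  obtains u v where "u \<in> R" "v \<in> R" "p \<star> u = u" "u \<star> q = u" "q \<star> v = v" "v \<star> p = v"
    "v \<star> u = q" "u \<star> v = p" "u \<noteq> 0"
proof -
  have pR: "p \<in> R" "p \<star> p = p" and qR: "q \<in> R" "q \<star> q = q" using p q by (auto simp: prim_def)
  obtain a where a: "a \<in> R" "p \<star> a \<star> q \<noteq> 0" using l by (auto simp: linked_def)
  define u where "u = p \<star> a \<star> q"
  have uR: "u \<in> R" and u0: "u \<noteq> 0" using a by (simp_all add: u_def)
  have "p \<star> u = (p \<star> p) \<star> a \<star> q" by (simp only: u_def conv_assoc)
  hence pu: "p \<star> u = u" by (simp only: pR(2) u_def)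
  have "u \<star> q = p \<star> a \<star> (q \<star> q)" by (simp only: u_def conv_assoc)
  hence uq: "u \<star> q = u" by (simp only: qR(2) u_def)
  have "right_ideal ((\<star>) u ` R)"
    unfolding right_ideal_def
  proof (intro conjI ballI)
    show "fv.subspace ((\<star>) u ` R)"
    proof (rule fv.subspaceI)
      show "0 \<in> (\<star>) u ` R" by (rule image_eqI[of _ _ 0]) auto
      fix x y assume "x \<in> (\<star>) u ` R" "y \<in> (\<star>) u ` R"
      then obtain x' y' where "x' \<in> R" "x = u \<star> x'" "y' \<in> R" "y = u \<star> y'" by auto
      thus "x + y \<in> (\<star>) u ` R" by (intro image_eqI[of _ _ "x' + y'"] R_add) (auto simp: conv_add_right)
    next
      fix c x assume "x \<in> (\<star>) u ` R"
      then obtain x' where "x' \<in> R" "x = u \<star> x'" by auto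
      thus "(\<lambda>y. c * x y) \<in> (\<star>) u ` R"
        by (intro image_eqI[of _ _ "\<lambda>y. c * x' y"] R_scale) (auto simp: conv_scale_right)
    qed
    fix k b assume "k \<in> (\<star>) u ` R" "b \<in> R"
    thus "k \<star> b \<in> (\<star>) u ` R" by (auto simp: conv_assoc)
  qed auto
  then obtain f0 where f0: "f0 \<in> (\<star>) u ` R" "\<And>k. k \<in> (\<star>) u ` R \<Longrightarrow> f0 \<star> k = k"
    using right_ideal_idempotent by blast
  then obtain w where w: "w \<in> R" "f0 = u \<star> w" by auto
  have "u \<in> (\<star>) u ` R" by (rule image_eqI[of _ _ "dl \<one>"]) (simp_all add: conv_one_right uR)
  hence uwu: "u \<star> w \<star> u = u" using f0(2)[of u] by (simp only: w(2))
  define v where "v = q \<star> w \<star> p"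
  have "q \<star> v = (q \<star> q) \<star> w \<star> p" "v \<star> p = q \<star> w \<star> (p \<star> p)" by (simp_all only: v_def conv_assoc)
  hence vR: "v \<in> R" "q \<star> v = v" "v \<star> p = v" by (simp_all only: qR(2) pR(2) v_def conv_R)
  have uvu: "u \<star> v \<star> u = u"
  by (metis v_def conv_assoc uq pu uwu)
  obtain c where c: "q \<star> (v \<star> u) \<star> q = (\<lambda>x. c * q x)" by (rule prim_scalar[OF q conv_R])
  have c': "v \<star> u = (\<lambda>x. c * q x)"
  by (metis conv_assoc c vR uq)
  have "(\<lambda>x. c * u x) = u \<star> (v \<star> u)" by (simp only: c' conv_scale_right uq)
  hence "(\<lambda>x. c * u x) = u" using uvu by (simp only: conv_assoc)
  moreover obtain x where "u x \<noteq> 0" using u0 by (auto simp: fun_eq_iff)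
  ultimately have c1: "c = 1" by (metis mult_cancel_right1)
  obtain d where d: "p \<star> (u \<star> v) \<star> p = (\<lambda>x. d * p x)" by (rule prim_scalar[OF p conv_R])
  have d': "u \<star> v = (\<lambda>x. d * p x)" by (metis conv_assoc d vR pu)
  have "(\<lambda>x. d * u x) = (u \<star> v) \<star> u" by (simp only: d' conv_scale_left pu)
  hence "(\<lambda>x. d * u x) = u" by (simp only: uvu)
  hence d1: "d = 1" using \<open>u x \<noteq> 0\<close> by (metis mult_cancel_right1)
  show thesis by (rule that[of u v]) (use uR vR pu uq c' c1 d' d1 u0 in simp_all)
qed

lemma linked_refl: "prim p \<Longrightarrow> linked p p"
  unfolding linked_def by (intro bexI[of _ p]) (simp_all add: prim_def)

lemma linked_sym: assumes "prim p" "prim q" "linked p q" shows "linked q p"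
proof -
  obtain u v where uv: "v \<in> R" "q \<star> v = v" "v \<star> p = v" "v \<star> u = q"
    using linkedE[OF assms] by metis
  have "v \<noteq> 0" using uv assms(2) by (auto simp: prim_def)
  thus ?thesis unfolding linked_def by (intro bexI[of _ v]) (simp_all add: uv)
qed

lemma linked_trans: assumes "prim p" "prim q" "prim s" "linked p q" "linked q s" shows "linked p s"
proof -
  obtain u v where uv: "u \<in> R" "p \<star> u = u" "v \<star> u = q" "u \<star> q = u"
    using linkedE[OF assms(1,2,4)] by metis
  obtain b where b: "b \<in> R" "q \<star> b \<star> s \<noteq> 0" using assms by (auto simp: linked_def)
  have "v \<star> (p \<star> (u \<star> b) \<star> s) = q \<star> b \<star> s"
  by (metis conv_assoc uv(2) uv(3))
  hence "p \<star> (u \<star> b) \<star> s \<noteq> 0" using b by auto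
  thus ?thesis unfolding linked_def by (intro bexI[of _ "u \<star> b"]) auto
qed

text \<open>If linked, \<open>p R q\<close> is the line spanned by \<open>u\<close>, and the trace
  of the projection of the algebra onto a line is 1; otherwise the operator is zero.\<close>

lemma tr_prim: assumes p: "prim p" and q: "prim q" shows "tr p q = (if linked p q then 1 else 0)"
proof (cases "linked p q")
  case False
  hence "p \<star> dl h \<star> q = 0" if "h \<in> carrier G" for h using that by (auto simp: linked_def)
  thus ?thesis using False by (simp add: tr_def)
next
  case True
  obtain u v where uv: "u \<in> R" "v \<in> R" "p \<star> u = u" "u \<star> q = u" "q \<star> v = v" "v \<star> p = v"
    "v \<star> u = q" "u \<star> v = p" "u \<noteq> 0" using linkedE[OF p q True] by metis
  have "\<exists>c. p \<star> a \<star> q = (\<lambda>x. c * u x)" if "a \<in> R" for a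
  proof -
    have qq: "q \<star> q = q" using q by (simp add: prim_def)
    obtain c where c: "p \<star> (a \<star> q \<star> v) \<star> p = (\<lambda>x. c * p x)" by (rule prim_scalar[OF p conv_R])
    have "p \<star> a \<star> q = p \<star> a \<star> q \<star> (v \<star> u)" by (simp only: uv(7) conv_assoc qq)
    also have "\<dots> = p \<star> a \<star> q \<star> (v \<star> p) \<star> u" by (simp only: uv(6) conv_assoc)
    also have "\<dots> = (p \<star> (a \<star> q \<star> v) \<star> p) \<star> u" by (simp only: conv_assoc)
    also have "\<dots> = (\<lambda>x. c * u x)" by (simp only: c conv_scale_left uv)
    finally show ?thesis ..
  qed
  hence "\<forall>h\<in>carrier G. \<exists>c. p \<star> dl h \<star> q = (\<lambda>x. c * u x)" by simp
  then obtain c where c: "\<And>h. h \<in> carrier G \<Longrightarrow> p \<star> dl h \<star> q = (\<lambda>x. c h * u x)" by metis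
  have "u = p \<star> (\<Sum>h\<in>carrier G. (\<lambda>x. u h * dl h x)) \<star> q"
    by (simp only: R_expand[OF uv(1), symmetric] uv)
  also have "\<dots> = (\<Sum>h\<in>carrier G. (\<lambda>x. u h * (c h * u x)))"
    by (simp add: conv_sum_left conv_sum_right conv_scale_left conv_scale_right c)
  finally have e: "u = (\<Sum>h\<in>carrier G. (\<lambda>x. u h * (c h * u x)))" .
  obtain x where x: "u x \<noteq> 0" using uv(9) by (auto simp: fun_eq_iff)
  have "u x = (\<Sum>h\<in>carrier G. u h * (c h * u x))" using fun_cong[OF e, of x] unfolding fun_sum_apply .
  also have "\<dots> = (\<Sum>h\<in>carrier G. c h * u h) * u x"
    unfolding sum_distrib_right by (intro sum.cong HOL.refl) simp
  finally have "(\<Sum>h\<in>carrier G. c h * u h) = 1" using x by simp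
  thus ?thesis using True by (simp add: tr_def c)
qed

text \<open>With \<open>p = u v\<close> and \<open>q = v u\<close> this is the trace property:
  linked idempotents afford the same character.\<close>

lemma tr_linked: assumes "prim p" "prim q" "linked p q" "g \<in> carrier G"
  shows "tr (dl g) p = tr (dl g) q"
  using linkedE[OF assms(1-3)] tr_dl_trace[OF assms(4)] by metis

lemma tr_conj: assumes "g \<in> carrier G" "t \<in> carrier G"
  shows "tr (dl (t \<otimes> g \<otimes> inv t)) b = tr (dl g) b"
proof -
  have "tr (dl (t \<otimes> g \<otimes> inv t)) b = (\<Sum>h\<in>carrier G. b (inv (inv t \<otimes> h) \<otimes> inv g \<otimes> (inv t \<otimes> h)))"
    using assms by (subst tr_dl_left) (auto simp: inv_mult_group m_assoc intro!: sum.cong)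
  also have "\<dots> = tr (dl g) b"
    using sum_left_translate[of "inv t" "\<lambda>h. b (inv h \<otimes> inv g \<otimes> h)"] assms by (simp add: tr_dl_left)
  finally show ?thesis .
qed

text \<open>The trace counts the primitive summands of \<open>f\<close> linked to \<open>q\<close>,
  that is, it is the dimension of \<open>f R q\<close>. The clause for \<open>n = 0\<close> later
  shows that absent eigenvalues have zero eigenspaces.\<close>

lemma idempotent_trace_nat:
  assumes f: "f \<in> R" "f \<star> f = f" and q: "prim q"
  shows "\<exists>n::nat. tr f q = of_nat n \<and> (n = 0 \<longrightarrow> (\<forall>a\<in>R. f \<star> a \<star> q = 0))"
proof -
  obtain n :: nat and p where p: "\<And>i. i < n \<Longrightarrow> prim (p i)" "f = (\<Sum>i<n. p i)"
    using prim_decomposition[OF f] by blast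
  have "tr f q = (\<Sum>i<n. if linked (p i) q then 1 else 0)"
    unfolding p(2) tr_sum_left by (intro sum.cong HOL.refl) (use p(1) q in \<open>auto simp: tr_prim\<close>)
  also have "\<dots> = of_nat (card {i \<in> {..<n}. linked (p i) q})"
    by (simp add: sum.If_cases Int_def)
  finally have "tr f q = of_nat (card {i \<in> {..<n}. linked (p i) q})" .
  moreover have "f \<star> a \<star> q = 0" if "card {i \<in> {..<n}. linked (p i) q} = 0" "a \<in> R" for a
  proof -
    have "\<not> linked (p i) q" if "i < n" for i using \<open>card _ = 0\<close> that by auto
    hence "p i \<star> a \<star> q = 0" if "i < n" for i using that \<open>a \<in> R\<close> by (auto simp: linked_def)
    thus ?thesis unfolding p(2) by (simp add: conv_sum_left)
  qed
  ultimately show ?thesis by blast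
qed

text \<open>The eigenvalue multiplicities of \<open>g\<close> on the irreducible module of a primitive idempotent.\<close>

lemma character_multiplicities:
  assumes g: "g \<in> carrier G" and m: "m > 0" "g [^] m = \<one>" and q: "prim q"
  obtains n :: "nat \<Rightarrow> nat" where
    "tr (dl g) q = (\<Sum>k<m. of_nat (n k) * root1 m ^ k)"
    "tr (dl \<one>) q = of_nat (\<Sum>k<m. n k)"
    "\<And>j a. j < m \<Longrightarrow> \<forall>k<m. k \<noteq> j \<longrightarrow> n k = 0 \<Longrightarrow> a \<in> R \<Longrightarrow>
       dl g \<star> a \<star> q = (\<lambda>x. root1 m ^ j * (a \<star> q) x)"
proof -
  let ?z = "root1 m"
  have z0: "?z \<noteq> 0" by (simp add: root1_def)
  have zz: "?z ^ m = 1" using m root1_pow by blast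
  have gpow: "g [^] (t mod m) = g [^] t" for t :: nat
  proof -
    have "g [^] t = g [^] (m * (t div m) + t mod m)" by simp
    also have "\<dots> = g [^] (m * (t div m)) \<otimes> g [^] (t mod m)"
      by (rule nat_pow_mult[symmetric, OF g])
    also have "g [^] (m * (t div m)) = \<one>"
      unfolding nat_pow_pow[symmetric, OF g] m(2) by (rule nat_pow_one)
    finally show ?thesis using g by simp
  qed
  \<comment> \<open>The inverse of \<open>?z ^ (k * t)\<close>, written with the nonnegative
    exponent \<open>m - 1\<close> in place of -1.\<close>
  define w where "w k t = (?z ^ (m - 1)) ^ (k * t)" for k t :: nat
  have winv: "?z ^ (m - 1) * ?z = 1" using zz m(1) by (metis One_nat_def Suc_pred power_Suc2)
  have w_mod: "w k (t mod m) = w k t" for k t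
  proof -
    have "(?z ^ (m - 1)) ^ m = 1" by (metis zz power_mult mult.commute power_one)
    hence "((?z ^ (m - 1)) ^ k) ^ m = 1" by (metis power_mult mult.commute power_one)
    hence "((?z ^ (m - 1)) ^ k) ^ (m * (t div m) + t mod m) = ((?z ^ (m - 1)) ^ k) ^ (t mod m)"
      by (simp only: power_add power_mult power_one mult_1)
    thus ?thesis by (simp add: w_def power_mult)
  qed
  have w_add: "w k (s + t) = w k s * w k t" for k s t by (simp add: w_def distrib_left power_add)
  have w_shift: "w k 1 * ?z ^ k = 1" for k
    using winv by (simp add: w_def power_mult_distrib[symmetric])
  \<comment> \<open>Discrete Fourier transform over the powers of \<open>g\<close>:
    \<open>f k\<close> is the spectral idempotent of \<open>g\<close> for the eigenvalue
    \<open>?z ^ k\<close>, and the multiplicity \<open>n k\<close> is its trace.\<close>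
  define f where "f k = (\<Sum>t<m. (\<lambda>x. (w k t / of_nat m) * dl (g [^] t) x))" for k
  have fR: "f k \<in> R" for k unfolding f_def by (intro R_sum R_scale dl_R) (use g in auto)
  have gf: "dl (g [^] s) \<star> f k = (\<lambda>x. ?z ^ (k * s) * f k x)" for s k :: nat
  proof (induction s)
    case 0
    thus ?case by (simp add: conv_one_left fR)
  next
    case (Suc s)
    have one: "dl g \<star> f k = (\<lambda>x. ?z ^ k * f k x)"
    proof -
      have "dl g \<star> f k = (\<Sum>t<m. (\<lambda>x. (w k t / of_nat m) * dl (g [^] (Suc t)) x))"
        unfolding f_def conv_sum_right conv_scale_right
      proof (rule sum.cong[OF HOL.refl])
        fix t :: nat
        have "dl g \<star> dl (g [^] t) = dl (g [^] Suc t)"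
          unfolding conv_dl_dl[OF g nat_pow_closed[OF g]] nat_pow_Suc2[OF g] ..
        thus "(\<lambda>x. w k t / of_nat m * (dl g \<star> dl (g [^] t)) x) = (\<lambda>x. w k t / of_nat m * dl (g [^] Suc t) x)"
          by (simp only:)
      qed
      also have "\<dots> = (\<Sum>t<m. (\<lambda>x. (?z ^ k * w k (Suc t mod m) / of_nat m) * dl (g [^] (Suc t mod m)) x))"
      proof (rule sum.cong[OF HOL.refl])
        fix t
        have "w k t = ?z ^ k * w k (Suc t)"
          using w_shift[of k] w_add[of k t 1] by (simp add: mult_ac)
        thus "(\<lambda>x. (w k t / of_nat m) * dl (g [^] (Suc t)) x) =
            (\<lambda>x. (?z ^ k * w k (Suc t mod m) / of_nat m) * dl (g [^] (Suc t mod m)) x)"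
          by (simp only: w_mod gpow)
      qed
      also have "\<dots> = (\<Sum>t<m. (\<lambda>x. (?z ^ k * w k t / of_nat m) * dl (g [^] t) x))"
      proof (rule sum.reindex_bij_witness[of _ "\<lambda>t. (t + (m - 1)) mod m" "\<lambda>t. Suc t mod m"])
        fix t assume "t \<in> {..<m}"
        hence t: "(t + m) mod m = t" by simp
        have "(Suc t mod m + (m - 1)) mod m = (Suc t + (m - 1)) mod m" by (rule mod_add_left_eq)
        also have "Suc t + (m - 1) = t + m" using m(1) by simp
        finally show "(Suc t mod m + (m - 1)) mod m = t" using t by simp
        have "Suc ((t + (m - 1)) mod m) mod m = Suc (t + (m - 1)) mod m" by (rule mod_Suc_eq)
        also have "Suc (t + (m - 1)) = t + m" using m(1) by simp
        finally show "Suc ((t + (m - 1)) mod m) mod m = t" using t by simp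
      qed (use m in auto)
      also have "\<dots> = (\<lambda>x. ?z ^ k * f k x)"
        by (auto simp: f_def fun_eq_iff fun_sum_apply sum_distrib_left intro!: sum.cong)
      finally show ?thesis .
    qed
    have "dl (g [^] Suc s) \<star> f k = dl (g [^] s) \<star> (dl g \<star> f k)"
      using g by (simp add: conv_assoc[symmetric] conv_dl_dl)
    also have "\<dots> = (\<lambda>x. ?z ^ k * (?z ^ (k * s) * f k x))" by (simp only: one conv_scale_right Suc)
    finally show ?case by (simp add: power_add mult_ac)
  qed
  have wz: "w k t * ?z ^ (k * t) = 1" for k t
  by (metis w_def power_mult_distrib winv power_one)
  have ff: "f k \<star> f k = f k" for k
  proof -
    have "f k \<star> f k = (\<Sum>t<m. (\<lambda>x. (w k t / of_nat m) * (?z ^ (k * t) * f k x)))"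
    proof -
      have "f k \<star> f k = (\<Sum>t<m. (\<lambda>x. (w k t / of_nat m) * dl (g [^] t) x)) \<star> f k"
        using arg_cong[OF f_def[of k], of "\<lambda>u. u \<star> f k"] .
      thus ?thesis by (simp only: conv_sum_left conv_scale_left gf)
    qed
    also have "\<dots> = (\<Sum>t<m. (\<lambda>x. f k x / of_nat m))"
    proof (rule sum.cong[OF HOL.refl], rule ext)
      fix t x
      have "(w k t / of_nat m) * (?z ^ (k * t) * f k x) = (w k t * ?z ^ (k * t)) * f k x / of_nat m" by simp
      thus "(w k t / of_nat m) * (?z ^ (k * t) * f k x) = f k x / of_nat m" by (simp only: wz mult_1)
    qed
    also have "\<dots> = f k" using m(1) by (auto simp: fun_eq_iff fun_sum_apply)
    finally show ?thesis .
  qed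
  have geom: "(\<Sum>k<m. w k t) = (if t = 0 then of_nat m else 0)" if t: "t < m" for t
  proof (cases "t = 0")
    case True
    thus ?thesis by (simp add: w_def)
  next
    case False
    let ?r = "(?z ^ (m - 1)) ^ t"
    have "?r * ?z ^ t = 1" using wz[of 1 t] by (simp add: w_def)
    moreover have "?z ^ t \<noteq> 1" using root1_pow_neq_1 False t by simp
    ultimately have "?r \<noteq> 1" by auto
    moreover have "(\<Sum>k<m. w k t) = (\<Sum>k<m. ?r ^ k)"
      by (intro sum.cong HOL.refl) (simp add: w_def power_mult[symmetric] mult_ac)
    moreover have "?r ^ m = 1"
      by (metis (no_types, lifting) power_mult mult.commute power_one zz)
    moreover have "(\<Sum>k<m. ?r ^ k) = (?r ^ m - 1) / (?r - 1)" by (rule geometric_sum) fact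
    ultimately show ?thesis using False by simp
  qed
  have sumf: "(\<Sum>k<m. f k) = dl \<one>"
  proof
    fix x
    have "(\<Sum>k<m. f k) x = (\<Sum>k<m. \<Sum>t<m. w k t / of_nat m * dl (g [^] t) x)"
      by (simp add: f_def fun_sum_apply)
    also have "\<dots> = (\<Sum>t<m. \<Sum>k<m. w k t / of_nat m * dl (g [^] t) x)" by (rule sum.swap)
    also have "\<dots> = (\<Sum>t<m. (\<Sum>k<m. w k t) / of_nat m * dl (g [^] t) x)"
      by (simp add: sum_distrib_right sum_divide_distrib)
    also have "\<dots> = (\<Sum>t<m. if t = 0 then dl (g [^] t) x else 0)"
      using m(1) geom by (intro sum.cong HOL.refl) auto
    also have "\<dots> = dl \<one> x" using m(1) by (subst sum.delta) auto
    finally show "(\<Sum>k<m. f k) x = dl \<one> x" .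
  qed
  obtain n where n: "\<And>k. tr (f k) q = of_nat (n k)" "\<And>k a. n k = 0 \<Longrightarrow> a \<in> R \<Longrightarrow> f k \<star> a \<star> q = 0"
    using idempotent_trace_nat[OF fR ff q] by metis
  have dlg: "dl g = (\<Sum>k<m. (\<lambda>x. ?z ^ k * f k x))"
  proof -
    have "dl g = dl g \<star> (\<Sum>k<m. f k)" unfolding sumf using g by (simp add: conv_one_right)
    also have "\<dots> = (\<Sum>k<m. (\<lambda>x. ?z ^ k * f k x))"
      unfolding conv_sum_right using gf[of 1] g by simp
    finally show ?thesis .
  qed
  show thesis
  proof (rule that[of n])
    show "tr (dl g) q = (\<Sum>k<m. of_nat (n k) * ?z ^ k)"
    proof -
      have "tr (dl g) q = tr (\<Sum>k<m. (\<lambda>x. ?z ^ k * f k x)) q" by (simp only: dlg[symmetric])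
      also have "\<dots> = (\<Sum>k<m. ?z ^ k * of_nat (n k))" by (simp only: tr_sum_left tr_scale_left n)
      finally show ?thesis by (simp only: mult.commute)
    qed
    show "tr (dl \<one>) q = of_nat (\<Sum>k<m. n k)"
      unfolding sumf[symmetric] tr_sum_left by (simp add: n)
    fix j a assume j: "j < m" and z: "\<forall>k<m. k \<noteq> j \<longrightarrow> n k = 0" and a: "a \<in> R"
    have fz: "f k \<star> a \<star> q = 0" if "k < m" "k \<noteq> j" for k using n(2) z that a by blast
    have aq: "a \<star> q = f j \<star> a \<star> q"
    proof -
      have "a \<star> q = (\<Sum>k<m. f k) \<star> a \<star> q" unfolding sumf using a by (simp add: conv_one_left)
      also have "\<dots> = (\<Sum>k<m. f k \<star> a \<star> q)" by (simp only: conv_sum_left)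
      also have "\<dots> = (\<Sum>k<m. if k = j then f j \<star> a \<star> q else 0)"
        by (intro sum.cong HOL.refl) (use fz in auto)
      also have "\<dots> = f j \<star> a \<star> q" using j by (subst sum.delta) auto
      finally show ?thesis .
    qed
    have "dl g \<star> a \<star> q = (\<Sum>k<m. (\<lambda>x. ?z ^ k * (f k \<star> a \<star> q) x))"
      using arg_cong[OF dlg, of "\<lambda>u. u \<star> a \<star> q"] by (simp only: conv_sum_left conv_scale_left)
    also have "\<dots> = (\<Sum>k<m. if k = j then (\<lambda>x. ?z ^ j * (f j \<star> a \<star> q) x) else 0)"
      by (intro sum.cong HOL.refl) (use fz in \<open>auto simp: fun_eq_iff\<close>)
    also have "\<dots> = (\<lambda>x. ?z ^ j * (f j \<star> a \<star> q) x)" using j by (subst sum.delta) auto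
    finally show "dl g \<star> a \<star> q = (\<lambda>x. ?z ^ j * (a \<star> q) x)" using aq by simp
  qed
qed

section \<open>Class sums and integrality of character values\<close>

lemma tr_sum_right: "tr a (\<Sum>i\<in>I. f i) = (\<Sum>i\<in>I. tr a (f i))"
  by (simp add: tr_def conv_sum_right fun_sum_apply) (rule sum.swap)

definition conj_class :: "'a \<Rightarrow> 'a set" where
  "conj_class g = (\<lambda>t. t \<otimes> g \<otimes> inv t) ` carrier G"

lemma conj_class_subset: "g \<in> carrier G \<Longrightarrow> conj_class g \<subseteq> carrier G"
  by (auto simp: conj_class_def)

lemma conj_class_conj: assumes "g \<in> carrier G" "x \<in> conj_class g" "h \<in> carrier G"
  shows "h \<otimes> x \<otimes> inv h \<in> conj_class g"
proof -
  obtain t where "t \<in> carrier G" "x = t \<otimes> g \<otimes> inv t" using assms by (auto simp: conj_class_def)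
  hence "h \<otimes> x \<otimes> inv h = (h \<otimes> t) \<otimes> g \<otimes> inv (h \<otimes> t)" "h \<otimes> t \<in> carrier G"
    using assms by (simp_all add: m_assoc inv_mult_group)
  thus ?thesis unfolding conj_class_def by blast
qed

definition class_sum :: "'a \<Rightarrow> 'a \<Rightarrow> complex" where
  "class_sum g = (\<Sum>x\<in>conj_class g. dl x)"

lemma class_sum_R: "g \<in> carrier G \<Longrightarrow> class_sum g \<in> R"
  unfolding class_sum_def using conj_class_subset by (intro R_sum dl_R) auto

lemma finite_conj_class: "finite (conj_class g)"
  using fin by (simp add: conj_class_def)

lemma class_sum_central_dl: assumes g: "g \<in> carrier G" and h: "h \<in> carrier G"
  shows "dl h \<star> class_sum g = class_sum g \<star> dl h"
proof -
  have "dl h \<star> class_sum g = (\<Sum>x\<in>conj_class g. dl (h \<otimes> x))"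
    unfolding class_sum_def conv_sum_right
    by (intro sum.cong HOL.refl conv_dl_dl h) (use conj_class_subset g in auto)
  also have "\<dots> = (\<Sum>x\<in>conj_class g. dl (x \<otimes> h))"
  proof (rule sum.reindex_bij_witness[of _ "\<lambda>x. inv h \<otimes> x \<otimes> h" "\<lambda>x. h \<otimes> x \<otimes> inv h"])
    fix x assume x: "x \<in> conj_class g"
    hence xG: "x \<in> carrier G" using conj_class_subset g by auto
    show "inv h \<otimes> (h \<otimes> x \<otimes> inv h) \<otimes> h = x" "h \<otimes> (inv h \<otimes> x \<otimes> h) \<otimes> inv h = x"
      using xG h by (simp_all add: m_assoc) (simp_all add: m_assoc[symmetric])
    show "h \<otimes> x \<otimes> inv h \<in> conj_class g" using conj_class_conj g x h by simp
    show "inv h \<otimes> x \<otimes> h \<in> conj_class g" using conj_class_conj[of g x "inv h"] g x h by simp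
    show "dl (h \<otimes> x \<otimes> inv h \<otimes> h) = dl (h \<otimes> x)" using xG h by (simp add: m_assoc)
  qed
  also have "\<dots> = class_sum g \<star> dl h"
    unfolding class_sum_def conv_sum_left
    by (intro sum.cong HOL.refl conv_dl_dl[symmetric] h) (use conj_class_subset g in auto)
  finally show ?thesis .
qed

lemma class_sum_central: assumes g: "g \<in> carrier G" and a: "a \<in> R"
  shows "a \<star> class_sum g = class_sum g \<star> a"
proof -
  have "a \<star> class_sum g = (\<Sum>h\<in>carrier G. (\<lambda>x. a h * dl h x)) \<star> class_sum g"
    using R_expand[OF a] by simp
  also have "\<dots> = (\<Sum>h\<in>carrier G. (\<lambda>x. a h * (class_sum g \<star> dl h) x))"
    unfolding conv_sum_left conv_scale_left
    by (intro sum.cong HOL.refl) (simp add: class_sum_central_dl[OF g])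
  also have "\<dots> = class_sum g \<star> (\<Sum>h\<in>carrier G. (\<lambda>x. a h * dl h x))"
    unfolding conv_sum_right conv_scale_right ..
  also have "\<dots> = class_sum g \<star> a" using R_expand[OF a] by simp
  finally show ?thesis .
qed

text \<open>A central element acts on \<open>p\<close> by a scalar \<open>w\<close>; taking traces
  identifies \<open>w\<close> as class size times character value divided by degree.\<close>

lemma class_sum_eigenvalue:
  assumes g: "g \<in> carrier G" and p: "prim p"
  obtains w where "class_sum g \<star> p = (\<lambda>x. w * p x)"
    "of_nat (card (conj_class g)) * tr (dl g) p = w * tr (dl \<one>) p"
proof -
  have pR: "p \<in> R" "p \<star> p = p" using p by (auto simp: prim_def)
  obtain w where w: "p \<star> class_sum g \<star> p = (\<lambda>x. w * p x)" by (rule prim_scalar[OF p class_sum_R[OF g]])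
  have cp: "class_sum g \<star> p = (\<lambda>x. w * p x)"
    using w unfolding class_sum_central[OF g pR(1)] conv_assoc pR(2) .
  have "tr (class_sum g) p = (\<Sum>x\<in>conj_class g. tr (dl g) p)"
    unfolding class_sum_def tr_sum_left
    by (intro sum.cong HOL.refl) (use g in \<open>auto simp: conj_class_def tr_conj\<close>)
  moreover have "tr (class_sum g) p = w * tr (dl \<one>) p"
  proof -
    have "class_sum g \<star> dl h \<star> p = (\<lambda>x. w * (dl \<one> \<star> dl h \<star> p) x)" if h: "h \<in> carrier G" for h
    proof -
      have "class_sum g \<star> dl h \<star> p = dl h \<star> (class_sum g \<star> p)"
        by (simp only: class_sum_central_dl[OF g h, symmetric] conv_assoc)
      thus ?thesis using h by (simp add: cp conv_scale_right conv_dl_dl)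
    qed
    thus ?thesis by (simp add: tr_def sum_distrib_left)
  qed
  ultimately show thesis by (intro that[OF cp]) simp
qed

text \<open>An integral combination of \<open>w\<close> and of the character value is an eigenvalue of an
  integer matrix indexed by the group times the residues modulo \<open>m\<close>.\<close>

lemma character_combination_integral:
  assumes g: "g \<in> carrier G" and p: "prim p" and m: "m > 0"
    and w: "class_sum g \<star> p = (\<lambda>x. w * p x)"
    and a: "a = of_int u * (\<Sum>k<m. of_nat (n k) * root1 m ^ k) + of_int v * w"
  shows "algebraic_int a"
proof -
  define N where "N t s = (\<Sum>k | k < m \<and> (t + k) mod m = s. int (n k))" for t s
  \<comment> \<open>The matrix of left multiplication by the class sum, with eigenvector
    \<open>p\<close>. Together with the circulant matrix \<open>N\<close> it acts on the product
    index set, where \<open>p x * root1 m ^ t\<close> is a common eigenvector.\<close>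
  define M where "M x y = (if x \<otimes> inv y \<in> conj_class g then 1 else 0 :: int)" for x y
  obtain x0 where x0: "p x0 \<noteq> 0" using p by (auto simp: prim_def fun_eq_iff)
  hence x0G: "x0 \<in> carrier G" using p by (auto simp: prim_def R_def)
  have NS: "(\<Sum>s<m. of_int (N t s) * root1 m ^ s) = (\<Sum>k<m. of_nat (n k) * root1 m ^ k) * root1 m ^ t" for t
  proof -
    have "(\<Sum>s<m. of_int (N t s) * root1 m ^ s)
        = (\<Sum>s<m. \<Sum>k | k < m \<and> (t + k) mod m = s. of_nat (n k) * root1 m ^ ((t + k) mod m))"
      by (intro sum.cong HOL.refl) (auto simp: N_def sum_distrib_right intro!: sum.cong)
    also have "\<dots> = (\<Sum>k<m. of_nat (n k) * root1 m ^ ((t + k) mod m))" by (rule sum_group_mod[OF m])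
    also have "\<dots> = (\<Sum>k<m. of_nat (n k) * root1 m ^ k) * root1 m ^ t"
      using m by (subst sum_distrib_right) (simp add: root1_mod power_add mult_ac)
    finally show ?thesis .
  qed
  have MS: "(\<Sum>y\<in>carrier G. of_int (M x y) * p y) = w * p x" if x: "x \<in> carrier G" for x
  proof -
    have cs: "class_sum g y = (if y \<in> conj_class g then 1 else 0)" for y
      unfolding class_sum_def fun_sum_apply dl_def using finite_conj_class by (simp add: sum.delta)
    have "w * p x = (class_sum g \<star> p) x" by (simp add: w)
    also have "\<dots> = (\<Sum>y\<in>carrier G. class_sum g y * p (inv y \<otimes> x))" using x by (simp add: conv_def)
    also have "\<dots> = (\<Sum>y\<in>carrier G. of_int (M x y) * p y)"
      by (rule sum.reindex_bij_witness[of _ "\<lambda>y. x \<otimes> inv y" "\<lambda>y. inv y \<otimes> x"])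
        (use x in \<open>auto simp: inv_mult_group m_assoc cs M_def\<close>, simp_all add: m_assoc[symmetric])
    finally show ?thesis ..
  qed
  show ?thesis
  proof (rule algebraic_int_eigenvalue[of "carrier G \<times> {..<m}" "(x0, 0)" "\<lambda>(x, t). p x * root1 m ^ t" a
        "\<lambda>(x, t) (y, s). u * (if x = y then N t s else 0) + v * (if t = s then M x y else 0)"])
    fix i assume "i \<in> carrier G \<times> {..<m}"
    then obtain x t where i: "i = (x, t)" "x \<in> carrier G" "t < m" by auto
    have "(\<Sum>(y, s)\<in>carrier G \<times> {..<m}. of_int (u * (if x = y then N t s else 0) + v * (if t = s then M x y else 0))
          * (p y * root1 m ^ s))
       = (\<Sum>y\<in>carrier G. \<Sum>s<m. of_int (u * (if x = y then N t s else 0)) * (p y * root1 m ^ s))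
       + (\<Sum>y\<in>carrier G. \<Sum>s<m. of_int (v * (if t = s then M x y else 0)) * (p y * root1 m ^ s))"
      by (simp add: sum.cartesian_product[symmetric] sum.distrib[symmetric] distrib_right)
    also have "(\<Sum>y\<in>carrier G. \<Sum>s<m. of_int (u * (if x = y then N t s else 0)) * (p y * root1 m ^ s))
        = (\<Sum>y\<in>carrier G. if y = x then (\<Sum>s<m. of_int u * of_int (N t s) * (p x * root1 m ^ s)) else 0)"
      by (intro sum.cong HOL.refl) auto
    also have "\<dots> = of_int u * p x * (\<Sum>s<m. of_int (N t s) * root1 m ^ s)"
      using i fin by (simp add: sum.delta sum_distrib_left mult_ac)
    also have "(\<Sum>y\<in>carrier G. \<Sum>s<m. of_int (v * (if t = s then M x y else 0)) * (p y * root1 m ^ s))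
        = (\<Sum>y\<in>carrier G. \<Sum>s<m. if s = t then of_int v * of_int (M x y) * (p y * root1 m ^ t) else 0)"
      by (intro sum.cong HOL.refl) auto
    also have "\<dots> = of_int v * root1 m ^ t * (\<Sum>y\<in>carrier G. of_int (M x y) * p y)"
      using i by (simp add: sum.delta sum_distrib_left mult_ac)
    finally have E: "(\<Sum>(y, s)\<in>carrier G \<times> {..<m}. of_int (u * (if x = y then N t s else 0) + v * (if t = s then M x y else 0))
          * (p y * root1 m ^ s)) = a * (p x * root1 m ^ t)"
      unfolding NS MS[OF i(2)] by (simp add: a algebra_simps)
    show "a * (case i of (x, t) \<Rightarrow> p x * root1 m ^ t) =
      (\<Sum>j\<in>carrier G \<times> {..<m}. of_int ((case i of (x, t) \<Rightarrow> \<lambda>(y, s). u * (if x = y then N t s else 0) + v * (if t = s then M x y else 0)) j)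
          * (case j of (x, t) \<Rightarrow> p x * root1 m ^ t))"
      unfolding i(1) prod.case E[symmetric] by (intro sum.cong HOL.refl) auto
  qed (use fin m x0 x0G in auto)
qed

text \<open>The elements acting by scalars on the left ideal of \<open>p\<close> form a normal
  subgroup containing \<open>g\<close>, hence all of the group. Their scalars form a linear
  character, which \<open>perfect\<close> makes trivial, so \<open>p\<close> is translation
  invariant and therefore constant.\<close>

lemma prim_scalar_action_uniform:
  assumes p: "prim p" and perfect: "\<And>\<chi> :: 'a \<Rightarrow> complex. (\<And>x y. x \<in> carrier G \<Longrightarrow> y \<in> carrier G \<Longrightarrow> \<chi> (x \<otimes> y) = \<chi> x * \<chi> y) \<Longrightarrow>
        (\<And>x. x \<in> carrier G \<Longrightarrow> \<chi> x \<noteq> 0) \<Longrightarrow> (\<And>x. x \<in> carrier G \<Longrightarrow> \<chi> x = 1)"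
    and normal: "\<And>N. N \<lhd> G \<Longrightarrow> g \<in> N \<Longrightarrow> N = carrier G"
    and g: "g \<in> carrier G" "c0 \<noteq> 0" "\<And>a. a \<in> R \<Longrightarrow> dl g \<star> a \<star> p = (\<lambda>x. c0 * (a \<star> p) x)"
  shows "p = (\<lambda>x. if x \<in> carrier G then 1 / of_nat (card (carrier G)) else 0)"
proof -
  have pR: "p \<in> R" "p \<star> p = p" "p \<noteq> 0" using p by (auto simp: prim_def)
  define S where "S h c \<longleftrightarrow> c \<noteq> 0 \<and> (\<forall>a\<in>R. dl h \<star> (a \<star> p) = (\<lambda>x. c * (a \<star> p) x))" for h c
  have Smul: "S (h \<otimes> k) (c * d)" if "h \<in> carrier G" "k \<in> carrier G" "S h c" "S k d" for h k c d
    unfolding S_def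
  proof (intro conjI ballI)
    fix a assume a: "a \<in> R"
    have "dl (h \<otimes> k) \<star> (a \<star> p) = dl h \<star> (dl k \<star> (a \<star> p))"
      using that by (simp add: conv_assoc[symmetric] conv_dl_dl)
    also have "\<dots> = (\<lambda>x. d * (c * (a \<star> p) x))" using that a by (simp add: S_def conv_scale_right)
    also have "\<dots> = (\<lambda>x. c * d * (a \<star> p) x)" by (rule ext) simp
    finally show "dl (h \<otimes> k) \<star> (a \<star> p) = (\<lambda>x. c * d * (a \<star> p) x)" .
  qed (use that in \<open>auto simp: S_def\<close>)
  have Sone: "S \<one> 1" by (simp add: S_def conv_one_left)
  have Suniq: "c = d" if "S h c" "S h d" for h c d
  by (use pR fun_eq_iff conv_one_left that dl_R mult_right_cancel one_closed in \<open>auto simp: S_def\<close>)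
  have Sinv: "S (inv h) (1 / c)" if h: "h \<in> carrier G" "S h c" for h c
    unfolding S_def
  proof (intro conjI ballI)
    fix a assume a: "a \<in> R"
    have "(\<lambda>x. c * (dl (inv h) \<star> (a \<star> p)) x) = dl (inv h) \<star> (dl h \<star> (a \<star> p))"
      using h a by (simp add: S_def conv_scale_right)
    also have "\<dots> = a \<star> p" using h by (simp add: conv_assoc[symmetric] conv_dl_dl, simp add: conv_assoc conv_one_left)
    finally have "c * (dl (inv h) \<star> (a \<star> p)) x = (a \<star> p) x" for x by metis
    thus "dl (inv h) \<star> (a \<star> p) = (\<lambda>x. 1 / c * (a \<star> p) x)"
      using h(2) by (auto simp: S_def fun_eq_iff field_simps)
  qed (use h in \<open>auto simp: S_def\<close>)
  define N where "N = {h \<in> carrier G. \<exists>c. S h c}"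
  have "N \<lhd> G"
    unfolding normal_inv_iff
  proof (intro conjI ballI)
    show "subgroup N G"
      by (rule subgroupI) (auto simp: N_def intro: Smul Sinv Sone)
    fix x h assume x: "x \<in> carrier G" and h: "h \<in> N"
    obtain c where c: "h \<in> carrier G" "S h c" using h by (auto simp: N_def)
    have "S (x \<otimes> h \<otimes> inv x) c" unfolding S_def
    proof (intro conjI ballI)
      fix a assume a: "a \<in> R"
      have "dl (x \<otimes> h \<otimes> inv x) \<star> (a \<star> p) = dl x \<star> (dl h \<star> ((dl (inv x) \<star> a) \<star> p))"
      proof -
        have "dl (x \<otimes> h \<otimes> inv x) = dl x \<star> dl h \<star> dl (inv x)" using x c(1) by (simp add: conv_dl_dl)
        thus ?thesis by (simp only: conv_assoc)
      qed
      also have "\<dots> = (\<lambda>y. c * (dl x \<star> ((dl (inv x) \<star> a) \<star> p)) y)"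
        using c by (simp add: S_def conv_scale_right)
      also have "dl x \<star> ((dl (inv x) \<star> a) \<star> p) = a \<star> p"
      proof -
        have "dl x \<star> dl (inv x) = dl \<one>" using x by (simp add: conv_dl_dl)
        hence "(dl x \<star> dl (inv x)) \<star> a = a" using a by (simp only: conv_one_left)
        thus ?thesis by (simp only: conv_assoc[symmetric])
      qed
      finally show "dl (x \<otimes> h \<otimes> inv x) \<star> (a \<star> p) = (\<lambda>y. c * (a \<star> p) y)" .
    qed (use c in \<open>auto simp: S_def\<close>)
    thus "x \<otimes> h \<otimes> inv x \<in> N" using x c by (auto simp: N_def)
  qed
  moreover have "g \<in> N" using g by (auto simp: N_def S_def conv_assoc)
  ultimately have NG: "N = carrier G" by (rule normal)
  hence "\<forall>h\<in>carrier G. \<exists>c. S h c" by (auto simp: N_def)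
  then obtain \<chi> where chi: "\<And>h. h \<in> carrier G \<Longrightarrow> S h (\<chi> h)" by metis
  have chi1: "\<chi> h = 1" if "h \<in> carrier G" for h
  proof (rule perfect[OF _ _ that])
    fix x y assume xy: "x \<in> carrier G" "y \<in> carrier G"
    show "\<chi> (x \<otimes> y) = \<chi> x * \<chi> y"
      by (rule Suniq[OF chi Smul]) (use xy chi in auto)
    show "\<chi> x \<noteq> 0" using chi[OF xy(1)] by (simp add: S_def)
  qed
  have "dl h \<star> p = p" if h: "h \<in> carrier G" for h
  proof -
    have "\<forall>a\<in>R. dl h \<star> (a \<star> p) = (\<lambda>x. (a \<star> p) x)"
      using chi[OF h] chi1[OF h] unfolding S_def by simp
    hence "dl h \<star> (dl \<one> \<star> p) = dl \<one> \<star> p" by simp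
    thus ?thesis using pR(1) by (simp only: conv_one_left)
  qed
  hence inva: "p (inv h \<otimes> x) = p x" if "h \<in> carrier G" "x \<in> carrier G" for h x
    using that conv_dl_left[of h p] by metis
  have const: "p x = p \<one>" if "x \<in> carrier G" for x
    using inva[OF that that] that by simp
  have p1: "p \<one> \<noteq> 0"
  proof
    assume "p \<one> = 0"
    hence "p x = 0" for x by (cases "x \<in> carrier G") (use const[of x] pR(1) in \<open>auto simp: R_def\<close>)
    thus False using pR(3) by (simp add: fun_eq_iff)
  qed
  have "p \<one> = (p \<star> p) \<one>" using pR by simp
  also have "\<dots> = (\<Sum>h\<in>carrier G. p h * p (inv h \<otimes> \<one>))" by (simp add: conv_def)
  also have "\<dots> = (\<Sum>h\<in>carrier G. p \<one> * p \<one>)"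
  proof (rule sum.cong[OF HOL.refl])
    fix h assume h: "h \<in> carrier G"
    hence "inv h \<otimes> \<one> \<in> carrier G" by simp
    from const[OF h] const[OF this] show "p h * p (inv h \<otimes> \<one>) = p \<one> * p \<one>" by (simp only:)
  qed
  also have "\<dots> = of_nat (card (carrier G)) * (p \<one> * p \<one>)" by simp
  finally have "p \<one> = 1 / of_nat (card (carrier G))" using p1 card_pos by (simp add: field_simps)
  hence "p x = 1 / of_nat (card (carrier G))" if "x \<in> carrier G" for x
    using const[OF that] by (simp only:)
  thus ?thesis using pR(1) by (auto simp: fun_eq_iff R_def)
qed

end

subsection \<open>Conjugacy classes of prime power size\<close>

context finite_group
begin

text \<open>Burnside: the trivial character contributes 1 to the vanishing sum of all
  \<open>\<chi>(1) \<chi>(g)\<close>, every other one contributes 0 or a multiple of the prime.\<close>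

lemma prime_power_class:
  assumes perfect: "\<And>\<chi> :: 'a \<Rightarrow> complex. (\<And>x y. x \<in> carrier G \<Longrightarrow> y \<in> carrier G \<Longrightarrow> \<chi> (x \<otimes> y) = \<chi> x * \<chi> y) \<Longrightarrow>
        (\<And>x. x \<in> carrier G \<Longrightarrow> \<chi> x \<noteq> 0) \<Longrightarrow> (\<And>x. x \<in> carrier G \<Longrightarrow> \<chi> x = 1)"
    and normal: "\<And>N. N \<lhd> G \<Longrightarrow> g \<in> N \<Longrightarrow> N = carrier G"
    and g: "g \<in> carrier G" "g \<noteq> \<one>" and q: "prime q" and card: "card (conj_class g) = q ^ e"
  shows False
proof -
  define m where "m = Coset.order G"
  have m: "m > 0" "g [^] m = \<one>"
    using card_pos g pow_order_eq_1 by (auto simp: m_def Coset.order_def)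
  have one: "dl \<one> \<in> R" "dl \<one> \<star> dl \<one> = dl \<one>" by (simp_all add: conv_dl_dl)
  obtain N :: nat and p where p: "\<And>i. i < N \<Longrightarrow> prim (p i)" and sump: "dl \<one> = (\<Sum>i<N. p i)"
    using prim_decomposition[OF one] by blast
  define chi where "chi i = tr (dl g) (p i)" for i
  define d where "d i = card {j \<in> {..<N}. linked (p j) (p i)}" for i
  have d: "tr (dl \<one>) (p i) = of_nat (d i)" if "i < N" for i
  proof -
    have "tr (dl \<one>) (p i) = (\<Sum>j<N. if linked (p j) (p i) then 1 else 0)"
      unfolding sump tr_sum_left by (intro sum.cong HOL.refl) (use that p in \<open>auto simp: tr_prim\<close>)
    also have "\<dots> = of_nat (d i)" by (simp add: sum.If_cases Int_def d_def)
    finally show ?thesis .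
  qed
  have dpos: "d i > 0" if i: "i < N" for i
  by (use i linked_refl p in \<open>auto simp: d_def card_gt_0_iff\<close>)
  have "\<forall>i. \<exists>n. i < N \<longrightarrow> chi i = (\<Sum>k<m. of_nat (n k) * root1 m ^ k) \<and> (\<Sum>k<m. n k) = d i \<and>
      (\<forall>j<m. (\<forall>k<m. k \<noteq> j \<longrightarrow> n k = 0) \<longrightarrow> (\<forall>a\<in>R. dl g \<star> a \<star> p i = (\<lambda>x. root1 m ^ j * (a \<star> p i) x)))"
  proof
    fix i
    show "\<exists>n. i < N \<longrightarrow> chi i = (\<Sum>k<m. of_nat (n k) * root1 m ^ k) \<and> (\<Sum>k<m. n k) = d i \<and>
      (\<forall>j<m. (\<forall>k<m. k \<noteq> j \<longrightarrow> n k = 0) \<longrightarrow> (\<forall>a\<in>R. dl g \<star> a \<star> p i = (\<lambda>x. root1 m ^ j * (a \<star> p i) x)))"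
    proof (cases "i < N")
      case True
      obtain n where n: "tr (dl g) (p i) = (\<Sum>k<m. of_nat (n k) * root1 m ^ k)"
        "tr (dl \<one>) (p i) = of_nat (\<Sum>k<m. n k)"
        "\<And>j a. j < m \<Longrightarrow> \<forall>k<m. k \<noteq> j \<longrightarrow> n k = 0 \<Longrightarrow> a \<in> R \<Longrightarrow>
          dl g \<star> a \<star> p i = (\<lambda>x. root1 m ^ j * (a \<star> p i) x)"
        by (rule character_multiplicities[OF g(1) m p[OF True]]) blast
      have "(\<Sum>k<m. n k) = d i" using n(2) d[OF True] by (metis of_nat_eq_iff)
      thus ?thesis using n by (intro exI[of _ n]) (auto simp: chi_def)
    qed simp
  qed
  from choice[OF this] obtain n where nn: "\<forall>i. i < N \<longrightarrow> chi i = (\<Sum>k<m. of_nat (n i k) * root1 m ^ k) \<and> (\<Sum>k<m. n i k) = d i \<and>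
      (\<forall>j<m. (\<forall>k<m. k \<noteq> j \<longrightarrow> n i k = 0) \<longrightarrow> (\<forall>a\<in>R. dl g \<star> a \<star> p i = (\<lambda>x. root1 m ^ j * (a \<star> p i) x)))" ..
  have n: "chi i = (\<Sum>k<m. of_nat (n i k) * root1 m ^ k)" if "i < N" for i using nn that by blast
  have nd: "(\<Sum>k<m. n i k) = d i" if "i < N" for i using nn that by blast
  have nscal: "dl g \<star> a \<star> p i = (\<lambda>x. root1 m ^ j * (a \<star> p i) x)"
    if "i < N" "j < m" "\<forall>k<m. k \<noteq> j \<longrightarrow> n i k = 0" "a \<in> R" for i j a
    using nn that by blast
  \<comment> \<open>The averaging idempotent, which affords the trivial character.\<close>
  define e0 where "e0 = (\<lambda>x. if x \<in> carrier G then 1 / complex_of_nat (card (carrier G)) else 0)"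
  have chi0: "chi i = 0 \<or> p i = e0" if i: "i < N" and nq: "\<not> q dvd d i" for i
  proof (rule disjCI)
    assume ne: "p i \<noteq> e0"
    obtain w where w: "class_sum g \<star> p i = (\<lambda>x. w * p i x)"
      "of_nat (card (conj_class g)) * tr (dl g) (p i) = w * tr (dl \<one>) (p i)"
      by (rule class_sum_eigenvalue[OF g(1) p[OF i]])
    have "coprime (int (d i)) (int (q ^ e))"
      using nq q by (metis coprime_commute coprime_int_iff coprime_power_left_iff prime_imp_coprime)
    then obtain u v where uv: "u * int (d i) + v * int (q ^ e) = 1"
      by (metis bezout_int coprime_iff_gcd_eq_1)
    \<comment> \<open>Character value divided by degree. Since the degree is prime to the class
      size, the Bezout relation \<open>uv\<close> writes \<open>a\<close> as an integral combination
      of the character value and of the class-sum eigenvalue \<open>w\<close>.\<close>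
    define a where "a = chi i / of_nat (d i)"
    have da: "of_nat (d i) * a = chi i" using dpos[OF i] by (simp add: a_def)
    have wa: "w = of_nat (q ^ e) * a"
      using w(2) dpos[OF i] unfolding card d[OF i] chi_def[symmetric] da[symmetric] by simp
    have "a = of_int (u * int (d i) + v * int (q ^ e)) * a" by (simp only: uv of_int_1 mult_1)
    also have "\<dots> = of_int u * (of_nat (d i) * a) + of_int v * (of_nat (q ^ e) * a)"
      by (simp add: algebra_simps)
    also have "\<dots> = of_int u * (\<Sum>k<m. of_nat (n i k) * root1 m ^ k) + of_int v * w"
      by (simp only: da wa n[OF i])
    finally have alg: "algebraic_int a"
      by (rule character_combination_integral[OF g(1) p[OF i] m(1) w(1)])
    have a1: "a = 0" if "cmod a < 1"
      by (rule average_of_roots_of_unity[OF m(1) dpos[OF i] nd[OF i] _ alg that]) (simp only: da n[OF i])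
    \<comment> \<open>If \<open>cmod a < 1\<close>, the norm argument gives \<open>a = 0\<close>.
      Otherwise only one eigenvalue of \<open>g\<close> occurs, so \<open>g\<close> acts as a scalar
      and \<open>p i\<close> would be the trivial idempotent.\<close>
    show "chi i = 0"
    proof (cases "cmod a < 1")
      case True
      thus ?thesis using a1 da by simp
    next
      case False
      have "real (d i) * 1 \<le> real (d i) * cmod a" using False by (intro mult_left_mono) auto
      also have "\<dots> = cmod (of_nat (d i) * a)" by (simp add: norm_mult)
      finally have "real (d i) \<le> cmod (\<Sum>k<m. of_nat (n i k) * root1 m ^ k)" by (simp only: da n[OF i])
      then obtain j where j: "j < m" "\<And>k. k < m \<Longrightarrow> k \<noteq> j \<Longrightarrow> n i k = 0"
        using root1_sum_extremal[OF nd[OF i] dpos[OF i]] by blast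
      have "root1 m ^ j \<noteq> 0" by (metis norm_root1 norm_zero zero_neq_one)
      have "p i = e0" unfolding e0_def
      proof (rule prim_scalar_action_uniform[OF p[OF i] _ _ g(1) \<open>root1 m ^ j \<noteq> 0\<close>], goal_cases)
        case (1 \<chi> x) thus ?case by (rule perfect)
      next
        case (2 N) thus ?case by (rule normal)
      next
        case (3 a) show ?case by (rule nscal[OF i j(1) _ 3]) (use j(2) in blast)
      qed
      thus ?thesis using ne by simp
    qed
  qed
  have Gn: "complex_of_nat (card (carrier G)) \<noteq> 0" using card_pos by simp
  have tr_e0: "tr (dl h) e0 = 1" if "h \<in> carrier G" for h
    using that Gn by (simp add: tr_dl_left e0_def)
  have e0R: "e0 \<in> R" by (simp add: e0_def R_def)
  have dle0: "dl h \<star> e0 = e0" if "h \<in> carrier G" for h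
    using that by (auto simp: conv_dl_left e0_def fun_eq_iff)
  have ae0: "a \<star> e0 = (\<lambda>x. (\<Sum>h\<in>carrier G. a h) * e0 x)" if a: "a \<in> R" for a
  proof -
    have "a \<star> e0 = (\<Sum>h\<in>carrier G. (\<lambda>x. a h * dl h x)) \<star> e0" using R_expand[OF a] by simp
    also have "\<dots> = (\<Sum>h\<in>carrier G. (\<lambda>x. a h * e0 x))"
      unfolding conv_sum_left conv_scale_left by (intro sum.cong HOL.refl) (simp add: dle0)
    finally show ?thesis by (auto simp: fun_eq_iff fun_sum_apply sum_distrib_right)
  qed
  have e0e0: "e0 \<star> e0 = e0" using ae0[OF e0R] Gn by (simp add: e0_def fun_eq_iff)
  have e00: "e0 \<noteq> 0" using Gn by (auto simp: e0_def fun_eq_iff)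
  have prim0: "prim e0" unfolding prim_def
  by (use e0R e00 e0e0 ae0 in simp)
  \<comment> \<open>Some summand is linked to \<open>e0\<close>. It has degree 1, which
    \<open>q\<close> does not divide, and value 1 at \<open>g\<close>, so the dichotomy
    \<open>chi0\<close> leaves only \<open>e0\<close> itself.\<close>
  have "\<exists>i<N. p i = e0"
  proof -
    have "\<exists>i<N. p i \<star> e0 \<noteq> 0"
    proof (rule ccontr)
      assume "\<not> (\<exists>i<N. p i \<star> e0 \<noteq> 0)"
      hence "(\<Sum>i<N. p i) \<star> e0 = 0" by (simp add: conv_sum_left)
      thus False using e00 e0R unfolding sump[symmetric] by (simp add: conv_one_left)
    qed
    then obtain i where i: "i < N" "p i \<star> e0 \<noteq> 0" by blast
    have "p i \<star> dl \<one> \<star> e0 \<noteq> 0" using i p[OF i(1)] by (simp add: conv_one_right prim_def)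
    hence l: "linked (p i) e0" unfolding linked_def using one(1) by blast
    have "chi i = 1" using tr_linked[OF p[OF i(1)] prim0 l g(1)] tr_e0[OF g(1)] by (simp add: chi_def)
    moreover have "of_nat (d i) = (1::complex)"
      using tr_linked[OF p[OF i(1)] prim0 l one_closed] tr_e0[OF one_closed] d[OF i(1)] by simp
    hence "d i = 1" by (metis of_nat_1 of_nat_eq_iff)
    hence "\<not> q dvd d i" using q by (simp add: prime_nat_iff)
    ultimately show ?thesis using chi0[OF i(1)] i(1) by auto
  qed
  then obtain i0 where i0: "i0 < N" "p i0 = e0" by blast
  have "of_nat (d i0) = (1::complex)" using d[OF i0(1)] tr_e0[OF one_closed] i0 by simp
  hence d0: "d i0 = 1" by (metis of_nat_1 of_nat_eq_iff)
  have uniq: "i = i0" if "i < N" "p i = e0" for i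
  proof -
    have "{i, i0} \<subseteq> {j \<in> {..<N}. linked (p j) (p i0)}" using that i0 linked_refl prim0 by auto
    hence "card {i, i0} \<le> d i0" unfolding d_def by (intro card_mono) simp_all
    hence "card {i, i0} \<le> 1" using d0 by simp
    thus ?thesis by (auto simp: card_insert_if split: if_splits)
  qed
  define J where "J = {i \<in> {..<N}. q dvd d i}"
  \<comment> \<open>The character of the regular representation vanishes at
    \<open>g \<noteq> \<one>\<close>.\<close>
  have "0 = tr (dl g) (dl \<one>)"
  proof -
    have "inv h \<otimes> inv g \<otimes> h \<noteq> \<one>" if "h \<in> carrier G" for h
    proof
      assume "inv h \<otimes> inv g \<otimes> h = \<one>"
      hence "h \<otimes> (inv h \<otimes> inv g \<otimes> h) \<otimes> inv h = \<one>" using that by simp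
      hence "inv g = \<one>" using that g(1) by (simp add: m_assoc[symmetric]) (simp add: m_assoc)
      thus False using g by (metis inv_inv inv_one)
    qed
    hence "dl \<one> (inv h \<otimes> inv g \<otimes> h) = 0" if "h \<in> carrier G" for h
      using that by (simp add: dl_def)
    thus ?thesis unfolding tr_dl_left[OF g(1)] by (intro sum.neutral[symmetric]) simp
  qed
  also have "\<dots> = (\<Sum>i<N. chi i)"
    using arg_cong[OF sump, of "tr (dl g)"] by (simp only: tr_sum_right chi_def)
  also have "\<dots> = (\<Sum>i<N. (if i = i0 then 1 else 0) + (if q dvd d i then chi i else 0))"
  proof (rule sum.cong[OF HOL.refl])
    fix i assume "i \<in> {..<N}"
    hence i: "i < N" by simp
    have "\<not> q dvd d i0" using d0 q by (simp add: prime_nat_iff)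
    moreover have "chi i0 = 1" using i0 tr_e0[OF g(1)] by (simp add: chi_def)
    ultimately show "chi i = (if i = i0 then 1 else 0) + (if q dvd d i then chi i else 0)"
      using chi0[OF i] uniq[OF i] by auto
  qed
  also have "\<dots> = 1 + (\<Sum>i\<in>J. chi i)"
  proof -
    have "(\<Sum>i\<in>J. chi i) = (\<Sum>i<N. if q dvd d i then chi i else 0)"
      unfolding J_def by (rule sum.inter_filter) simp
    thus ?thesis using i0(1) by (simp add: sum.distrib)
  qed
  finally have eq: "(\<Sum>i\<in>J. chi i) = -1" by (simp add: eq_neg_iff_add_eq_0 add.commute)
  \<comment> \<open>Grouping summands by linkage: the class of \<open>r\<close> has exactly
    \<open>d r\<close> members, all with the value \<open>chi r\<close>, which turns the sum over
    summands into a sum of degree times character value.\<close>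
  define L where "L i j \<longleftrightarrow> linked (p i) (p j)" for i j
  have Lsym: "L i j \<Longrightarrow> i < N \<Longrightarrow> j < N \<Longrightarrow> L j i" for i j using linked_sym p unfolding L_def by blast
  have Ltrans: "L i j \<Longrightarrow> L j k \<Longrightarrow> i < N \<Longrightarrow> j < N \<Longrightarrow> k < N \<Longrightarrow> L i k" for i j k
    using linked_trans p unfolding L_def by blast
  have Lrefl: "i < N \<Longrightarrow> L i i" for i using linked_refl p unfolding L_def by blast
  define rep where "rep i = (LEAST j. j < N \<and> L i j)" for i
  have rep: "rep i < N \<and> L i (rep i)" if "i < N" for i
    unfolding rep_def using Lrefl that by (intro LeastI[of "\<lambda>j. j < N \<and> L i j" i]) simp
  have repeq: "rep i = rep j" if "L i j" "i < N" "j < N" for i j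
  proof -
    have "(\<lambda>k. k < N \<and> L i k) = (\<lambda>k. k < N \<and> L j k)"
      using that Lsym Ltrans by blast
    thus ?thesis by (simp add: rep_def)
  qed
  have chid: "chi i = chi j \<and> d i = d j" if "L i j" "i < N" "j < N" for i j
  proof -
    have "tr (dl g) (p i) = tr (dl g) (p j)" "tr (dl \<one>) (p i) = tr (dl \<one>) (p j)"
      using that p tr_linked g(1) unfolding L_def by auto
    thus ?thesis using d that by (simp add: chi_def)
  qed
  have fJ: "finite J" by (simp add: J_def)
  have "(\<Sum>i\<in>J. chi i) = (\<Sum>r\<in>rep ` J. \<Sum>i | i \<in> J \<and> rep i = r. chi i)"
    using sum.image_gen[OF fJ, of chi rep] by simp
  also have "\<dots> = (\<Sum>r\<in>rep ` J. of_nat (d r) * chi r)"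
  proof (rule sum.cong[OF HOL.refl])
    fix r assume "r \<in> rep ` J"
    then obtain i1 where i1: "i1 \<in> J" "r = rep i1" by auto
    have i1N: "i1 < N" and r: "r < N" "L i1 r" using i1 rep by (auto simp: J_def)
    have rr: "rep r = r" using repeq[OF r(2) i1N r(1)] i1 by simp
    have "{i. i \<in> J \<and> rep i = r} = {j \<in> {..<N}. linked (p j) (p r)}"
    proof (rule Set.set_eqI, rule HOL.iffI)
      fix i assume "i \<in> {i. i \<in> J \<and> rep i = r}"
      thus "i \<in> {j \<in> {..<N}. linked (p j) (p r)}" using rep[of i] by (auto simp: J_def L_def)
    next
      fix i assume "i \<in> {j \<in> {..<N}. linked (p j) (p r)}"
      hence i: "i < N" "L i r" by (auto simp: L_def)
      have "d i = d i1" using chid[OF i(2) i(1) r(1)] chid[OF r(2) i1N r(1)] by simp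
      thus "i \<in> {i. i \<in> J \<and> rep i = r}" using i i1 repeq[OF i(2) i(1) r(1)] rr by (simp add: J_def)
    qed
    moreover have "chi i = chi r" if "i \<in> {j \<in> {..<N}. linked (p j) (p r)}" for i
      using that chid[of i r] r by (simp add: L_def)
    ultimately have "(\<Sum>i | i \<in> J \<and> rep i = r. chi i) = (\<Sum>i\<in>{j \<in> {..<N}. linked (p j) (p r)}. chi r)"
      by (intro sum.cong) auto
    thus "(\<Sum>i | i \<in> J \<and> rep i = r. chi i) = of_nat (d r) * chi r" by (simp add: d_def)
  qed
  also have "\<dots> = (\<Sum>r\<in>rep ` J. \<Sum>k<m. of_nat q * (of_nat (d r div q * n r k) * root1 m ^ k))"
  proof (rule sum.cong[OF HOL.refl])
    fix r assume "r \<in> rep ` J"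
    then obtain i1 where i1: "i1 \<in> J" "r = rep i1" by auto
    have i1N: "i1 < N" and r: "r < N" "L i1 r" using i1 rep by (auto simp: J_def)
    have "q dvd d r" using chid[OF r(2) i1N r(1)] i1 by (simp add: J_def)
    hence dr: "d r = q * (d r div q)" by simp
    have "of_nat (d r) * chi r = of_nat (q * (d r div q)) * (\<Sum>k<m. of_nat (n r k) * root1 m ^ k)"
      using n[OF r(1)] dr by simp
    thus "of_nat (d r) * chi r = (\<Sum>k<m. of_nat q * (of_nat (d r div q * n r k) * root1 m ^ k))"
      by (simp add: sum_distrib_left mult_ac)
  qed
  also have "\<dots> = of_nat q * (\<Sum>k<m. of_nat (\<Sum>r\<in>rep ` J. d r div q * n r k) * root1 m ^ k)"
    by (subst sum.swap) (simp add: sum_distrib_left sum_distrib_right)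
  finally have fin_eq: "of_nat q * (\<Sum>k<m. of_nat (\<Sum>r\<in>rep ` J. d r div q * n r k) * root1 m ^ k) = (-1::complex)"
    using eq by simp
  \<comment> \<open>Every \<open>d r\<close> occurring is divisible by \<open>q\<close>, so the
    vanishing sum becomes \<open>q * x = -1\<close> with \<open>x\<close> an integral combination of
    roots of unity; a rational algebraic integer is an integer, which is absurd here.\<close>
  define c where "c k = (\<Sum>r\<in>rep ` J. d r div q * n r k)" for k
  define x :: complex where "x = (\<Sum>k<m. of_nat (c k) * root1 m ^ k)"
  have q0: "q > 1" using q by (rule prime_gt_1_nat)
  have qx: "of_nat q * x = -1" using fin_eq by (simp only: x_def c_def)
  have "algebraic_int x"
  proof (rule algebraic_int_eigenvalue[of "{..<m}" 0 "\<lambda>t. root1 m ^ t" x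
        "\<lambda>t s. \<Sum>k | k < m \<and> (t + k) mod m = s. int (c k)"])
    fix t assume "t \<in> {..<m}"
    have "(\<Sum>s<m. of_int (\<Sum>k | k < m \<and> (t + k) mod m = s. int (c k)) * root1 m ^ s)
        = (\<Sum>s<m. \<Sum>k | k < m \<and> (t + k) mod m = s. of_nat (c k) * root1 m ^ ((t + k) mod m))"
      by (intro sum.cong HOL.refl) (auto simp: sum_distrib_right intro!: sum.cong)
    also have "\<dots> = (\<Sum>k<m. of_nat (c k) * root1 m ^ ((t + k) mod m))" by (rule sum_group_mod[OF m(1)])
    also have "\<dots> = x * root1 m ^ t"
      unfolding x_def using m(1) by (subst sum_distrib_right) (simp add: root1_mod power_add mult_ac)
    finally show "x * root1 m ^ t = (\<Sum>j\<in>{..<m}. of_int (\<Sum>k | k < m \<and> (t + k) mod m = j. int (c k)) * root1 m ^ j)" ..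
  qed (use m in auto)
  moreover have xr: "x = of_real (- 1 / real q)" using qx q0 by (simp add: field_simps)
  moreover have "x \<in> \<rat>" unfolding xr by (simp add: Rats_divide)
  ultimately have "x \<in> \<int>" by (intro rational_algebraic_int_is_int)
  then obtain z :: int where z: "x = of_int z" by (auto elim: Ints_cases)
  hence "of_int (int q * z) = (of_int (-1) :: complex)" using qx by simp
  hence "int q * z = -1" by (metis of_int_eq_iff)
  hence "int q dvd 1" by (metis dvd_minus_iff dvd_triv_left)
  thus False using q0 by simp
qed

end

subsection \<open>Parts of a number with respect to a set of primes\<close>

text \<open>The pi-part of \<open>n\<close>. For \<open>n = 0\<close> the factorization is empty and
  the value is 1, so a part is always positive.\<close>

definition part :: "nat set \<Rightarrow> nat \<Rightarrow> nat" where
  "part \<pi> n = prod_mset (filter_mset (\<lambda>p. p \<in> \<pi>) (prime_factorization n))"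

lemma prime_factorization_part:
  "prime_factorization (part \<pi> n) = filter_mset (\<lambda>p. p \<in> \<pi>) (prime_factorization n)"
  unfolding part_def by (rule prime_factorization_prod_mset_primes) (auto simp: in_prime_factors_iff)

lemma part_pos [simp]: "part \<pi> n > 0"
  unfolding part_def by (auto simp: prod_mset_zero_iff in_prime_factors_iff intro!: gr0I)

lemma part_mult: "m > 0 \<Longrightarrow> n > 0 \<Longrightarrow> part \<pi> (m * n) = part \<pi> m * part \<pi> n"
  by (simp add: part_def prime_factorization_mult)

lemma part_part: "part \<pi> (part \<rho> n) = part (\<pi> \<inter> \<rho>) n"
proof -
  have "filter_mset (\<lambda>p. p \<in> \<pi>) (filter_mset (\<lambda>p. p \<in> \<rho>) M) = filter_mset (\<lambda>p. p \<in> \<pi> \<inter> \<rho>) M" for M :: "nat multiset"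
    by (simp add: filter_filter_mset conj_commute)
  thus ?thesis unfolding part_def[of \<pi> "part \<rho> n"] prime_factorization_part by (simp add: part_def)
qed

lemma part_Un_Int: "part \<pi> n * part \<rho> n = part (\<pi> \<inter> \<rho>) n * part (\<pi> \<union> \<rho>) n"
proof -
  have "filter_mset (\<lambda>p. p \<in> \<pi>) M + filter_mset (\<lambda>p. p \<in> \<rho>) M
     = filter_mset (\<lambda>p. p \<in> \<pi> \<inter> \<rho>) M + filter_mset (\<lambda>p. p \<in> \<pi> \<union> \<rho>) M" for M :: "nat multiset"
    by (rule multiset_eqI) auto
  thus ?thesis unfolding part_def by (metis prod_mset_Un)
qed

lemma part_UNIV [simp]: "n > 0 \<Longrightarrow> part UNIV n = n"
  by (simp add: part_def prod_mset_prime_factorization_nat)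

lemma part_empty [simp]: "part {} n = 1"
  by (simp add: part_def)

lemma part_compl: "n > 0 \<Longrightarrow> part \<pi> n * part (- \<pi>) n = n"
  using part_Un_Int[of \<pi> n "- \<pi>"] by simp

lemma part_self: assumes "n > 0" "prime_factors n \<subseteq> \<pi>" shows "part \<pi> n = n"
proof -
  have "filter_mset (\<lambda>p. p \<in> \<pi>) (prime_factorization n) = prime_factorization n"
    using assms by (auto simp: filter_mset_eq_conv)
  thus ?thesis using assms by (simp add: part_def prod_mset_prime_factorization_nat)
qed

lemma prime_factors_part: "prime_factors (part \<pi> n) = prime_factors n \<inter> \<pi>"
  by (auto simp: prime_factorization_part)

lemma part_dvd_mono: assumes "a dvd b" "b > 0" shows "part \<pi> a dvd part \<pi> b"
proof -
  obtain c where "b = a * c" using assms by blast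
  thus ?thesis using assms by (auto simp: part_mult)
qed

lemma coprime_part: assumes "prime_factors m \<subseteq> \<pi>" "m > 0" shows "coprime m (part (- \<pi>) n)"
proof (rule ccontr)
  assume "\<not> coprime m (part (- \<pi>) n)"
  hence "gcd m (part (- \<pi>) n) \<noteq> 1" by (simp add: coprime_iff_gcd_eq_1)
  then obtain p where "prime p" "p dvd gcd m (part (- \<pi>) n)" using prime_factor_nat by blast
  hence p: "prime p" "p dvd m" "p dvd part (- \<pi>) n" by simp_all
  hence "p \<in> prime_factors m" "p \<in> prime_factors (part (- \<pi>) n)"
    using assms by (auto simp: in_prime_factors_iff)
  thus False using assms by (auto simp: prime_factors_part)
qed

lemma part_single: assumes "prime p" shows "\<exists>a. part {p} n = p ^ a"
proof -
  have "filter_mset (\<lambda>q. q \<in> {p}) M = replicate_mset (count M p) p" for M :: "nat multiset"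
    by (rule multiset_eqI) auto
  thus ?thesis unfolding part_def by (metis prod_mset_replicate_mset)
qed

subsection \<open>Finite groups\<close>

context group
begin

text \<open>The fibre of the product map over \<open>h \<otimes> k\<close> consists of the pairs
  \<open>(h \<otimes> t, inv t \<otimes> k)\<close> with \<open>t\<close> in the
  intersection.\<close>

lemma card_set_mult:
  assumes H: "subgroup H G" and K: "subgroup K G" and fin: "finite (carrier G)"
  shows "card (H <#> K) * card (H \<inter> K) = card H * card K"
proof -
  have HG: "H \<subseteq> carrier G" "K \<subseteq> carrier G" using subgroup.subset[OF H] subgroup.subset[OF K] by auto
  have fH: "finite H" "finite K" using HG fin finite_subset by auto
  let ?f = "\<lambda>(h, k). h \<otimes> k"
  have img: "H <#> K = ?f ` (H \<times> K)" by (auto simp: set_mult_def)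
  have fib: "card {p \<in> H \<times> K. ?f p = y} = card (H \<inter> K)" if yy: "y \<in> ?f ` (H \<times> K)" for y
  proof -
    obtain h k where hk: "h \<in> H" "k \<in> K" "y = h \<otimes> k" using yy by auto
    have hk': "h \<in> carrier G" "k \<in> carrier G" using hk HG by auto
    have "bij_betw (\<lambda>t. (h \<otimes> t, inv t \<otimes> k)) (H \<inter> K) {p \<in> H \<times> K. ?f p = y}"
    proof (rule bij_betwI[where g="\<lambda>p. inv h \<otimes> fst p"])
      show "(\<lambda>t. (h \<otimes> t, inv t \<otimes> k)) \<in> H \<inter> K \<rightarrow> {p \<in> H \<times> K. ?f p = y}"
      proof
        fix t assume t: "t \<in> H \<inter> K"
        hence tG: "t \<in> carrier G" using HG by auto
        have "h \<otimes> t \<otimes> (inv t \<otimes> k) = h \<otimes> (t \<otimes> inv t) \<otimes> k" using tG hk' by (simp only: m_assoc m_closed inv_closed)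
        hence "h \<otimes> t \<otimes> (inv t \<otimes> k) = h \<otimes> k" using tG hk' by simp
        thus "(h \<otimes> t, inv t \<otimes> k) \<in> {p \<in> H \<times> K. ?f p = y}"
          using t hk H K by (auto intro: subgroup.m_closed subgroup.m_inv_closed)
      qed
      show "(\<lambda>p. inv h \<otimes> fst p) \<in> {p \<in> H \<times> K. ?f p = y} \<rightarrow> H \<inter> K"
      proof
        fix p assume "p \<in> {p \<in> H \<times> K. ?f p = y}"
        then obtain a b where ab: "p = (a, b)" "a \<in> H" "b \<in> K" "a \<otimes> b = h \<otimes> k" using hk by auto
        have abG: "a \<in> carrier G" "b \<in> carrier G" using ab HG by auto
        have "inv h \<otimes> a = inv h \<otimes> (a \<otimes> b) \<otimes> inv b" using abG hk' by (simp add: m_assoc)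
        also have "\<dots> = k \<otimes> inv b" using abG hk' by (simp add: ab(4) m_assoc[symmetric])
        finally have "inv h \<otimes> a \<in> K" using ab hk K by (simp add: subgroup.m_closed subgroup.m_inv_closed)
        thus "inv h \<otimes> fst p \<in> H \<inter> K"
          using ab hk H by (simp add: subgroup.m_closed subgroup.m_inv_closed)
      qed
      show "inv h \<otimes> fst (h \<otimes> t, inv t \<otimes> k) = t" if "t \<in> H \<inter> K" for t
        using that hk' HG by (auto simp: m_assoc[symmetric])
      show "(h \<otimes> (inv h \<otimes> fst p), inv (inv h \<otimes> fst p) \<otimes> k) = p" if pp: "p \<in> {p \<in> H \<times> K. ?f p = y}" for p
      proof -
        obtain a b where ab: "p = (a, b)" "a \<in> H" "b \<in> K" "a \<otimes> b = h \<otimes> k" using pp hk by auto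
        have abG: "a \<in> carrier G" "b \<in> carrier G" using ab HG by auto
        have "inv (inv h \<otimes> a) \<otimes> k = inv a \<otimes> (h \<otimes> k)" using abG hk' by (simp add: inv_mult_group m_assoc)
        also have "\<dots> = b" using abG by (simp add: ab(4)[symmetric] m_assoc[symmetric])
        finally show ?thesis using ab abG hk' by (simp add: m_assoc[symmetric])
      qed
    qed
    thus ?thesis by (rule bij_betw_same_card[symmetric])
  qed
  have "card H * card K = (\<Sum>p\<in>H \<times> K. 1)" by (simp add: card_cartesian_product)
  also have "\<dots> = (\<Sum>y\<in>?f ` (H \<times> K). \<Sum>p | p \<in> H \<times> K \<and> ?f p = y. 1)"
    by (rule sum.image_gen) (use fH in simp)
  also have "\<dots> = (\<Sum>y\<in>?f ` (H \<times> K). card {p \<in> H \<times> K. ?f p = y})" by simp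
  also have "\<dots> = (\<Sum>y\<in>?f ` (H \<times> K). card (H \<inter> K))" by (rule sum.cong[OF HOL.refl]) (rule fib)
  finally show ?thesis by (simp add: img)
qed

lemma card_subgroup_dvd:
  assumes "subgroup H G" "subgroup K G" "H \<subseteq> K" shows "card H dvd card K"
proof -
  interpret K: group "G\<lparr>carrier := K\<rparr>" using assms subgroup_imp_group by blast
  have "card (rcosets\<^bsub>G\<lparr>carrier := K\<rparr>\<^esub> H) * card H = Coset.order (G\<lparr>carrier := K\<rparr>)"
    by (rule K.lagrange) (use assms subgroup_incl in blast)
  hence "card (rcosets\<^bsub>G\<lparr>carrier := K\<rparr>\<^esub> H) * card H = card K" by (simp add: Coset.order_def)
  thus ?thesis by (metis dvd_triv_right)
qed

text \<open>Normality relative to a subgroup \<open>H\<close>, with both sets kept inside the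
  ambient group, so that products, inverses and Hall subgroups stay the same throughout the
  inductions.\<close>

definition nrm :: "'a set \<Rightarrow> 'a set \<Rightarrow> bool" where
  "nrm N H \<longleftrightarrow> subgroup N G \<and> N \<subseteq> H \<and> (\<forall>h\<in>H. \<forall>x\<in>N. h \<otimes> x \<otimes> inv h \<in> N)"

lemma nrm_normal: assumes "nrm N H" "subgroup H G" shows "N \<lhd> (G\<lparr>carrier := H\<rparr>)"
proof -
  interpret H: group "G\<lparr>carrier := H\<rparr>" using assms subgroup_imp_group by blast
  show ?thesis unfolding H.normal_inv_iff
    using assms subgroup_incl[of N H] by (auto simp: nrm_def m_inv_consistent)
qed

lemma nrm_set_mult_subgroup:
  assumes N: "nrm N H" and H: "subgroup H G" and K: "subgroup K G" "K \<subseteq> H"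
  shows "subgroup (N <#> K) G"
proof -
  have NG: "N \<subseteq> carrier G" "K \<subseteq> carrier G" "subgroup N G"
    using N subgroup.subset[of N G] subgroup.subset[OF K(1)] by (auto simp: nrm_def)
  have mem: "N <#> K = {n \<otimes> k |n k. n \<in> N \<and> k \<in> K}" by (auto simp: set_mult_def)
  have conj: "k \<otimes> n \<otimes> inv k \<in> N" if "k \<in> K" "n \<in> N" for k n using that N K by (auto simp: nrm_def)
  show ?thesis
  proof (rule subgroupI)
    show "N <#> K \<subseteq> carrier G" using NG by (auto simp: mem)
    show "N <#> K \<noteq> {}" using subgroup.one_closed[OF NG(3)] subgroup.one_closed[OF K(1)] by (auto simp: mem)
    fix a assume "a \<in> N <#> K"
    then obtain n k where a: "a = n \<otimes> k" "n \<in> N" "k \<in> K" by (auto simp: mem)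
    have aG: "n \<in> carrier G" "k \<in> carrier G" using a NG by auto
    have ik: "inv k \<in> K" using subgroup.m_inv_closed[OF K(1) a(3)] .
    have "inv a = (inv k \<otimes> inv n \<otimes> inv (inv k)) \<otimes> inv k"
      using aG by (simp add: a(1) inv_mult_group m_assoc)
    moreover have "inv k \<otimes> inv n \<otimes> inv (inv k) \<in> N"
      using conj[OF ik subgroup.m_inv_closed[OF NG(3) a(2)]] .
    ultimately show "inv a \<in> N <#> K" using ik by (auto simp: mem)
    fix b assume "b \<in> N <#> K"
    then obtain m l where b: "b = m \<otimes> l" "m \<in> N" "l \<in> K" by (auto simp: mem)
    have bG: "m \<in> carrier G" "l \<in> carrier G" using b NG by auto
    have "a \<otimes> b = (n \<otimes> (k \<otimes> m \<otimes> inv k)) \<otimes> (k \<otimes> l)"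
      using aG bG by (simp add: a(1) b(1) m_assoc) (simp add: m_assoc[symmetric])
    moreover have "n \<otimes> (k \<otimes> m \<otimes> inv k) \<in> N" using subgroup.m_closed[OF NG(3) a(2) conj[OF a(3) b(2)]] .
    moreover have "k \<otimes> l \<in> K" using subgroup.m_closed[OF K(1) a(3) b(3)] .
    ultimately show "a \<otimes> b \<in> N <#> K" by (auto simp: mem)
  qed
qed

text \<open>The core construction exchanges a subgroup \<open>D\<close> for one that is normal in
  the larger group \<open>B\<close>.\<close>

lemma core_nrm:
  assumes M: "nrm M B" and B: "subgroup B G" and D: "subgroup D G"
  shows "nrm {x \<in> M. \<forall>b\<in>B. b \<otimes> x \<otimes> inv b \<in> D} B"
proof -
  have MG: "subgroup M G" "M \<subseteq> carrier G" "B \<subseteq> carrier G" "D \<subseteq> carrier G"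
    using M subgroup.subset[of M G] subgroup.subset[OF B] subgroup.subset[OF D] by (auto simp: nrm_def)
  let ?C = "{x \<in> M. \<forall>b\<in>B. b \<otimes> x \<otimes> inv b \<in> D}"
  have "subgroup ?C G"
  proof (rule subgroupI)
    show "?C \<subseteq> carrier G" using MG by auto
    have "\<one> \<in> ?C"
      using subgroup.one_closed[OF MG(1)] subgroup.one_closed[OF D] MG(3) by (auto simp: subset_iff)
    thus "?C \<noteq> {}" by blast
    fix a assume a: "a \<in> ?C"
    have aG: "a \<in> carrier G" using a MG by auto
    have "b \<otimes> inv a \<otimes> inv b \<in> D" if b: "b \<in> B" for b
    proof -
      have bG: "b \<in> carrier G" using b MG by auto
      have "b \<otimes> inv a \<otimes> inv b = inv (b \<otimes> a \<otimes> inv b)" using aG bG by (simp add: inv_mult_group m_assoc)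
      moreover have "b \<otimes> a \<otimes> inv b \<in> D" using a b by blast
      ultimately show ?thesis using subgroup.m_inv_closed[OF D] by simp
    qed
    thus "inv a \<in> ?C" using a subgroup.m_inv_closed[OF MG(1)] by blast
    fix c assume c: "c \<in> ?C"
    have cG: "c \<in> carrier G" using c MG by auto
    have "b \<otimes> (a \<otimes> c) \<otimes> inv b \<in> D" if b: "b \<in> B" for b
    proof -
      have bG: "b \<in> carrier G" using b MG by auto
      have "b \<otimes> (a \<otimes> c) \<otimes> inv b = b \<otimes> a \<otimes> (inv b \<otimes> b) \<otimes> c \<otimes> inv b" using aG bG cG by (simp add: m_assoc)
      also have "\<dots> = (b \<otimes> a \<otimes> inv b) \<otimes> (b \<otimes> c \<otimes> inv b)" using aG bG cG by (simp only: m_assoc m_closed inv_closed)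
      moreover have "b \<otimes> a \<otimes> inv b \<in> D" "b \<otimes> c \<otimes> inv b \<in> D" using a b c by blast+
      ultimately show ?thesis using subgroup.m_closed[OF D] by simp
    qed
    thus "a \<otimes> c \<in> ?C" using a c subgroup.m_closed[OF MG(1)] by blast
  qed
  moreover have "?C \<subseteq> B" using M by (auto simp: nrm_def)
  moreover have "h \<otimes> x \<otimes> inv h \<in> ?C" if h: "h \<in> B" and x: "x \<in> ?C" for h x
  proof -
    have hG: "h \<in> carrier G" "x \<in> carrier G" using h x MG by auto
    have "b \<otimes> (h \<otimes> x \<otimes> inv h) \<otimes> inv b \<in> D" if b: "b \<in> B" for b
    proof -
      have bG: "b \<in> carrier G" using b MG by auto
      have "b \<otimes> (h \<otimes> x \<otimes> inv h) \<otimes> inv b = (b \<otimes> h) \<otimes> x \<otimes> inv (b \<otimes> h)"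
        using hG bG by (simp add: inv_mult_group m_assoc)
      moreover have "(b \<otimes> h) \<otimes> x \<otimes> inv (b \<otimes> h) \<in> D" using x subgroup.m_closed[OF B b h] by blast
      ultimately show ?thesis by simp
    qed
    thus ?thesis using x h M by (auto simp: nrm_def)
  qed
  ultimately show ?thesis by (simp add: nrm_def)
qed

lemma nat_pow_conj:
  assumes "b \<in> carrier G" "m \<in> carrier G" shows "(b \<otimes> m \<otimes> inv b) [^] (k::nat) = b \<otimes> m [^] k \<otimes> inv b"
proof (induct k)
  case 0 thus ?case using assms by simp
next
  case (Suc k)
  have mk: "m [^] k \<in> carrier G" using assms by simp
  have "(b \<otimes> m [^] k \<otimes> inv b) \<otimes> (b \<otimes> m \<otimes> inv b) = b \<otimes> m [^] k \<otimes> (inv b \<otimes> b) \<otimes> m \<otimes> inv b"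
    using assms mk by (simp only: m_assoc m_closed inv_closed)
  also have "\<dots> = b \<otimes> (m [^] k \<otimes> m) \<otimes> inv b" using assms mk by (simp add: m_assoc)
  finally show ?case using Suc by simp
qed

end

section \<open>Quotients, orbits and fixed points of groups of prime power order\<close>

context finite_group
begin

lemma finite_group_subgroup: "subgroup H G \<Longrightarrow> finite_group (G\<lparr>carrier := H\<rparr>)"
  using subgroup_imp_group subgroup.subset fin finite_subset
  by (fastforce simp: finite_group_def finite_group_axioms_def)

lemma quotient_hom:
  assumes "nrm N H" "subgroup H G"
  obtains F :: "'a set monoid" and \<phi> where "finite_group F"
    "\<forall>x\<in>H. \<forall>y\<in>H. \<phi> (x \<otimes> y) = \<phi> x \<otimes>\<^bsub>F\<^esub> \<phi> y"
    "\<phi> ` H = carrier F" "\<forall>x\<in>H. \<phi> x = \<one>\<^bsub>F\<^esub> \<longleftrightarrow> x \<in> N" "card (carrier F) * card N = card H"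
proof -
  let ?H = "G\<lparr>carrier := H\<rparr>"
  interpret H: group ?H using assms subgroup_imp_group by blast
  interpret N: normal N ?H using nrm_normal assms by blast
  let ?F = "?H Mod N" and ?p = "\<lambda>x. N #>\<^bsub>?H\<^esub> x"
  have fH: "finite H" using assms subgroup.subset fin finite_subset by metis
  have img: "?p ` H = carrier ?F" by (auto simp: FactGroup_def RCOSETS_def)
  have "finite_group ?F"
    unfolding finite_group_def finite_group_axioms_def
    using N.factorgroup_is_group img fH by (metis finite_imageI)
  moreover have "?p (x \<otimes> y) = ?p x \<otimes>\<^bsub>?F\<^esub> ?p y" if "x \<in> H" "y \<in> H" for x y
    using N.rcos_sum[of x y] that by (simp add: FactGroup_def)
  moreover have "?p x = \<one>\<^bsub>?F\<^esub> \<longleftrightarrow> x \<in> N" if "x \<in> H" for x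
    using that H.coset_join1[OF _ _ N.subgroup_axioms] H.coset_join2[OF _ N.subgroup_axioms] N.subset
    by (auto simp: FactGroup_def)
  moreover have "card (carrier ?F) * card N = card H"
    using H.lagrange[OF N.subgroup_axioms] by (simp add: FactGroup_def Coset.order_def)
  ultimately show thesis using img by (intro that[of ?F ?p]) auto
qed

lemma orbit_card:
  assumes act: "\<And>x e. x \<in> carrier G \<Longrightarrow> e \<in> E \<Longrightarrow> act x e \<in> E" "\<And>e. e \<in> E \<Longrightarrow> act \<one> e = e"
      "\<And>x y e. x \<in> carrier G \<Longrightarrow> y \<in> carrier G \<Longrightarrow> e \<in> E \<Longrightarrow> act (x \<otimes> y) e = act x (act y e)"
    and e: "e \<in> E"
  shows "card ((\<lambda>x. act x e) ` carrier G) * card {x \<in> carrier G. act x e = e} = card (carrier G)"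
proof -
  let ?f = "\<lambda>x. act x e"
  have fib: "card {x \<in> carrier G. ?f x = y} = card {x \<in> carrier G. act x e = e}" if yy: "y \<in> ?f ` carrier G" for y
  proof -
    obtain g where g: "g \<in> carrier G" "y = act g e" using yy by auto
    have ret: "act (inv g) (act g e) = e" using act(3)[of "inv g" g e] act(2) g e by simp
    have "bij_betw (\<lambda>x. g \<otimes> x) {x \<in> carrier G. act x e = e} {x \<in> carrier G. ?f x = y}"
    proof (rule bij_betwI[where g="\<lambda>x. inv g \<otimes> x"])
      show "(\<lambda>x. g \<otimes> x) \<in> {x \<in> carrier G. act x e = e} \<rightarrow> {x \<in> carrier G. ?f x = y}"
        using g e act(3) by auto
      show "(\<lambda>x. inv g \<otimes> x) \<in> {x \<in> carrier G. ?f x = y} \<rightarrow> {x \<in> carrier G. act x e = e}"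
      proof
        fix x assume "x \<in> {x \<in> carrier G. ?f x = y}"
        hence x: "x \<in> carrier G" "act x e = act g e" using g by auto
        have "act (inv g \<otimes> x) e = act (inv g) (act x e)" using act(3)[of "inv g" x e] x g e by simp
        thus "inv g \<otimes> x \<in> {x \<in> carrier G. act x e = e}" using x g ret by simp
      qed
      show "inv g \<otimes> (g \<otimes> x) = x" if "x \<in> {x \<in> carrier G. act x e = e}" for x
        using that g by (simp add: m_assoc[symmetric])
      show "g \<otimes> (inv g \<otimes> x) = x" if "x \<in> {x \<in> carrier G. ?f x = y}" for x
        using that g by (simp add: m_assoc[symmetric])
    qed
    thus ?thesis by (rule bij_betw_same_card[symmetric])
  qed
  have "card (carrier G) = (\<Sum>x\<in>carrier G. 1)" by simp
  also have "\<dots> = (\<Sum>y\<in>?f ` carrier G. \<Sum>x | x \<in> carrier G \<and> ?f x = y. 1)"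
    by (rule sum.image_gen) (rule fin)
  also have "\<dots> = (\<Sum>y\<in>?f ` carrier G. card {x \<in> carrier G. ?f x = y})" by simp
  also have "\<dots> = (\<Sum>y\<in>?f ` carrier G. card {x \<in> carrier G. act x e = e})" by (rule sum.cong[OF HOL.refl]) (rule fib)
  finally show ?thesis by simp
qed

text \<open>Orbits that are not single points have size divisible by \<open>q\<close>, so the number
  of fixed points is divisible by \<open>q\<close>; having one of them forces another.\<close>

lemma prime_power_fixed_point:
  assumes q: "prime q" "card (carrier G) = q ^ k" and E: "finite E" "q dvd card E"
    and act: "\<And>x e. x \<in> carrier G \<Longrightarrow> e \<in> E \<Longrightarrow> act x e \<in> E" "\<And>e. e \<in> E \<Longrightarrow> act \<one> e = e"
      "\<And>x y e. x \<in> carrier G \<Longrightarrow> y \<in> carrier G \<Longrightarrow> e \<in> E \<Longrightarrow> act (x \<otimes> y) e = act x (act y e)"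
    and e0: "e0 \<in> E" "\<And>x. x \<in> carrier G \<Longrightarrow> act x e0 = e0"
  obtains e where "e \<in> E" "e \<noteq> e0" "\<And>x. x \<in> carrier G \<Longrightarrow> act x e = e"
proof -
  define F where "F = {e \<in> E. \<forall>x\<in>carrier G. act x e = e}"
  define orb where "orb e = (\<lambda>x. act x e) ` carrier G" for e
  have orbE: "orb e \<subseteq> E" "e \<in> orb e" if "e \<in> E" for e
    using act(1,2) that one_closed by (auto simp: orb_def image_iff intro: bexI[of _ \<one>])
  have orbeq: "orb e = orb f" if ef: "e \<in> E" "f \<in> orb e" for e f
  proof -
    obtain g where g: "g \<in> carrier G" "f = act g e" using ef by (auto simp: orb_def)
    have "act x f \<in> orb e" if "x \<in> carrier G" for x
      using that g act(3)[of x g e] ef unfolding orb_def by (metis image_eqI m_closed)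
    moreover have "act x e \<in> orb f" if "x \<in> carrier G" for x
    proof -
      have "act (x \<otimes> inv g) f = act (x \<otimes> inv g \<otimes> g) e" using that g ef act(3)[of "x \<otimes> inv g" g e] by simp
      also have "x \<otimes> inv g \<otimes> g = x" using that g by (simp add: m_assoc)
      finally show ?thesis using that g unfolding orb_def by (metis image_eqI m_closed inv_closed)
    qed
    ultimately show ?thesis unfolding orb_def by blast
  qed
  have qdvd: "q dvd card (orb e)" if e: "e \<in> E - F" for e
  proof -
    have eE: "e \<in> E" using e by simp
    have "card (orb e) * card {x \<in> carrier G. act x e = e} = q ^ k"
      unfolding orb_def q(2)[symmetric] by (rule orbit_card[of E act, OF act eE])
    hence "card (orb e) dvd q ^ k" by (metis dvd_triv_left)
    then obtain j where j: "card (orb e) = q ^ j" using q(1) by (auto simp: divides_primepow_nat)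
    have "card (orb e) \<noteq> 1"
    proof
      assume "card (orb e) = 1"
      then obtain f where "orb e = {f}" by (auto simp: card_1_singleton_iff)
      hence "orb e = {e}" using orbE(2)[of e] e by auto
      hence "act x e = e" if "x \<in> carrier G" for x using that by (auto simp: orb_def)
      thus False using e by (auto simp: F_def)
    qed
    thus ?thesis using j by (cases j) auto
  qed
  have un: "\<Union>(orb ` (E - F)) = E - F"
  proof
    show "E - F \<subseteq> \<Union>(orb ` (E - F))" using orbE(2) by auto
    show "\<Union>(orb ` (E - F)) \<subseteq> E - F"
    proof
      fix f assume "f \<in> \<Union>(orb ` (E - F))"
      then obtain e where e: "e \<in> E - F" "f \<in> orb e" by auto
      have fE: "f \<in> E" using e orbE by auto
      have "f \<notin> F"
      proof
        assume "f \<in> F"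
        hence "orb f = {f}" using one_closed by (auto simp: orb_def F_def)
        hence "e = f" using orbeq[of e f] orbE(2)[of e] e by auto
        thus False using e \<open>f \<in> F\<close> by auto
      qed
      thus "f \<in> E - F" using fE by auto
    qed
  qed
  have "q dvd card (\<Union>(orb ` (E - F)))"
  proof (rule dvd_partition)
    show "finite (\<Union>(orb ` (E - F)))" using un E by simp
    show "\<forall>c\<in>orb ` (E - F). q dvd card c" using qdvd by auto
    show "\<forall>c1\<in>orb ` (E - F). \<forall>c2\<in>orb ` (E - F). c1 \<noteq> c2 \<longrightarrow> c1 \<inter> c2 = {}"
      using orbeq by blast
  qed
  hence "q dvd card (E - F)" by (simp only: un)
  moreover have "card E = card (E - F) + card F"
    using E by (metis (no_types, lifting) F_def card_Diff_subset card_mono finite_subset le_add_diff_inverse2 mem_Collect_eq subsetI)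
  ultimately have qF: "q dvd card F" using E by (metis dvd_add_right_iff)
  have "e0 \<in> F" using e0 by (simp add: F_def)
  have "F \<noteq> {e0}" using qF q(1) by (auto simp: prime_nat_iff)
  then obtain e where "e \<in> F" "e \<noteq> e0" using \<open>e0 \<in> F\<close> by blast
  thus thesis using that by (auto simp: F_def)
qed

lemma card_group_pos: "card (carrier G) > 0"
  using fin by (auto simp: card_gt_0_iff)

text \<open>A central element of a Sylow subgroup has a conjugacy class of prime power size.\<close>

lemma two_primes_not_simple_perfect:
  assumes p: "prime p" and q: "prime q" and card: "card (carrier G) = p ^ a * q ^ b" and a: "p ^ a \<noteq> 1"
    and simple: "\<And>N. N \<lhd> G \<Longrightarrow> N = {\<one>} \<or> N = carrier G"
  obtains \<chi> :: "'a \<Rightarrow> complex" where "\<forall>x\<in>carrier G. \<forall>y\<in>carrier G. \<chi> (x \<otimes> y) = \<chi> x * \<chi> y"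
    "\<forall>x\<in>carrier G. \<chi> x \<noteq> 0" "\<exists>x\<in>carrier G. \<chi> x \<noteq> 1"
proof (rule ccontr)
  assume no: "\<not> thesis"
  obtain P where P: "subgroup P G" "card P = p ^ a"
    using sylow_thm[OF p is_group _ fin, of a "q ^ b"] card by (auto simp: Coset.order_def)
  have PG: "P \<subseteq> carrier G" using P subgroup.subset by auto
  have fP: "finite P" using PG fin finite_subset by auto
  interpret P: finite_group "G\<lparr>carrier := P\<rparr>" by (rule finite_group_subgroup[OF P(1)])
  have pd: "p dvd card P" using P a p by (cases a) auto
  \<comment> \<open>Conjugation of \<open>P\<close> on itself fixes the unit, so it fixes a further
    element: the centre of a nontrivial group of prime power order is nontrivial.\<close>
  obtain z where z: "z \<in> P" "z \<noteq> \<one>" "\<And>x. x \<in> P \<Longrightarrow> x \<otimes> z \<otimes> inv x = z"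
  proof (rule P.prime_power_fixed_point[OF p, where k=a and E=P and act="\<lambda>x e. x \<otimes> e \<otimes> inv x" and ?e0.0="\<one>"], goal_cases)
    case 1 thus ?case using P by simp
  next
    case 2 show ?case by (rule fP)
  next
    case 3 show ?case by (rule pd)
  next
    case (4 x e) thus ?case using P(1) by (simp add: subgroup.m_closed subgroup.m_inv_closed)
  next
    case (5 e) thus ?case using PG by auto
  next
    case (6 x y e) thus ?case using PG by (auto simp: inv_mult_group m_assoc subset_iff)
  next
    case 7 thus ?case using P(1) by (simp add: subgroup.one_closed)
  next
    case (8 x) thus ?case using PG by (auto simp: subset_iff)
  next
    case (9 e) thus ?case by simp
  qed
  have zG: "z \<in> carrier G" using z PG by auto
  define C where "C = {x \<in> carrier G. x \<otimes> z \<otimes> inv x = z}"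
  have oc: "card ((\<lambda>x. x \<otimes> z \<otimes> inv x) ` carrier G) * card C = card (carrier G)"
    unfolding C_def by (rule orbit_card[where E="carrier G" and act="\<lambda>x e. x \<otimes> e \<otimes> inv x"])
      (use zG in \<open>auto simp: inv_mult_group m_assoc\<close>)
  have cc: "conj_class z = (\<lambda>x. x \<otimes> z \<otimes> inv x) ` carrier G" by (auto simp: conj_class_def)
  have Csub: "subgroup C G"
  proof (rule subgroupI)
    show "C \<subseteq> carrier G" "C \<noteq> {}" using zG by (auto simp: C_def intro!: exI[of _ \<one>])
    have Cm: "x \<in> C \<longleftrightarrow> x \<in> carrier G \<and> x \<otimes> z = z \<otimes> x" for x
    proof -
      have "x \<otimes> z \<otimes> inv x = z \<longleftrightarrow> x \<otimes> z = z \<otimes> x" if "x \<in> carrier G"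
        using that zG by (metis inv_solve_right m_closed)
      thus ?thesis by (auto simp: C_def)
    qed
    fix x assume x: "x \<in> C"
    hence xG: "x \<in> carrier G" and xz: "x \<otimes> z = z \<otimes> x" using Cm by auto
    have "inv x \<otimes> (x \<otimes> z) \<otimes> inv x = inv x \<otimes> (z \<otimes> x) \<otimes> inv x" by (simp only: xz)
    moreover have "inv x \<otimes> (x \<otimes> z) \<otimes> inv x = z \<otimes> inv x" using xG zG by (simp add: m_assoc[symmetric])
    moreover have "inv x \<otimes> (z \<otimes> x) \<otimes> inv x = inv x \<otimes> z" using xG zG by (simp add: m_assoc)
    ultimately have "inv x \<otimes> z = z \<otimes> inv x" by simp
    thus "inv x \<in> C" using Cm xG by simp
    fix y assume y: "y \<in> C"
    hence yG: "y \<in> carrier G" and yz: "y \<otimes> z = z \<otimes> y" using Cm by auto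
    have "(x \<otimes> y) \<otimes> z = x \<otimes> (y \<otimes> z)" using xG yG zG by (simp add: m_assoc)
    also have "\<dots> = (x \<otimes> z) \<otimes> y" using xG yG zG by (simp add: yz m_assoc)
    also have "\<dots> = z \<otimes> (x \<otimes> y)" using xG yG zG by (simp add: xz m_assoc)
    finally show "x \<otimes> y \<in> C" using Cm xG yG by simp
  qed
  \<comment> \<open>The centralizer \<open>C\<close> of a central element of \<open>P\<close>
    contains this Sylow subgroup, so the size of the conjugacy class divides the other factor
    \<open>q ^ b\<close>.\<close>
  have "P \<subseteq> C" using z(3) PG by (auto simp: C_def)
  hence "p ^ a dvd card C" using card_subgroup_dvd[OF P(1) Csub] P(2) by simp
  then obtain c where c: "card C = p ^ a * c" by blast
  have "card (conj_class z) * c * p ^ a = q ^ b * p ^ a"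
    using oc c card cc by (simp add: mult_ac)
  hence "card (conj_class z) * c = q ^ b" using p by (simp add: prime_gt_0_nat)
  then obtain e where e: "card (conj_class z) = q ^ e"
    using q by (metis divides_primepow_nat dvd_triv_left)
  show False
  proof (rule prime_power_class[OF _ _ zG z(2) q e], goal_cases)
    case (1 \<chi> x) thus ?case using no that[of \<chi>] by metis
  next
    case (2 N) thus ?case using simple[of N] z(2) by auto
  qed
qed

end

section \<open>Abelian chief factors\<close>

context group
begin

lemma pow_coprime_one:
  assumes "x \<in> carrier G" "x [^] (a::nat) = \<one>" "x [^] (b::nat) = \<one>" "coprime a b"
  shows "x = \<one>"
proof -
  have "ord x dvd a" "ord x dvd b" using assms pow_eq_id by blast+
  hence "ord x = 1" using assms(4) by (metis coprime_common_divisor_nat)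
  thus ?thesis using assms(1) ord_eq_1 by blast
qed

end

context finite_group
begin

lemma quotient_pow:
  assumes H: "subgroup H G" and F: "finite_group F" and hom: "\<And>x y. x \<in> H \<Longrightarrow> y \<in> H \<Longrightarrow> \<phi> (x \<otimes> y) = \<phi> x \<otimes>\<^bsub>F\<^esub> \<phi> y"
    and one: "\<phi> \<one> = \<one>\<^bsub>F\<^esub>" and x: "x \<in> H"
  shows "\<phi> (x [^] (k::nat)) = \<phi> x [^]\<^bsub>F\<^esub> k \<and> x [^] k \<in> H"
proof (induct k)
  case 0 thus ?case using one subgroup.one_closed[OF H] F
    by (simp add: finite_group_def group.is_monoid monoid.nat_pow_0)
next
  case (Suc k)
  interpret F: finite_group F by fact
  show ?case using Suc hom[OF _ x] subgroup.m_closed[OF H _ x] by simp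
qed

text \<open>Such a factor is elementary abelian. For a prime \<open>q\<close> dividing the order of
  a nontrivial element of M/N, the elements of \<open>M\<close> whose \<open>q\<close>-th power lies
  in \<open>N\<close> form a \<open>B\<close>-normal subgroup larger than \<open>N\<close>, hence
  equal \<open>M\<close>; an element of order prime to \<open>q\<close> is then trivial modulo
  \<open>N\<close>.\<close>

lemma abelian_chief_factor:
  assumes B: "subgroup B G" and M: "nrm M B" and N: "nrm N B" "N \<subseteq> M" "N \<noteq> M"
    and min: "\<And>D. nrm D B \<Longrightarrow> N \<subseteq> D \<Longrightarrow> D \<subseteq> M \<Longrightarrow> D = N \<or> D = M"
    and ab: "\<And>x y. x \<in> M \<Longrightarrow> y \<in> M \<Longrightarrow> x \<otimes> y \<otimes> inv x \<otimes> inv y \<in> N"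
  obtains q :: nat where "prime q"
    "\<forall>m\<in>M. \<forall>c::nat. m [^] c = \<one> \<longrightarrow> coprime q c \<longrightarrow> m \<in> N"
proof -
  have Ms: "subgroup M G" "M \<subseteq> B" using M by (auto simp: nrm_def)
  have Mc: "M \<subseteq> carrier G" using subgroup.subset[OF Ms(1)] .
  have NM: "nrm N M" using N Ms by (auto simp: nrm_def)
  obtain F :: "'a set monoid" and \<phi> where F: "finite_group F"
    and hom0: "\<forall>x\<in>M. \<forall>y\<in>M. \<phi> (x \<otimes> y) = \<phi> x \<otimes>\<^bsub>F\<^esub> \<phi> y"
    and img: "\<phi> ` M = carrier F" and ker0: "\<forall>x\<in>M. \<phi> x = \<one>\<^bsub>F\<^esub> \<longleftrightarrow> x \<in> N"
    and cF: "card (carrier F) * card N = card M"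
    by (rule quotient_hom[OF NM Ms(1)])
  have hom: "\<phi> (x \<otimes> y) = \<phi> x \<otimes>\<^bsub>F\<^esub> \<phi> y" if "x \<in> M" "y \<in> M" for x y using hom0 that by blast
  have ker: "\<phi> x = \<one>\<^bsub>F\<^esub> \<longleftrightarrow> x \<in> N" if "x \<in> M" for x using ker0 that by blast
  interpret F: finite_group F by (rule F)
  have oneM: "\<one> \<in> M" by (rule subgroup.one_closed[OF Ms(1)])
  have oneN: "\<one> \<in> N" using N(1) subgroup.one_closed[of N G] by (simp add: nrm_def)
  have \<phi>1: "\<phi> \<one> = \<one>\<^bsub>F\<^esub>" using ker[OF oneM] oneN by simp
  have \<phi>c: "\<phi> x \<in> carrier F" if "x \<in> M" for x using that img by auto
  have pow: "\<phi> (x [^] k) = \<phi> x [^]\<^bsub>F\<^esub> k" "x [^] k \<in> M" if "x \<in> M" for x and k :: nat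
    using quotient_pow[OF Ms(1) F hom \<phi>1 that] by auto
  have comm: "\<phi> x \<otimes>\<^bsub>F\<^esub> \<phi> y = \<phi> y \<otimes>\<^bsub>F\<^esub> \<phi> x" if xy: "x \<in> M" "y \<in> M" for x y
  proof -
    have c: "x \<otimes> y \<otimes> inv x \<otimes> inv y \<in> N" by (rule ab[OF xy])
    have xyG: "x \<in> carrier G" "y \<in> carrier G" using xy Mc by auto
    have yx: "y \<otimes> x \<in> M" "x \<otimes> y \<in> M" using xy subgroup.m_closed[OF Ms(1)] by auto
    have cM: "x \<otimes> y \<otimes> inv x \<otimes> inv y \<in> M" using c N(2) by auto
    have "x \<otimes> y \<otimes> inv x \<otimes> inv y \<otimes> (y \<otimes> x) = x \<otimes> y \<otimes> inv x \<otimes> (inv y \<otimes> y) \<otimes> x"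
      using xyG by (simp only: m_assoc m_closed inv_closed)
    also have "\<dots> = x \<otimes> y" using xyG by (simp add: m_assoc)
    finally have "x \<otimes> y \<otimes> inv x \<otimes> inv y \<otimes> (y \<otimes> x) = x \<otimes> y" .
    hence "\<phi> (x \<otimes> y) = \<phi> (x \<otimes> y \<otimes> inv x \<otimes> inv y) \<otimes>\<^bsub>F\<^esub> \<phi> (y \<otimes> x)"
      using hom[OF cM yx(1)] by simp
    also have "\<dots> = \<phi> (y \<otimes> x)" using ker[OF cM] c \<phi>c[OF yx(1)] by simp
    finally show ?thesis using hom xy by simp
  qed
  interpret F: comm_group F
  proof
    fix a b assume "a \<in> carrier F" "b \<in> carrier F"
    then obtain x y where "x \<in> M" "y \<in> M" "a = \<phi> x" "b = \<phi> y" using img by (metis imageE)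
    thus "a \<otimes>\<^bsub>F\<^esub> b = b \<otimes>\<^bsub>F\<^esub> a" using comm by simp
  qed
  obtain m0 where m0: "m0 \<in> M" "m0 \<notin> N" using N by blast
  define t where "t = F.ord (\<phi> m0)"
  have t1: "t \<noteq> 1" using F.ord_eq_1[OF \<phi>c[OF m0(1)]] ker[OF m0(1)] m0 by (simp add: t_def)
  have t0: "t > 0" using F.ord_ge_1[OF F.fin \<phi>c[OF m0(1)]] by (simp add: t_def)
  obtain q where q: "prime q" "q dvd t" using prime_factor_nat[OF t1] by blast
  define T where "T = {m \<in> M. m [^] q \<in> N}"
  have Tm: "m \<in> T \<longleftrightarrow> m \<in> M \<and> \<phi> m [^]\<^bsub>F\<^esub> q = \<one>\<^bsub>F\<^esub>" for m
    using ker[OF pow(2), of m q] pow(1)[of m q] unfolding T_def by auto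
  obtain s where s: "t = q * s" using q by blast
  have "m0 [^] s \<in> T"
  proof -
    have "\<phi> m0 [^]\<^bsub>F\<^esub> t = \<one>\<^bsub>F\<^esub>" using F.pow_ord_eq_1[OF \<phi>c[OF m0(1)]] by (simp add: t_def)
    hence "\<phi> (m0 [^] s) [^]\<^bsub>F\<^esub> q = \<one>\<^bsub>F\<^esub>"
      using \<phi>c[OF m0(1)] by (simp add: pow(1)[OF m0(1)] F.nat_pow_pow s mult.commute)
    thus ?thesis using Tm pow(2)[OF m0(1)] by simp
  qed
  moreover have "m0 [^] s \<notin> N"
  proof
    assume "m0 [^] s \<in> N"
    hence "\<phi> m0 [^]\<^bsub>F\<^esub> s = \<one>\<^bsub>F\<^esub>" using ker[OF pow(2)[OF m0(1)]] pow(1)[OF m0(1)] by simp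
    hence "t dvd s" using F.pow_eq_id[OF \<phi>c[OF m0(1)]] by (simp add: t_def)
    moreover have "s < t" "s > 0" using s t0 q(1) prime_gt_1_nat[OF q(1)] by auto
    ultimately show False using nat_dvd_not_less by blast
  qed
  ultimately have TN: "T \<noteq> N" by blast
  have "subgroup T G"
  proof (rule subgroupI)
    show "T \<subseteq> carrier G" using Mc by (auto simp: T_def)
    have "\<one> \<in> T" using Tm oneM \<phi>1 by simp
    thus "T \<noteq> {}" by blast
    fix a assume a: "a \<in> T"
    hence aM: "a \<in> M" "inv a \<in> M" using subgroup.m_inv_closed[OF Ms(1)] by (auto simp: T_def)
    have "inv a \<otimes> a = \<one>" using aM Mc by auto
    hence "\<phi> (inv a) \<otimes>\<^bsub>F\<^esub> \<phi> a = \<one>\<^bsub>F\<^esub>" using hom[OF aM(2,1)] \<phi>1 by simp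
    hence "\<phi> (inv a) = inv\<^bsub>F\<^esub> (\<phi> a)" using F.inv_equality \<phi>c aM by metis
    thus "inv a \<in> T" using a aM Tm \<phi>c[OF aM(1)] by (simp add: F.nat_pow_inv)
    fix b assume b: "b \<in> T"
    hence bM: "b \<in> M" by (auto simp: T_def)
    have "\<phi> (a \<otimes> b) [^]\<^bsub>F\<^esub> q = \<phi> a [^]\<^bsub>F\<^esub> q \<otimes>\<^bsub>F\<^esub> \<phi> b [^]\<^bsub>F\<^esub> q"
      using hom[OF aM(1) bM] \<phi>c[OF aM(1)] \<phi>c[OF bM] by (simp add: F.nat_pow_distrib)
    thus "a \<otimes> b \<in> T" using a b Tm subgroup.m_closed[OF Ms(1) aM(1) bM] by simp
  qed
  moreover have "b \<otimes> x \<otimes> inv b \<in> T" if b: "b \<in> B" and x: "x \<in> T" for b x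
  proof -
    have xM: "x \<in> M" "x [^] q \<in> N" using x by (auto simp: T_def)
    have bG: "b \<in> carrier G" using b subgroup.subset[OF B] by auto
    have xG: "x \<in> carrier G" using xM Mc by auto
    have "(b \<otimes> x \<otimes> inv b) [^] q = b \<otimes> x [^] q \<otimes> inv b" by (rule nat_pow_conj[OF bG xG])
    also have "\<dots> \<in> N" using N(1) b xM by (auto simp: nrm_def)
    finally show ?thesis using M b xM by (auto simp: T_def nrm_def)
  qed
  ultimately have "nrm T B" using Ms by (auto simp: nrm_def T_def)
  moreover have "N \<subseteq> T"
  proof
    fix x assume x: "x \<in> N"
    hence xM: "x \<in> M" using N by auto
    show "x \<in> T" unfolding Tm using xM ker[OF xM] x by simp
  qed
  ultimately have TM: "T = M" using min[of T] TN by (auto simp: T_def)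
  show thesis
  proof (rule that[OF q(1)], intro ballI allI impI)
    fix m and c :: nat assume m: "m \<in> M" "m [^] c = \<one>" "coprime q c"
    show "m \<in> N"
    proof -
      have "\<phi> m [^]\<^bsub>F\<^esub> q = \<one>\<^bsub>F\<^esub>" using m TM Tm by auto
      moreover have "\<phi> m [^]\<^bsub>F\<^esub> c = \<one>\<^bsub>F\<^esub>" using pow(1)[OF m(1), of c] m(2) \<phi>1 by simp
      ultimately have "\<phi> m = \<one>\<^bsub>F\<^esub>" using F.pow_coprime_one[OF \<phi>c[OF m(1)] _ _ m(3)] by blast
      thus ?thesis using ker m by blast
    qed
  qed
qed

end

subsection \<open>Systems of Hall subgroups\<close>

locale hall_system = finite_group G for G (structure) +
  fixes Hall :: "nat set \<Rightarrow> 'a set"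
  assumes hall_sub: "subgroup (Hall \<pi>) G"
    and hall_int: "Hall \<pi> \<inter> Hall \<rho> = Hall (\<pi> \<inter> \<rho>)"
    and hall_card: "card (Hall \<pi>) = part \<pi> (card (carrier G))"
begin

text \<open>The subgroups that inherit the Hall system by intersection. The induction on sections
  stays within this class, which contains with \<open>H\<close> its normal subgroups and its
  intersections with the Hall subgroups.\<close>

definition compat :: "'a set \<Rightarrow> bool" where
  "compat H \<longleftrightarrow> subgroup H G \<and> (\<forall>\<pi>. card (H \<inter> Hall \<pi>) = part \<pi> (card H))"

lemma card_sub_pos: "subgroup H G \<Longrightarrow> card H > 0"
  using subgroup.one_closed[of H G] subgroup.subset[of H G] fin finite_subset by (fastforce simp: card_gt_0_iff)

lemma finite_sub: "subgroup H G \<Longrightarrow> finite H"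
  using subgroup.subset[of H G] fin finite_subset by blast

lemma compat_carrier: "compat (carrier G)"
  using hall_card subgroup.subset[OF hall_sub] subgroup_self by (simp add: compat_def Int_absorb1)

lemma compat_sub: "compat H \<Longrightarrow> subgroup H G"
  by (simp add: compat_def)

lemma compat_card: "compat H \<Longrightarrow> card (H \<inter> Hall \<pi>) = part \<pi> (card H)"
  by (simp add: compat_def)

lemma sub_hall: "subgroup H G \<Longrightarrow> subgroup (H \<inter> Hall \<pi>) G"
  using subgroups_Inter_pair hall_sub by blast

lemma compat_hall: assumes "compat H" shows "compat (H \<inter> Hall \<pi>)"
  unfolding compat_def
proof (intro conjI allI)
  show "subgroup (H \<inter> Hall \<pi>) G" using assms compat_sub sub_hall by blast
  fix \<rho>
  have "H \<inter> Hall \<pi> \<inter> Hall \<rho> = H \<inter> Hall (\<rho> \<inter> \<pi>)" using hall_int[of \<rho> \<pi>] by blast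
  thus "card (H \<inter> Hall \<pi> \<inter> Hall \<rho>) = part \<rho> (card (H \<inter> Hall \<pi>))"
    using assms by (simp add: compat_card part_part)
qed

text \<open>Let \<open>K\<close> be the Hall part of \<open>H\<close>. The order of
  \<open>N <#> K\<close> has pi-part \<open>card K\<close>, since it lies between \<open>K\<close>
  and \<open>H\<close>. Taking pi-parts in the product formula leaves
  \<open>card (N \<inter> K)\<close> as the pi-part of \<open>card N\<close>.\<close>

lemma compat_nrm: assumes H: "compat H" and N: "nrm N H" shows "compat N"
  unfolding compat_def
proof (intro conjI allI)
  show Ns: "subgroup N G" using N by (simp add: nrm_def)
  have Hs: "subgroup H G" using H by (rule compat_sub)
  fix \<pi>
  define K where "K = H \<inter> Hall \<pi>"
  have Ks: "subgroup K G" unfolding K_def by (rule sub_hall[OF Hs])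
  have KH: "K \<subseteq> H" by (auto simp: K_def)
  have NKs: "subgroup (N <#> K) G" by (rule nrm_set_mult_subgroup[OF N Hs Ks KH])
  have NK: "N \<inter> Hall \<pi> = N \<inter> K" using N by (auto simp: K_def nrm_def)
  have NKi: "subgroup (N \<inter> K) G" using subgroups_Inter_pair[OF Ns Ks] .
  have eq: "card (N <#> K) * card (N \<inter> K) = card N * card K" by (rule card_set_mult[OF Ns Ks fin])
  have cK: "card K = part \<pi> (card H)" using H by (simp add: K_def compat_card)
  have "card (N \<inter> K) dvd card K" by (rule card_subgroup_dvd[OF NKi Ks]) auto
  hence "prime_factors (card (N \<inter> K)) \<subseteq> prime_factors (card K)"
    using card_sub_pos[OF Ks] by (intro dvd_prime_factors) auto
  hence sub: "prime_factors (card (N \<inter> K)) \<subseteq> \<pi>" unfolding cK prime_factors_part by auto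
  hence self: "part \<pi> (card (N \<inter> K)) = card (N \<inter> K)"
    by (intro part_self card_sub_pos[OF NKi])
  have sKK: "part \<pi> (card K) = card K" using cK by (simp add: part_part)
  have "K \<subseteq> N <#> K"
  proof
    fix k assume k: "k \<in> K"
    hence "k = \<one> \<otimes> k" using subgroup.subset[OF Ks] by auto
    thus "k \<in> N <#> K" using k subgroup.one_closed[OF Ns] unfolding set_mult_def by blast
  qed
  hence "card K dvd card (N <#> K)" by (rule card_subgroup_dvd[OF Ks NKs])
  hence d1: "card K dvd part \<pi> (card (N <#> K))"
    using part_dvd_mono[of "card K" "card (N <#> K)" \<pi>] card_sub_pos[OF NKs] sKK by simp
  have "N <#> K \<subseteq> H" using N KH subgroup.m_closed[OF Hs] by (auto simp: set_mult_def nrm_def)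
  hence "card (N <#> K) dvd card H" by (rule card_subgroup_dvd[OF NKs Hs])
  hence d2: "part \<pi> (card (N <#> K)) dvd card K"
    unfolding cK using card_sub_pos[OF Hs] by (rule part_dvd_mono)
  have e: "part \<pi> (card (N <#> K)) = card K" using d1 d2 by (rule dvd_antisym[symmetric])
  have "part \<pi> (card (N <#> K)) * part \<pi> (card (N \<inter> K)) = part \<pi> (card N) * part \<pi> (card K)"
    using arg_cong[OF eq, of "part \<pi>"] card_sub_pos Ns Ks NKs NKi by (simp add: part_mult)
  hence "card K * card (N \<inter> K) = card K * part \<pi> (card N)" by (simp only: e self sKK mult.commute)
  thus "card (N \<inter> Hall \<pi>) = part \<pi> (card N)"
    unfolding NK by (simp only: nat_mult_eq_cancel1[OF card_sub_pos[OF Ks]])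
qed

text \<open>Together the two sets contain every prime, so the product formula and
  \<open>part_Un_Int\<close> give the product the full size.\<close>

lemma hall_prod:
  assumes H: "compat H" and un: "\<pi> \<union> \<rho> = UNIV"
  shows "(H \<inter> Hall \<pi>) <#> (H \<inter> Hall \<rho>) = H"
proof (rule card_subset_eq)
  have Hs: "subgroup H G" using H by (rule compat_sub)
  show "finite H" by (rule finite_sub[OF Hs])
  show "(H \<inter> Hall \<pi>) <#> (H \<inter> Hall \<rho>) \<subseteq> H" using subgroup.m_closed[OF Hs] by (auto simp: set_mult_def)
  have "(H \<inter> Hall \<pi>) \<inter> (H \<inter> Hall \<rho>) = H \<inter> Hall (\<pi> \<inter> \<rho>)" using hall_int[of \<pi> \<rho>] by auto
  hence "card ((H \<inter> Hall \<pi>) <#> (H \<inter> Hall \<rho>)) * part (\<pi> \<inter> \<rho>) (card H) = part \<pi> (card H) * part \<rho> (card H)"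
    using card_set_mult[OF sub_hall[OF Hs] sub_hall[OF Hs] fin, of \<pi> \<rho>] H by (simp add: compat_card)
  also have "\<dots> = card H * part (\<pi> \<inter> \<rho>) (card H)"
    using part_Un_Int[of \<pi> "card H" \<rho>] part_UNIV[OF card_sub_pos[OF Hs]] unfolding un by (simp only: mult.commute)
  finally show "card ((H \<inter> Hall \<pi>) <#> (H \<inter> Hall \<rho>)) = card H"
    using part_pos[of "\<pi> \<inter> \<rho>" "card H"] by simp
qed

lemma pow_card_sub: assumes "subgroup H G" "x \<in> H" shows "x [^] card H = \<one>"
proof -
  interpret H: finite_group "G\<lparr>carrier := H\<rparr>" by (rule finite_group_subgroup[OF assms(1)])
  have "x [^]\<^bsub>G\<lparr>carrier := H\<rparr>\<^esub> Coset.order (G\<lparr>carrier := H\<rparr>) = \<one>"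
    using H.pow_order_eq_1[of x] assms by simp
  thus ?thesis using nat_pow_consistent[of x "card H" H] by (simp add: Coset.order_def)
qed

lemma pow_hall: assumes "x \<in> Hall \<pi>" shows "x [^] part \<pi> (card (carrier G)) = \<one>"
  using pow_card_sub[OF hall_sub assms] by (simp add: hall_card)

lemma card_index_part:
  assumes "compat H" "nrm N H" "card H = n * card N"
  shows "card (H \<inter> Hall \<pi>) = part \<pi> n * card (N \<inter> Hall \<pi>)" "n > 0"
proof -
  have "card H > 0" "card N > 0"
    using card_sub_pos[OF compat_sub[OF assms(1)]] card_sub_pos[of N] assms(2) by (simp_all add: nrm_def)
  thus "n > 0" using assms(3) by (cases n) auto
  thus "card (H \<inter> Hall \<pi>) = part \<pi> n * card (N \<inter> Hall \<pi>)"
    using assms compat_nrm[OF assms(1,2)] \<open>card N > 0\<close> by (simp add: compat_card part_mult)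
qed

text \<open>The hypothesis provides \<open>D0\<close> normal only in \<open>K\<close>. Its core in
  \<open>H1\<close> is proper and lies above \<open>N1\<close>, so minimality identifies it with
  \<open>N1\<close>; conjugates of commutators are commutators, hence K/N1 is abelian.\<close>

lemma chief_factor:
  assumes H1s: "subgroup H1 G" and K: "nrm K H1" and N1: "nrm N1 H1" "N1 \<subseteq> K" "N1 \<noteq> K"
    and min: "\<And>D. nrm D H1 \<Longrightarrow> N1 \<subseteq> D \<Longrightarrow> D \<subseteq> K \<Longrightarrow> D = N1 \<or> D = K"
    and D0: "nrm D0 K" "N1 \<subseteq> D0" "D0 \<noteq> K" "\<forall>x\<in>K. \<forall>y\<in>K. x \<otimes> y \<otimes> inv x \<otimes> inv y \<in> D0"
  obtains p where "prime p" "K \<inter> Hall (- {p}) \<subseteq> N1"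
proof -
  have Ks: "subgroup K G" "K \<subseteq> H1" using K by (auto simp: nrm_def)
  have D0s: "subgroup D0 G" using D0 by (simp add: nrm_def)
  have cN: "nrm {x \<in> K. \<forall>b\<in>H1. b \<otimes> x \<otimes> inv b \<in> D0} H1" by (rule core_nrm[OF K H1s D0s])
  have oneH1: "\<one> \<in> H1" by (rule subgroup.one_closed[OF H1s])
  have KG: "K \<subseteq> carrier G" "H1 \<subseteq> carrier G" using subgroup.subset[OF Ks(1)] subgroup.subset[OF H1s] by blast+
  have cD: "x \<in> D0" if "x \<in> {x \<in> K. \<forall>b\<in>H1. b \<otimes> x \<otimes> inv b \<in> D0}" for x
  by (use that oneH1 KG in \<open>fastforce\<close>)
  have "N1 \<subseteq> {x \<in> K. \<forall>b\<in>H1. b \<otimes> x \<otimes> inv b \<in> D0}" using N1 D0(2) by (auto simp: nrm_def)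
  hence "{x \<in> K. \<forall>b\<in>H1. b \<otimes> x \<otimes> inv b \<in> D0} = N1 \<or> {x \<in> K. \<forall>b\<in>H1. b \<otimes> x \<otimes> inv b \<in> D0} = K"
    by (intro min cN) auto
  moreover have "{x \<in> K. \<forall>b\<in>H1. b \<otimes> x \<otimes> inv b \<in> D0} \<noteq> K"
  by (use cD D0(1,3) in \<open>fastforce simp: nrm_def\<close>)
  ultimately have core: "{x \<in> K. \<forall>b\<in>H1. b \<otimes> x \<otimes> inv b \<in> D0} = N1" by blast
  have ab: "x \<otimes> y \<otimes> inv x \<otimes> inv y \<in> N1" if xy: "x \<in> K" "y \<in> K" for x y
  proof -
    have "x \<otimes> y \<otimes> inv x \<otimes> inv y \<in> K"
      using xy subgroup.m_closed[OF Ks(1)] subgroup.m_inv_closed[OF Ks(1)] by auto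
    moreover have "b \<otimes> (x \<otimes> y \<otimes> inv x \<otimes> inv y) \<otimes> inv b \<in> D0" if b: "b \<in> H1" for b
    proof -
      have xyG: "x \<in> carrier G" "y \<in> carrier G" "b \<in> carrier G" using xy b KG by auto
      have bx: "b \<otimes> x \<otimes> inv b \<in> K" "b \<otimes> y \<otimes> inv b \<in> K" using K b xy by (auto simp: nrm_def)
      have "(b \<otimes> x \<otimes> inv b) \<otimes> (b \<otimes> y \<otimes> inv b) \<otimes> inv (b \<otimes> x \<otimes> inv b) \<otimes> inv (b \<otimes> y \<otimes> inv b)
        = b \<otimes> x \<otimes> (inv b \<otimes> b) \<otimes> y \<otimes> (inv b \<otimes> b) \<otimes> inv x \<otimes> (inv b \<otimes> b) \<otimes> inv y \<otimes> inv b"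
        using xyG by (simp only: inv_mult_group m_assoc m_closed inv_closed inv_inv)
      also have "\<dots> = b \<otimes> (x \<otimes> y \<otimes> inv x \<otimes> inv y) \<otimes> inv b" using xyG by (simp add: m_assoc)
      finally show ?thesis using D0(4) bx by metis
    qed
    ultimately show ?thesis using core by blast
  qed
  obtain p where p: "prime p" and pN: "\<forall>m\<in>K. \<forall>c::nat. m [^] c = \<one> \<longrightarrow> coprime p c \<longrightarrow> m \<in> N1"
    by (rule abelian_chief_factor[OF H1s K N1 min ab])
  have Kp': "K \<inter> Hall (- {p}) \<subseteq> N1"
  proof
    fix m assume m: "m \<in> K \<inter> Hall (- {p})"
    have "coprime p (part (- {p}) (card (carrier G)))"
      by (rule coprime_part) (use p in \<open>auto simp: prime_factorization_prime prime_gt_0_nat\<close>)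
    thus "m \<in> N1" using pN pow_hall m by blast
  qed
  from p Kp' show thesis by (rule that)
qed

text \<open>Induction on the index. First \<open>N\<close> is enlarged until H/N is simple, of order
  \<open>k\<close>. If at most two primes divide \<open>k\<close>, Burnside's theorem supplies a
  linear character and \<open>D\<close> is its kernel. With three primes, a minimal normal section
  K/N1 of a complement \<open>H1\<close> of one prime is abelian by induction, of exponent
  \<open>p\<close>. For a third prime \<open>pi\<close> the complement \<open>Hi\<close> contains
  the \<open>p\<close>-part of \<open>K\<close>, and all conjugates of that part stay inside
  \<open>N <#> Hi\<close>; its core contradicts simplicity.\<close>

lemma section_not_perfect:
  assumes "compat H" "nrm N H" "N \<noteq> H" "card H = n * card N"
  shows "\<exists>D. nrm D H \<and> N \<subseteq> D \<and> D \<noteq> H \<and> (\<forall>x\<in>H. \<forall>y\<in>H. x \<otimes> y \<otimes> inv x \<otimes> inv y \<in> D)"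
  using assms
proof (induct n arbitrary: H N rule: less_induct)
  case (less n H N0)
  note IH = less.hyps and H = less.prems(1)
  have Hs: "subgroup H G" by (rule compat_sub[OF H])
  have HG: "H \<subseteq> carrier G" by (rule subgroup.subset[OF Hs])
  have fH: "finite H" by (rule finite_sub[OF Hs])
  define \<N> where "\<N> = {N. nrm N H \<and> N0 \<subseteq> N \<and> N \<noteq> H}"
  have "finite \<N>" by (rule finite_subset[of _ "Pow H"]) (auto simp: \<N>_def nrm_def fH)
  moreover have "N0 \<in> \<N>" using less.prems by (simp add: \<N>_def)
  ultimately obtain N where N\<N>: "N \<in> \<N>" and Nmax: "\<And>K. K \<in> \<N> \<Longrightarrow> N \<subseteq> K \<Longrightarrow> K = N"
    using finite_has_maximal2[of \<N> N0] by metis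
  have N: "nrm N H" "N0 \<subseteq> N" "N \<noteq> H" using N\<N> by (auto simp: \<N>_def)
  have max: "K = N \<or> K = H" if "nrm K H" "N \<subseteq> K" for K
    using Nmax[of K] that N(2) by (auto simp: \<N>_def)
  have Ns: "subgroup N G" "N \<subseteq> H" using N by (auto simp: nrm_def)
  have N0s: "subgroup N0 G" using less.prems by (auto simp: nrm_def)
  have "card N dvd card H" by (rule card_subgroup_dvd[OF Ns(1) Hs Ns(2)])
  then obtain k where k: "card H = k * card N" by (metis dvd_div_mult_self)
  have k0: "k > 0" by (rule card_index_part(2)[OF H N(1) k])
  have kn: "k \<le> n"
  proof -
    have "card N0 \<le> card N" using N(2) finite_sub[OF Ns(1)] by (rule card_mono[rotated])
    moreover have "k * card N = n * card N0" using k less.prems(4) by simp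
    ultimately have "k * card N0 \<le> n * card N0" by (metis mult_le_mono2)
    thus ?thesis using card_sub_pos[OF N0s] by simp
  qed
  have k1: "k \<noteq> 1"
  proof
    assume "k = 1"
    hence "card H = card N" using k by simp
    thus False using card_subset_eq[OF fH Ns(2)] N(3) by simp
  qed
  show ?case
  proof (cases "\<exists>p q. prime p \<and> prime q \<and> p dvd k \<and> prime_factors k \<subseteq> {p, q}")
    case True
    then obtain p q where pq: "prime p" "prime q" "p dvd k" "prime_factors k \<subseteq> {p, q}" by blast
    obtain a where a: "part {p} k = p ^ a" using part_single[OF pq(1)] by blast
    obtain b where b: "part {q} (part (- {p}) k) = q ^ b" using part_single[OF pq(2)] by blast
    have "part {q} (part (- {p}) k) = part (- {p}) k"
      by (rule part_self) (use pq(4) in \<open>auto simp: prime_factors_part\<close>)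
    hence kab: "k = p ^ a * q ^ b" using part_compl[OF k0, of "{p}"] a b by simp
    have pa: "p ^ a \<noteq> 1"
    proof
      assume "p ^ a = 1"
      moreover have "p \<in> prime_factors (part {p} k)" using pq(1,3) k0 by (simp add: prime_factors_part in_prime_factors_iff)
      ultimately show False unfolding a by (simp only: prime_factorization_1 set_mset_empty empty_iff)
    qed
    obtain F :: "'a set monoid" and \<phi> where F: "finite_group F"
    and hom0: "\<forall>x\<in>H. \<forall>y\<in>H. \<phi> (x \<otimes> y) = \<phi> x \<otimes>\<^bsub>F\<^esub> \<phi> y"
    and img: "\<phi> ` H = carrier F" and ker0: "\<forall>x\<in>H. \<phi> x = \<one>\<^bsub>F\<^esub> \<longleftrightarrow> x \<in> N"
    and cF: "card (carrier F) * card N = card H"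
    by (rule quotient_hom[OF N(1) Hs])
  have hom: "\<phi> (x \<otimes> y) = \<phi> x \<otimes>\<^bsub>F\<^esub> \<phi> y" if "x \<in> H" "y \<in> H" for x y using hom0 that by blast
  have ker: "\<phi> x = \<one>\<^bsub>F\<^esub> \<longleftrightarrow> x \<in> N" if "x \<in> H" for x using ker0 that by blast
  interpret F: finite_group F by (rule F)
    have \<phi>c: "\<phi> x \<in> carrier F" if "x \<in> H" for x using that img by auto
    have one: "\<one> \<in> H" "\<phi> \<one> = \<one>\<^bsub>F\<^esub>"
      using subgroup.one_closed[OF Hs] ker[OF subgroup.one_closed[OF Hs]] subgroup.one_closed[OF Ns(1)] by simp_all
    have \<phi>inv: "\<phi> (inv x) = inv\<^bsub>F\<^esub> (\<phi> x)" if x: "x \<in> H" for x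
    proof -
      have ix: "inv x \<in> H" by (rule subgroup.m_inv_closed[OF Hs x])
      have "\<phi> (inv x) \<otimes>\<^bsub>F\<^esub> \<phi> x = \<one>\<^bsub>F\<^esub>" using hom[OF ix x] x HG one by auto
      thus ?thesis by (rule F.inv_equality[symmetric]) (use \<phi>c x ix in auto)
    qed
    have N\<phi>: "\<phi> x = \<one>\<^bsub>F\<^esub>" if "x \<in> N" for x using that ker[of x] Ns(2) by blast
    have pre: "nrm {h \<in> H. \<phi> h \<in> K} H" if K: "K \<lhd> F" for K
    proof -
      interpret K: normal K F by (rule K)
      have "subgroup {h \<in> H. \<phi> h \<in> K} G"
      proof (rule subgroupI)
        show "{h \<in> H. \<phi> h \<in> K} \<subseteq> carrier G" using HG by auto
        show "{h \<in> H. \<phi> h \<in> K} \<noteq> {}" using one K.one_closed by auto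
      qed (use subgroup.m_closed[OF Hs] subgroup.m_inv_closed[OF Hs] \<phi>inv hom in auto)
      moreover have "h \<otimes> x \<otimes> inv h \<in> {h \<in> H. \<phi> h \<in> K}" if h: "h \<in> H" "x \<in> H" "\<phi> x \<in> K" for h x
      proof -
        have cl: "h \<otimes> x \<in> H" "inv h \<in> H" "h \<otimes> x \<otimes> inv h \<in> H"
          using h subgroup.m_closed[OF Hs] subgroup.m_inv_closed[OF Hs] by auto
        have "\<phi> (h \<otimes> x \<otimes> inv h) = \<phi> h \<otimes>\<^bsub>F\<^esub> \<phi> x \<otimes>\<^bsub>F\<^esub> inv\<^bsub>F\<^esub> (\<phi> h)"
          using cl h by (simp add: hom \<phi>inv)
        thus ?thesis using cl(3) K.inv_op_closed2[OF \<phi>c[OF h(1)] h(3)] by simp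
      qed
      ultimately show ?thesis by (auto simp: nrm_def)
    qed
    have simple: "K = {\<one>\<^bsub>F\<^esub>} \<or> K = carrier F" if K: "K \<lhd> F" for K
    proof -
      have KF: "K \<subseteq> carrier F" "\<one>\<^bsub>F\<^esub> \<in> K"
        using subgroup.subset[OF normal_imp_subgroup[OF K]] subgroup.one_closed[OF normal_imp_subgroup[OF K]] by blast+
      have "N \<subseteq> {h \<in> H. \<phi> h \<in> K}" using N\<phi> Ns(2) KF by auto
      hence "{h \<in> H. \<phi> h \<in> K} = N \<or> {h \<in> H. \<phi> h \<in> K} = H" by (rule max[OF pre[OF K]])
      thus ?thesis
      proof
        assume e: "{h \<in> H. \<phi> h \<in> K} = N"
        have "y = \<one>\<^bsub>F\<^esub>" if y: "y \<in> K" for y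
        proof -
          obtain h where h: "h \<in> H" "y = \<phi> h" using y KF unfolding img[symmetric] by auto
          hence "h \<in> N" using y e by auto
          thus ?thesis using N\<phi> h by simp
        qed
        thus ?thesis using KF(2) by blast
      next
        assume e: "{h \<in> H. \<phi> h \<in> K} = H"
        have "carrier F \<subseteq> K" unfolding img[symmetric] using e by auto
        thus ?thesis using KF by auto
      qed
    qed
    have cF': "card (carrier F) = p ^ a * q ^ b"
      using cF k card_sub_pos[OF Ns(1)] kab by simp
    obtain \<chi> :: "'a set \<Rightarrow> complex" where \<chi>: "\<forall>x\<in>carrier F. \<forall>y\<in>carrier F. \<chi> (x \<otimes>\<^bsub>F\<^esub> y) = \<chi> x * \<chi> y"
      "\<forall>x\<in>carrier F. \<chi> x \<noteq> 0" "\<exists>x\<in>carrier F. \<chi> x \<noteq> 1"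
      by (rule F.two_primes_not_simple_perfect[OF pq(1,2) cF' pa simple])
    define D where "D = {h \<in> H. \<chi> (\<phi> h) = 1}"
    have h\<chi>: "\<chi> (\<phi> (x \<otimes> y)) = \<chi> (\<phi> x) * \<chi> (\<phi> y)" if "x \<in> H" "y \<in> H" for x y
      using that hom \<chi>(1) \<phi>c by simp
    have \<chi>1: "\<chi> (\<phi> \<one>) = 1"
    proof -
      have "\<chi> (\<phi> \<one>) * \<chi> (\<phi> \<one>) = \<chi> (\<phi> \<one>)" using h\<chi>[OF one(1) one(1)] by simp
      thus ?thesis using \<chi>(2) \<phi>c[OF one(1)] by simp
    qed
    have \<chi>i: "\<chi> (\<phi> x) * \<chi> (\<phi> (inv x)) = 1" if x: "x \<in> H" for x
      using h\<chi>[OF x subgroup.m_inv_closed[OF Hs x]] x HG \<chi>1 by auto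
    have conj1: "\<chi> (\<phi> (h \<otimes> x \<otimes> inv h)) = \<chi> (\<phi> x)" if "h \<in> H" "x \<in> H" for h x
    proof -
      have "\<chi> (\<phi> (h \<otimes> x \<otimes> inv h)) = \<chi> (\<phi> h) * \<chi> (\<phi> x) * \<chi> (\<phi> (inv h))"
        using that subgroup.m_closed[OF Hs] subgroup.m_inv_closed[OF Hs] by (simp add: h\<chi>)
      thus ?thesis using \<chi>i[OF that(1)] by (simp add: mult_ac)
    qed
    have "nrm D H" unfolding nrm_def
    proof (intro conjI ballI)
      show "subgroup D G"
      proof (rule subgroupI)
        show "D \<subseteq> carrier G" using HG by (auto simp: D_def)
        show "D \<noteq> {}" using one \<chi>1 by (auto simp: D_def)
        fix x assume x: "x \<in> D"
        thus "inv x \<in> D" using \<chi>i[of x] subgroup.m_inv_closed[OF Hs] by (auto simp: D_def)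
        fix y assume "y \<in> D"
        thus "x \<otimes> y \<in> D" using x h\<chi> subgroup.m_closed[OF Hs] by (auto simp: D_def)
      qed
      show "D \<subseteq> H" by (auto simp: D_def)
      fix h x assume hx: "h \<in> H" "x \<in> D"
      hence "h \<otimes> x \<otimes> inv h \<in> H" using subgroup.m_closed[OF Hs] subgroup.m_inv_closed[OF Hs] by (auto simp: D_def)
      thus "h \<otimes> x \<otimes> inv h \<in> D" using hx conj1 by (auto simp: D_def)
    qed
    moreover have "N0 \<subseteq> D"
    proof
      fix x assume "x \<in> N0"
      hence "x \<in> H" "x \<in> N" using N(2) Ns by auto
      hence "\<phi> x = \<phi> \<one>" using N\<phi> one by simp
      thus "x \<in> D" using \<open>x \<in> H\<close> \<chi>1 by (simp add: D_def)
    qed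
    moreover have "D \<noteq> H"
    proof
      assume "D = H"
      obtain y where "y \<in> carrier F" "\<chi> y \<noteq> 1" using \<chi>(3) by blast
      then obtain x where "x \<in> H" "\<chi> (\<phi> x) \<noteq> 1" unfolding img[symmetric] by auto
      thus False using \<open>D = H\<close> by (auto simp: D_def)
    qed
    moreover have "x \<otimes> y \<otimes> inv x \<otimes> inv y \<in> D" if xy: "x \<in> H" "y \<in> H" for x y
    proof -
      have cl: "inv x \<in> H" "inv y \<in> H" "x \<otimes> y \<otimes> inv x \<in> H" "x \<otimes> y \<otimes> inv x \<otimes> inv y \<in> H"
        using xy subgroup.m_closed[OF Hs] subgroup.m_inv_closed[OF Hs] by auto
      have "\<chi> (\<phi> (x \<otimes> y \<otimes> inv x \<otimes> inv y)) = \<chi> (\<phi> y) * \<chi> (\<phi> (inv y))"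
        using h\<chi>[OF cl(3,2)] conj1[OF xy] by simp
      thus ?thesis using \<chi>i[OF xy(2)] cl(4) by (simp add: D_def)
    qed
    ultimately show ?thesis by blast
  next
    case False
    obtain p1 where p1: "prime p1" "p1 dvd k" using prime_factor_nat[OF k1] by blast
    have "\<not> prime_factors k \<subseteq> {p1, p1}" using False p1 by blast
    then obtain p2 where p2: "prime p2" "p2 dvd k" "p2 \<noteq> p1" by (auto simp: in_prime_factors_iff)
    have "\<not> prime_factors k \<subseteq> {p1, p2}" using False p1 p2 by blast
    then obtain p3 where p3: "prime p3" "p3 dvd k" "p3 \<noteq> p1" "p3 \<noteq> p2" by (auto simp: in_prime_factors_iff)
    define H1 where "H1 = H \<inter> Hall (- {p1})"
    have H1: "compat H1" unfolding H1_def by (rule compat_hall[OF H])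
    have H1s: "subgroup H1 G" by (rule compat_sub[OF H1])
    define N1 where "N1 = N \<inter> Hall (- {p1})"
    have N1s: "subgroup N1 G" unfolding N1_def by (rule sub_hall[OF Ns(1)])
    have N1: "nrm N1 H1" unfolding nrm_def
    proof (intro conjI ballI)
      show "N1 \<subseteq> H1" using Ns by (auto simp: N1_def H1_def)
      fix h x assume hx: "h \<in> H1" "x \<in> N1"
      hence "h \<otimes> x \<otimes> inv h \<in> N" using N(1) by (auto simp: nrm_def N1_def H1_def)
      moreover have "h \<otimes> x \<otimes> inv h \<in> Hall (- {p1})"
        using hx subgroup.m_closed[OF hall_sub] subgroup.m_inv_closed[OF hall_sub] by (auto simp: N1_def H1_def)
      ultimately show "h \<otimes> x \<otimes> inv h \<in> N1" by (simp add: N1_def)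
    qed (rule N1s)
    define k' where "k' = part (- {p1}) k"
    have ck: "card H1 = k' * card N1"
      unfolding H1_def N1_def k'_def by (rule card_index_part(1)[OF H N(1) k])
    have k'k: "k' < k"
    proof -
      have "p1 \<in> prime_factors (part {p1} k)" using p1 k0 by (simp add: prime_factors_part in_prime_factors_iff)
      hence "p1 dvd part {p1} k" by (simp add: in_prime_factors_iff)
      hence "part {p1} k \<ge> p1" using part_pos[of "{p1}" k] dvd_imp_le by blast
      hence "part {p1} k > 1" using prime_gt_1_nat[OF p1(1)] by linarith
      moreover have "k' > 0" by (simp add: k'_def)
      ultimately have "k' * 1 < k' * part {p1} k" by (rule mult_strict_left_mono[rotated, rotated])
      thus ?thesis using part_compl[OF k0, of "{p1}"] by (simp add: k'_def mult.commute)
    qed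
    have NH1: "N1 \<noteq> H1"
    proof
      assume "N1 = H1"
      hence "k' = 1" using ck card_sub_pos[OF H1s] by simp
      moreover have "p2 \<in> prime_factors k'" using p2 k0 by (simp add: k'_def prime_factors_part in_prime_factors_iff)
      ultimately show False by simp
    qed
    define \<K> where "\<K> = {K. nrm K H1 \<and> N1 \<subseteq> K \<and> K \<noteq> N1}"
    have "finite \<K>" by (rule finite_subset[of _ "Pow H1"]) (auto simp: \<K>_def nrm_def finite_sub[OF H1s])
    moreover have "H1 \<in> \<K>" using H1s NH1 N1 subgroup.m_closed[OF H1s] subgroup.m_inv_closed[OF H1s] by (auto simp: \<K>_def nrm_def)
    ultimately obtain K where K\<K>: "K \<in> \<K>" and Kmin: "\<And>D. D \<in> \<K> \<Longrightarrow> D \<subseteq> K \<Longrightarrow> D = K"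
      using finite_has_minimal2[of \<K> H1] by metis
    have K: "nrm K H1" "N1 \<subseteq> K" "K \<noteq> N1" using K\<K> by (auto simp: \<K>_def)
    have Kc: "compat K" by (rule compat_nrm[OF H1 K(1)])
    have Ks: "subgroup K G" "K \<subseteq> H1" using K by (auto simp: nrm_def)
    have N1K: "nrm N1 K" using N1 K(2) Ks by (auto simp: nrm_def)
    have Kmin': "D = N1 \<or> D = K" if "nrm D H1" "N1 \<subseteq> D" "D \<subseteq> K" for D
      using Kmin[of D] that by (auto simp: \<K>_def)
    obtain l where l: "card K = l * card N1"
      using card_subgroup_dvd[OF N1s Ks(1) K(2)] by (metis dvd_div_mult_self)
    have "l * card N1 \<le> k' * card N1" using l ck Ks(2) finite_sub[OF H1s] card_mono by metis
    hence "l \<le> k'" using card_sub_pos[OF N1s] by simp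
    hence "l < n" using k'k kn by linarith
    from IH[OF this Kc N1K K(3)[symmetric] l] obtain D0 where
      D0: "nrm D0 K" "N1 \<subseteq> D0" "D0 \<noteq> K" "\<forall>x\<in>K. \<forall>y\<in>K. x \<otimes> y \<otimes> inv x \<otimes> inv y \<in> D0" by blast
    have KG: "K \<subseteq> carrier G" "H1 \<subseteq> carrier G" using subgroup.subset[OF Ks(1)] subgroup.subset[OF H1s] by blast+
    obtain p where p: "prime p" and Kp': "K \<inter> Hall (- {p}) \<subseteq> N1"
      by (rule chief_factor[OF H1s K(1) N1 K(2) K(3)[symmetric] Kmin' D0])
    have Kprod: "(K \<inter> Hall {p}) <#> (K \<inter> Hall (- {p})) = K" by (rule hall_prod[OF Kc]) auto
    have KN: "K \<subseteq> (K \<inter> Hall {p}) <#> N1"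
    by (use Kp' Kprod in \<open>fastforce simp: set_mult_def\<close>)
    \<comment> \<open>For \<open>p = p1\<close> all of \<open>K\<close> would lie in
      \<open>Hall (- {p})\<close>, hence in \<open>N1\<close>.\<close>
    have "p \<noteq> p1"
    by (use Ks(2) False Kp' K(2,3) in \<open>auto simp: H1_def\<close>)
    \<comment> \<open>Here three prime divisors of \<open>k\<close> are used: \<open>pi\<close> must
      avoid both \<open>p1\<close>, to get \<open>Hi <#> H1 = H\<close>, and \<open>p\<close>, to
      get the \<open>p\<close>-part of \<open>K\<close> into \<open>Hi\<close>.\<close>
    obtain pi where pi: "prime pi" "pi dvd k" "pi \<noteq> p1" "pi \<noteq> p" using p2 p3 by metis
    define Hi where "Hi = H \<inter> Hall (- {pi})"
    have His: "subgroup Hi G" unfolding Hi_def by (rule sub_hall[OF Hs])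
    have HiH: "Hi \<subseteq> H" by (simp add: Hi_def)
    have prod: "Hi <#> H1 = H" unfolding Hi_def H1_def by (rule hall_prod[OF H]) (use pi in auto)
    have KpHi: "K \<inter> Hall {p} \<subseteq> Hi"
    proof -
      have "Hall {p} \<subseteq> Hall (- {pi})" using hall_int[of "{p}" "- {pi}"] pi(4) by (metis Compl_iff Int_absorb2 Int_commute insert_iff inf.orderI singletonD singletonI subsetI)
      thus ?thesis using Ks(2) by (auto simp: Hi_def H1_def)
    qed
    define Y where "Y = N <#> Hi"
    have Ys: "subgroup Y G" unfolding Y_def by (rule nrm_set_mult_subgroup[OF N(1) Hs His HiH])
    have NY: "N \<subseteq> Y" "Hi \<subseteq> Y"
    proof -
      show "N \<subseteq> Y"
      proof
        fix x assume x: "x \<in> N"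
        hence "x = x \<otimes> \<one>" using Ns HG by auto
        thus "x \<in> Y" using x subgroup.one_closed[OF His] unfolding Y_def set_mult_def by blast
      qed
      show "Hi \<subseteq> Y"
      proof
        fix x assume x: "x \<in> Hi"
        hence "x = \<one> \<otimes> x" using HiH HG by auto
        thus "x \<in> Y" using x subgroup.one_closed[OF Ns(1)] unfolding Y_def set_mult_def by blast
      qed
    qed
    have HH: "nrm H H" using Hs subgroup.m_closed[OF Hs] subgroup.m_inv_closed[OF Hs] by (simp add: nrm_def)
    define L where "L = {x \<in> H. \<forall>b\<in>H. b \<otimes> x \<otimes> inv b \<in> Y}"
    have Ln: "nrm L H" unfolding L_def by (rule core_nrm[OF HH Hs Ys])
    have NL: "N \<subseteq> L" using N(1) NY by (auto simp: L_def nrm_def)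
    have KpL: "K \<inter> Hall {p} \<subseteq> L"
    proof
      fix x assume x: "x \<in> K \<inter> Hall {p}"
      have xH: "x \<in> H" using x Ks(2) by (auto simp: H1_def)
      have "b \<otimes> x \<otimes> inv b \<in> Y" if b: "b \<in> H" for b
      proof -
        \<comment> \<open>With \<open>b = c \<otimes> d\<close>, conjugation by \<open>d\<close>
          keeps \<open>x\<close> inside \<open>K\<close>, hence inside the product of its
          \<open>p\<close>-part with \<open>N1\<close>, which lies in \<open>Y\<close>; conjugation
          by \<open>c\<close> then does not leave the subgroup \<open>Y\<close>.\<close>
        obtain c d where cd: "c \<in> Hi" "d \<in> H1" "b = c \<otimes> d" using b prod by (auto simp: set_mult_def)
        have cdG: "c \<in> carrier G" "d \<in> carrier G" "x \<in> carrier G" using cd HiH HG KG xH by auto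
        have "d \<otimes> x \<otimes> inv d \<in> K" using K(1) cd x by (auto simp: nrm_def)
        then obtain u v where uv: "u \<in> K \<inter> Hall {p}" "v \<in> N1" "d \<otimes> x \<otimes> inv d = u \<otimes> v"
          using KN by (auto simp: set_mult_def)
        have "u \<in> Y" "v \<in> Y" "c \<in> Y" using uv KpHi NY cd by (auto simp: N1_def)
        hence "c \<otimes> (u \<otimes> v) \<otimes> inv c \<in> Y" using subgroup.m_closed[OF Ys] subgroup.m_inv_closed[OF Ys] by simp
        moreover have "b \<otimes> x \<otimes> inv b = c \<otimes> (d \<otimes> x \<otimes> inv d) \<otimes> inv c"
          using cdG by (simp add: cd(3) inv_mult_group m_assoc)
        ultimately show ?thesis using uv by simp
      qed
      thus "x \<in> L" using xH by (simp add: L_def)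
    qed
    have "L \<noteq> N"
    proof
      assume LN: "L = N"
      have "K \<subseteq> N1"
      proof
        fix x assume x: "x \<in> K"
        then obtain u v where uv: "u \<in> K \<inter> Hall {p}" "v \<in> N1" "x = u \<otimes> v" using KN by (auto simp: set_mult_def)
        hence "u \<in> N" "v \<in> N" using KpL LN by (auto simp: N1_def)
        hence "x \<in> N" using uv subgroup.m_closed[OF Ns(1)] by simp
        thus "x \<in> N1" using x Ks(2) by (auto simp: N1_def H1_def)
      qed
      thus False using K by auto
    qed
    hence "L = H" using max[OF Ln NL] by blast
    hence HY: "H \<subseteq> Y"
    proof -
      have "\<one> \<otimes> x \<otimes> inv \<one> \<in> Y" if "x \<in> H" for x
        using that \<open>L = H\<close> subgroup.one_closed[OF Hs] unfolding L_def by blast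
      thus ?thesis using HG by (metis inv_one l_one r_one subsetD subsetI)
    qed
    \<comment> \<open>Counting: \<open>Y = H\<close> would make \<open>k\<close> at most its
      prime-to-\<open>pi\<close> part, although \<open>pi\<close> divides \<open>k\<close>.\<close>
    have "card Hi = part (- {pi}) k * card (N \<inter> Hall (- {pi}))"
      unfolding Hi_def by (rule card_index_part(1)[OF H N(1) k])
    moreover have "N \<inter> Hi = N \<inter> Hall (- {pi})" using Ns by (auto simp: Hi_def)
    moreover have "card Y * card (N \<inter> Hi) = card N * card Hi"
      unfolding Y_def by (rule card_set_mult[OF Ns(1) His fin])
    moreover have "card (N \<inter> Hi) > 0" using card_sub_pos[OF subgroups_Inter_pair[OF Ns(1) His]] .
    ultimately have cY: "card Y = part (- {pi}) k * card N" by simp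
    have "card H \<le> card Y" using HY finite_sub[OF Ys] by (rule card_mono[rotated])
    hence "k \<le> part (- {pi}) k" using cY k card_sub_pos[OF Ns(1)] by simp
    moreover have "part {pi} k * part (- {pi}) k = k" by (rule part_compl[OF k0])
    moreover have "pi dvd part {pi} k"
    by (use pi k0 prime_factors_part in_prime_factors_iff in blast)
    hence "pi \<le> part {pi} k" using part_pos[of "{pi}" k] by (rule dvd_imp_le)
    hence "2 \<le> part {pi} k" using prime_gt_1_nat[OF pi(1)] by linarith
    hence "2 * part (- {pi}) k \<le> part {pi} k * part (- {pi}) k" by (rule mult_le_mono1)
    ultimately have "2 * part (- {pi}) k \<le> part (- {pi}) k" by linarith
    hence False using part_pos[of "- {pi}" k] by linarith
    thus ?thesis ..
  qed
qed

text \<open>The order of \<open>U\<close> is divisible by the \<open>p\<close>-part of the order of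
  the group for each prime \<open>p\<close>, hence by the whole order.\<close>

lemma hall_generate:
  assumes U: "subgroup U G" and p: "\<And>p. prime p \<Longrightarrow> Hall {p} \<subseteq> U"
  shows "U = carrier G"
proof -
  have Us: "U \<subseteq> carrier G" by (rule subgroup.subset[OF U])
  have "multiplicity p (card (carrier G)) \<le> multiplicity p (card U)" if pp: "prime p" for p
  proof -
    have "filter_mset (\<lambda>q. q \<in> {p}) (prime_factorization n) = replicate_mset (multiplicity p n) p" for n :: nat
      by (rule multiset_eqI) (use pp in \<open>auto simp: count_prime_factorization\<close>)
    hence "part {p} n = p ^ multiplicity p n" for n :: nat by (simp add: part_def)
    moreover have "part {p} (card (carrier G)) dvd card U"
      using card_subgroup_dvd[OF hall_sub U p[OF pp]] by (simp add: hall_card)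
    ultimately have "p ^ multiplicity p (card (carrier G)) dvd card U" by simp
    thus ?thesis using card_sub_pos[OF U] pp by (intro multiplicity_geI) auto
  qed
  hence "card (carrier G) dvd card U" using card_sub_pos[OF U] card_group_pos by (intro multiplicity_le_imp_dvd) auto
  hence "card (carrier G) \<le> card U" using card_sub_pos[OF U] dvd_imp_le by blast
  thus ?thesis using Us fin card_seteq by blast
qed

end

subsection \<open>Permutation groups with Hall systems\<close>

text \<open>Abstracts the finite group of counts built further below. \<open>gen x\<close> is a
  generator fixing the letter \<open>x\<close>, and \<open>pt p x\<close> is its
  \<open>p\<close>-part, a power of \<open>gen x\<close>. The rule \<open>pt_move\<close> exchanges
  a \<open>p'\<close>-element with a \<open>p\<close>-part, at the price of moving the letter; it is
  the one axiom that links the action with the Hall subgroups.\<close>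

locale permutation_hall_system = hall_system G Hall for G :: "'a monoid" (structure) and Hall +
  fixes A :: "'x set" and act :: "'a \<Rightarrow> 'x \<Rightarrow> 'x" and gen :: "'x \<Rightarrow> 'a" and pt :: "nat \<Rightarrow> 'x \<Rightarrow> 'a"
  assumes act_closed: "a \<in> carrier G \<Longrightarrow> x \<in> A \<Longrightarrow> act a x \<in> A"
    and act_one: "x \<in> A \<Longrightarrow> act \<one> x = x"
    and act_mult: "a \<in> carrier G \<Longrightarrow> b \<in> carrier G \<Longrightarrow> x \<in> A \<Longrightarrow> act (a \<otimes> b) x = act a (act b x)"
    and gen: "x \<in> A \<Longrightarrow> gen x \<in> carrier G" "x \<in> A \<Longrightarrow> act (gen x) x = x"
    and gen_induct: "\<one> \<in> U \<Longrightarrow> (\<And>x u. x \<in> A \<Longrightarrow> u \<in> U \<Longrightarrow> u \<in> carrier G \<Longrightarrow> gen x \<otimes> u \<in> U) \<Longrightarrow> carrier G \<subseteq> U"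
    and pt: "prime p \<Longrightarrow> x \<in> A \<Longrightarrow> pt p x \<in> Hall {p}" "prime p \<Longrightarrow> x \<in> A \<Longrightarrow> \<exists>k::nat. pt p x = gen x [^] k"
    and pt_generate: "prime p \<Longrightarrow> subgroup U G \<Longrightarrow> (\<And>x. x \<in> A \<Longrightarrow> pt p x \<in> U) \<Longrightarrow> Hall {p} \<subseteq> U"
    and pt_move: "prime p \<Longrightarrow> x \<in> A \<Longrightarrow> f \<in> Hall (- {p}) \<Longrightarrow>
       \<exists>f'\<in>Hall (- {p}). f \<otimes> pt p x = pt p (act f x) \<otimes> f'"
begin

definition comm_in :: "'a set \<Rightarrow> 'a \<Rightarrow> 'a \<Rightarrow> bool" where
  "comm_in N a b \<longleftrightarrow> a \<otimes> b \<otimes> inv a \<otimes> inv b \<in> N"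

lemma hall_carrier: "Hall \<pi> \<subseteq> carrier G"
  by (rule subgroup.subset[OF hall_sub])

lemma nrm_carrier:
  assumes "nrm N (carrier G)" shows "subgroup N G" "N \<subseteq> carrier G" "N \<lhd> G"
    "\<And>g x. g \<in> carrier G \<Longrightarrow> x \<in> N \<Longrightarrow> g \<otimes> x \<otimes> inv g \<in> N"
  using assms normal_inv_iff by (auto simp: nrm_def)

lemma comm_in_iff:
  assumes N: "nrm N (carrier G)" and ab: "a \<in> carrier G" "b \<in> carrier G"
  shows "comm_in N a b \<longleftrightarrow> (\<exists>n\<in>N. a \<otimes> b = n \<otimes> (b \<otimes> a))"
proof -
  have NG: "N \<subseteq> carrier G" using nrm_carrier[OF N] by blast
  have e: "a \<otimes> b \<otimes> inv a \<otimes> inv b \<otimes> (b \<otimes> a) = a \<otimes> b"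
  proof -
    have "a \<otimes> b \<otimes> inv a \<otimes> inv b \<otimes> (b \<otimes> a) = a \<otimes> b \<otimes> inv a \<otimes> (inv b \<otimes> b) \<otimes> a"
      using ab by (simp only: m_assoc m_closed inv_closed)
    thus ?thesis using ab by (simp add: m_assoc)
  qed
  show ?thesis
  proof
    assume "comm_in N a b"
    thus "\<exists>n\<in>N. a \<otimes> b = n \<otimes> (b \<otimes> a)" using e unfolding comm_in_def by metis
  next
    assume "\<exists>n\<in>N. a \<otimes> b = n \<otimes> (b \<otimes> a)"
    then obtain n where n: "n \<in> N" "a \<otimes> b = n \<otimes> (b \<otimes> a)" by blast
    have nG: "n \<in> carrier G" using n NG by auto
    have "a \<otimes> b \<otimes> inv a \<otimes> inv b = n \<otimes> (b \<otimes> (a \<otimes> inv a) \<otimes> inv b)"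
      unfolding n(2) using ab nG by (simp only: m_assoc m_closed inv_closed)
    also have "\<dots> = n" using ab nG by simp
    finally show "comm_in N a b" using n by (simp add: comm_in_def)
  qed
qed

definition quotient_map :: "'a set \<Rightarrow> 'c monoid \<Rightarrow> ('a \<Rightarrow> 'c) \<Rightarrow> bool" where
  "quotient_map N F \<phi> \<longleftrightarrow> group F \<and>
    (\<forall>x\<in>carrier G. \<forall>y\<in>carrier G. \<phi> (x \<otimes> y) = \<phi> x \<otimes>\<^bsub>F\<^esub> \<phi> y) \<and>
    (\<forall>x\<in>carrier G. \<phi> x \<in> carrier F) \<and>
    (\<forall>x\<in>carrier G. \<phi> (inv x) = inv\<^bsub>F\<^esub> (\<phi> x)) \<and>
    (\<forall>x\<in>carrier G. \<phi> x = \<one>\<^bsub>F\<^esub> \<longleftrightarrow> x \<in> N) \<and>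
    (\<forall>x\<in>carrier G. \<forall>y\<in>carrier G. comm_in N x y \<longleftrightarrow> \<phi> x \<otimes>\<^bsub>F\<^esub> \<phi> y = \<phi> y \<otimes>\<^bsub>F\<^esub> \<phi> x) \<and>
    (\<forall>x\<in>carrier G. \<forall>k::nat. \<phi> (x [^] k) = \<phi> x [^]\<^bsub>F\<^esub> k)"

lemma quotient_mapD:
  assumes "quotient_map N F \<phi>"
  shows "group F"
    and "\<forall>x\<in>carrier G. \<forall>y\<in>carrier G. \<phi> (x \<otimes> y) = \<phi> x \<otimes>\<^bsub>F\<^esub> \<phi> y"
    and "\<forall>x\<in>carrier G. \<phi> x \<in> carrier F"
    and "\<forall>x\<in>carrier G. \<phi> (inv x) = inv\<^bsub>F\<^esub> (\<phi> x)"
    and "\<forall>x\<in>carrier G. \<phi> x = \<one>\<^bsub>F\<^esub> \<longleftrightarrow> x \<in> N"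
    and "\<forall>x\<in>carrier G. \<forall>y\<in>carrier G. comm_in N x y \<longleftrightarrow> \<phi> x \<otimes>\<^bsub>F\<^esub> \<phi> y = \<phi> y \<otimes>\<^bsub>F\<^esub> \<phi> x"
    and "\<forall>x\<in>carrier G. \<forall>k::nat. \<phi> (x [^] k) = \<phi> x [^]\<^bsub>F\<^esub> k"
  using assms by (simp_all add: quotient_map_def)

lemma normal_quotient:
  assumes N: "nrm N (carrier G)"
  obtains F :: "'a set monoid" and \<phi> where "quotient_map N F \<phi>"
proof -
  obtain F :: "'a set monoid" and \<phi> where F: "finite_group F"
    and hom: "\<forall>x\<in>carrier G. \<forall>y\<in>carrier G. \<phi> (x \<otimes> y) = \<phi> x \<otimes>\<^bsub>F\<^esub> \<phi> y"
    and img: "\<phi> ` carrier G = carrier F" and ker: "\<forall>x\<in>carrier G. \<phi> x = \<one>\<^bsub>F\<^esub> \<longleftrightarrow> x \<in> N"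
    and cF: "card (carrier F) * card N = card (carrier G)"
    by (rule quotient_hom[OF N subgroup_self])
  interpret F: finite_group F by (rule F)
  have c: "\<phi> x \<in> carrier F" if "x \<in> carrier G" for x using that img by auto
  have one: "\<phi> \<one> = \<one>\<^bsub>F\<^esub>" using ker subgroup.one_closed[OF nrm_carrier(1)[OF N]] by simp
  have inv: "\<phi> (inv x) = inv\<^bsub>F\<^esub> (\<phi> x)" if x: "x \<in> carrier G" for x
  proof -
    have "\<phi> (inv x) \<otimes>\<^bsub>F\<^esub> \<phi> x = \<phi> \<one>" using hom[rule_format, of "inv x" x] x by simp
    thus ?thesis by (intro F.inv_equality[symmetric]) (use c x one in auto)
  qed
  have comm: "comm_in N x y \<longleftrightarrow> \<phi> x \<otimes>\<^bsub>F\<^esub> \<phi> y = \<phi> y \<otimes>\<^bsub>F\<^esub> \<phi> x" if xy: "x \<in> carrier G" "y \<in> carrier G" for x y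
  proof
    assume "comm_in N x y"
    then obtain n where n: "n \<in> N" "x \<otimes> y = n \<otimes> (y \<otimes> x)" using comm_in_iff[OF N xy] by blast
    have nG: "n \<in> carrier G" using n nrm_carrier(2)[OF N] by blast
    have n1: "\<phi> n = \<one>\<^bsub>F\<^esub>" using ker n(1) nG by blast
    have "\<phi> (x \<otimes> y) = \<phi> n \<otimes>\<^bsub>F\<^esub> \<phi> (y \<otimes> x)" using hom[rule_format, of n "y \<otimes> x"] n(2) nG xy by simp
    also have "\<dots> = \<phi> (y \<otimes> x)" using n1 c[of "y \<otimes> x"] xy by simp
    finally show "\<phi> x \<otimes>\<^bsub>F\<^esub> \<phi> y = \<phi> y \<otimes>\<^bsub>F\<^esub> \<phi> x" using hom xy by simp
  next
    assume e: "\<phi> x \<otimes>\<^bsub>F\<^esub> \<phi> y = \<phi> y \<otimes>\<^bsub>F\<^esub> \<phi> x"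
    have "\<phi> (x \<otimes> y \<otimes> inv x \<otimes> inv y) = \<phi> x \<otimes>\<^bsub>F\<^esub> \<phi> y \<otimes>\<^bsub>F\<^esub> inv\<^bsub>F\<^esub> (\<phi> x) \<otimes>\<^bsub>F\<^esub> inv\<^bsub>F\<^esub> (\<phi> y)"
      using hom xy inv by simp
    also have "\<dots> = \<one>\<^bsub>F\<^esub>" unfolding e using c[OF xy(1)] c[OF xy(2)] by (simp add: F.m_assoc)
    finally show "comm_in N x y" using ker xy by (simp add: comm_in_def)
  qed
  have pow: "\<forall>x\<in>carrier G. \<forall>k::nat. \<phi> (x [^] k) = \<phi> x [^]\<^bsub>F\<^esub> k"
    by (intro ballI allI, rule quotient_pow[where \<phi>=\<phi>, OF subgroup_self F _ one, THEN conjunct1]) (use hom in auto)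
  show thesis by (rule that[of F \<phi>]) (use F.is_group hom c inv ker comm pow in \<open>auto simp: quotient_map_def\<close>)
qed

lemma comm_in_subgroup:
  assumes N: "nrm N (carrier G)" and S: "S \<subseteq> carrier G"
  shows "subgroup {a \<in> carrier G. \<forall>b\<in>S. comm_in N a b} G"
proof -
  obtain F :: "'a set monoid" and \<phi> where Q: "quotient_map N F \<phi>" by (rule normal_quotient[OF N])
  note F = quotient_mapD(1)[OF Q] and hom = quotient_mapD(2)[OF Q] and c = quotient_mapD(3)[OF Q] and inv = quotient_mapD(4)[OF Q] and ker = quotient_mapD(5)[OF Q] and comm = quotient_mapD(6)[OF Q]
  interpret F: group F by (rule F)
  have one: "\<phi> \<one> = \<one>\<^bsub>F\<^esub>" using ker subgroup.one_closed[OF nrm_carrier(1)[OF N]] by simp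
  show ?thesis
  proof (rule subgroupI)
    show "{a \<in> carrier G. \<forall>b\<in>S. comm_in N a b} \<noteq> {}" using comm one c S one_closed by (auto simp: subset_iff intro!: exI[of _ \<one>])
    fix a assume a: "a \<in> {a \<in> carrier G. \<forall>b\<in>S. comm_in N a b}"
    hence aG: "a \<in> carrier G" by simp
    have ca: "\<phi> a \<otimes>\<^bsub>F\<^esub> \<phi> b = \<phi> b \<otimes>\<^bsub>F\<^esub> \<phi> a" if "b \<in> S" for b using a comm S that by auto
    have "comm_in N (inv a) b" if b: "b \<in> S" for b
    proof -
      have cl: "\<phi> a \<in> carrier F" "\<phi> b \<in> carrier F" "b \<in> carrier G" using c aG b S by auto
      have "inv\<^bsub>F\<^esub> (\<phi> a) \<otimes>\<^bsub>F\<^esub> (\<phi> a \<otimes>\<^bsub>F\<^esub> \<phi> b) \<otimes>\<^bsub>F\<^esub> inv\<^bsub>F\<^esub> (\<phi> a) = \<phi> b \<otimes>\<^bsub>F\<^esub> inv\<^bsub>F\<^esub> (\<phi> a)"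
        using cl by (simp add: F.m_assoc[symmetric])
      moreover have "inv\<^bsub>F\<^esub> (\<phi> a) \<otimes>\<^bsub>F\<^esub> (\<phi> b \<otimes>\<^bsub>F\<^esub> \<phi> a) \<otimes>\<^bsub>F\<^esub> inv\<^bsub>F\<^esub> (\<phi> a) = inv\<^bsub>F\<^esub> (\<phi> a) \<otimes>\<^bsub>F\<^esub> \<phi> b"
        using cl by (simp add: F.m_assoc)
      ultimately have "inv\<^bsub>F\<^esub> (\<phi> a) \<otimes>\<^bsub>F\<^esub> \<phi> b = \<phi> b \<otimes>\<^bsub>F\<^esub> inv\<^bsub>F\<^esub> (\<phi> a)" using ca[OF b] by simp
      thus ?thesis using comm inv aG cl by simp
    qed
    thus "inv a \<in> {a \<in> carrier G. \<forall>b\<in>S. comm_in N a b}" using aG by simp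
    fix d assume d: "d \<in> {a \<in> carrier G. \<forall>b\<in>S. comm_in N a b}"
    hence dG: "d \<in> carrier G" by simp
    have cd: "\<phi> d \<otimes>\<^bsub>F\<^esub> \<phi> b = \<phi> b \<otimes>\<^bsub>F\<^esub> \<phi> d" if "b \<in> S" for b using d comm S that by auto
    have "comm_in N (a \<otimes> d) b" if b: "b \<in> S" for b
    proof -
      have cl: "\<phi> a \<in> carrier F" "\<phi> b \<in> carrier F" "\<phi> d \<in> carrier F" "b \<in> carrier G" using c aG dG b S by auto
      have "\<phi> a \<otimes>\<^bsub>F\<^esub> \<phi> d \<otimes>\<^bsub>F\<^esub> \<phi> b = \<phi> a \<otimes>\<^bsub>F\<^esub> \<phi> b \<otimes>\<^bsub>F\<^esub> \<phi> d" using cl cd[OF b] by (simp add: F.m_assoc)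
      also have "\<dots> = \<phi> b \<otimes>\<^bsub>F\<^esub> (\<phi> a \<otimes>\<^bsub>F\<^esub> \<phi> d)" using cl ca[OF b] by (simp add: F.m_assoc)
      finally show ?thesis using comm hom aG dG cl by simp
    qed
    thus "a \<otimes> d \<in> {a \<in> carrier G. \<forall>b\<in>S. comm_in N a b}" using aG dG by simp
  qed auto
qed

lemma comm_in_sym:
  assumes N: "nrm N (carrier G)" and ab: "a \<in> carrier G" "b \<in> carrier G" and "comm_in N a b"
  shows "comm_in N b a"
proof -
  have "inv (a \<otimes> b \<otimes> inv a \<otimes> inv b) = b \<otimes> a \<otimes> inv b \<otimes> inv a"
    using ab by (simp add: inv_mult_group m_assoc)
  thus ?thesis using assms(4) subgroup.m_inv_closed[OF nrm_carrier(1)[OF N]] unfolding comm_in_def by metis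
qed

lemma hall_comm_in:
  assumes N: "nrm N (carrier G)" and pr: "prime p" "prime q"
    and pq: "\<And>x y. x \<in> A \<Longrightarrow> y \<in> A \<Longrightarrow> comm_in N (pt p x) (pt q y)"
    and ab: "a \<in> Hall {p}" "b \<in> Hall {q}"
  shows "comm_in N a b"
proof -
  have ptG: "pt s x \<in> carrier G" if "prime s" "x \<in> A" for s x using pt(1)[OF that] hall_carrier by blast
  have "Hall {p} \<subseteq> {a \<in> carrier G. \<forall>b\<in>pt q ` A. comm_in N a b}"
    by (rule pt_generate[OF pr(1) comm_in_subgroup[OF N]]) (use pq ptG pr in auto)
  hence sub: "comm_in N a (pt q y)" if "y \<in> A" for y using that ab by blast
  have aG: "a \<in> carrier G" "b \<in> carrier G" using ab hall_carrier by auto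
  have "Hall {q} \<subseteq> {b \<in> carrier G. \<forall>a'\<in>{a}. comm_in N b a'}"
  proof (rule pt_generate[OF pr(2) comm_in_subgroup[OF N]])
    show "{a} \<subseteq> carrier G" using aG by simp
    fix y assume y: "y \<in> A"
    show "pt q y \<in> {b \<in> carrier G. \<forall>a'\<in>{a}. comm_in N b a'}"
      using comm_in_sym[OF N aG(1) ptG[OF pr(2) y] sub[OF y]] ptG[OF pr(2) y] by simp
  qed
  hence "comm_in N b a" using ab by auto
  thus ?thesis by (rule comm_in_sym[OF N aG(2,1)])
qed

section \<open>Descent through transitive normal subgroups\<close>

definition transitive_on :: "'a set \<Rightarrow> bool" where
  "transitive_on M \<longleftrightarrow> (\<forall>x\<in>A. \<forall>y\<in>A. \<exists>m\<in>M. act m x = y)"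

text \<open>The commutation of Hall subgroups for distinct primes is carried along so that it holds
  modulo the smaller subgroup as well. From it follows that M/N is central in the quotient by
  \<open>N\<close>; a central \<open>m\<close> moving \<open>x\<close> to \<open>y\<close> then
  shows that \<open>gen x\<close>, which fixes \<open>x\<close>, moves \<open>y\<close> only by an
  element of \<open>N\<close>.\<close>

lemma transitive_step:
  assumes M: "nrm M (carrier G)" "transitive_on M" and N: "nrm N (carrier G)" "N \<subseteq> M"
    and q: "prime q" "M \<inter> Hall (- {q}) \<subseteq> N" and NM: "N \<noteq> M"
    and max: "\<And>D. nrm D (carrier G) \<Longrightarrow> N \<subseteq> D \<Longrightarrow> D \<subseteq> M \<Longrightarrow> D = N \<or> D = M"
    and pr: "\<And>p r a b. prime p \<Longrightarrow> prime r \<Longrightarrow> p \<noteq> r \<Longrightarrow> a \<in> Hall {p} \<Longrightarrow> b \<in> Hall {r} \<Longrightarrow> comm_in M a b"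
  shows "transitive_on N"
    and "\<And>p r a b. prime p \<Longrightarrow> prime r \<Longrightarrow> p \<noteq> r \<Longrightarrow> a \<in> Hall {p} \<Longrightarrow> b \<in> Hall {r} \<Longrightarrow> comm_in N a b"
proof -
  note Ms = nrm_carrier[OF M(1)] and Ns = nrm_carrier[OF N(1)]
  have Mc: "compat M" by (rule compat_nrm[OF compat_carrier M(1)])
  have ptG: "pt s x \<in> carrier G" if "prime s" "x \<in> A" for s x using pt(1)[OF that] hall_carrier by blast
  obtain F :: "'a set monoid" and \<phi> where Q: "quotient_map N F \<phi>" by (rule normal_quotient[OF N(1)])
  note F = quotient_mapD(1)[OF Q] and hom = quotient_mapD(2)[OF Q] and c = quotient_mapD(3)[OF Q] and inv = quotient_mapD(4)[OF Q] and ker = quotient_mapD(5)[OF Q] and comm = quotient_mapD(6)[OF Q]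
  interpret F: group F by (rule F)
  have move: "\<phi> (pt p x) = \<phi> (pt p (act f x))" if p: "prime p" and x: "x \<in> A" and f: "f \<in> M \<inter> Hall (- {p})" for p x f
  proof -
    have fG: "f \<in> carrier G" using f Ms by auto
    define z where "z = act f x"
    have z: "z \<in> A" unfolding z_def using act_closed fG x by blast
    obtain f' where f': "f' \<in> Hall (- {p})" "f \<otimes> pt p x = pt p z \<otimes> f'"
      using pt_move[OF p x] f z_def by blast
    note cl = ptG[OF p x] ptG[OF p z]
    have f'G: "f' \<in> carrier G" using f' hall_carrier by blast
    \<comment> \<open>The defect of \<open>pt p x\<close> against \<open>pt p z\<close>, a
      \<open>p\<close>-element. It satisfies \<open>f' = y \<otimes> w\<close> with a
      \<open>p'\<close>-element \<open>f'\<close> and \<open>w\<close> in \<open>M\<close>, so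
      modulo \<open>M\<close> it has both kinds of order and is trivial. For
      \<open>p \<noteq> q\<close> its place in \<open>Hall (- {q})\<close> puts it into
      \<open>N\<close>; for \<open>p = q\<close> both \<open>f'\<close> and \<open>w\<close> are in
      \<open>N\<close>.\<close>
    define y where "y = inv (pt p z) \<otimes> pt p x"
    have yG: "y \<in> carrier G" using cl by (simp add: y_def)
    have yp: "y \<in> Hall {p}" unfolding y_def
      by (intro subgroup.m_closed[OF hall_sub] subgroup.m_inv_closed[OF hall_sub] pt p x z)
    have cop: "coprime (part {p} (card (carrier G))) (part (- {p}) (card (carrier G)))"
      by (rule coprime_part) (use prime_factors_part in auto)
    define w where "w = inv (pt p x) \<otimes> f \<otimes> pt p x"
    have wM: "w \<in> M"
      using Ms(4)[of "inv (pt p x)" f] cl f by (simp add: w_def)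
    have wG: "w \<in> carrier G" using wM Ms by auto
    have ff: "f' = y \<otimes> w"
    proof -
      have "f' = inv (pt p z) \<otimes> (pt p z \<otimes> f')" using cl f'G by (simp add: m_assoc[symmetric])
      also have "\<dots> = inv (pt p z) \<otimes> (pt p x \<otimes> inv (pt p x)) \<otimes> f \<otimes> pt p x"
        unfolding f'(2)[symmetric] using cl fG by (simp add: m_assoc)
      also have "\<dots> = y \<otimes> w" unfolding y_def w_def using cl fG by (simp only: m_assoc m_closed inv_closed)
      finally show ?thesis .
    qed
    have yM: "y \<in> M"
    proof -
      obtain F' :: "'a set monoid" and \<psi> where Q': "quotient_map M F' \<psi>" by (rule normal_quotient[OF M(1)])
      note F' = quotient_mapD(1)[OF Q'] and hom' = quotient_mapD(2)[OF Q'] and c' = quotient_mapD(3)[OF Q'] and ker' = quotient_mapD(5)[OF Q'] and pow' = quotient_mapD(7)[OF Q']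
      interpret F': group F' by (rule F')
      have cy: "\<psi> y \<in> carrier F'" using c' yG by blast
      have "\<psi> f' = \<psi> y \<otimes>\<^bsub>F'\<^esub> \<psi> w" unfolding ff using hom' yG wG by blast
      also have "\<psi> w = \<one>\<^bsub>F'\<^esub>" using ker' wG wM by blast
      finally have e: "\<psi> f' = \<psi> y" using cy by simp
      have one': "\<psi> \<one> = \<one>\<^bsub>F'\<^esub>" using ker' subgroup.one_closed[OF Ms(1)] by simp
      have "\<psi> y [^]\<^bsub>F'\<^esub> part {p} (card (carrier G)) = \<one>\<^bsub>F'\<^esub>"
        using pow' yG pow_hall[OF yp] one' by metis
      moreover have "\<psi> y [^]\<^bsub>F'\<^esub> part (- {p}) (card (carrier G)) = \<one>\<^bsub>F'\<^esub>"
        using pow' f'G pow_hall[OF f'(1)] one' e by metis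
      ultimately have "\<psi> y = \<one>\<^bsub>F'\<^esub>" using F'.pow_coprime_one[OF cy _ _ cop] by blast
      thus ?thesis using ker' yG by blast
    qed
    have "y \<in> N"
    proof (cases "p = q")
      case False
      hence "Hall {p} \<subseteq> Hall (- {q})" using hall_int[of "{p}" "- {q}"] by (simp add: inf.absorb_iff1)
      thus ?thesis using yp yM q by blast
    next
      case True
      have fN: "f \<in> N" using f q True by blast
      have wN: "w \<in> N" using Ns(4)[of "inv (pt p x)" f] cl fN by (simp add: w_def)
      have "f' \<in> M" unfolding ff using yM wM by (rule subgroup.m_closed[OF Ms(1)])
      hence f'N: "f' \<in> N" using f' q True by blast
      have "y = f' \<otimes> inv w" unfolding ff using yG wG by (simp add: m_assoc)
      thus ?thesis using f'N wN subgroup.m_closed[OF Ns(1)] subgroup.m_inv_closed[OF Ns(1)] by simp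
    qed
    hence "\<phi> y = \<one>\<^bsub>F\<^esub>" using ker yG by blast
    moreover have "pt p x = pt p z \<otimes> y" unfolding y_def using cl by (simp add: m_assoc[symmetric])
    hence "\<phi> (pt p x) = \<phi> (pt p z) \<otimes>\<^bsub>F\<^esub> \<phi> y" using hom cl yG by metis
    ultimately show ?thesis using c cl by (simp add: z_def)
  qed
  have ptcomm: "comm_in N (pt p x) (pt r y)" if p: "prime p" "prime r" "p \<noteq> r" and xy: "x \<in> A" "y \<in> A" for p r x y
  proof -
    obtain m where m: "m \<in> M" "act m x = y" using M(2) xy by (auto simp: transitive_on_def)
    \<comment> \<open>Splitting \<open>m\<close> through the intermediate letter
      \<open>z = act m2 x\<close>: modulo \<open>N\<close> the \<open>p\<close>-part of
      \<open>x\<close> and the \<open>r\<close>-part of \<open>y\<close> are both replaced by powers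
      of the single element \<open>gen z\<close>.\<close>
    have "(M \<inter> Hall (- {r})) <#> (M \<inter> Hall (- {p})) = M" by (rule hall_prod[OF Mc]) (use p in auto)
    then obtain m1 m2 where mm: "m1 \<in> M \<inter> Hall (- {r})" "m2 \<in> M \<inter> Hall (- {p})" "m = m1 \<otimes> m2"
      using m(1) unfolding set_mult_def by blast
    have mG: "m1 \<in> carrier G" "m2 \<in> carrier G" using mm Ms by auto
    define z where "z = act m2 x"
    have z: "z \<in> A" using act_closed mG xy by (simp add: z_def)
    have y: "y = act m1 z" using m mm(3) mG xy act_mult by (simp add: z_def)
    have e1: "\<phi> (pt p x) = \<phi> (pt p z)" unfolding z_def by (rule move[OF p(1) xy(1) mm(2)])
    have e2: "\<phi> (pt r z) = \<phi> (pt r y)" unfolding y by (rule move[OF p(2) z mm(1)])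
    obtain k l :: nat where kl: "pt p z = gen z [^] k" "pt r z = gen z [^] l" using pt(2) p z by metis
    have "pt p z \<otimes> pt r z = pt r z \<otimes> pt p z"
      unfolding kl using gen(1)[OF z] by (simp add: nat_pow_mult add.commute)
    hence "\<phi> (pt p z) \<otimes>\<^bsub>F\<^esub> \<phi> (pt r z) = \<phi> (pt r z) \<otimes>\<^bsub>F\<^esub> \<phi> (pt p z)"
      using hom ptG[OF p(1) z] ptG[OF p(2) z] by metis
    thus ?thesis using comm ptG p xy by (simp add: e1 e2[symmetric])
  qed
  show hallc: "comm_in N a b" if "prime p" "prime r" "p \<noteq> r" "a \<in> Hall {p}" "b \<in> Hall {r}" for p r a b
    by (rule hall_comm_in[OF N(1) that(1,2) ptcomm[OF that(1-3)] that(4,5)])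
  have phicomm: "\<phi> a \<otimes>\<^bsub>F\<^esub> \<phi> b = \<phi> b \<otimes>\<^bsub>F\<^esub> \<phi> a" if "comm_in N a b" "a \<in> carrier G" "b \<in> carrier G" for a b
    using comm that by blast
  \<comment> \<open>The part of \<open>M\<close> that centralizes \<open>Hall {q}\<close> modulo
    \<open>N\<close>. It will be shown to be normal and different from \<open>N\<close>, hence equal
    to \<open>M\<close>.\<close>
  define C where "C = {m \<in> M. \<forall>a\<in>Hall {q}. comm_in N m a}"
  have Cs: "subgroup C G"
  proof -
    have "C = M \<inter> {a \<in> carrier G. \<forall>b\<in>Hall {q}. comm_in N a b}" using Ms(2) by (auto simp: C_def)
    thus ?thesis using subgroups_Inter_pair[OF Ms(1) comm_in_subgroup[OF N(1) hall_carrier]] by simp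
  qed
  have CG: "C \<subseteq> carrier G" by (rule subgroup.subset[OF Cs])
  have CN: "n \<in> N \<Longrightarrow> n \<in> C" for n
  proof -
    assume n: "n \<in> N"
    hence nG: "n \<in> carrier G" "\<phi> n = \<one>\<^bsub>F\<^esub>" using Ns(2) ker by auto
    have "comm_in N n a" if a: "a \<in> Hall {q}" for a
    proof -
      have "a \<in> carrier G" "\<phi> a \<in> carrier F" using a hall_carrier c by auto
      thus ?thesis using comm nG by simp
    qed
    thus "n \<in> C" using n N(2) by (auto simp: C_def)
  qed
  \<comment> \<open>The normalizer of \<open>C\<close>. It contains \<open>Hall {q}\<close>, which
    commutes with \<open>C\<close> modulo \<open>N\<close>, and each other \<open>Hall {p}\<close>,
    which commutes with \<open>Hall {q}\<close> modulo \<open>N\<close>.\<close>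
  define V where "V = {b \<in> carrier G. \<forall>m\<in>C. b \<otimes> m \<otimes> inv b \<in> C}"
  have Cq: "\<phi> m \<otimes>\<^bsub>F\<^esub> \<phi> a = \<phi> a \<otimes>\<^bsub>F\<^esub> \<phi> m" if "m \<in> C" "a \<in> Hall {q}" for m a
    using that CG hall_carrier by (intro phicomm) (auto simp: C_def)
  have "subgroup V G"
  proof (rule subgroupI)
    show "V \<subseteq> carrier G" by (auto simp: V_def)
    show "V \<noteq> {}" using CG by (auto simp: V_def subset_iff intro!: exI[of _ \<one>])
    fix b assume b: "b \<in> V"
    hence bG: "b \<in> carrier G" by (simp add: V_def)
    have "(\<lambda>m. b \<otimes> m \<otimes> inv b) ` C = C"
    proof (rule endo_inj_surj)
      show "finite C" by (rule finite_sub[OF Cs])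
      show "(\<lambda>m. b \<otimes> m \<otimes> inv b) ` C \<subseteq> C" using b by (auto simp: V_def)
      show "inj_on (\<lambda>m. b \<otimes> m \<otimes> inv b) C" by (rule inj_onI) (use bG CG in \<open>auto simp: subset_iff\<close>)
    qed
    hence "inv b \<otimes> m \<otimes> b \<in> C" if m: "m \<in> C" for m
    proof -
      obtain l where l: "l \<in> C" "m = b \<otimes> l \<otimes> inv b" using m \<open>(\<lambda>m. b \<otimes> m \<otimes> inv b) ` C = C\<close> by blast
      have lG: "l \<in> carrier G" using l CG by auto
      have "inv b \<otimes> m \<otimes> b = (inv b \<otimes> b) \<otimes> l \<otimes> (inv b \<otimes> b)"
        unfolding l(2) using bG lG by (simp only: m_assoc m_closed inv_closed)
      thus ?thesis using bG lG l by simp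
    qed
    thus "inv b \<in> V" using bG by (simp add: V_def)
    fix d assume d: "d \<in> V"
    hence dG: "d \<in> carrier G" by (simp add: V_def)
    have "(b \<otimes> d) \<otimes> m \<otimes> inv (b \<otimes> d) \<in> C" if m: "m \<in> C" for m
    proof -
      have "(b \<otimes> d) \<otimes> m \<otimes> inv (b \<otimes> d) = b \<otimes> (d \<otimes> m \<otimes> inv d) \<otimes> inv b"
        using bG dG m CG by (auto simp: inv_mult_group m_assoc subset_iff)
      thus ?thesis using b d m by (auto simp: V_def)
    qed
    thus "b \<otimes> d \<in> V" using bG dG by (simp add: V_def)
  qed
  moreover have "Hall {p} \<subseteq> V" if p: "prime p" for p
  proof
    fix b assume b: "b \<in> Hall {p}"
    hence bG: "b \<in> carrier G" using hall_carrier by blast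
    have "b \<otimes> m \<otimes> inv b \<in> C" if m: "m \<in> C" for m
    proof -
      have mG: "m \<in> carrier G" "m \<in> M" using m CG by (auto simp: C_def)
      define m' where "m' = b \<otimes> m \<otimes> inv b"
      have m'M: "m' \<in> M" using Ms(4) bG mG by (simp add: m'_def)
      have m'G: "m' \<in> carrier G" using m'M Ms by auto
      have cF: "\<phi> b \<in> carrier F" "\<phi> m \<in> carrier F" using c bG mG by auto
      have \<phi>m': "\<phi> m' = \<phi> b \<otimes>\<^bsub>F\<^esub> \<phi> m \<otimes>\<^bsub>F\<^esub> inv\<^bsub>F\<^esub> (\<phi> b)" using hom inv bG mG by (simp add: m'_def)
      have "comm_in N m' a" if a: "a \<in> Hall {q}" for a
      proof -
        have aG: "a \<in> carrier G" "\<phi> a \<in> carrier F" using a hall_carrier c by auto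
        have ma: "\<phi> m \<otimes>\<^bsub>F\<^esub> \<phi> a = \<phi> a \<otimes>\<^bsub>F\<^esub> \<phi> m" by (rule Cq[OF m a])
        have "\<phi> m' \<otimes>\<^bsub>F\<^esub> \<phi> a = \<phi> a \<otimes>\<^bsub>F\<^esub> \<phi> m'"
        proof (cases "p = q")
          case True
          have "\<phi> m \<otimes>\<^bsub>F\<^esub> \<phi> b = \<phi> b \<otimes>\<^bsub>F\<^esub> \<phi> m" using Cq[OF m] b True by blast
          hence "\<phi> m' = \<phi> m" unfolding \<phi>m' using cF by (metis F.inv_solve_right F.m_closed)
          thus ?thesis using ma by simp
        next
          case False
          have ba: "\<phi> b \<otimes>\<^bsub>F\<^esub> \<phi> a = \<phi> a \<otimes>\<^bsub>F\<^esub> \<phi> b"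
            by (rule phicomm[OF hallc[OF p q(1) False b a] bG aG(1)])
          have iba: "inv\<^bsub>F\<^esub> (\<phi> b) \<otimes>\<^bsub>F\<^esub> \<phi> a = \<phi> a \<otimes>\<^bsub>F\<^esub> inv\<^bsub>F\<^esub> (\<phi> b)"
          proof -
            have "inv\<^bsub>F\<^esub> (\<phi> b) \<otimes>\<^bsub>F\<^esub> (\<phi> b \<otimes>\<^bsub>F\<^esub> \<phi> a) \<otimes>\<^bsub>F\<^esub> inv\<^bsub>F\<^esub> (\<phi> b) = \<phi> a \<otimes>\<^bsub>F\<^esub> inv\<^bsub>F\<^esub> (\<phi> b)"
              using cF aG by (simp add: F.m_assoc[symmetric])
            moreover have "inv\<^bsub>F\<^esub> (\<phi> b) \<otimes>\<^bsub>F\<^esub> (\<phi> a \<otimes>\<^bsub>F\<^esub> \<phi> b) \<otimes>\<^bsub>F\<^esub> inv\<^bsub>F\<^esub> (\<phi> b) = inv\<^bsub>F\<^esub> (\<phi> b) \<otimes>\<^bsub>F\<^esub> \<phi> a"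
              using cF aG by (simp add: F.m_assoc)
            ultimately show ?thesis using ba by simp
          qed
          have "\<phi> m' \<otimes>\<^bsub>F\<^esub> \<phi> a = \<phi> b \<otimes>\<^bsub>F\<^esub> \<phi> m \<otimes>\<^bsub>F\<^esub> (inv\<^bsub>F\<^esub> (\<phi> b) \<otimes>\<^bsub>F\<^esub> \<phi> a)"
            unfolding \<phi>m' using cF aG by (simp add: F.m_assoc)
          also have "\<dots> = \<phi> b \<otimes>\<^bsub>F\<^esub> (\<phi> m \<otimes>\<^bsub>F\<^esub> \<phi> a) \<otimes>\<^bsub>F\<^esub> inv\<^bsub>F\<^esub> (\<phi> b)"
            unfolding iba using cF aG by (simp add: F.m_assoc)
          also have "\<dots> = (\<phi> b \<otimes>\<^bsub>F\<^esub> \<phi> a) \<otimes>\<^bsub>F\<^esub> \<phi> m \<otimes>\<^bsub>F\<^esub> inv\<^bsub>F\<^esub> (\<phi> b)"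
            unfolding ma using cF aG by (simp add: F.m_assoc)
          also have "\<dots> = \<phi> a \<otimes>\<^bsub>F\<^esub> \<phi> m'" unfolding ba \<phi>m' using cF aG by (simp add: F.m_assoc)
          finally show ?thesis .
        qed
        thus ?thesis using comm m'G aG by blast
      qed
      thus ?thesis using m'M by (simp add: C_def m'_def)
    qed
    thus "b \<in> V" using bG by (simp add: V_def)
  qed
  ultimately have VG: "V = carrier G" by (rule hall_generate)
  hence Cn: "nrm C (carrier G)" using Cs CG by (auto simp: nrm_def V_def)
  \<comment> \<open>\<open>Hall {q}\<close> acts by conjugation on the image \<open>E\<close> of
    \<open>M\<close>, whose size is a nontrivial power of \<open>q\<close>. The fixed-point lemma
    gives a nontrivial fixed element, and a preimage of it lies in \<open>C\<close> but not in
    \<open>N\<close>.\<close>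
  have "C \<noteq> N"
  proof
    assume CN': "C = N"
    define \<kappa> where "\<kappa> m = (\<lambda>n. n \<otimes> m) ` N" for m
    have \<kappa>eq: "\<kappa> m = \<kappa> l \<longleftrightarrow> \<phi> m = \<phi> l" if ml: "m \<in> carrier G" "l \<in> carrier G" for m l
    proof
      assume e: "\<kappa> m = \<kappa> l"
      have "m \<in> \<kappa> m" using subgroup.one_closed[OF Ns(1)] ml by (auto simp: \<kappa>_def image_iff intro!: bexI[of _ \<one>])
      then obtain n where n: "n \<in> N" "m = n \<otimes> l" using e by (auto simp: \<kappa>_def)
      have "n \<in> carrier G" "\<phi> n = \<one>\<^bsub>F\<^esub>" using n Ns(2) ker by auto
      thus "\<phi> m = \<phi> l" using n(2) hom ml c by simp
    next
      assume e: "\<phi> m = \<phi> l"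
      have "\<phi> (m \<otimes> inv l) = \<one>\<^bsub>F\<^esub>" using hom inv ml e c by simp
      hence t: "m \<otimes> inv l \<in> N" using ker ml by simp
      have "\<phi> (l \<otimes> inv m) = \<one>\<^bsub>F\<^esub>" using hom inv ml e c by simp
      hence t': "l \<otimes> inv m \<in> N" using ker ml by simp
      have "n \<otimes> m \<in> \<kappa> l" if n: "n \<in> N" for n
      proof -
        have "n \<otimes> m = (n \<otimes> (m \<otimes> inv l)) \<otimes> l" using n Ns(2) ml by (auto simp: m_assoc subset_iff)
        thus ?thesis unfolding \<kappa>_def using subgroup.m_closed[OF Ns(1) n t] by blast
      qed
      moreover have "n \<otimes> l \<in> \<kappa> m" if n: "n \<in> N" for n
      proof -
        have "n \<otimes> l = (n \<otimes> (l \<otimes> inv m)) \<otimes> m" using n Ns(2) ml by (auto simp: m_assoc subset_iff)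
        thus ?thesis unfolding \<kappa>_def using subgroup.m_closed[OF Ns(1) n t'] by blast
      qed
      ultimately show "\<kappa> m = \<kappa> l" by (auto simp: \<kappa>_def)
    qed
    interpret Q: finite_group "G\<lparr>carrier := Hall {q}\<rparr>" by (rule finite_group_subgroup[OF hall_sub])
    obtain k where k: "part {q} (card (carrier G)) = q ^ k" using part_single[OF q(1)] by blast
    define E where "E = \<phi> ` M"
    define pre where "pre e = (SOME m. m \<in> M \<and> \<phi> m = e)" for e
    have pre: "pre e \<in> M" "\<phi> (pre e) = e" if "e \<in> E" for e
      using that someI_ex[of "\<lambda>m. m \<in> M \<and> \<phi> m = e"] by (auto simp: E_def pre_def)
    define ac where "ac a e = \<phi> a \<otimes>\<^bsub>F\<^esub> e \<otimes>\<^bsub>F\<^esub> inv\<^bsub>F\<^esub> (\<phi> a)" for a e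
    have acm: "ac a (\<phi> m) = \<phi> (a \<otimes> m \<otimes> inv a)" if "a \<in> carrier G" "m \<in> carrier G" for a m
      using that hom inv by (simp add: ac_def)
    have EF: "E \<subseteq> carrier F" using c Ms(2) by (auto simp: E_def)
    have fE: "finite E" using finite_sub[OF Ms(1)] by (simp add: E_def)
    have fib: "card {m \<in> M. \<phi> m = e} = card N" if e: "e \<in> E" for e
    proof -
      obtain m where m: "m \<in> M" "e = \<phi> m" using e by (auto simp: E_def)
      have mG: "m \<in> carrier G" using m Ms by auto
      have "{l \<in> M. \<phi> l = e} = \<kappa> m"
      proof (rule Set.set_eqI, rule HOL.iffI)
        fix l assume "l \<in> {l \<in> M. \<phi> l = e}"
        hence l: "l \<in> M" "l \<in> carrier G" "\<kappa> l = \<kappa> m" using \<kappa>eq m mG Ms(2) by auto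
        have "l \<in> \<kappa> l" unfolding \<kappa>_def
          by (rule image_eqI[where x="\<one>"]) (use subgroup.one_closed[OF Ns(1)] l(2) in simp_all)
        thus "l \<in> \<kappa> m" using l by simp
      next
        fix l assume "l \<in> \<kappa> m"
        then obtain n where n: "n \<in> N" "l = n \<otimes> m" by (auto simp: \<kappa>_def)
        have "n \<in> carrier G" "\<phi> n = \<one>\<^bsub>F\<^esub>" "n \<in> M" using n Ns(2) ker N(2) by auto
        thus "l \<in> {l \<in> M. \<phi> l = e}" using n m mG hom c subgroup.m_closed[OF Ms(1)] by simp
      qed
      moreover have "card (\<kappa> m) = card N" unfolding \<kappa>_def
        by (rule card_image, rule inj_onI) (use Ns(2) mG in \<open>auto simp: subset_iff\<close>)
      ultimately show ?thesis by simp
    qed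
    have "card M = (\<Sum>m\<in>M. 1)" by simp
    also have "\<dots> = (\<Sum>e\<in>E. \<Sum>m | m \<in> M \<and> \<phi> m = e. 1)" unfolding E_def
      by (rule sum.image_gen) (rule finite_sub[OF Ms(1)])
    also have "\<dots> = (\<Sum>e\<in>E. card N)" by (rule sum.cong[OF HOL.refl]) (use fib in simp)
    finally have cE: "card M = card E * card N" by simp
    have qE: "q dvd card E"
    proof -
      have "card (M \<inter> Hall (- {q})) dvd card N"
        by (rule card_subgroup_dvd[OF sub_hall[OF Ms(1)] Ns(1) q(2)])
      then obtain j where j: "card N = part (- {q}) (card M) * j" using Mc by (auto simp: compat_card)
      have "part {q} (card M) * part (- {q}) (card M) = card E * j * part (- {q}) (card M)"
        unfolding part_compl[OF card_sub_pos[OF Ms(1)]] using cE unfolding j by (simp only: mult_ac)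
      hence "part {q} (card M) = card E * j" using part_pos[of "- {q}" "card M"] by simp
      moreover obtain i where "part {q} (card M) = q ^ i" using part_single[OF q(1)] by blast
      ultimately obtain i' where i': "card E = q ^ i'" using divides_primepow_nat[OF q(1)] by (metis dvd_triv_left)
      have "card E \<noteq> 1"
      proof
        assume "card E = 1"
        hence "card M = card N" using cE by simp
        thus False using card_subset_eq[OF finite_sub[OF Ms(1)] N(2)] NM by simp
      qed
      thus ?thesis using i' by (cases i') auto
    qed
    obtain e where e: "e \<in> E" "e \<noteq> \<one>\<^bsub>F\<^esub>" "\<forall>a\<in>Hall {q}. ac a e = e"
    proof (rule Q.prime_power_fixed_point[OF q(1), where k=k and E=E and act=ac and ?e0.0="\<one>\<^bsub>F\<^esub>"], goal_cases)
      case 1 show ?case using k by (simp add: hall_card)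
    next
      case 2 show ?case by (rule fE)
    next
      case 3 show ?case by (rule qE)
    next
      case (4 a e)
      have aG: "a \<in> carrier G" using 4 hall_carrier by auto
      have "ac a e = \<phi> (a \<otimes> pre e \<otimes> inv a)" using acm[OF aG, of "pre e"] pre[OF 4(3)] Ms(2) by auto
      thus ?case using Ms(4)[OF aG pre(1)[OF 4(3)]] by (auto simp: E_def)
    next
      case (5 e)
      have "\<phi> \<one> = \<one>\<^bsub>F\<^esub>" using ker subgroup.one_closed[OF Ns(1)] by simp
      thus ?case using 5 EF by (auto simp: ac_def)
    next
      case (6 a b e)
      have ab: "a \<in> carrier G" "b \<in> carrier G" using 6 hall_carrier by auto
      have "\<phi> a \<in> carrier F" "\<phi> b \<in> carrier F" "e \<in> carrier F" using c ab 6 EF by auto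
      thus ?case using hom ab by (simp add: ac_def F.inv_mult_group F.m_assoc)
    next
      case 7 show ?case using ker subgroup.one_closed[OF Ns(1)] subgroup.one_closed[OF Ms(1)] unfolding E_def by (metis image_eqI one_closed)
    next
      case (8 a)
      have "a \<in> carrier G" using 8 hall_carrier[of "{q}"] by auto
      hence "\<phi> a \<in> carrier F" using c by blast
      thus ?case by (simp add: ac_def)
    next
      case (9 e) thus ?case by simp
    qed
    obtain m where m: "m \<in> M" "\<phi> m = e" using e by (auto simp: E_def)
    have mG: "m \<in> carrier G" using m Ms by auto
    have "comm_in N m a" if a: "a \<in> Hall {q}" for a
    proof -
      have aG: "a \<in> carrier G" "\<phi> a \<in> carrier F" "\<phi> m \<in> carrier F" using a hall_carrier c mG by auto
      have "\<phi> a \<otimes>\<^bsub>F\<^esub> \<phi> m \<otimes>\<^bsub>F\<^esub> inv\<^bsub>F\<^esub> (\<phi> a) = \<phi> m" using e(3) a m by (simp add: ac_def)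
      hence "\<phi> a \<otimes>\<^bsub>F\<^esub> \<phi> m = \<phi> m \<otimes>\<^bsub>F\<^esub> \<phi> a" using aG by (metis F.inv_solve_right F.m_closed)
      thus ?thesis using comm mG aG by simp
    qed
    hence "m \<in> C" using m by (simp add: C_def)
    thus False using CN' m e ker mG by auto
  qed
  hence CM: "C = M" using max[OF Cn] CN by (auto simp: C_def)
  \<comment> \<open>Centrality of \<open>M\<close> modulo \<open>N\<close>: for
    \<open>p \<noteq> q\<close> an element of \<open>M\<close> is congruent to one in
    \<open>Hall {q}\<close>, because its \<open>q'\<close>-factor lies in \<open>N\<close>; for
    \<open>p = q\<close> this is \<open>C = M\<close>.\<close>
  have Gall: "{b \<in> carrier G. \<forall>m\<in>M. comm_in N b m} = carrier G"
  proof (rule hall_generate[OF comm_in_subgroup[OF N(1) Ms(2)]])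
    fix p :: nat assume p: "prime p"
    show "Hall {p} \<subseteq> {b \<in> carrier G. \<forall>m\<in>M. comm_in N b m}"
    proof
      fix b assume b: "b \<in> Hall {p}"
      have bG: "b \<in> carrier G" "\<phi> b \<in> carrier F" using b hall_carrier c by auto
      have "comm_in N b m" if m: "m \<in> M" for m
      proof (cases "p = q")
        case True
        have mG: "m \<in> carrier G" using m Ms by auto
        have "comm_in N m b" using m CM b True by (auto simp: C_def)
        thus ?thesis by (rule comm_in_sym[OF N(1) mG bG(1)])
      next
        case False
        have "(M \<inter> Hall {q}) <#> (M \<inter> Hall (- {q})) = M" by (rule hall_prod[OF Mc]) auto
        then obtain u v where uv: "u \<in> M \<inter> Hall {q}" "v \<in> M \<inter> Hall (- {q})" "m = u \<otimes> v"
          using m unfolding set_mult_def by blast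
        have uvG: "u \<in> carrier G" "v \<in> carrier G" "\<phi> u \<in> carrier F" using uv Ms(2) c by auto
        have "v \<in> N" using uv q by blast
        hence "\<phi> v = \<one>\<^bsub>F\<^esub>" using ker uvG by blast
        hence mu: "\<phi> m = \<phi> u" using uv hom uvG by simp
        have "\<phi> b \<otimes>\<^bsub>F\<^esub> \<phi> u = \<phi> u \<otimes>\<^bsub>F\<^esub> \<phi> b"
          by (rule phicomm[OF hallc[OF p q(1) False b] bG(1) uvG(1)]) (use uv in blast)
        moreover have "m \<in> carrier G" using m Ms by auto
        ultimately show ?thesis using comm bG(1) mu by simp
      qed
      thus "b \<in> {b \<in> carrier G. \<forall>m\<in>M. comm_in N b m}" using bG by blast
    qed
  qed
  \<comment> \<open>If \<open>y = act m x\<close>, then \<open>gen x \<otimes> m\<close> equals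
    \<open>n \<otimes> (m \<otimes> gen x)\<close>, and \<open>gen x\<close> fixes
    \<open>x\<close>.\<close>
  have genN: "\<exists>n\<in>N. act (gen x) y = act n y" if xy: "x \<in> A" "y \<in> A" for x y
  proof -
    obtain m where m: "m \<in> M" "act m x = y" using M(2) xy by (auto simp: transitive_on_def)
    have mG: "m \<in> carrier G" using m Ms by auto
    have "comm_in N (gen x) m" using Gall gen(1)[OF xy(1)] m by blast
    then obtain n where n: "n \<in> N" "gen x \<otimes> m = n \<otimes> (m \<otimes> gen x)"
      using comm_in_iff[OF N(1) gen(1)[OF xy(1)] mG] by blast
    have nG: "n \<in> carrier G" using n Ns by auto
    have "act (gen x) y = act (gen x \<otimes> m) x" using m act_mult gen(1) xy mG by simp
    also have "\<dots> = act n (act m (act (gen x) x))"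
      unfolding n(2) using nG mG gen(1)[OF xy(1)] xy(1) act_mult act_closed m_closed by simp
    also have "\<dots> = act n y" using gen(2) xy m by simp
    finally show ?thesis using n by blast
  qed
  have all: "carrier G \<subseteq> {b. \<forall>y\<in>A. \<exists>n\<in>N. act b y = act n y}"
  proof (rule gen_induct)
    show "\<one> \<in> {b. \<forall>y\<in>A. \<exists>n\<in>N. act b y = act n y}" using subgroup.one_closed[OF Ns(1)] by blast
    fix x u assume x: "x \<in> A" and u: "u \<in> {b. \<forall>y\<in>A. \<exists>n\<in>N. act b y = act n y}" and uG: "u \<in> carrier G"
    have "\<exists>n\<in>N. act (gen x \<otimes> u) y = act n y" if y: "y \<in> A" for y
    proof -
      obtain n where n: "n \<in> N" "act u y = act n y" using u y by blast
      have nG: "n \<in> carrier G" using n Ns by auto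
      obtain n' where n': "n' \<in> N" "act (gen x) (act n y) = act n' (act n y)"
        using genN[OF x act_closed[OF nG y]] by blast
      have n'G: "n' \<in> carrier G" using n' Ns by auto
      have "act (gen x \<otimes> u) y = act (n' \<otimes> n) y" using act_mult gen(1)[OF x] uG y n n' nG n'G by simp
      thus ?thesis using subgroup.m_closed[OF Ns(1) n'(1) n(1)] by blast
    qed
    thus "gen x \<otimes> u \<in> {b. \<forall>y\<in>A. \<exists>n\<in>N. act b y = act n y}" by blast
  qed
  show "transitive_on N" unfolding transitive_on_def
  proof (intro ballI)
    fix x y assume xy: "x \<in> A" "y \<in> A"
    obtain m where m: "m \<in> M" "act m x = y" using M(2) xy by (auto simp: transitive_on_def)
    have "m \<in> carrier G" using m Ms by auto
    then obtain n where "n \<in> N" "act m x = act n x" using all xy by blast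
    thus "\<exists>m\<in>N. act m x = y" using m by auto
  qed
qed

text \<open>Among the transitive normal subgroups modulo which Hall subgroups of distinct primes
  commute, a minimal one is taken; the whole group is a candidate. Were it nontrivial, a maximal
  normal subgroup of the group properly inside it would give an abelian chief factor, and the
  descent step a smaller candidate.\<close>

theorem transitive_singleton:
  assumes tr: "transitive_on (carrier G)" and x: "x \<in> A" and y: "y \<in> A"
  shows "x = y"
proof -
  define \<M> where "\<M> = {M. nrm M (carrier G) \<and> transitive_on M \<and>
     (\<forall>p r a b. prime p \<longrightarrow> prime r \<longrightarrow> p \<noteq> r \<longrightarrow> a \<in> Hall {p} \<longrightarrow> b \<in> Hall {r} \<longrightarrow> comm_in M a b)}"
  have f\<M>: "finite \<M>" by (rule finite_subset[of _ "Pow (carrier G)"]) (auto simp: \<M>_def nrm_def fin)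
  have GG: "nrm (carrier G) (carrier G)" using subgroup_self by (simp add: nrm_def)
  have "carrier G \<in> \<M>" using GG tr hall_carrier by (auto simp: \<M>_def comm_in_def subset_iff)
  then obtain M where M\<M>: "M \<in> \<M>" and Mmin: "\<And>D. D \<in> \<M> \<Longrightarrow> D \<subseteq> M \<Longrightarrow> D = M"
    using finite_has_minimal2[OF f\<M>] by metis
  have M: "nrm M (carrier G)" "transitive_on M" using M\<M> by (auto simp: \<M>_def)
  have pr: "comm_in M a b" if "prime p" "prime r" "p \<noteq> r" "a \<in> Hall {p}" "b \<in> Hall {r}" for p r a b
    using M\<M> that unfolding \<M>_def by blast
  note Ms = nrm_carrier[OF M(1)]
  show ?thesis
  proof (cases "M = {\<one>}")
    case True
    thus ?thesis using M(2) x y act_one by (auto simp: transitive_on_def)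
  next
    case False
    define \<N> where "\<N> = {N. nrm N (carrier G) \<and> N \<subseteq> M \<and> N \<noteq> M}"
    have f\<N>: "finite \<N>" by (rule finite_subset[of _ "Pow (carrier G)"]) (auto simp: \<N>_def nrm_def fin)
    have "{\<one>} \<in> \<N>" using False subgroup.one_closed[OF Ms(1)] triv_subgroup by (auto simp: \<N>_def nrm_def)
    then obtain N where N\<N>: "N \<in> \<N>" and Nmax: "\<And>D. D \<in> \<N> \<Longrightarrow> N \<subseteq> D \<Longrightarrow> D = N"
      using finite_has_maximal2[OF f\<N>] by metis
    have N: "nrm N (carrier G)" "N \<subseteq> M" "N \<noteq> M" using N\<N> by (auto simp: \<N>_def)
    have max: "D = N \<or> D = M" if "nrm D (carrier G)" "N \<subseteq> D" "D \<subseteq> M" for D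
      using Nmax[of D] that by (auto simp: \<N>_def)
    note Ns = nrm_carrier[OF N(1)]
    have NM: "nrm N M" using N Ms(2) by (auto simp: nrm_def)
    have Mc: "compat M" by (rule compat_nrm[OF compat_carrier M(1)])
    obtain l where l: "card M = l * card N"
      using card_subgroup_dvd[OF Ns(1) Ms(1) N(2)] by (metis dvd_div_mult_self)
    obtain D where D: "nrm D M" "N \<subseteq> D" "D \<noteq> M" "\<forall>x\<in>M. \<forall>y\<in>M. x \<otimes> y \<otimes> inv x \<otimes> inv y \<in> D"
      using section_not_perfect[OF Mc NM N(3) l] by blast
    obtain q where q: "prime q" "M \<inter> Hall (- {q}) \<subseteq> N"
      by (rule chief_factor[OF subgroup_self M(1) N max D])
    have "transitive_on N" by (rule transitive_step(1)[OF M N(1,2) q N(3) max pr])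
    moreover have "comm_in N a b" if "prime p" "prime r" "p \<noteq> r" "a \<in> Hall {p}" "b \<in> Hall {r}" for p r a b
      by (rule transitive_step(2)[OF M N(1,2) q N(3) max pr that])
    ultimately have "N \<in> \<M>" using N(1) unfolding \<M>_def by blast
    thus ?thesis using Mmin N by blast
  qed
qed

end

subsection \<open>Presented monoids\<close>

lemma word_cong_context: assumes "word_cong R u v" shows "word_cong R (a @ u @ b) (a @ v @ b)"
  using assms
proof induct
  case (rel u v c d)
  thus ?case using word_cong.rel[of u v R "a @ c" "d @ b"] by simp
qed (auto intro: word_cong.intros)

lemma word_cong_append: "word_cong R u u' \<Longrightarrow> word_cong R v v' \<Longrightarrow> word_cong R (u @ v) (u' @ v')"
  using word_cong_context[of R u u' "[]" v] word_cong_context[of R v v' u' "[]"] word_cong.trans by fastforce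

lemma word_cong_Cons: "word_cong R u v \<Longrightarrow> word_cong R (x # u) (x # v)"
  using word_cong_context[of R u v "[x]" "[]"] by simp

lemma word_cong_invariant:
  assumes "\<And>u v a b. (u, v) \<in> R \<Longrightarrow> f (a @ u @ b) = f (a @ v @ b)" "word_cong R u v"
  shows "f u = f v"
  using assms(2) by induct (auto simp: assms(1))

lemma word_class_mem [simp]: "v \<in> word_class R u \<longleftrightarrow> word_cong R u v"
  by (simp add: word_class_def)

lemma word_class_eq_iff: "word_class R u = word_class R v \<longleftrightarrow> word_cong R u v"
proof
  assume "word_class R u = word_class R v"
  thus "word_cong R u v" using word_class_mem[of v R u] word_class_mem[of v R v] word_cong.refl[of R v] by simp
next
  assume "word_cong R u v"
  thus "word_class R u = word_class R v"
    unfolding word_class_def using word_cong.trans word_cong.sym by blast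
qed

lemma presented_mult [simp]:
  "word_class R u \<otimes>\<^bsub>presented_monoid R\<^esub> word_class R v = word_class R (u @ v)"
proof -
  have "word_class R (u' @ v') = word_class R (u @ v)" if "word_cong R u u'" "word_cong R v v'" for u' v'
    using that word_cong_append word_cong.sym unfolding word_class_eq_iff by metis
  hence "(\<Union>u'\<in>word_class R u. \<Union>v'\<in>word_class R v. word_class R (u' @ v'))
      = (\<Union>u'\<in>word_class R u. \<Union>v'\<in>word_class R v. word_class R (u @ v))"
    by (intro SUP_cong HOL.refl) simp
  also have "\<dots> = word_class R (u @ v)"
    using word_cong.refl[of R u] word_cong.refl[of R v] by (auto simp del: SUP_const)
  finally show ?thesis by (simp add: presented_monoid_def)
qed

lemma presented_one: "\<one>\<^bsub>presented_monoid R\<^esub> = word_class R []"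
  by (simp add: presented_monoid_def)

lemma presented_carrier: "carrier (presented_monoid R) = range (word_class R)"
  by (simp add: presented_monoid_def)

lemma word_class_carrier [simp]: "word_class R w \<in> carrier (presented_monoid R)"
  by (simp add: presented_carrier)

lemma presented_carrierE:
  assumes "a \<in> carrier (presented_monoid R)" obtains w where "a = word_class R w"
  using assms by (auto simp: presented_carrier)

lemma presented_monoid: "Group.monoid (presented_monoid R)"
  by unfold_locales (auto simp: presented_carrier presented_one simp del: word_class_mem)

lemma word_prod_Nil: "word_prod M [] = \<one>\<^bsub>M\<^esub>" and word_prod_Cons: "word_prod M (a # w) = a \<otimes>\<^bsub>M\<^esub> word_prod M w"
  by (simp_all add: word_prod_def)

lemma word_prod_classes: "word_prod (presented_monoid R) (map (\<lambda>x. word_class R [x]) w) = word_class R w"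
  by (induct w) (simp_all add: word_prod_Nil word_prod_Cons presented_one)

subsection \<open>Quantum binomial sets with condition lri\<close>

text \<open>The opposite map. Reversing words turns the relations of \<open>r\<close> into those of
  \<open>op_map r\<close>, and \<open>l_act\<close> and \<open>r_act\<close> change places, so every
  statement about left ends of words yields one about right ends.\<close>

definition op_map :: "'x quad_map \<Rightarrow> 'x quad_map" where
  "op_map r = (\<lambda>(x, y). prod.swap (r (y, x)))"

locale qbset =
  fixes r :: "'x quad_map"
  assumes quantum_binomial: "quantum_binomial_set r" and lri: "lri r"
begin

abbreviation L :: "'x \<Rightarrow> 'x \<Rightarrow> 'x" where "L \<equiv> l_act r"
abbreviation Li :: "'x \<Rightarrow> 'x \<Rightarrow> 'x" where "Li \<equiv> r_act r"
abbreviation cong :: "'x list \<Rightarrow> 'x list \<Rightarrow> bool" (infix \<open>~~\<close> 50) where "cong \<equiv> word_cong (relations r)"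

lemma r_eq: "r (x, y) = (L x y, Li y x)"
  by (simp add: l_act_def r_act_def)

lemma L_Li [simp]: "L x (Li x y) = y" and Li_L [simp]: "Li x (L x y) = y"
  using lri by (simp_all add: lri_def)

lemma L_inj [simp]: "L x y = L x z \<longleftrightarrow> y = z" and Li_inj [simp]: "Li x y = Li x z \<longleftrightarrow> y = z"
  by (metis Li_L, metis L_Li)

lemma L_self [simp]: "L x x = x" and Li_self [simp]: "Li x x = x"
  using quantum_binomial by (simp_all add: quantum_binomial_set_def square_free_map_def l_act_def r_act_def)

lemma L_eq_self [simp]: "L x y = x \<longleftrightarrow> y = x" and Li_eq_self [simp]: "Li x y = x \<longleftrightarrow> y = x"
  by (metis Li_L L_self, metis L_Li Li_self)

lemma rr: "r (r p) = p"
  using quantum_binomial unfolding quantum_binomial_set_def involutive_def by (metis comp_apply id_apply)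

lemma involution: "L (L x y) (Li y x) = x" "Li (Li y x) (L x y) = y"
  using rr[of "(x, y)"] by (simp_all add: r_eq)

text \<open>The cyclic condition: under lri it is involutivity with one map moved to the other side.
  The same holds for the variants that follow.\<close>

lemma cyclic: "L (Li y x) y = L x y"
  using involution(2)[of y x] by (metis L_Li)

lemma cyclic': "Li (L x y) x = Li y x"
  using involution(1)[of x y] by (metis Li_L)

lemma cyclic_L: "L (L y z) y = L z y"
  using cyclic[of y "L y z"] by simp

lemma relationsI: assumes "x \<noteq> y" shows "([x, y], [L x y, Li y x]) \<in> relations r"
proof -
  have "(x, y) \<noteq> (L x y, Li y x)" using assms L_eq_self[of x y] by (metis prod.inject)
  thus ?thesis unfolding relations_def using r_eq[of x y] by blast
qed

lemma relationsE:
  assumes "(u, v) \<in> relations r"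
  obtains x y where "u = [x, y]" "v = [L x y, Li y x]" "x \<noteq> y"
proof -
  obtain x y y' x' where uv: "u = [x, y]" "v = [y', x']" "r (x, y) = (y', x')" "(x, y) \<noteq> (y', x')"
    using assms unfolding relations_def by blast
  hence "v = [L x y, Li y x]" using r_eq[of x y] by simp
  moreover have "x \<noteq> y" using uv r_eq[of x y] by auto
  ultimately show thesis using that uv(1) by blast
qed

lemma step: "a @ [x, y] @ b ~~ a @ [L x y, Li y x] @ b"
proof (cases "x = y")
  case True
  thus ?thesis by (simp add: word_cong.refl)
next
  case False
  show ?thesis by (rule word_cong.rel[OF relationsI[OF False]])
qed

lemma invariant:
  assumes "\<And>a b x y. f (a @ [x, y] @ b) = f (a @ [L x y, Li y x] @ b)" and "u ~~ v"
  shows "f u = f v"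
proof (rule word_cong_invariant[OF _ assms(2)])
  fix u v a b assume "(u, v) \<in> relations r"
  then obtain x y where "u = [x, y]" "v = [L x y, Li y x]" by (rule relationsE)
  thus "f (a @ u @ b) = f (a @ v @ b)" using assms(1)[of a x y b] by simp
qed

lemma cong_length: "u ~~ v \<Longrightarrow> length u = length v"
  by (rule invariant[of length]) simp_all

lemma word_orbit_eq: "word_orbit r w = word_class (relations r) w"
proof -
  have step': "a @ [x, y] @ b ~~ a @ [y', x'] @ b" if "r (x, y) = (y', x')" for a b x y x' y'
    using step[of a x y b] r_eq[of x y] that by simp
  have "w ~~ v" if "(w, v) \<in> (braid_step r \<union> (braid_step r)\<inverse>)\<^sup>*" for v
    using that
  proof induct
    case base thus ?case by (rule word_cong.refl)
  next
    case (step y z)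
    have "y ~~ z" using step(2) step' word_cong.sym unfolding braid_step_def by blast
    thus ?case using step(3) word_cong.trans by blast
  qed
  moreover have "(w, v) \<in> (braid_step r \<union> (braid_step r)\<inverse>)\<^sup>*" if "w ~~ v" for v
    using that
  proof induct
    case (rel u v a b)
    then obtain x y where "u = [x, y]" "v = [L x y, Li y x]" by (rule relationsE)
    hence "(a @ u @ b, a @ v @ b) \<in> braid_step r" using r_eq unfolding braid_step_def by blast
    thus ?case by blast
  next
    case (sym u v)
    have "HOL.eq ((braid_step r \<union> (braid_step r)\<inverse>)\<inverse>) (braid_step r \<union> (braid_step r)\<inverse>)" by auto
    thus ?case using sym(2) by (metis rtrancl_converseI)
  next
    case (trans u v w) from trans(2,4) show ?case by (rule rtrancl_trans)
  qed auto
  ultimately show ?thesis by (auto simp: word_orbit_def)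
qed

lemma op_L: "l_act (op_map r) = Li" and op_Li: "r_act (op_map r) = L"
  by (auto simp: fun_eq_iff op_map_def l_act_def r_act_def prod.swap_def)

lemma op_qbset: "qbset (op_map r)"
proof
  have "op_map r \<circ> op_map r = id"
    by (rule ext) (auto simp: op_map_def prod.swap_def rr)
  hence "bij (op_map r)" "involutive (op_map r)" using o_bij by (auto simp: involutive_def)
  moreover have "square_free_map (op_map r)"
    by (simp add: square_free_map_def op_map_def r_eq)
  moreover have "bij (L x)" "bij (Li x)" for x
    using quantum_binomial by (auto simp: quantum_binomial_set_def nondegenerate_def)
  hence "nondegenerate (op_map r)" by (simp add: nondegenerate_def op_L op_Li)
  ultimately show "quantum_binomial_set (op_map r)" by (simp add: quantum_binomial_set_def quadratic_set_def)
  show "lri (op_map r)" by (simp add: lri_def op_L op_Li)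
qed

lemma op_op: "op_map (op_map r) = r"
  by (rule ext) (auto simp: op_map_def prod.swap_def)

lemma op_cong_imp: assumes "u ~~ v" shows "word_cong (relations (op_map r)) (rev u) (rev v)"
  using assms
proof induct
  case (rel u v a b)
  interpret op: qbset "op_map r" by (rule op_qbset)
  obtain x y where "u = [x, y]" "v = [L x y, Li y x]" using rel by (rule relationsE)
  thus ?case using op.step[of "rev b" y x "rev a"] by (simp add: op_L op_Li)
qed (auto intro: word_cong.intros)

lemma op_cong: "word_cong (relations (op_map r)) (rev u) (rev v) \<longleftrightarrow> u ~~ v"
proof -
  interpret op: qbset "op_map r" by (rule op_qbset)
  show ?thesis using op_cong_imp[of u v] op.op_cong_imp[of "rev u" "rev v"] by (auto simp: op_op)
qed

definition yb :: bool where
  "yb \<longleftrightarrow> (\<forall>x y z. L x (L y z) = L (L x y) (L (Li y x) z))"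

lemma yb_Li: assumes yb shows "Li y (Li x z) = Li (Li y x) (Li (L x y) z)"
proof -
  have "L x (L y (Li (Li y x) (Li (L x y) z))) = z" using assms unfolding yb_def by (metis L_Li)
  thus ?thesis by (metis Li_L)
qed

text \<open>The middle component of the braid relation comes for free from the cyclic condition.\<close>

lemma yang_baxter_iff: "yang_baxter r \<longleftrightarrow> yb"
proof
  assume yb: "yang_baxter r"
  have "L x (L y z) = L (L x y) (L (Li y x) z)" for x y z
    using fun_cong[OF yb[unfolded yang_baxter_def], of "(x, y, z)"] by (simp add: r12_def r23_def r_eq)
  thus yb by (simp add: yb_def)
next
  assume yb: yb
  have "Li (L (Li y x) z) (L x y) = L (Li (L y z) x) (Li z y)" for x y z
  by (metis yb Li_L L_Li cyclic cyclic_L yb_def)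
  thus "yang_baxter r"
    using yb yb_Li[OF yb] unfolding yang_baxter_def yb_def
    by (auto simp: fun_eq_iff r12_def r23_def r_eq)
qed

lemma op_yb: "qbset.yb (op_map r) \<longleftrightarrow> yb"
proof -
  have imp: "qbset.yb (op_map s)" if "qbset s" "qbset.yb s" for s :: "'x quad_map"
  proof -
    interpret s: qbset s by (rule that(1))
    interpret op: qbset "op_map s" by (rule s.op_qbset)
    show ?thesis unfolding op.yb_def s.op_L s.op_Li using s.yb_Li[OF that(2)] by blast
  qed
  show ?thesis using imp[of r] imp[of "op_map r"] op_qbset qbset_axioms op_op by auto
qed

section \<open>The action of words, and their heads\<close>

primrec Lw :: "'x list \<Rightarrow> 'x \<Rightarrow> 'x" where
  "Lw [] z = z" | "Lw (x # w) z = L x (Lw w z)"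

primrec Lwi :: "'x list \<Rightarrow> 'x \<Rightarrow> 'x" where
  "Lwi [] z = z" | "Lwi (x # w) z = Lwi w (Li x z)"

lemma Lw_Lwi [simp]: "Lw w (Lwi w z) = z" and Lwi_Lw [simp]: "Lwi w (Lw w z) = z"
  by (induct w arbitrary: z) simp_all

lemma Lw_inj [simp]: "Lw w x = Lw w y \<longleftrightarrow> x = y"
  by (metis Lwi_Lw)

lemma Lw_append [simp]: "Lw (u @ v) z = Lw u (Lw v z)"
  by (induct u) simp_all

lemma Lwi_append [simp]: "Lwi (u @ v) z = Lwi v (Lwi u z)"
  by (induct u arbitrary: z) simp_all

text \<open>The head of a letter is the letter that it becomes when the relations carry it to the
  front of the word, as \<open>head_first\<close> shows.\<close>

primrec heads :: "'x list \<Rightarrow> 'x list" where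
  "heads [] = []" | "heads (x # w) = x # map (L x) (heads w)"

lemma length_heads [simp]: "length (heads w) = length w"
  by (induct w) simp_all

lemma heads_append: "heads (u @ v) = heads u @ map (Lw u) (heads v)"
  by (induct u) simp_all

definition sqfree :: "'x list \<Rightarrow> bool" where
  "sqfree w \<longleftrightarrow> \<not> (\<exists>u x v. w ~~ u @ [x, x] @ v)"

lemma square_free_class: "square_free_elem (word_class (relations r) w) \<longleftrightarrow> sqfree w"
  by (simp add: square_free_elem_def sqfree_def)

lemma sqfree_cong: "u ~~ v \<Longrightarrow> sqfree u \<longleftrightarrow> sqfree v"
  unfolding sqfree_def using word_cong.trans word_cong.sym by metis

lemma sqfree_append: assumes "sqfree (u @ v)" shows "sqfree u" "sqfree v"
proof -
  have "u @ v ~~ a @ [x, x] @ b @ v" if "u ~~ a @ [x, x] @ b" for a x b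
    using word_cong_append[OF that word_cong.refl[of _ v]] by simp
  thus "sqfree u" using assms unfolding sqfree_def by blast
  have "u @ v ~~ (u @ a) @ [x, x] @ b" if "v ~~ a @ [x, x] @ b" for a x b
    using word_cong_append[OF word_cong.refl[of _ u] that] by simp
  thus "sqfree v" using assms unfolding sqfree_def by blast
qed

lemma head_first: "x \<in> set (heads w) \<Longrightarrow> \<exists>w'. w ~~ x # w'"
proof (induct w arbitrary: x)
  case (Cons y v)
  show ?case
  proof (cases "x = y")
    case True thus ?thesis using word_cong.refl by blast
  next
    case False
    then obtain z where z: "z \<in> set (heads v)" "x = L y z" using Cons.prems by auto
    obtain v' where "v ~~ z # v'" using Cons.hyps[OF z(1)] by blast
    hence "y # v ~~ y # z # v'" by (rule word_cong_Cons)
    moreover have "y # z # v' ~~ x # Li z y # v'" using step[of "[]" y z v'] z by simp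
    ultimately show ?thesis using word_cong.trans by blast
  qed
qed simp

text \<open>If a later letter has the first letter as its head, carrying it to the front of the
  remaining word produces a square at the beginning.\<close>

lemma sqfree_heads: "sqfree w \<Longrightarrow> distinct (heads w)"
proof (induct w)
  case (Cons y v)
  have sv: "sqfree v" using sqfree_append(2)[of "[y]" v] Cons.prems by simp
  have "y \<notin> set (heads v)"
  proof
    assume "y \<in> set (heads v)"
    then obtain v' where "v ~~ y # v'" using head_first by blast
    hence "y # v ~~ [] @ [y, y] @ v'" using word_cong_Cons by fastforce
    thus False using Cons.prems unfolding sqfree_def by blast
  qed
  hence "y \<notin> L y ` set (heads v)" by (metis L_eq_self imageE)
  moreover have "inj_on (L y) (set (heads v))" by (rule inj_onI) simp
  ultimately show ?case using Cons.hyps[OF sv] by (simp add: distinct_map)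
qed simp

lemma op_sqfree: "qbset.sqfree (op_map r) (rev w) \<longleftrightarrow> sqfree w"
proof -
  interpret op: qbset "op_map r" by (rule op_qbset)
  have e: "rev w = v' \<longleftrightarrow> w = rev v'" for v' :: "'x list" by auto
  show ?thesis
  proof
    assume "op.sqfree (rev w)"
    hence "\<not> word_cong (relations (op_map r)) (rev w) (rev (u @ [x, x] @ v))" for u x v
      unfolding op.sqfree_def by simp
    thus "sqfree w" unfolding sqfree_def op_cong by blast
  next
    assume "sqfree w"
    hence "\<not> w ~~ rev (u @ [x, x] @ v)" for u x v unfolding sqfree_def by simp
    hence "\<not> word_cong (relations (op_map r)) (rev w) (u @ [x, x] @ v)" for u x v
      unfolding op_cong[symmetric] by simp
    thus "op.sqfree (rev w)" unfolding op.sqfree_def by blast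
  qed
qed

end

text \<open>In a square-free word of maximal length the heads of a prefix of length \<open>n - 1\<close> determine the
  last head, and every triple \<open>xyz\<close> not covered by lri is the end of such a word.\<close>

lemma (in qbset) sqfree_full_heads:
  assumes "finite (UNIV :: 'x set)" "sqfree w" "length w = card (UNIV :: 'x set)"
  shows "set (heads w) = UNIV"
  using assms sqfree_heads[OF assms(2)] by (metis card_subset_eq distinct_card length_heads subset_UNIV)

lemma (in qbset) yb_of_sqfree:
  assumes fin: "finite (UNIV :: 'x set)" and W: "sqfree W" "length W = card (UNIV :: 'x set)"
  shows yb
  unfolding yb_def
proof (intro allI)
  fix x y z
  interpret op: qbset "op_map r" by (rule op_qbset)
  let ?n = "card (UNIV :: 'x set)"
  have tail: "\<exists>w'. w ~~ w' @ [t]" if tw: "t \<in> set (op.heads (rev w))" for w t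
  proof -
    obtain w' where "word_cong (relations (op_map r)) (rev w) (t # w')" using op.head_first[OF tw] by blast
    hence "w ~~ rev (t # w')" using op_cong[of w "rev (t # w')"] by simp
    thus ?thesis by auto
  qed
  have dist: "distinct (op.heads (rev w))" if "sqfree w" for w
    using op.sqfree_heads that op_sqfree by blast
  show "L x (L y z) = L (L x y) (L (Li y x) z)"
  proof (cases "x = y \<or> y = z \<or> x = L y z")
    case True
    thus ?thesis using involution(1)[of x y] by (auto simp: cyclic)
  next
    case False
    \<comment> \<open>Letters are peeled off from the right. The heads of the reversed word in the
      opposite map are the letters that can be carried to the end: all of X for \<open>W\<close>,
      all but \<open>z\<close> once \<open>z\<close> is removed, all but \<open>y\<close> and
      \<open>L y z\<close> once \<open>y\<close> is removed too.\<close>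
    have "op.sqfree (rev W)" using W op_sqfree by simp
    hence "set (op.heads (rev W)) = UNIV" using W fin by (intro op.sqfree_full_heads) simp_all
    then obtain w1 where w1: "W ~~ w1 @ [z]" using tail by blast
    have l1: "length w1 = ?n - 1" "?n > 0" using cong_length[OF w1] W by simp_all
    have s1: "sqfree (w1 @ [z])" using W w1 sqfree_cong by blast
    have d1: "distinct (z # map (Li z) (op.heads (rev w1)))" using dist[OF s1] by (simp add: op_L)
    hence "z \<notin> set (op.heads (rev w1))" by (metis Li_self distinct.simps(2) image_eqI list.set_map)
    hence "set (op.heads (rev w1)) \<subseteq> UNIV - {z}" by blast
    moreover have "card (set (op.heads (rev w1))) = card (UNIV - {z})"
      using d1 l1 fin by (simp add: distinct_map distinct_card card_Diff_singleton)
    ultimately have "set (op.heads (rev w1)) = UNIV - {z}" using fin by (intro card_subset_eq) auto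
    then obtain w2 where w2: "w1 ~~ w2 @ [y]" using tail[of y w1] False by blast
    have "w1 @ [z] ~~ w2 @ [y, z]" using word_cong_append[OF w2 word_cong.refl[of _ "[z]"]] by simp
    hence w2': "W ~~ w2 @ [y, z]" using w1 word_cong.trans by blast
    have s2: "sqfree (w2 @ [y, z])" using W w2' sqfree_cong by blast
    have l2: "length w2 = ?n - 2" "?n \<ge> 2" using cong_length[OF w2'] W by simp_all
    have d2: "distinct (z # map (Li z) (y # map (Li y) (op.heads (rev w2))))" using dist[OF s2] by (simp add: op_L)
    define T where "T = set (op.heads (rev w2))"
    have "y \<notin> T"
    proof
      assume "y \<in> T"
      hence "Li y y \<in> Li y ` T" by blast
      hence "Li z y \<in> Li z ` Li y ` T" by auto
      thus False using d2 by (simp add: T_def image_image)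
    qed
    moreover have "L y z \<notin> T"
    proof
      assume "L y z \<in> T"
      hence "Li z (Li y (L y z)) \<in> Li z ` Li y ` T" by blast
      thus False using d2 by (simp add: T_def image_image)
    qed
    ultimately have T: "T \<subseteq> UNIV - {y, L y z}" by blast
    have yz: "y \<noteq> L y z" using False by (metis L_eq_self)
    have dT: "distinct (op.heads (rev w2))" using d2 by (simp add: distinct_map)
    have "card T = card (UNIV - {y, L y z})"
      using distinct_card[OF dT] l2 fin yz by (simp add: T_def card_Diff_subset)
    hence "T = UNIV - {y, L y z}" using T fin by (intro card_subset_eq) auto
    then obtain u where u: "w2 ~~ u @ [x]" using tail[of x w2] False unfolding T_def by blast
    have "w2 @ [y, z] ~~ u @ [x, y, z]" using word_cong_append[OF u word_cong.refl[of _ "[y, z]"]] by simp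
    hence Wu: "W ~~ u @ [x, y, z]" using w2' word_cong.trans by blast
    define a where "a = L x y"
    define b where "b = Li y x"
    have "u @ [x, y, z] ~~ u @ [a, b, z]" using step[of u x y "[z]"] by (simp add: a_def b_def)
    hence Wa: "W ~~ u @ [a, b, z]" using Wu word_cong.trans by blast
    have fullh: "distinct (heads w) \<and> set (heads w) = UNIV" if w: "W ~~ w" for w
    by (use w W sqfree_cong cong_length sqfree_heads sqfree_full_heads fin in simp)
    \<comment> \<open>Both words represent \<open>W\<close>, so each list of heads exhausts X
      without repetition. Before the last place they differ only by interchanging the heads of
      \<open>x\<close> and \<open>a\<close>, so the last heads agree.\<close>
    have h1: "heads (u @ [x, y, z]) = (heads u @ map (Lw u) [x, a]) @ [Lw u (L x (L y z))]"
      by (simp add: heads_append a_def)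
    have h2: "heads (u @ [a, b, z]) = (heads u @ map (Lw u) [a, x]) @ [Lw u (L a (L b z))]"
      using involution(1)[of x y] by (simp add: heads_append a_def b_def)
    have notin: "q \<notin> set P" if "distinct (P @ [q])" for P and q :: 'x using that by simp
    have "Lw u (L x (L y z)) \<notin> set (heads u @ map (Lw u) [x, a])"
      by (rule notin) (use fullh[OF Wu] h1 in metis)
    moreover have "Lw u (L x (L y z)) \<in> set ((heads u @ map (Lw u) [a, x]) @ [Lw u (L a (L b z))])"
      using fullh[OF Wa] unfolding h2 by blast
    ultimately have "Lw u (L x (L y z)) = Lw u (L a (L b z))"
      by (simp only: set_append set_map list.set Un_iff image_insert insert_iff image_empty empty_iff) blast
    thus ?thesis by (simp add: a_def b_def)
  qed
qed

subsection \<open>The structure monoid of a solution\<close>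

locale ybset = qbset r for r :: "'x quad_map" +
  assumes yb: yb
begin

lemma yb_rule: "L (L x y) (L (Li y x) z) = L x (L y z)"
  using yb by (simp add: yb_def)

lemma op_ybset: "ybset (op_map r)"
  using op_qbset op_yb yb by (simp add: ybset_def ybset_axioms_def)

text \<open>\<open>cnt w\<close> counts how often each letter occurs among the heads of \<open>w\<close>.\<close>

primrec cnt :: "'x list \<Rightarrow> 'x \<Rightarrow> nat" where
  "cnt [] = (\<lambda>_. 0)"
| "cnt (x # w) = (\<lambda>z. (if z = x then 1 else 0) + cnt w (Li x z))"

lemma cnt_append: "cnt (u @ v) z = cnt u z + cnt v (Lwi u z)"
  by (induct u arbitrary: z) simp_all

lemma cong_Lw: "u ~~ v \<Longrightarrow> Lw u = Lw v"
  by (rule invariant[of Lw]) (rule ext, simp add: yb_rule)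

lemma cong_Lwi: "u ~~ v \<Longrightarrow> Lwi u = Lwi v"
proof (rule invariant[of Lwi])
  show "Lwi (a @ [x, y] @ b) = Lwi (a @ [L x y, Li y x] @ b)" for a b x y
    by (rule ext) (simp only: Lwi_append Lwi.simps yb_Li[OF yb, of y x])
qed

lemma cong_cnt: assumes "u ~~ v" shows "cnt u = cnt v"
proof (rule invariant[of cnt, OF _ assms])
  fix a b x y
  have "cnt [x, y] z = cnt [L x y, Li y x] z" for z
  proof -
    have "Li x z = y \<longleftrightarrow> z = L x y" by auto
    moreover have "Li (L x y) z = Li y x \<longleftrightarrow> z = x" using involution(1)[of x y] by (metis L_Li Li_L)
    ultimately show ?thesis by simp
  qed
  moreover have "Lwi [x, y] z = Lwi [L x y, Li y x] z" for z
    by (simp only: Lwi.simps) (rule yb_Li[OF yb])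
  ultimately show "cnt (a @ [x, y] @ b) = cnt (a @ [L x y, Li y x] @ b)"
    by (intro ext) (simp only: cnt_append)
qed

lemma cnt_pos_heads: "cnt w x > 0 \<longleftrightarrow> x \<in> set (heads w)"
proof (induct w arbitrary: x)
  case (Cons y v)
  have "Li y x \<in> set (heads v) \<longleftrightarrow> x \<in> L y ` set (heads v)" by (metis L_Li Li_L image_iff)
  thus ?case using Cons[of "Li y x"] by auto
qed simp

lemma cnt_head: "cnt w x > 0 \<Longrightarrow> \<exists>w'. w ~~ x # w'"
  using head_first cnt_pos_heads by blast

text \<open>A letter counted by \<open>v\<close> can be carried to the front of \<open>v\<close>;
  removing the common first letter \<open>x\<close> shifts both counts by the same bijection
  \<open>L x\<close>.\<close>

lemma cnt_inj: "cnt u = cnt v \<Longrightarrow> u ~~ v"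
proof (induct u arbitrary: v)
  case Nil
  have "v = []"
  proof (cases v)
    case (Cons y w)
    hence "cnt v y > 0" by simp
    thus ?thesis using Nil by (metis cnt.simps(1) less_numeral_extra(3))
  qed
  thus ?case by (simp add: word_cong.refl)
next
  case (Cons x u)
  have "cnt v x > 0" using fun_cong[OF Cons.prems, of x] by simp
  then obtain v' where v': "v ~~ x # v'" using cnt_head by blast
  hence e: "cnt (x # v') = cnt (x # u)" using cong_cnt Cons.prems by metis
  have "cnt v' z = cnt u z" for z using fun_cong[OF e, of "L x z"] by simp
  hence "u ~~ v'" using Cons.hyps[of v'] by auto
  thus ?case using v' word_cong_Cons word_cong.trans word_cong.sym by metis
qed

lemma cong_iff: "u ~~ v \<longleftrightarrow> cnt u = cnt v"
  using cnt_inj cong_cnt by blast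

text \<open>A letter \<open>x\<close> of the support is written first, and the remaining counts are
  shifted by \<open>L x\<close>; the total drops by one because \<open>L x\<close> permutes
  \<open>A\<close>. The version relative to an invariant set \<open>A\<close> serves the permutation
  group of \<open>A\<close>.\<close>

lemma cnt_exists:
  assumes "finite A" "\<And>x y. x \<in> A \<Longrightarrow> L x y \<in> A \<longleftrightarrow> y \<in> A" "\<And>x. x \<notin> A \<Longrightarrow> f x = 0"
  shows "\<exists>w\<in>lists A. cnt w = f"
  using assms(3)
proof (induct "sum f A" arbitrary: f)
  case 0
  hence "f = (\<lambda>_. 0)" using assms(1) by (auto simp: fun_eq_iff)
  thus ?case by (intro bexI[of _ "[]"]) simp_all
next
  case (Suc n f)
  then obtain x where x: "x \<in> A" "f x > 0" by (metis sum.neutral not_gr_zero zero_neq_one Zero_not_Suc)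
  define g where "g z = f (L x z) - (if z = x then 1 else 0)" for z
  have LiA: "Li x y \<in> A" if "y \<in> A" for y using assms(2)[OF x(1), of "Li x y"] that by simp
  have bij: "bij_betw (L x) A A" by (rule bij_betwI[where g="Li x"]) (use assms(2)[OF x(1)] LiA in auto)
  have "f (L x z) = g z + (if z = x then 1 else 0)" for z using x by (auto simp: g_def)
  hence "sum f A = sum (\<lambda>z. g z + (if z = x then 1 else 0)) A"
    using sum.reindex_bij_betw[OF bij, of f] by simp
  also have "\<dots> = sum g A + 1" using x assms(1) by (simp add: sum.distrib)
  finally have "n = sum g A" using Suc.hyps(2) by simp
  moreover have "g z = 0" if "z \<notin> A" for z using that Suc.prems assms(2)[OF x(1)] by (simp add: g_def)
  ultimately obtain w where w: "w \<in> lists A" "cnt w = g" using Suc.hyps(1)[of g] by blast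
  have "cnt (x # w) = f"
  by (use x w in \<open>simp add: g_def\<close>)
  thus ?case using w x by (intro bexI[of _ "x # w"]) auto
qed

lemma cnt_sum: assumes "finite (UNIV :: 'x set)" shows "sum (cnt w) UNIV = length w"
proof (induct w)
  case (Cons x w)
  have "bij (Li x)" by (rule o_bij[of "L x"]) (auto simp: fun_eq_iff)
  hence "sum (\<lambda>z. cnt w (Li x z)) UNIV = sum (cnt w) UNIV" by (rule sum.reindex_bij_betw)
  thus ?case using Cons assms by (simp add: sum.distrib)
qed simp

lemma left_divides_iff: assumes "finite (UNIV :: 'x set)"
  shows "(\<exists>c. v ~~ u @ c) \<longleftrightarrow> (\<forall>x. cnt u x \<le> cnt v x)"
proof
  assume "\<exists>c. v ~~ u @ c"
  thus "\<forall>x. cnt u x \<le> cnt v x" using cong_cnt cnt_append by fastforce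
next
  assume le: "\<forall>x. cnt u x \<le> cnt v x"
  obtain c where c: "cnt c = (\<lambda>z. cnt v (Lw u z) - cnt u (Lw u z))"
    using cnt_exists[of UNIV] assms by blast
  have "cnt (u @ c) = cnt v" by (rule ext) (use le in \<open>simp add: cnt_append c\<close>)
  thus "\<exists>c. v ~~ u @ c" using cnt_inj by metis
qed

lemma sqfree_iff: "sqfree w \<longleftrightarrow> (\<forall>x. cnt w x \<le> 1)"
proof
  assume s: "sqfree w"
  show "\<forall>x. cnt w x \<le> 1"
  proof (rule allI, rule ccontr)
    fix x assume x: "\<not> cnt w x \<le> 1"
    then obtain w' where w': "w ~~ x # w'" using cnt_head[of w x] by auto
    have "cnt w' x > 0" using x cong_cnt[OF w'] by simp
    then obtain w'' where "w' ~~ x # w''" using cnt_head by blast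
    hence "x # w' ~~ [] @ [x, x] @ w''" using word_cong_Cons by fastforce
    thus False using w' s word_cong.trans unfolding sqfree_def by blast
  qed
next
  assume le: "\<forall>x. cnt w x \<le> 1"
  show "sqfree w" unfolding sqfree_def
  proof
    assume "\<exists>u x v. w ~~ u @ [x, x] @ v"
    then obtain u x v where "w ~~ u @ [x, x] @ v" by blast
    hence "cnt w (Lw u x) \<ge> 2" using cong_cnt by (simp add: cnt_append)
    thus False using le by (metis Suc_1 not_less_eq_eq)
  qed
qed

end

subsection \<open>The permutation group of an invariant subset\<close>

lemma part_dvd: "n > 0 \<Longrightarrow> part \<pi> n dvd n"
  using part_compl[of n \<pi>] by (metis dvd_triv_left)

lemma part_mono: assumes "\<pi> \<subseteq> \<rho>" shows "part \<pi> n dvd part \<rho> n"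
  using part_dvd[of "part \<rho> n" \<pi>] assms by (simp add: part_part Int_absorb2)

lemma part_power: "n > 0 \<Longrightarrow> part \<pi> (n ^ m) = part \<pi> n ^ m"
proof (induct m)
  case 0 thus ?case by (simp add: part_def)
next
  case (Suc m) thus ?case by (simp add: part_mult)
qed

lemma part_coprime: assumes "\<pi> \<inter> \<rho> = {}" shows "coprime (part \<pi> m) (part \<rho> n)"
proof (rule ccontr)
  assume "\<not> coprime (part \<pi> m) (part \<rho> n)"
  hence "gcd (part \<pi> m) (part \<rho> n) \<noteq> 1" by (simp add: coprime_iff_gcd_eq_1)
  then obtain p where "prime p" "p dvd gcd (part \<pi> m) (part \<rho> n)" using prime_factor_nat by blast
  hence "p \<in> prime_factors (part \<pi> m)" "p \<in> prime_factors (part \<rho> n)" by (simp_all add: in_prime_factors_iff)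
  thus False using assms by (auto simp: prime_factors_part)
qed

lemma part_Un_dvd: assumes "part \<pi> n dvd k" "part \<rho> n dvd k" shows "part (\<pi> \<union> \<rho>) n dvd k"
proof -
  have "part \<pi> n * part (\<rho> - \<pi>) n = part (\<pi> \<union> \<rho>) n"
    using part_Un_Int[of \<pi> n "\<rho> - \<pi>"] by simp
  moreover have "part (\<rho> - \<pi>) n dvd k" using part_mono[of "\<rho> - \<pi>" \<rho> n] assms(2) by (metis Diff_subset dvd_trans)
  moreover have "coprime (part \<pi> n) (part (\<rho> - \<pi>) n)" by (rule part_coprime) auto
  ultimately show ?thesis using assms(1) by (metis divides_mult)
qed

lemma funpow_inj_id: fixes f :: "'x::finite \<Rightarrow> 'x" assumes "inj f" shows "\<exists>n>0. f ^^ n = id"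
proof -
  have "\<not> inj (\<lambda>n. f ^^ n)"
    using finite_imageD[of "\<lambda>n::nat. f ^^ n" UNIV] finite_subset[OF subset_UNIV, of "range (\<lambda>n. f ^^ n)"] by auto
  then obtain i j where ij: "f ^^ i = f ^^ j" "i < j" by (metis injI linorder_neqE_nat)
  have "(f ^^ (j - i)) x = x" for x
  proof -
    have "(f ^^ i) ((f ^^ (j - i)) x) = (f ^^ j) x" using ij(2) by (metis funpow_add le_add_diff_inverse less_imp_le comp_apply)
    also have "\<dots> = (f ^^ i) x" by (simp add: ij(1))
    finally show ?thesis using inj_fn[OF assms, of i] by (simp add: inj_eq)
  qed
  thus ?thesis using ij(2) by (intro exI[of _ "j - i"]) (auto simp: fun_eq_iff)
qed

lemma card_functions:
  fixes A :: "'x::finite set" and S :: "nat set"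
  shows "card {a. (\<forall>z\<in>A. a z \<in> S) \<and> (\<forall>z. z \<notin> A \<longrightarrow> a z = 0)} = card S ^ card A"
proof -
  have "bij_betw (\<lambda>a. restrict a A) {a. (\<forall>z\<in>A. a z \<in> S) \<and> (\<forall>z. z \<notin> A \<longrightarrow> a z = 0)} (A \<rightarrow>\<^sub>E S)"
    by (rule bij_betwI[where g="\<lambda>g z. if z \<in> A then g z else 0"]) (auto simp: fun_eq_iff PiE_def extensional_def)
  hence "card {a. (\<forall>z\<in>A. a z \<in> S) \<and> (\<forall>z. z \<notin> A \<longrightarrow> a z = 0)} = card (A \<rightarrow>\<^sub>E S)" by (rule bij_betw_same_card)
  thus ?thesis by (simp add: card_PiE)
qed

section \<open>The finite group of counts modulo d\<close>

locale fin_ybset = ybset r for r :: "'x::finite quad_map"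

text \<open>The words over the invariant set \<open>A\<close> modulo \<open>d\<close>-th powers of
  letters form a finite brace: its additive group is \<open>(Z/d)^A\<close>, its multiplication is
  concatenation.\<close>

locale brace = fin_ybset r for r :: "'x::finite quad_map" +
  fixes A :: "'x set" and d :: nat
  assumes A: "x \<in> A \<Longrightarrow> L x y \<in> A \<longleftrightarrow> y \<in> A"
    and d: "d > 0" "(Li x ^^ d) y = y"
begin

lemma Lw_A: "w \<in> lists A \<Longrightarrow> Lw w y \<in> A \<longleftrightarrow> y \<in> A"
  by (induct w) (auto simp: A)

lemma cnt_off: "w \<in> lists A \<Longrightarrow> z \<notin> A \<Longrightarrow> cnt w z = 0"
proof (induct w arbitrary: z)
  case (Cons x w)
  hence "Li x z \<notin> A" using A[of x "Li x z"] by simp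
  thus ?case using Cons by auto
qed simp

lemma cnt_lists: "(\<And>z. z \<notin> A \<Longrightarrow> f z = 0) \<Longrightarrow> \<exists>w\<in>lists A. cnt w = f"
  by (rule cnt_exists) (simp_all add: A)

lemma cnt_replicate: "cnt (replicate m x) z = (if z = x then m else 0)"
  by (induct m arbitrary: z) auto

lemma Lwi_replicate: "Lwi (replicate m x) z = (Li x ^^ m) z"
  by (induct m arbitrary: z) (simp_all add: funpow_swap1)

lemma Lwi_d: "Lwi (replicate (d * m) x) z = z"
proof -
  have "((Li x ^^ d) ^^ m) z = z" by (induct m) (simp_all add: d(2))
  thus ?thesis by (simp add: Lwi_replicate funpow_mult mult.commute)
qed

definition N :: "'x list \<Rightarrow> 'x \<Rightarrow> nat" where "N w = (\<lambda>z. cnt w z mod d)"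

text \<open>A power of a letter with exponent divisible by \<open>d\<close> acts trivially, so
  counts divisible by \<open>d\<close> can be put in front of a word without disturbing the counts
  behind them.\<close>

lemma period_word:
  assumes "distinct xs" "set xs \<subseteq> A"
  shows "\<exists>p\<in>lists A. (\<forall>z. cnt p z = (if z \<in> set xs then d * c z else 0)) \<and> (\<forall>z. Lwi p z = z)"
  using assms
proof (induct xs)
  case Nil show ?case by (intro bexI[of _ "[]"]) simp_all
next
  case (Cons x xs)
  then obtain p where p: "p \<in> lists A" "\<forall>z. cnt p z = (if z \<in> set xs then d * c z else 0)" "\<forall>z. Lwi p z = z" by auto
  let ?p = "replicate (d * c x) x @ p"
  have "cnt ?p z = (if z \<in> set (x # xs) then d * c z else 0)" for z
    using Cons.prems p(2) unfolding cnt_append Lwi_d cnt_replicate by auto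
  moreover have "Lwi ?p z = z" for z using p(3) by (simp add: Lwi_d)
  moreover have "?p \<in> lists A" using p(1) Cons.prems by (auto simp: in_lists_conv_set)
  ultimately show ?case by blast
qed

text \<open>Padding \<open>u\<close> with the multiples of \<open>d\<close> in the counts of
  \<open>v\<close>, and conversely, makes the counts equal; the padded words are congruent and the
  padding acts trivially.\<close>

lemma N_Lwi: assumes "u \<in> lists A" "v \<in> lists A" "N u = N v" shows "Lwi u = Lwi v" "Lw u = Lw v"
proof -
  obtain xs where xs: "set xs = A" "distinct xs" using finite_distinct_list[of A] by auto
  obtain p where p: "p \<in> lists A" "\<forall>z. cnt p z = (if z \<in> set xs then d * (cnt v z div d) else 0)" "\<forall>z. Lwi p z = z"
    using period_word[of xs "\<lambda>z. cnt v z div d"] xs by blast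
  obtain q where q: "q \<in> lists A" "\<forall>z. cnt q z = (if z \<in> set xs then d * (cnt u z div d) else 0)" "\<forall>z. Lwi q z = z"
    using period_word[of xs "\<lambda>z. cnt u z div d"] xs by blast
  have "cnt (p @ u) z = cnt (q @ v) z" for z
  proof (cases "z \<in> A")
    case True
    have "cnt u z mod d = cnt v z mod d" using fun_cong[OF assms(3), of z] by (simp add: N_def)
    hence "d * (cnt v z div d) + cnt u z = d * (cnt u z div d) + cnt v z"
      using mult_div_mod_eq[of d "cnt u z"] mult_div_mod_eq[of d "cnt v z"] by linarith
    thus ?thesis using True p q xs by (simp add: cnt_append)
  next
    case False
    thus ?thesis using p q xs assms cnt_off by (simp add: cnt_append)
  qed
  hence "p @ u ~~ q @ v" by (intro cnt_inj ext)
  hence e: "Lwi (p @ u) = Lwi (q @ v)" by (rule cong_Lwi)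
  show l: "Lwi u = Lwi v" by (rule ext) (use fun_cong[OF e] p(3) q(3) in simp)
  show "Lw u = Lw v" by (rule ext) (metis l Lw_Lwi Lwi_Lw)
qed

definition B :: "('x \<Rightarrow> nat) set" where "B = N ` lists A"
definition rep :: "('x \<Rightarrow> nat) \<Rightarrow> 'x list" where "rep a = (SOME w. w \<in> lists A \<and> N w = a)"
text \<open>The quotient group, encoded by its normal forms: counts modulo \<open>d\<close>,
  multiplied through chosen representing words.\<close>

definition BG :: "('x \<Rightarrow> nat) monoid" where
  "BG = \<lparr>carrier = B, monoid.mult = (\<lambda>a b. N (rep a @ rep b)), one = N []\<rparr>"
definition act :: "('x \<Rightarrow> nat) \<Rightarrow> 'x \<Rightarrow> 'x" where "act a = Lw (rep a)"

lemma rep: "w \<in> lists A \<Longrightarrow> rep (N w) \<in> lists A \<and> N (rep (N w)) = N w"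
  unfolding rep_def by (rule someI_ex) blast

lemma N_append_cong:
  assumes "u \<in> lists A" "u' \<in> lists A" "N u = N u'" "N v = N v'" shows "N (u @ v) = N (u' @ v')"
proof
  fix z
  have "cnt u z mod d = cnt u' z mod d" using fun_cong[OF assms(3), of z] by (simp add: N_def)
  moreover have "cnt v (Lwi u z) mod d = cnt v' (Lwi u' z) mod d"
    using fun_cong[OF assms(4)] N_Lwi(1)[OF assms(1-3)] by (simp add: N_def)
  ultimately show "N (u @ v) z = N (u' @ v') z" unfolding N_def cnt_append by (metis mod_add_eq)
qed

lemma BG_mult: "u \<in> lists A \<Longrightarrow> v \<in> lists A \<Longrightarrow> N u \<otimes>\<^bsub>BG\<^esub> N v = N (u @ v)"
  using N_append_cong[of "rep (N u)" u "rep (N v)" v] rep by (simp add: BG_def)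

lemma BG_carrier: "carrier BG = B" and BG_one: "\<one>\<^bsub>BG\<^esub> = N []"
  by (simp_all add: BG_def)

lemma N_B: "w \<in> lists A \<Longrightarrow> N w \<in> B" by (simp add: B_def)

lemma BE: assumes "a \<in> B" obtains u where "u \<in> lists A" "a = N u"
  using assms unfolding B_def by blast

lemma act_N: "w \<in> lists A \<Longrightarrow> act (N w) = Lw w"
  unfolding act_def using N_Lwi(2)[of "rep (N w)" w] rep by blast

lemma N_eq_zero: "(\<And>z. d dvd cnt w z) \<Longrightarrow> N w = N []"
  by (rule ext) (simp add: N_def)

text \<open>Behind \<open>u\<close> the letters of \<open>v\<close> are read through
  \<open>u\<close>; the counts of \<open>v\<close> are prescribed so that \<open>u @ v\<close> has
  \<open>d\<close> times the counts of \<open>u\<close>.\<close>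

lemma right_inverse:
  assumes "u \<in> lists A"
  obtains v where "v \<in> lists A" "N (u @ v) = N []" "\<forall>z. cnt v z = (d - 1) * cnt u (Lw u z)"
proof -
  have "\<exists>v\<in>lists A. cnt v = (\<lambda>z. (d - 1) * cnt u (Lw u z))"
    by (rule cnt_lists) (use assms Lw_A cnt_off in auto)
  then obtain v where v: "v \<in> lists A" "cnt v = (\<lambda>z. (d - 1) * cnt u (Lw u z))" by blast
  have "cnt (u @ v) z = d * cnt u z" for z using d(1) by (cases d) (simp_all add: cnt_append v(2))
  hence "N (u @ v) = N []" by (intro N_eq_zero) simp
  thus thesis using that v by simp
qed

lemma BG_group: "Group.group BG"
proof (rule groupI)
  fix a b c assume "a \<in> carrier BG" "b \<in> carrier BG" "c \<in> carrier BG"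
  then obtain u v w where "u \<in> lists A" "v \<in> lists A" "w \<in> lists A" "a = N u" "b = N v" "c = N w"
    by (auto simp: BG_carrier B_def)
  thus "a \<otimes>\<^bsub>BG\<^esub> b \<otimes>\<^bsub>BG\<^esub> c = a \<otimes>\<^bsub>BG\<^esub> (b \<otimes>\<^bsub>BG\<^esub> c)" by (simp add: BG_mult)
next
  fix a b assume "a \<in> carrier BG" "b \<in> carrier BG"
  then obtain u v where "u \<in> lists A" "v \<in> lists A" "a = N u" "b = N v" unfolding BG_carrier by (metis BE)
  thus "a \<otimes>\<^bsub>BG\<^esub> b \<in> carrier BG" by (simp add: BG_carrier BG_mult N_B)
next
  show "\<one>\<^bsub>BG\<^esub> \<in> carrier BG" by (simp add: BG_carrier BG_one N_B)
next
  fix a assume "a \<in> carrier BG"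
  then obtain u where u: "u \<in> lists A" "a = N u" by (auto simp: BG_carrier B_def)
  show "\<one>\<^bsub>BG\<^esub> \<otimes>\<^bsub>BG\<^esub> a = a" using BG_mult[of "[]" u] u by (simp add: BG_one)
  obtain v where v: "v \<in> lists A" "N (u @ v) = N []" by (rule right_inverse[OF u(1)])
  obtain w where w: "w \<in> lists A" "N (v @ w) = N []" by (rule right_inverse[OF v(1)])
  have "N u = N (u @ (v @ w))" using N_append_cong[of u u "v @ w" "[]"] u w by simp
  also have "\<dots> = N w" using N_append_cong[of "u @ v" "[]" w w] u v by simp
  finally have "N (v @ u) = N []" using N_append_cong[of v v u w] v w by simp
  thus "\<exists>b\<in>carrier BG. b \<otimes>\<^bsub>BG\<^esub> a = \<one>\<^bsub>BG\<^esub>"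
    using u v by (intro bexI[of _ "N v"]) (simp_all add: BG_mult BG_one BG_carrier N_B)
qed

lemma N_pow: assumes "w \<in> lists A" shows "N w [^]\<^bsub>BG\<^esub> (k::nat) = N (concat (replicate k w))"
proof -
  interpret BG: group BG by (rule BG_group)
  have c: "concat (replicate k w) \<in> lists A" for k using assms by (induct k) auto
  show ?thesis
  proof (induct k)
    case 0 show ?case by (simp add: BG_one)
  next
    case (Suc k)
    have "N w [^]\<^bsub>BG\<^esub> Suc k = N w \<otimes>\<^bsub>BG\<^esub> N w [^]\<^bsub>BG\<^esub> k"
      by (rule BG.nat_pow_Suc2) (simp add: BG_carrier N_B assms)
    thus ?case using Suc c assms by (simp add: BG_mult)
  qed
qed

lemma N_replicate: "x \<in> A \<Longrightarrow> N [x] [^]\<^bsub>BG\<^esub> (k::nat) = N (replicate k x)"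
proof -
  assume x: "x \<in> A"
  have "concat (replicate k [x]) = replicate k x" by (induct k) simp_all
  thus ?thesis using N_pow[of "[x]" k] x by simp
qed

lemma B_eq: "B = {a. (\<forall>z\<in>A. a z \<in> {k. k < d}) \<and> (\<forall>z. z \<notin> A \<longrightarrow> a z = 0)}"
proof (rule Set.set_eqI, rule HOL.iffI)
  fix a assume "a \<in> B"
  thus "a \<in> {a. (\<forall>z\<in>A. a z \<in> {k. k < d}) \<and> (\<forall>z. z \<notin> A \<longrightarrow> a z = 0)}"
  proof (rule BE)
    fix u assume u: "u \<in> lists A" "a = N u"
    hence "a z = 0" if "z \<notin> A" for z using cnt_off[OF u(1) that] by (simp add: N_def)
    thus ?thesis using u(2) d(1) by (simp add: N_def)
  qed
next
  fix a assume a: "a \<in> {a. (\<forall>z\<in>A. a z \<in> {k. k < d}) \<and> (\<forall>z. z \<notin> A \<longrightarrow> a z = 0)}"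
  then obtain w where w: "w \<in> lists A" "cnt w = a" using cnt_lists[of a] by blast
  have "N w z = a z" for z using a w(2) d(1) by (cases "z \<in> A") (auto simp: N_def)
  hence "N w = a" ..
  thus "a \<in> B" using w by (auto simp: B_def)
qed

text \<open>The Hall subgroup of the additive group \<open>(Z/d)^A\<close>. It is closed under the
  multiplication too, since a product adds a permuted copy of the second function to the first and
  divisibility of all values survives permutation.\<close>

definition Hall :: "nat set \<Rightarrow> ('x \<Rightarrow> nat) set" where
  "Hall \<pi> = {a \<in> B. \<forall>z. part (- \<pi>) d dvd a z}"

lemma N_Hall: "w \<in> lists A \<Longrightarrow> N w \<in> Hall \<pi> \<longleftrightarrow> (\<forall>z. part (- \<pi>) d dvd cnt w z)"
  using part_dvd[OF d(1), of "- \<pi>"] by (simp add: Hall_def N_B) (simp add: N_def dvd_mod_iff)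

lemma card_Hall: "card (Hall \<pi>) = part \<pi> d ^ card A"
proof -
  let ?p = "part (- \<pi>) d"
  have "Hall \<pi> = {a. (\<forall>z\<in>A. a z \<in> {k. k < d \<and> ?p dvd k}) \<and> (\<forall>z. z \<notin> A \<longrightarrow> a z = 0)}"
  by (use Set.set_eqI dvd_0_right in \<open>auto simp: Hall_def B_eq\<close>)
  hence "card (Hall \<pi>) = card {k. k < d \<and> ?p dvd k} ^ card A" by (simp only: card_functions)
  also have "{k. k < d \<and> ?p dvd k} = (\<lambda>j. ?p * j) ` {..<part \<pi> d}"
  proof (rule Set.set_eqI, rule HOL.iffI)
    fix k assume "k \<in> {k. k < d \<and> ?p dvd k}"
    then obtain j where j: "k = ?p * j" "k < d" by auto
    hence "?p * j < ?p * part \<pi> d" using part_compl[OF d(1), of \<pi>] by (simp add: mult.commute)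
    hence "j \<in> {..<part \<pi> d}" by simp
    thus "k \<in> (\<lambda>j. ?p * j) ` {..<part \<pi> d}" unfolding j(1) by (rule imageI)
  next
    fix k assume "k \<in> (\<lambda>j. ?p * j) ` {..<part \<pi> d}"
    then obtain j where j: "k = ?p * j" "j < part \<pi> d" by auto
    hence "?p * j < ?p * part \<pi> d" by simp
    thus "k \<in> {k. k < d \<and> ?p dvd k}" using part_compl[OF d(1), of \<pi>] j by (simp add: mult.commute)
  qed
  also have "card ((\<lambda>j. ?p * j) ` {..<part \<pi> d}) = part \<pi> d"
  proof -
    have "inj_on (\<lambda>j. ?p * j) S" for S by (rule inj_onI) (simp only: nat_mult_eq_cancel1[OF part_pos])
    thus ?thesis by (subst card_image) simp_all
  qed
  finally show ?thesis .
qed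

lemma Hall_UNIV: "Hall UNIV = B"
  by (simp add: Hall_def)

lemma BG_hall_system: "hall_system BG Hall"
proof -
  interpret BG: group BG by (rule BG_group)
  have cB: "card B = d ^ card A" using card_Hall[of UNIV] d(1) by (simp add: Hall_UNIV)
  hence "finite B" using d(1) by (metis card.infinite power_eq_0_iff less_numeral_extra(3))
  moreover have "subgroup (Hall \<pi>) BG" for \<pi>
  proof (rule BG.subgroupI)
    show "Hall \<pi> \<subseteq> carrier BG" by (auto simp: Hall_def BG_carrier)
    have "N [] \<in> Hall \<pi>" by (simp add: N_Hall)
    thus "Hall \<pi> \<noteq> {}" by blast
    fix a assume a: "a \<in> Hall \<pi>"
    then obtain u where u: "u \<in> lists A" "a = N u" unfolding Hall_def by (blast elim: BE)
    have du: "part (- \<pi>) d dvd cnt u z" for z using a u N_Hall by blast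
    obtain v where v: "v \<in> lists A" "N (u @ v) = N []" "\<forall>z. cnt v z = (d - 1) * cnt u (Lw u z)"
      by (rule right_inverse[OF u(1)])
    have cl: "a \<in> carrier BG" "N v \<in> carrier BG" using u v by (simp_all add: BG_carrier N_B)
    have "a \<otimes>\<^bsub>BG\<^esub> N v = \<one>\<^bsub>BG\<^esub>" using u v by (simp add: BG_mult BG_one)
    hence "N v \<otimes>\<^bsub>BG\<^esub> a = \<one>\<^bsub>BG\<^esub>" by (rule BG.inv_comm[OF _ cl])
    hence "inv\<^bsub>BG\<^esub> a = N v" by (rule BG.inv_equality[OF _ cl])
    moreover have "N v \<in> Hall \<pi>" using v du by (simp add: N_Hall)
    ultimately show "inv\<^bsub>BG\<^esub> a \<in> Hall \<pi>" by simp
    fix b assume b: "b \<in> Hall \<pi>"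
    then obtain w where w: "w \<in> lists A" "b = N w" unfolding Hall_def by (blast elim: BE)
    have "part (- \<pi>) d dvd cnt w z" for z using b w N_Hall by blast
    hence "\<forall>z. part (- \<pi>) d dvd cnt (u @ w) z" using du by (simp add: cnt_append)
    moreover have "u @ w \<in> lists A" using u w by simp
    ultimately have "N (u @ w) \<in> Hall \<pi>" using N_Hall by blast
    thus "a \<otimes>\<^bsub>BG\<^esub> b \<in> Hall \<pi>" using u w by (simp only: BG_mult)
  qed
  moreover have "Hall \<pi> \<inter> Hall \<rho> = Hall (\<pi> \<inter> \<rho>)" for \<pi> \<rho>
  proof -
    have "part (- \<pi>) d dvd k \<and> part (- \<rho>) d dvd k \<longleftrightarrow> part (- (\<pi> \<inter> \<rho>)) d dvd k" for k
    by (use part_mono part_Un_dvd dvd_trans in auto)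
    thus ?thesis unfolding Hall_def by blast
  qed
  moreover have "card (Hall \<pi>) = part \<pi> (card (carrier BG))" for \<pi>
    by (simp add: card_Hall BG_carrier cB part_power d(1))
  ultimately show ?thesis
    unfolding hall_system_def hall_system_axioms_def finite_group_def finite_group_axioms_def
    using BG_group by (simp add: BG_carrier)
qed

text \<open>The Chinese remainder exponent: 0 modulo the \<open>p'\<close>-part of \<open>d\<close>
  and 1 modulo its \<open>p\<close>-part, so that \<open>kp p\<close> copies of a letter are the
  \<open>p\<close>-part of its generator.\<close>

definition kp :: "nat \<Rightarrow> nat" where
  "kp p = (SOME k. part (- {p}) d dvd k \<and> [k = 1] (mod part {p} d))"

lemma kp: "part (- {p}) d dvd kp p \<and> [kp p = 1] (mod part {p} d)"
  unfolding kp_def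
proof (rule someI_ex)
  have "coprime (part (- {p}) d) (part {p} d)" by (rule part_coprime) auto
  then obtain x where "[part (- {p}) d * x = Suc 0] (mod part {p} d)" using cong_solve_coprime_nat by blast
  thus "\<exists>k. part (- {p}) d dvd k \<and> [k = 1] (mod part {p} d)"
    by (intro exI[of _ "part (- {p}) d * x"]) simp
qed

definition pt :: "nat \<Rightarrow> 'x \<Rightarrow> 'x \<Rightarrow> nat" where "pt p x = N (replicate (kp p) x)"

lemma replicate_lists: "x \<in> A \<Longrightarrow> replicate m x \<in> lists A"
  by (auto simp: in_lists_conv_set)

text \<open>The powers of \<open>pt p x\<close> give all powers of \<open>x\<close> with exponent
  divisible by the \<open>p'\<close>-part of \<open>d\<close>. A general element of the Hall
  subgroup is reduced by writing one letter of its support first with its full count, which shrinks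
  the support of the rest.\<close>

lemma pt_generate:
  assumes U: "subgroup U BG" and pt: "\<And>x. x \<in> A \<Longrightarrow> pt p x \<in> U" shows "Hall {p} \<subseteq> U"
proof -
  interpret BG: group BG by (rule BG_group)
  have pw: "N (replicate c x) \<in> U" if x: "x \<in> A" and c: "part (- {p}) d dvd c" for c x
  proof -
    obtain c' where c': "c = part (- {p}) d * c'" using c by blast
    have "[part (- {p}) d * kp p = part (- {p}) d * 1] (mod (part (- {p}) d * part {p} d))"
      using kp by (intro cong_cmult_leftI) blast
    hence "[part (- {p}) d * kp p * c' = part (- {p}) d * 1 * c'] (mod d)"
      using part_compl[OF d(1), of "{p}"] by (intro cong_scalar_right) (simp add: mult.commute)
    hence e: "[kp p * c = c] (mod d)" unfolding c' by (simp add: mult_ac)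
    have "pt p x [^]\<^bsub>BG\<^esub> c = N [x] [^]\<^bsub>BG\<^esub> (kp p * c)"
      unfolding pt_def N_replicate[OF x, symmetric] using x by (intro BG.nat_pow_pow) (simp add: BG_carrier N_B)
    also have "\<dots> = N (replicate c x)"
      unfolding N_replicate[OF x] using e by (auto simp: N_def cnt_replicate fun_eq_iff cong_def)
    finally have "N (replicate c x) = pt p x [^]\<^bsub>BG\<^esub> c" ..
    moreover have "pt p x [^]\<^bsub>BG\<^esub> m \<in> U" for m :: nat
      by (induct m) (use pt[OF x] subgroup.one_closed[OF U] subgroup.m_closed[OF U] in auto)
    ultimately show ?thesis by simp
  qed
  have "N u \<in> U" if "u \<in> lists A" "\<forall>z. part (- {p}) d dvd cnt u z" "card {z. cnt u z > 0} = m" for u m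
    using that
  proof (induct m arbitrary: u)
    case 0
    hence "cnt u = cnt []" by (auto simp: fun_eq_iff)
    hence "N u = \<one>\<^bsub>BG\<^esub>" by (simp add: N_def BG_one)
    thus ?case using subgroup.one_closed[OF U] by simp
  next
    case (Suc m)
    then obtain x where x: "cnt u x > 0" by (metis card.empty empty_Collect_eq nat.distinct(1))
    have xA: "x \<in> A" using x cnt_off[OF Suc.prems(1)] by (metis less_numeral_extra(3))
    define c where "c = cnt u x"
    define \<rho> where "\<rho> = replicate c x"
    have \<rho>: "\<rho> \<in> lists A" using replicate_lists[OF xA] by (simp add: \<rho>_def)
    have "\<exists>v\<in>lists A. cnt v = (\<lambda>z. if Lw \<rho> z = x then 0 else cnt u (Lw \<rho> z))"
      by (rule cnt_lists) (use Lw_A[OF \<rho>] cnt_off[OF Suc.prems(1)] in auto)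
    then obtain v where v: "v \<in> lists A" "cnt v = (\<lambda>z. if Lw \<rho> z = x then 0 else cnt u (Lw \<rho> z))" by blast
    have "cnt (\<rho> @ v) = cnt u" by (rule ext) (simp add: cnt_append v(2), simp add: \<rho>_def cnt_replicate c_def)
    hence uv: "N u = N \<rho> \<otimes>\<^bsub>BG\<^esub> N v" using \<rho> v by (simp add: BG_mult) (simp add: N_def)
    have "{z. cnt v z > 0} = Lwi \<rho> ` ({z. cnt u z > 0} - {x})"
    proof (rule Set.set_eqI, rule HOL.iffI)
      fix z assume "z \<in> {z. cnt v z > 0}"
      hence "Lw \<rho> z \<in> {z. cnt u z > 0} - {x}" using v by (auto split: if_splits)
      thus "z \<in> Lwi \<rho> ` ({z. cnt u z > 0} - {x})" by (metis Lwi_Lw image_eqI)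
    next
      fix z assume "z \<in> Lwi \<rho> ` ({z. cnt u z > 0} - {x})"
      thus "z \<in> {z. cnt v z > 0}" using v by auto
    qed
    moreover have "inj_on (Lwi \<rho>) S" for S by (rule inj_onI) (metis Lw_Lwi)
    ultimately have "card {z. cnt v z > 0} = m"
      using Suc.prems(3) x by (simp add: card_image card_Diff_singleton)
    hence "N v \<in> U" using Suc.prems(2) v by (intro Suc.hyps) auto
    moreover have "N \<rho> \<in> U" unfolding \<rho>_def by (rule pw[OF xA]) (use Suc.prems(2) in \<open>simp add: c_def\<close>)
    ultimately show ?case using uv subgroup.m_closed[OF U] by simp
  qed
  moreover have "\<exists>u\<in>lists A. a = N u \<and> (\<forall>z. part (- {p}) d dvd cnt u z)" if a: "a \<in> Hall {p}" for a
  proof -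
    obtain u where u: "u \<in> lists A" "a = N u" using a unfolding Hall_def by (blast elim: BE)
    thus ?thesis using N_Hall[OF u(1), of "{p}"] a by blast
  qed
  ultimately show ?thesis by blast
qed

text \<open>Commutativity of the addition: as a function the product is the count of
  \<open>f\<close> plus \<open>kp p\<close> at the letter \<open>act f x\<close>, so the power of
  that letter can be written first. The other factor has the counts of \<open>f\<close> in permuted
  places and stays in the Hall subgroup.\<close>

lemma pt_move:
  assumes x: "x \<in> A" and f: "f \<in> Hall (- {p})"
  shows "\<exists>f'\<in>Hall (- {p}). f \<otimes>\<^bsub>BG\<^esub> pt p x = pt p (act f x) \<otimes>\<^bsub>BG\<^esub> f'"
proof -
  obtain u where u: "u \<in> lists A" "f = N u" using f by (auto simp: Hall_def B_def)
  define z where "z = Lw u x"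
  have z: "z \<in> A" using u x Lw_A by (simp add: z_def)
  have zf: "z = act f x" using act_N u by (simp add: z_def)
  define \<rho> where "\<rho> = replicate (kp p) z"
  have \<rho>: "\<rho> \<in> lists A" using replicate_lists[OF z] by (simp add: \<rho>_def)
  have "\<exists>w\<in>lists A. cnt w = (\<lambda>y. cnt u (Lw \<rho> y))"
    by (rule cnt_lists) (use Lw_A[OF \<rho>] cnt_off[OF u(1)] in auto)
  then obtain w where w: "w \<in> lists A" "cnt w = (\<lambda>y. cnt u (Lw \<rho> y))" by blast
  have "cnt (u @ replicate (kp p) x) y = cnt (\<rho> @ w) y" for y
  proof -
    have "Lwi u y = x \<longleftrightarrow> y = z" by (auto simp: z_def)
    thus ?thesis by (simp add: cnt_append w(2)) (simp add: \<rho>_def cnt_replicate)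
  qed
  hence "N (u @ replicate (kp p) x) = N (\<rho> @ w)" by (simp add: N_def)
  hence "f \<otimes>\<^bsub>BG\<^esub> pt p x = pt p z \<otimes>\<^bsub>BG\<^esub> N w"
    using u w x z \<rho> replicate_lists by (simp add: pt_def BG_mult \<rho>_def[symmetric])
  moreover have "N w \<in> Hall (- {p})" using f u w N_Hall by simp
  ultimately show ?thesis using zf by blast
qed

lemma BG_permutation: "permutation_hall_system BG Hall A act (\<lambda>x. N [x]) pt"
proof -
  interpret BG: hall_system BG Hall by (rule BG_hall_system)
  show ?thesis
  proof
    fix a b x assume a: "a \<in> carrier BG" and x: "x \<in> A"
    obtain u where u: "u \<in> lists A" "a = N u" using a by (auto simp: BG_carrier B_def)
    show "act a x \<in> A" using u x by (simp add: act_N Lw_A)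
    assume b: "b \<in> carrier BG"
    obtain v where v: "v \<in> lists A" "b = N v" using b by (auto simp: BG_carrier B_def)
    have "u @ v \<in> lists A" using u v by simp
    thus "act (a \<otimes>\<^bsub>BG\<^esub> b) x = act a (act b x)" using u v by (simp only: BG_mult act_N Lw_append)
  next
    fix x assume x: "x \<in> A"
    show "act \<one>\<^bsub>BG\<^esub> x = x" by (simp add: BG_one act_N)
    show "N [x] \<in> carrier BG" using x by (simp add: BG_carrier N_B)
    show "act (N [x]) x = x" using x by (simp add: act_N)
    show "prime p \<Longrightarrow> pt p x \<in> Hall {p}" for p
      unfolding pt_def using kp[of p] by (simp only: N_Hall[OF replicate_lists[OF x]]) (simp add: cnt_replicate)
    show "\<exists>k::nat. pt p x = N [x] [^]\<^bsub>BG\<^esub> k" for p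
      unfolding pt_def N_replicate[OF x] by blast
    show "prime p \<Longrightarrow> f \<in> Hall (- {p}) \<Longrightarrow> \<exists>f'\<in>Hall (- {p}). f \<otimes>\<^bsub>BG\<^esub> pt p x = pt p (act f x) \<otimes>\<^bsub>BG\<^esub> f'" for p f
      by (rule pt_move[OF x])
  next
    fix U assume one: "\<one>\<^bsub>BG\<^esub> \<in> U" and st: "\<And>x u. x \<in> A \<Longrightarrow> u \<in> U \<Longrightarrow> u \<in> carrier BG \<Longrightarrow> N [x] \<otimes>\<^bsub>BG\<^esub> u \<in> U"
    have "N w \<in> U" if "w \<in> lists A" for w
      using that
    proof (induct w)
      case Nil show ?case using one by (simp add: BG_one)
    next
      case (Cons x w)
      hence "N [x] \<otimes>\<^bsub>BG\<^esub> N w \<in> U" by (intro st) (auto simp: BG_carrier N_B)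
      thus ?case using Cons BG_mult[of "[x]" w] by simp
    qed
    thus "carrier BG \<subseteq> U" by (auto simp: BG_carrier B_def)
  next
    show "\<And>p U. prime p \<Longrightarrow> subgroup U BG \<Longrightarrow> (\<And>x. x \<in> A \<Longrightarrow> pt p x \<in> U) \<Longrightarrow> Hall {p} \<subseteq> U"
      using pt_generate by blast
  qed
qed

lemma transitive_singleton:
  assumes "\<And>x y. x \<in> A \<Longrightarrow> y \<in> A \<Longrightarrow> \<exists>w\<in>lists A. Lw w x = y" "x \<in> A" "y \<in> A"
  shows "x = y"
proof -
  interpret P: permutation_hall_system BG Hall A act "\<lambda>x. N [x]" pt by (rule BG_permutation)
  show ?thesis
  by (metis P.transitive_singleton assms(2,3) P.transitive_on_def assms(1) act_N BG_carrier N_B)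
qed

end

section \<open>Enumerations compatible with the relations\<close>

context fin_ybset
begin

lemma exists_period: "\<exists>d>0. \<forall>x y. (Li x ^^ d) y = y"
proof -
  have "\<forall>x. \<exists>n>0. Li x ^^ n = id"
    by (intro allI funpow_inj_id) (simp add: inj_def)
  then obtain n where n: "\<And>x. n x > 0 \<and> Li x ^^ n x = id" by metis
  have "(Li x ^^ prod n UNIV) y = y" for x y
  proof -
    have "n x dvd prod n UNIV" by (rule dvd_prodI) auto
    then obtain k where k: "prod n UNIV = n x * k" by blast
    have "((Li x ^^ n x) ^^ k) y = y" using n[of x] by simp
    thus ?thesis by (simp add: k funpow_mult mult.commute)
  qed
  moreover have "prod n UNIV > 0" using n by (simp add: prod_pos)
  ultimately show ?thesis by blast
qed

text \<open>The skew-polynomial shape seen from the ascending side: \<open>r\<close> sends the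
  ascending pair at \<open>i < j\<close> to a strictly descending pair whose first letter lies above
  the letter at \<open>i\<close>.\<close>

definition good :: "'x list \<Rightarrow> bool" where
  "good xs \<longleftrightarrow> distinct xs \<and> (\<forall>i j. i < j \<longrightarrow> j < length xs \<longrightarrow>
     (\<exists>k l. l < k \<and> k < length xs \<and> i < k \<and> L (xs ! i) (xs ! j) = xs ! k \<and> Li (xs ! j) (xs ! i) = xs ! l))"

text \<open>A pair from different blocks crosses over: \<open>L\<close> keeps the second letter in
  the upper block and \<open>Li\<close> keeps the first in the lower one, so the image is descending
  whatever the orders inside the blocks.\<close>

lemma good_append:
  assumes ys: "good ys" and zs: "good zs" and disj: "set ys \<inter> set zs = {}"
    and LY: "\<And>a y. a \<in> set zs \<Longrightarrow> y \<in> set ys \<Longrightarrow> Li a y \<in> set ys"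
    and LZ: "\<And>a z. a \<in> set ys \<Longrightarrow> z \<in> set zs \<Longrightarrow> L a z \<in> set zs"
  shows "good (ys @ zs)"
  unfolding good_def
proof (intro conjI allI impI)
  show "distinct (ys @ zs)" using ys zs disj by (simp add: good_def)
  fix i j assume ij: "i < j" "j < length (ys @ zs)"
  consider "j < length ys" | "i < length ys" "length ys \<le> j" | "length ys \<le> i" using ij by linarith
  thus "\<exists>k l. l < k \<and> k < length (ys @ zs) \<and> i < k \<and> L ((ys @ zs) ! i) ((ys @ zs) ! j) = (ys @ zs) ! k
     \<and> Li ((ys @ zs) ! j) ((ys @ zs) ! i) = (ys @ zs) ! l"
  proof cases
    case 1
    then obtain k l where "l < k" "k < length ys" "i < k" "L (ys ! i) (ys ! j) = ys ! k" "Li (ys ! j) (ys ! i) = ys ! l"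
      using ys ij unfolding good_def by blast
    thus ?thesis using 1 ij by (intro exI[of _ k] exI[of _ l]) (simp add: nth_append)
  next
    case 2
    define j' where "j' = j - length ys"
    have j': "j' < length zs" using 2 ij by (simp add: j'_def)
    have "L (ys ! i) (zs ! j') \<in> set zs" "Li (zs ! j') (ys ! i) \<in> set ys"
      using LZ LY 2(1) j' nth_mem by blast+
    then obtain k l where kl: "k < length zs" "L (ys ! i) (zs ! j') = zs ! k" "l < length ys" "Li (zs ! j') (ys ! i) = ys ! l"
      by (metis in_set_conv_nth)
    show ?thesis
      using 2 kl by (intro exI[of _ "length ys + k"] exI[of _ l]) (simp add: nth_append j'_def[symmetric])
  next
    case 3
    define i' j' where "i' = i - length ys" and "j' = j - length ys"
    have ij': "i' < j'" "j' < length zs" using 3 ij by (simp_all add: i'_def j'_def)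
    then obtain k l where "l < k" "k < length zs" "i' < k" "L (zs ! i') (zs ! j') = zs ! k" "Li (zs ! j') (zs ! i') = zs ! l"
      using zs unfolding good_def by blast
    thus ?thesis using 3 ij
      by (intro exI[of _ "length ys + k"] exI[of _ "length ys + l"])
        (simp add: nth_append i'_def[symmetric] j'_def[symmetric], simp add: i'_def)
  qed
qed

text \<open>Rump's theorem (a square-free solution with a transitive action is trivial) splits \<open>A\<close> into
  two invariant subsets.\<close>

lemma good_exists:
  assumes "\<And>x y. x \<in> A \<Longrightarrow> L x y \<in> A \<longleftrightarrow> y \<in> A"
  shows "\<exists>xs. good xs \<and> set xs = A"
  using assms
proof (induct "card A" arbitrary: A rule: less_induct)
  case less
  note inv = less.prems
  show ?case
  proof (cases "\<exists>x\<in>A. \<exists>y\<in>A. x \<noteq> y")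
    case False
    hence "A = {} \<or> (\<exists>x. A = {x})" by blast
    thus ?thesis
    proof
      assume "A = {}" thus ?thesis by (intro exI[of _ "[]"]) (simp add: good_def)
    next
      assume "\<exists>x. A = {x}"
      then obtain x where "A = {x}" ..
      thus ?thesis by (intro exI[of _ "[x]"]) (simp add: good_def)
    qed
  next
    case True
    obtain d where d: "d > 0" "\<forall>x y. (Li x ^^ d) y = y" using exists_period by blast
    interpret brace r A d by unfold_locales (use inv d in auto)
    have "\<exists>x\<in>A. \<exists>y\<in>A. \<forall>w\<in>lists A. Lw w x \<noteq> y" using transitive_singleton True by metis
    then obtain x0 y0 where xy: "x0 \<in> A" "y0 \<in> A" "\<And>w. w \<in> lists A \<Longrightarrow> Lw w x0 \<noteq> y0" by blast
    \<comment> \<open>The orbit of \<open>x0\<close> under words over \<open>A\<close>. It is stable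
      under all letters of \<open>A\<close>, and so is its complement in \<open>A\<close>, which
      contains \<open>y0\<close>; the induction hypothesis applies to both.\<close>
    define Y where "Y = (\<lambda>w. Lw w x0) ` lists A"
    have YA: "Y \<subseteq> A" using xy(1) Lw_A by (auto simp: Y_def)
    have x0Y: "x0 \<in> Y" unfolding Y_def by (rule image_eqI[where x="[]"]) simp_all
    have y0Y: "y0 \<notin> Y" using xy(3) by (auto simp: Y_def)
    have LY: "L a y \<in> Y" if a: "a \<in> A" "y \<in> Y" for a y
    proof -
      obtain w where "w \<in> lists A" "y = Lw w x0" using a by (auto simp: Y_def)
      thus ?thesis unfolding Y_def using a by (intro image_eqI[where x="a # w"]) simp_all
    qed
    have LiY: "Li a y \<in> Y" if a: "a \<in> A" "y \<in> Y" for a y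
    proof -
      have "L a ` Y = Y" by (rule endo_inj_surj) (use LY a in \<open>auto simp: inj_on_def\<close>)
      then obtain y' where "y' \<in> Y" "y = L a y'" using a by blast
      thus ?thesis by simp
    qed
    have Yinv: "L a y \<in> Y \<longleftrightarrow> y \<in> Y" if "a \<in> A" for a y using LY[OF that] LiY[OF that, of "L a y"] by auto
    define Z where "Z = A - Y"
    have Zinv: "L a y \<in> Z \<longleftrightarrow> y \<in> Z" if "a \<in> A" for a y using Yinv[OF that] inv[OF that] by (simp add: Z_def)
    have "card Y < card A" using YA y0Y xy(2) by (intro psubset_card_mono) auto
    then obtain ys where ys: "good ys" "set ys = Y" using less.hyps[of Y] Yinv YA by blast
    have "card Z < card A" using x0Y xy(1) by (intro psubset_card_mono) (auto simp: Z_def)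
    moreover have "L x y \<in> Z \<longleftrightarrow> y \<in> Z" if "x \<in> Z" for x y using that by (intro Zinv) (simp add: Z_def)
    ultimately obtain zs where zs: "good zs" "set zs = Z" using less.hyps[of Z] by blast
    have "good (ys @ zs)"
    proof (rule good_append[OF ys(1) zs(1)])
      show "set ys \<inter> set zs = {}" using ys zs by (auto simp: Z_def)
      show "Li a y \<in> set ys" if "a \<in> set zs" "y \<in> set ys" for a y
        using that LiY[of a y] unfolding ys zs Z_def by blast
      show "L a z \<in> set zs" if "a \<in> set ys" "z \<in> set zs" for a z
        using that Zinv[of a z] YA unfolding ys zs by blast
    qed
    moreover have "set (ys @ zs) = A" using ys zs YA by (auto simp: Z_def)
    ultimately show ?thesis by blast
  qed
qed

end

lemma word_cong_map:
  assumes "\<And>u v. (u, v) \<in> R \<Longrightarrow> (map f u, map f v) \<in> R'" "word_cong R u v"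
  shows "word_cong R' (map f u) (map f v)"
  using assms(2)
proof induct
  case (rel u v a b)
  thus ?case using word_cong.rel[OF assms(1)[OF rel], of "map f a" "map f b"] by simp
qed (auto intro: word_cong.intros)

subsection \<open>The Garside structure\<close>

context fin_ybset
begin

abbreviation cl :: "'x list \<Rightarrow> 'x list set" where "cl \<equiv> word_class (relations r)"
abbreviation S where "S \<equiv> S_monoid r"

lemma cl_eq: "cl u = cl v \<longleftrightarrow> cnt u = cnt v"
  by (simp add: word_class_eq_iff cong_iff)

lemma op_finite: "fin_ybset (op_map r)"
  using op_ybset by (simp add: fin_ybset_def)

lemma left_cancel: assumes "w @ u ~~ w @ v" shows "u ~~ v"
proof (rule cnt_inj, rule ext)
  fix z show "cnt u z = cnt v z" using fun_cong[OF cong_cnt[OF assms], of "Lw w z"] by (simp add: cnt_append)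
qed

lemma right_cancel: assumes "u @ w ~~ v @ w" shows "u ~~ v"
proof -
  interpret op: fin_ybset "op_map r" by (rule op_finite)
  have "word_cong (relations (op_map r)) (rev w @ rev u) (rev w @ rev v)"
    using op_cong[of "u @ w" "v @ w"] assms by simp
  hence "word_cong (relations (op_map r)) (rev u) (rev v)" by (rule op.left_cancel)
  thus ?thesis using op_cong by blast
qed

lemma left_divides_cl: "left_divides S (cl u) (cl v) \<longleftrightarrow> (\<forall>x. cnt u x \<le> cnt v x)"
proof -
  have "left_divides S (cl u) (cl v) \<longleftrightarrow> (\<exists>c. v ~~ u @ c)"
    by (auto simp: left_divides_def presented_carrier word_class_eq_iff)
  thus ?thesis using left_divides_iff by simp
qed

lemma right_divides_cl: "right_divides S (cl u) (cl v) \<longleftrightarrow> (\<exists>c. v ~~ c @ u)"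
  by (auto simp: right_divides_def presented_carrier word_class_eq_iff)

definition delta :: "'x list" where "delta = (SOME w. cnt w = (\<lambda>_. 1))"

lemma cnt_surj: "\<exists>w. cnt w = f"
  using cnt_exists[of UNIV f] by auto

lemma cnt_delta: "cnt delta = (\<lambda>_. 1)"
  unfolding delta_def by (rule someI_ex[OF cnt_surj])

lemma left_divides_delta: "left_divides S (cl w) (cl delta) \<longleftrightarrow> sqfree w"
  by (simp add: left_divides_cl cnt_delta sqfree_iff)

lemma sqfree_full: assumes "sqfree w" "length w = card (UNIV :: 'x set)" shows "cnt w = (\<lambda>_. 1)"
proof (rule ext, rule ccontr)
  fix x assume "cnt w x \<noteq> 1"
  hence "cnt w x < 1" using assms(1) unfolding sqfree_iff by (metis nat_less_le)
  hence "sum (cnt w) UNIV < sum (\<lambda>_. 1) (UNIV :: 'x set)"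
    using assms(1) unfolding sqfree_iff by (intro sum_strict_mono_ex1 bexI[of _ x]) simp_all
  thus False using assms(2) by (simp add: cnt_sum)
qed

lemma length_delta: "length delta = card (UNIV :: 'x set)"
  using cnt_sum[of delta] by (simp add: cnt_delta)

lemma sqfree_delta: "sqfree delta"
  by (simp add: sqfree_iff cnt_delta)

text \<open>Square-freeness is symmetric under reversal, and by its length a square-free word with
  as many letters as X must represent the constant function 1; hence the reversal of
  \<open>delta\<close> plays the part of \<open>delta\<close> for the opposite map.\<close>

lemma right_divides_delta: "right_divides S (cl w) (cl delta) \<longleftrightarrow> sqfree w"
proof -
  interpret op: fin_ybset "op_map r" by (rule op_finite)
  have "op.sqfree (rev delta)" using sqfree_delta by (simp add: op_sqfree)
  hence "op.cnt (rev delta) = (\<lambda>_. 1)" by (rule op.sqfree_full) (simp add: length_delta)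
  hence "op.sqfree (rev w) \<longleftrightarrow> (\<forall>x. op.cnt (rev w) x \<le> op.cnt (rev delta) x)" by (simp add: op.sqfree_iff)
  also have "\<dots> \<longleftrightarrow> (\<exists>c. word_cong (relations (op_map r)) (rev delta) (rev w @ c))"
    by (rule op.left_divides_iff[symmetric]) simp
  also have "\<dots> \<longleftrightarrow> (\<exists>c. word_cong (relations (op_map r)) (rev delta) (rev (c @ w)))"
    by (metis rev_append rev_rev_ident)
  finally show ?thesis unfolding op_cong right_divides_cl op_sqfree by blast
qed

lemma divisors_delta:
  "left_divisors S (cl delta) = cl ` Collect sqfree" "right_divisors S (cl delta) = cl ` Collect sqfree"
  unfolding left_divisors_def right_divisors_def
  using left_divides_delta right_divides_delta by (auto elim!: presented_carrierE)

lemma sqfree_single: "sqfree [x]" and sqfree_pair: "x \<noteq> y \<Longrightarrow> sqfree [x, y]"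
  by (auto simp: sqfree_iff)

lemma finite_sqfree: "finite (cl ` Collect sqfree)"
proof (rule finite_subset)
  show "finite (cl ` {w. set w \<subseteq> UNIV \<and> length w \<le> card (UNIV :: 'x set)})"
    by (intro finite_imageI finite_lists_length_le) simp
  have "length w \<le> card (UNIV :: 'x set)" if "sqfree w" for w
    using that sum_mono[of UNIV "cnt w" "\<lambda>_. 1"] by (simp add: sqfree_iff cnt_sum)
  thus "cl ` Collect sqfree \<subseteq> cl ` {w. set w \<subseteq> UNIV \<and> length w \<le> card (UNIV :: 'x set)}" by auto
qed

lemma lists_generators:
  assumes "p \<in> lists (range (\<lambda>x. cl [x]))" obtains w where "p = map (\<lambda>x. cl [x]) w"
proof -
  have "\<exists>w. p = map (\<lambda>x. cl [x]) w" using assms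
  proof (induct p)
    case (Cons a p)
    then obtain w x where "p = map (\<lambda>x. cl [x]) w" "a = cl [x]" by auto
    thus ?case by (intro exI[of _ "x # w"]) simp
  qed simp
  thus thesis using that by blast
qed

lemma generates: assumes "range (\<lambda>x. cl [x]) \<subseteq> Q" "Q \<subseteq> carrier S" shows "generates_monoid S Q"
  unfolding generates_monoid_def
proof (intro conjI equalityI subsetI)
  fix a assume "a \<in> carrier S"
  then obtain w where "a = cl w" by (rule presented_carrierE)
  hence "a = word_prod S (map (\<lambda>x. cl [x]) w)" by (simp add: word_prod_classes)
  moreover have "map (\<lambda>x. cl [x]) w \<in> lists Q" using assms(1) by (auto simp: image_subset_iff)
  ultimately show "a \<in> word_prod S ` lists Q" by blast
next
  fix a assume "a \<in> word_prod S ` lists Q"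
  then obtain p where p: "p \<in> lists Q" "a = word_prod S p" by auto
  interpret S: monoid S by (rule presented_monoid)
  have "word_prod S p \<in> carrier S" using p(1)
    by (induct p) (use assms in \<open>auto simp: word_prod_Nil word_prod_Cons\<close>)
  thus "a \<in> carrier S" using p by simp
qed (use assms in auto)

lemma atoms_S: "atoms S = range (\<lambda>x. cl [x])"
proof (rule Set.set_eqI, rule HOL.iffI)
  fix a assume a: "a \<in> atoms S"
  then obtain w where w: "a = cl w" unfolding atoms_def by (blast elim: presented_carrierE)
  have "w \<noteq> []" using a w by (auto simp: atoms_def presented_one)
  then obtain x v where xv: "w = x # v" by (cases w) auto
  have "a = cl [x] \<otimes>\<^bsub>S\<^esub> cl v" by (simp add: w xv)
  hence "cl [x] = cl [] \<or> cl v = cl []" using a unfolding atoms_def presented_one by auto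
  moreover have "cl [x] \<noteq> cl []" using cong_length unfolding word_class_eq_iff by fastforce
  ultimately have "length v = 0" using cong_length[of v "[]"] by (simp add: word_class_eq_iff)
  thus "a \<in> range (\<lambda>x. cl [x])" using w xv by simp
next
  fix a assume "a \<in> range (\<lambda>x. cl [x])"
  then obtain x where x: "a = cl [x]" by auto
  have "cl b = cl [] \<or> cl c = cl []" if "cl [x] = cl (b @ c)" for b c
  proof -
    have "length (b @ c) = 1" using that cong_length unfolding word_class_eq_iff by fastforce
    thus ?thesis by (cases b) auto
  qed
  moreover have "cl [x] \<noteq> cl []" using cong_length unfolding word_class_eq_iff by fastforce
  ultimately show "a \<in> atoms S" unfolding atoms_def x by (auto simp: presented_one presented_carrier)
qed

lemma garside: "garside_monoid S (cl delta)"
  unfolding garside_monoid_def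
proof (intro conjI ballI)
  have gen: "range (\<lambda>x. cl [x]) \<subseteq> cl ` Collect sqfree" using sqfree_single by auto
  have canc: "a = b" if ab: "a \<in> carrier S" "b \<in> carrier S"
      "cl delta \<otimes>\<^bsub>S\<^esub> a = cl delta \<otimes>\<^bsub>S\<^esub> b \<or> a \<otimes>\<^bsub>S\<^esub> cl delta = b \<otimes>\<^bsub>S\<^esub> cl delta" for a b
  proof -
    obtain u v where uv: "a = cl u" "b = cl v" using ab(1,2) by (metis presented_carrierE)
    have "delta @ u ~~ delta @ v \<or> u @ delta ~~ v @ delta" using ab(3) by (simp add: uv word_class_eq_iff)
    thus ?thesis using left_cancel[of delta u v] right_cancel[of u delta v]
      unfolding uv word_class_eq_iff by blast
  qed
  have sub: "cl ` Collect sqfree \<subseteq> carrier S" by auto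
  have cc: "\<forall>a\<in>cl ` Collect sqfree. \<forall>b\<in>cl ` Collect sqfree.
      cl delta \<otimes>\<^bsub>S\<^esub> a = cl delta \<otimes>\<^bsub>S\<^esub> b \<or> a \<otimes>\<^bsub>S\<^esub> cl delta = b \<otimes>\<^bsub>S\<^esub> cl delta \<longrightarrow> a = b"
    using canc sub by blast
  show "pre_garside_monoid S (cl delta)"
    unfolding pre_garside_monoid_def Let_def divisors_delta
    by (intro conjI presented_monoid word_class_carrier finite_sqfree generates[OF gen sub] HOL.refl cc)
  show "atomic_monoid S" unfolding atomic_monoid_def
  proof (intro conjI ballI)
    show "generates_monoid S (atoms S)" by (rule generates) (auto simp: atoms_S)
    fix a assume "a \<in> carrier S"
    then obtain v where v: "a = cl v" by (rule presented_carrierE)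
    have "length p \<le> length v" if p: "p \<in> lists (atoms S)" "word_prod S p = a" for p
    proof -
      obtain w where "p = map (\<lambda>x. cl [x]) w" using p(1) unfolding atoms_S by (rule lists_generators)
      thus ?thesis using p(2) v cong_length[of w v] by (simp add: word_prod_classes word_class_eq_iff)
    qed
    thus "\<exists>N. \<forall>w\<in>lists (atoms S). word_prod S w = a \<longrightarrow> length w \<le> N" by blast
  qed
  fix s t assume "s \<in> atoms S" "t \<in> atoms S"
  then obtain x y where st: "s = cl [x]" "t = cl [y]" by (auto simp: atoms_S)
  have one: "left_divides S (cl [z]) (cl w) \<longleftrightarrow> cnt w z > 0" for z w
    by (auto simp: left_divides_cl Suc_le_eq)
  define B where "B = {a \<in> left_divisors S (cl delta). left_divides S s a \<and> left_divides S t a}"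
  have B: "cl w \<in> B \<longleftrightarrow> sqfree w \<and> cnt w x > 0 \<and> cnt w y > 0" for w
    by (auto simp: B_def st one left_divisors_def left_divides_delta)
  \<comment> \<open>The least common right multiple of the two atoms is the maximum of their count
    functions; it takes values 0 and 1 and therefore divides \<open>delta\<close>.\<close>
  obtain w where w: "cnt w = (\<lambda>z. if z = x \<or> z = y then 1 else 0)" using cnt_surj by blast
  have wB: "cl w \<in> B" by (simp add: B w sqfree_iff)
  have least: "left_divides S (cl w) b" if b: "b \<in> B" for b
  proof -
    obtain v where v: "b = cl v" using b unfolding B_def left_divisors_def by (blast elim: presented_carrierE)
    thus ?thesis using b unfolding v B by (auto simp: left_divides_cl w Suc_leI)
  qed
  have anti: "b = cl w" if bB: "b \<in> B" "left_divides S b (cl w)" for b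
  proof -
    obtain v where v: "b = cl v" using bB unfolding B_def left_divisors_def by (blast elim: presented_carrierE)
    have "cnt v z = cnt w z" for z
      using least[OF bB(1)] bB(2) unfolding v left_divides_cl by (meson le_antisym)
    thus ?thesis unfolding v cl_eq by blast
  qed
  have "\<exists>!m. m \<in> B \<and> (\<forall>b\<in>B. left_divides S b m \<longrightarrow> b = m)"
    using wB least anti by metis
  thus "let B = {a \<in> left_divisors S (cl delta). left_divides S s a \<and> left_divides S t a}
     in \<exists>!m. m \<in> B \<and> (\<forall>b\<in>B. left_divides S b m \<longrightarrow> b = m)" by (simp only: Let_def B_def)
qed

text \<open>The defining presentation itself is a witness: generators have length one, and the two
  sides of a relation represent a square-free element of length two, so all of them divide
  \<open>delta\<close>.\<close>

lemma comprehensive: "comprehensive S (left_divisors S (cl delta))"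
proof -
  let ?g = "\<lambda>x. cl [x]"
  define R where "R = {(map ?g u, map ?g v) |u v. (u, v) \<in> relations r}"
  have ginj: "inj ?g"
  proof (rule injI)
    fix x y assume "cl [x] = cl [y]"
    hence "cnt [x] x = cnt [y] x" by (simp only: cl_eq)
    thus "x = y" by (simp split: if_splits)
  qed
  have "word_prod S p = word_prod S q \<longleftrightarrow> word_cong R p q" if pq: "p \<in> lists (range ?g)" "q \<in> lists (range ?g)" for p q
  proof -
    obtain u v where uv: "p = map ?g u" "q = map ?g v" using pq lists_generators by metis
    have "word_cong R p q" if "u ~~ v" unfolding uv by (rule word_cong_map[OF _ that]) (auto simp: R_def)
    moreover have "u ~~ v" if "word_cong R p q"
    proof -
      have "inv_into UNIV ?g (cl [x]) = x" for x using inv_f_f[OF ginj, of x] by simp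
      hence "map (inv_into UNIV ?g) (map ?g a) = a" for a by (induct a) simp_all
      moreover have "(map (inv_into UNIV ?g) a, map (inv_into UNIV ?g) b) \<in> relations r" if "(a, b) \<in> R" for a b
        using that calculation by (auto simp: R_def)
      ultimately show ?thesis using word_cong_map[of R "inv_into UNIV ?g" "relations r" p q] that uv by simp
    qed
    ultimately show ?thesis unfolding uv word_prod_classes word_class_eq_iff by blast
  qed
  moreover have "generates_monoid S (range ?g)" by (rule generates) auto
  moreover have "R \<subseteq> lists (range ?g) \<times> lists (range ?g)" by (auto simp: R_def)
  ultimately have "is_presentation S (range ?g) R" by (simp add: is_presentation_def)
  moreover have "range ?g \<subseteq> cl ` Collect sqfree" using sqfree_single by auto
  moreover have "word_prod S p \<in> cl ` Collect sqfree \<and> word_prod S q \<in> cl ` Collect sqfree" if "(p, q) \<in> R" for p q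
  proof -
    obtain u v where uv: "(u, v) \<in> relations r" "p = map ?g u" "q = map ?g v" using \<open>(p, q) \<in> R\<close> by (auto simp: R_def)
    have e: "cl v = cl u" using word_cong.rel[OF uv(1), of "[]" "[]"] word_class_eq_iff by fastforce
    have "sqfree u" using uv(1) by (rule relationsE) (simp add: sqfree_pair)
    thus ?thesis unfolding uv word_prod_classes e by blast
  qed
  moreover have "\<one>\<^bsub>S\<^esub> \<in> cl ` Collect sqfree" by (auto simp: presented_one sqfree_iff)
  ultimately show ?thesis unfolding comprehensive_def divisors_delta(1) by (intro conjI exI[of _ "range ?g"] exI[of _ R]) auto
qed

subsection \<open>The group of fractions\<close>

abbreviation GR where "GR \<equiv> group_relations (relations r)"
abbreviation gc where "gc \<equiv> word_class GR"

fun ginv :: "'x + 'x \<Rightarrow> 'x + 'x" where "ginv (Inl x) = Inr x" | "ginv (Inr x) = Inl x"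

lemma ginv_cancel: "word_cong GR [ginv a, a] []"
proof -
  have "([ginv a, a], []) \<in> GR" by (cases a) (auto simp: group_relations_def)
  thus ?thesis using word_cong.rel[of _ _ GR "[]" "[]"] by fastforce
qed

lemma G_group: "Group.group (G_group r)"
  unfolding presented_group_def
proof (rule monoid.group_l_invI[OF presented_monoid])
  fix a assume "a \<in> carrier (presented_monoid GR)"
  then obtain w where w: "a = gc w" by (rule presented_carrierE)
  have "word_cong GR (rev (map ginv w) @ w) []"
  proof (induct w)
    case (Cons x w)
    have "word_cong GR (rev (map ginv w) @ [ginv x, x] @ w) (rev (map ginv w) @ [] @ w)"
      by (rule word_cong_context[OF ginv_cancel])
    thus ?case using Cons word_cong.trans by fastforce
  qed (simp add: word_cong.refl)
  thus "\<exists>b\<in>carrier (presented_monoid GR). b \<otimes>\<^bsub>presented_monoid GR\<^esub> a = \<one>\<^bsub>presented_monoid GR\<^esub>"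
    by (intro bexI[of _ "gc (rev (map ginv w))"]) (simp_all add: w presented_one word_class_eq_iff)
qed

lemma GR_map: "u ~~ v \<Longrightarrow> word_cong GR (map Inl u) (map Inl v)"
  by (rule word_cong_map) (auto simp: group_relations_def)

lemma S_to_G_cl: "S_to_G r (cl w) = gc (map Inl w)"
proof -
  have "gc (map Inl v) = gc (map Inl w)" if "w ~~ v" for v
    using GR_map[OF that] word_cong.sym word_class_eq_iff by metis
  hence "S_to_G r (cl w) = (\<Union>v\<in>cl w. gc (map Inl w))" unfolding S_to_G_def by (intro SUP_cong) auto
  thus ?thesis using word_cong.refl[of "relations r" w] by (auto simp del: SUP_const)
qed

text \<open>The letter counts extend to the group with values in \<open>'x \<Rightarrow> int\<close>, which makes the
  embedding injective.\<close>

fun gact :: "'x + 'x \<Rightarrow> ('x \<Rightarrow> int) \<Rightarrow> 'x \<Rightarrow> int" where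
  "gact (Inl x) f = (\<lambda>z. (if z = x then 1 else 0) + f (Li x z))"
| "gact (Inr x) f = (\<lambda>z. f (L x z) - (if z = x then 1 else 0))"

lemma gact_rel: assumes "(u, v) \<in> GR" shows "foldr gact u f = foldr gact v f"
proof -
  consider p q where "(p, q) \<in> relations r" "u = map Inl p" "v = map Inl q"
    | x where "u = [Inl x, Inr x]" "v = []" | x where "u = [Inr x, Inl x]" "v = []"
    using assms by (auto simp: group_relations_def)
  thus ?thesis
  proof cases
    case 1
    obtain x y where xy: "p = [x, y]" "q = [L x y, Li y x]" using 1(1) by (rule relationsE)
    have e1: "Li x z = y \<longleftrightarrow> z = L x y" and e2: "Li (L x y) z = Li y x \<longleftrightarrow> z = x" for z
      by (auto, metis cyclic' Li_inj, metis cyclic')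
    have "foldr gact u f z = foldr gact v f z" for f z
    proof -
      have a: "foldr gact u f z = (if z = x then 1 else 0) + ((if z = L x y then 1 else 0) + f (Li y (Li x z)))"
        by (simp add: 1 xy e1)
      have b: "foldr gact v f z = (if z = L x y then 1 else 0) + ((if z = x then 1 else 0) + f (Li (Li y x) (Li (L x y) z)))"
        by (simp add: 1 xy e2)
      show ?thesis unfolding a b yb_Li[OF yb, of y x z] by (rule add.left_commute)
    qed
    thus ?thesis by blast
  qed (auto simp: fun_eq_iff)
qed

lemma S_to_G_inj: assumes "gc (map Inl u) = gc (map Inl v)" shows "u ~~ v"
proof -
  have "foldr gact (map Inl w) (\<lambda>_. 0) z = int (cnt w z)" for w z by (induct w arbitrary: z) simp_all
  moreover have "foldr gact (map Inl u) (\<lambda>_. 0) = foldr gact (map Inl v) (\<lambda>_. 0)"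
    by (rule word_cong_invariant[of GR "\<lambda>w. foldr gact w (\<lambda>_. 0)"])
      (use assms in \<open>auto simp: gact_rel word_class_eq_iff\<close>)
  ultimately have "int (cnt u z) = int (cnt v z)" for z by metis
  thus ?thesis by (intro cnt_inj ext) simp
qed

lemma common_right: "\<exists>p q. u @ p ~~ v @ q"
proof -
  obtain w where "cnt w = (\<lambda>z. cnt u z + cnt v z)" using cnt_surj by blast
  hence "\<exists>p. w ~~ u @ p" "\<exists>q. w ~~ v @ q" by (simp_all add: left_divides_iff)
  thus ?thesis using word_cong.trans word_cong.sym by metis
qed

lemma common_left: "\<exists>p q. p @ u ~~ q @ v"
proof -
  interpret op: fin_ybset "op_map r" by (rule op_finite)
  obtain p q where "word_cong (relations (op_map r)) (rev u @ p) (rev v @ q)" using op.common_right by blast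
  hence "word_cong (relations (op_map r)) (rev (rev p @ u)) (rev (rev q @ v))" by simp
  thus ?thesis using op_cong by blast
qed

lemma fractions: "group_of_fractions S (G_group r) (S_to_G r)"
proof -
  let ?G = "G_group r"
  interpret G: group ?G by (rule G_group)
  have car: "carrier ?G = range gc" by (simp add: presented_group_def presented_carrier)
  have mult: "gc u \<otimes>\<^bsub>?G\<^esub> gc v = gc (u @ v)" for u v by (simp add: presented_group_def)
  define j where "j w = gc (map Inl w)" for w
  have jc: "j w \<in> carrier ?G" for w by (simp add: j_def car)
  have jm: "j (u @ v) = j u \<otimes>\<^bsub>?G\<^esub> j v" for u v by (simp add: j_def mult)
  have jeq: "u ~~ v \<Longrightarrow> j u = j v" for u v unfolding j_def word_class_eq_iff by (rule GR_map)
  have gInr: "gc [Inr x] = inv\<^bsub>?G\<^esub> (j [x])" for x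
  proof (rule G.inv_equality[symmetric])
    show "gc [Inr x] \<otimes>\<^bsub>?G\<^esub> j [x] = \<one>\<^bsub>?G\<^esub>"
      using ginv_cancel[of "Inl x"] by (simp add: j_def mult) (simp add: presented_group_def presented_one word_class_eq_iff)
  qed (rule jc, simp add: car)
  have frac: "\<exists>u v. gc w = j u \<otimes>\<^bsub>?G\<^esub> inv\<^bsub>?G\<^esub> (j v)" for w
  proof (induct w)
    case Nil
    have "gc [] = j [] \<otimes>\<^bsub>?G\<^esub> inv\<^bsub>?G\<^esub> (j [])" using jc[of "[]"]
      by (simp only: G.r_inv) (simp add: presented_group_def presented_one)
    thus ?case by blast
  next
    case (Cons a w)
    then obtain u v where uv: "gc w = j u \<otimes>\<^bsub>?G\<^esub> inv\<^bsub>?G\<^esub> (j v)" by blast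
    have aw: "gc (a # w) = gc [a] \<otimes>\<^bsub>?G\<^esub> gc w" by (simp add: mult)
    show ?case
    proof (cases a)
      case (Inl x)
      have "gc (a # w) = j (x # u) \<otimes>\<^bsub>?G\<^esub> inv\<^bsub>?G\<^esub> (j v)"
      proof -
        have "gc [a] = j [x]" by (simp add: j_def Inl)
        thus ?thesis using jm[of "[x]" u] jc by (simp add: aw uv G.m_assoc)
      qed
      thus ?thesis by blast
    next
      case (Inr x)
      \<comment> \<open>The Ore condition: a common right multiple of \<open>[x]\<close> and
        \<open>u\<close> turns a left inverse of \<open>x\<close> followed by \<open>u\<close> into
        the right fraction of \<open>p\<close> by \<open>q\<close>.\<close>
      obtain p q where pq: "[x] @ p ~~ u @ q" using common_right by blast
      have e: "j [x] \<otimes>\<^bsub>?G\<^esub> j p = j u \<otimes>\<^bsub>?G\<^esub> j q" using jeq[OF pq] by (simp only: jm)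
      have "inv\<^bsub>?G\<^esub> (j [x]) \<otimes>\<^bsub>?G\<^esub> (j [x] \<otimes>\<^bsub>?G\<^esub> j p) \<otimes>\<^bsub>?G\<^esub> inv\<^bsub>?G\<^esub> (j q) = j p \<otimes>\<^bsub>?G\<^esub> inv\<^bsub>?G\<^esub> (j q)"
        using jc by (simp add: G.m_assoc[symmetric])
      moreover have "inv\<^bsub>?G\<^esub> (j [x]) \<otimes>\<^bsub>?G\<^esub> (j u \<otimes>\<^bsub>?G\<^esub> j q) \<otimes>\<^bsub>?G\<^esub> inv\<^bsub>?G\<^esub> (j q) = inv\<^bsub>?G\<^esub> (j [x]) \<otimes>\<^bsub>?G\<^esub> j u"
        using jc by (simp add: G.m_assoc)
      ultimately have xu: "inv\<^bsub>?G\<^esub> (j [x]) \<otimes>\<^bsub>?G\<^esub> j u = j p \<otimes>\<^bsub>?G\<^esub> inv\<^bsub>?G\<^esub> (j q)" using e by simp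
      have "gc (a # w) = inv\<^bsub>?G\<^esub> (j [x]) \<otimes>\<^bsub>?G\<^esub> j u \<otimes>\<^bsub>?G\<^esub> inv\<^bsub>?G\<^esub> (j v)"
        unfolding aw uv unfolding Inr gInr using jc by (simp add: G.m_assoc)
      also have "\<dots> = j p \<otimes>\<^bsub>?G\<^esub> inv\<^bsub>?G\<^esub> (j (v @ q))"
        unfolding xu jm using jc by (simp add: G.inv_mult_group G.m_assoc)
      finally show ?thesis by blast
    qed
  qed
  have lfrac: "\<exists>u v. gc w = inv\<^bsub>?G\<^esub> (j u) \<otimes>\<^bsub>?G\<^esub> j v" for w
  proof -
    obtain u v where uv: "gc w = j u \<otimes>\<^bsub>?G\<^esub> inv\<^bsub>?G\<^esub> (j v)" using frac by blast
    obtain p q where "p @ u ~~ q @ v" using common_left by blast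
    hence e: "j p \<otimes>\<^bsub>?G\<^esub> j u = j q \<otimes>\<^bsub>?G\<^esub> j v" using jeq by (simp only: jm[symmetric])
    have "inv\<^bsub>?G\<^esub> (j p) \<otimes>\<^bsub>?G\<^esub> (j p \<otimes>\<^bsub>?G\<^esub> j u) \<otimes>\<^bsub>?G\<^esub> inv\<^bsub>?G\<^esub> (j v) = gc w"
      unfolding uv using jc by (simp add: G.m_assoc[symmetric])
    moreover have "inv\<^bsub>?G\<^esub> (j p) \<otimes>\<^bsub>?G\<^esub> (j q \<otimes>\<^bsub>?G\<^esub> j v) \<otimes>\<^bsub>?G\<^esub> inv\<^bsub>?G\<^esub> (j v) = inv\<^bsub>?G\<^esub> (j p) \<otimes>\<^bsub>?G\<^esub> j q"
      using jc by (simp add: G.m_assoc)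
    ultimately show ?thesis using e by metis
  qed
  have SG: "S_to_G r (cl w) = j w" for w by (simp add: S_to_G_cl j_def)
  have "S_to_G r \<in> hom S ?G"
    unfolding hom_def by (auto simp: presented_carrier SG jc jm[symmetric])
  moreover have "inj_on (S_to_G r) (carrier S)"
  proof (rule inj_onI)
    fix a b assume ab: "a \<in> carrier S" "b \<in> carrier S" "S_to_G r a = S_to_G r b"
    obtain u v where uv: "a = cl u" "b = cl v" using ab(1,2) by (metis presented_carrierE)
    show "a = b" using ab(3) S_to_G_inj unfolding uv SG j_def word_class_eq_iff[of "relations r"] by blast
  qed
  moreover have "carrier ?G = {S_to_G r a \<otimes>\<^bsub>?G\<^esub> inv\<^bsub>?G\<^esub> (S_to_G r b) |a b. a \<in> carrier S \<and> b \<in> carrier S}"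
  proof (rule equalityI)
    show "carrier ?G \<subseteq> {S_to_G r a \<otimes>\<^bsub>?G\<^esub> inv\<^bsub>?G\<^esub> (S_to_G r b) |a b. a \<in> carrier S \<and> b \<in> carrier S}"
      unfolding car using frac SG word_class_carrier by (smt (verit) image_iff mem_Collect_eq subsetI)
  qed (auto simp: presented_carrier SG jc)
  moreover have "carrier ?G = {inv\<^bsub>?G\<^esub> (S_to_G r a) \<otimes>\<^bsub>?G\<^esub> S_to_G r b |a b. a \<in> carrier S \<and> b \<in> carrier S}"
  proof (rule equalityI)
    show "carrier ?G \<subseteq> {inv\<^bsub>?G\<^esub> (S_to_G r a) \<otimes>\<^bsub>?G\<^esub> S_to_G r b |a b. a \<in> carrier S \<and> b \<in> carrier S}"
      unfolding car using lfrac SG word_class_carrier by (smt (verit) image_iff mem_Collect_eq subsetI)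
  qed (auto simp: presented_carrier SG jc)
  ultimately show ?thesis unfolding group_of_fractions_def using G_group by blast
qed

text \<open>The universal property of the presentation gives a homomorphism from
  \<open>G_group r\<close> to \<open>H\<close>. It is onto because fractions exhaust
  \<open>H\<close>, and a fraction in its kernel has equal numerator and denominator because
  \<open>j\<close> is injective; the required map is its inverse.\<close>

lemma fractions_unique:
  fixes H :: "'h monoid"
  assumes H: "group_of_fractions S H j"
  shows "\<exists>\<phi>\<in>iso H (G_group r). \<forall>a\<in>carrier S. \<phi> (j a) = S_to_G r a"
proof -
  let ?G = "G_group r"
  interpret G: group ?G by (rule G_group)
  interpret H: group H using H by (simp add: group_of_fractions_def)
  have jh: "j \<in> hom S H" and jinj: "inj_on j (carrier S)" and jH: "carrier H = {j a \<otimes>\<^bsub>H\<^esub> inv\<^bsub>H\<^esub> (j b) |a b. a \<in> carrier S \<and> b \<in> carrier S}"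
    using H by (simp_all add: group_of_fractions_def)
  have jc: "j (cl w) \<in> carrier H" for w using jh by (auto simp: hom_def)
  have jm: "j (cl (u @ v)) = j (cl u) \<otimes>\<^bsub>H\<^esub> j (cl v)" for u v
    using jh unfolding hom_def by (auto simp: presented_mult[symmetric] simp del: presented_mult)
  have j1: "j (cl []) = \<one>\<^bsub>H\<^esub>" using jm[of "[]" "[]"] jc[of "[]"] by simp
  define ev where "ev = case_sum (\<lambda>x. j (cl [x])) (\<lambda>x. inv\<^bsub>H\<^esub> (j (cl [x])))"
  have evc: "ev a \<in> carrier H" for a using jc by (cases a) (simp_all add: ev_def)
  define E where "E w = word_prod H (map ev w)" for w
  have Ec: "E w \<in> carrier H" for w by (induct w) (simp_all add: E_def word_prod_Nil word_prod_Cons evc)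
  have Em: "E (u @ v) = E u \<otimes>\<^bsub>H\<^esub> E v" for u v
    by (induct u) (use Ec evc in \<open>simp_all add: E_def word_prod_Nil word_prod_Cons H.m_assoc\<close>)
  have EInl: "E (map Inl w) = j (cl w)" for w
  proof (induct w)
    case Nil show ?case by (simp add: E_def word_prod_Nil j1)
  next
    case (Cons x w)
    thus ?case using jm[of "[x]" w] by (simp add: E_def word_prod_Cons ev_def)
  qed
  have Erel: "E u = E v" if GR: "(u, v) \<in> GR" for u v
  proof -
    consider p q where "(p, q) \<in> relations r" "u = map Inl p" "v = map Inl q"
      | x where "u = [Inl x, Inr x]" "v = []" | x where "u = [Inr x, Inl x]" "v = []"
      using GR by (auto simp: group_relations_def)
    thus ?thesis
    proof cases
      case 1
      have "cl p = cl q" using word_cong.rel[OF 1(1), of "[]" "[]"] word_class_eq_iff by fastforce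
      thus ?thesis by (simp only: 1 EInl)
    qed (use jc in \<open>simp_all add: E_def word_prod_Nil word_prod_Cons ev_def\<close>)
  qed
  have Econg: "word_cong GR u v \<Longrightarrow> E u = E v" for u v
    by (rule word_cong_invariant[of GR E]) (simp add: Em Erel)
  have car: "carrier ?G = range gc" by (simp add: presented_group_def presented_carrier)
  have mult: "gc u \<otimes>\<^bsub>?G\<^esub> gc v = gc (u @ v)" for u v by (simp add: presented_group_def)
  define \<psi> where "\<psi> g = E (SOME w. gc w = g)" for g
  have \<psi>: "\<psi> (gc w) = E w" for w
  proof -
    have "gc (SOME v. gc v = gc w) = gc w" by (rule someI) (rule HOL.refl)
    thus ?thesis unfolding \<psi>_def by (intro Econg) (simp add: word_class_eq_iff)
  qed
  have \<psi>S: "\<psi> (S_to_G r (cl w)) = j (cl w)" for w by (simp add: S_to_G_cl \<psi> EInl)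
  have hom: "\<psi> \<in> hom ?G H" unfolding hom_def by (auto simp: car \<psi> Ec mult Em)
  interpret h: group_hom ?G H \<psi> by unfold_locales (rule hom)
  have cG: "carrier ?G = {S_to_G r a \<otimes>\<^bsub>?G\<^esub> inv\<^bsub>?G\<^esub> (S_to_G r b) |a b. a \<in> carrier S \<and> b \<in> carrier S}"
    using fractions unfolding group_of_fractions_def by (elim conjE)
  have fG: "\<exists>u v. g = S_to_G r (cl u) \<otimes>\<^bsub>?G\<^esub> inv\<^bsub>?G\<^esub> (S_to_G r (cl v))" if g: "g \<in> carrier ?G" for g
  proof -
    obtain a b where ab: "a \<in> carrier S" "b \<in> carrier S" "g = S_to_G r a \<otimes>\<^bsub>?G\<^esub> inv\<^bsub>?G\<^esub> (S_to_G r b)"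
      using g unfolding cG by blast
    thus ?thesis by (metis presented_carrierE)
  qed
  have sc: "S_to_G r (cl w) \<in> carrier ?G" for w by (simp add: S_to_G_cl car)
  have "g = \<one>\<^bsub>?G\<^esub>" if g: "g \<in> carrier ?G" "\<psi> g = \<one>\<^bsub>H\<^esub>" for g
  proof -
    obtain u v where uv: "g = S_to_G r (cl u) \<otimes>\<^bsub>?G\<^esub> inv\<^bsub>?G\<^esub> (S_to_G r (cl v))" using fG g by blast
    have "j (cl u) \<otimes>\<^bsub>H\<^esub> inv\<^bsub>H\<^esub> (j (cl v)) = \<one>\<^bsub>H\<^esub>" using g(2) sc by (simp add: uv \<psi>S)
    hence "j (cl u) = j (cl v)" using jc by (metis H.inv_equality H.inv_inv H.inv_closed)
    hence "cl u = cl v" using jinj by (auto simp: inj_on_def)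
    thus ?thesis using sc by (simp add: uv)
  qed
  hence "inj_on \<psi> (carrier ?G)" using h.inj_on_one_iff by blast
  moreover have "\<psi> ` carrier ?G = carrier H"
  proof (rule equalityI)
    show "carrier H \<subseteq> \<psi> ` carrier ?G"
    proof
      fix x assume "x \<in> carrier H"
      then obtain u v where "x = j (cl u) \<otimes>\<^bsub>H\<^esub> inv\<^bsub>H\<^esub> (j (cl v))" unfolding jH presented_carrier by blast
      hence "x = \<psi> (S_to_G r (cl u) \<otimes>\<^bsub>?G\<^esub> inv\<^bsub>?G\<^esub> (S_to_G r (cl v)))" using sc by (simp add: \<psi>S)
      thus "x \<in> \<psi> ` carrier ?G" using sc by blast
    qed
  qed (use hom in \<open>auto simp: hom_def\<close>)
  ultimately have iso: "\<psi> \<in> iso ?G H" using hom by (simp add: iso_def bij_betw_def)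
  have "inv_into (carrier ?G) \<psi> \<in> iso H ?G" by (rule G.iso_set_sym[OF iso])
  moreover have "inv_into (carrier ?G) \<psi> (j a) = S_to_G r a" if "a \<in> carrier S" for a
  proof -
    obtain w where "a = cl w" using \<open>a \<in> carrier S\<close> by (rule presented_carrierE)
    thus ?thesis using inv_into_f_f[OF \<open>inj_on \<psi> (carrier ?G)\<close> sc, of w] \<psi>S by simp
  qed
  ultimately show ?thesis by blast
qed

end

subsection \<open>The free associative algebra\<close>

lemma free_induct [case_names zero single add]:
  fixes f :: "('x, 'k::field) free_alg"
  assumes "P 0" "\<And>w c. P (Poly_Mapping.single w c)" "\<And>f g. P f \<Longrightarrow> P g \<Longrightarrow> P (f + g)"
  shows "P f"
proof -
  have "f = (\<Sum>w\<in>Poly_Mapping.keys f. Poly_Mapping.single w (Poly_Mapping.lookup f w))"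
    by (rule poly_mapping_eqI) (auto simp: lookup_sum lookup_single when_def sum.delta in_keys_iff)
  moreover have "P (\<Sum>w\<in>K. Poly_Mapping.single w (Poly_Mapping.lookup f w))" if "finite K" for K
    using that by induct (auto simp: assms)
  ultimately show ?thesis by (metis finite_keys)
qed

text \<open>The linear functional on the free algebra with prescribed values on the basis of
  words.\<close>

definition lf :: "('x list \<Rightarrow> 'k::field) \<Rightarrow> ('x, 'k) free_alg \<Rightarrow> 'k" where
  "lf \<chi> f = (\<Sum>w\<in>Poly_Mapping.keys f. Poly_Mapping.lookup f w * \<chi> w)"

lemma lf_superset: "finite K \<Longrightarrow> Poly_Mapping.keys f \<subseteq> K \<Longrightarrow> lf \<chi> f = (\<Sum>w\<in>K. Poly_Mapping.lookup f w * \<chi> w)"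
  unfolding lf_def by (rule sum.mono_neutral_left) (auto simp: in_keys_iff)

lemma lf_add [simp]: "lf \<chi> (f + g) = lf \<chi> f + lf \<chi> g" and lf_diff [simp]: "lf \<chi> (f - g) = lf \<chi> f - lf \<chi> g"
proof -
  let ?K = "Poly_Mapping.keys f \<union> Poly_Mapping.keys g"
  have k: "lf \<chi> h = (\<Sum>w\<in>?K. Poly_Mapping.lookup h w * \<chi> w)" if "Poly_Mapping.keys h \<subseteq> ?K" for h
    using that by (intro lf_superset) auto
  have s: "Poly_Mapping.keys (f + g) \<subseteq> ?K" "Poly_Mapping.keys (f - g) \<subseteq> ?K" "Poly_Mapping.keys f \<subseteq> ?K" "Poly_Mapping.keys g \<subseteq> ?K"
    by (auto simp: in_keys_iff lookup_add lookup_minus)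
  show "lf \<chi> (f + g) = lf \<chi> f + lf \<chi> g" "lf \<chi> (f - g) = lf \<chi> f - lf \<chi> g"
    unfolding k[OF s(1)] k[OF s(2)] k[OF s(3)] k[OF s(4)]
    by (simp_all add: lookup_add lookup_minus algebra_simps sum.distrib sum_subtractf)
qed

lemma lf_zero [simp]: "lf \<chi> 0 = 0" and lf_single [simp]: "lf \<chi> (Poly_Mapping.single w c) = c * \<chi> w"
  by (simp_all add: lf_def)

lemma lf_monomial [simp]: "lf \<chi> (word_monomial w) = \<chi> w"
  by (simp add: word_monomial_def)

lemma lf_mult_left: "lf \<chi> (Poly_Mapping.single u c * f) = c * lf (\<lambda>w. \<chi> (u @ w)) f"
  by (induct f rule: free_induct) (simp_all add: mult_single plus_list_def algebra_simps)

lemma lf_mult_right: "lf \<chi> (f * Poly_Mapping.single v c) = c * lf (\<lambda>w. \<chi> (w @ v)) f"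
  by (induct f rule: free_induct) (simp_all add: mult_single plus_list_def algebra_simps)

lemma monomial_mult: "word_monomial u * word_monomial v = word_monomial (u @ v)"
  by (simp add: word_monomial_def mult_single plus_list_def)

lemma free_simps:
  "carrier (ring_of_type_algebra :: 'a::ring_1 ring) = UNIV" "a \<oplus>\<^bsub>ring_of_type_algebra\<^esub> b = a + (b::'a)"
  "a \<otimes>\<^bsub>ring_of_type_algebra\<^esub> b = a * (b::'a)" "\<zero>\<^bsub>ring_of_type_algebra\<^esub> = (0::'a)" "\<one>\<^bsub>ring_of_type_algebra\<^esub> = (1::'a)"
  by (simp_all add: ring_of_type_algebra_def)

lemma free_ring: "ring (ring_of_type_algebra :: 'a::ring_1 ring)"
proof (rule ringI)
  show "abelian_group (ring_of_type_algebra :: 'a ring)"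
    by (rule abelian_groupI) (auto simp: free_simps algebra_simps intro: exI[of _ "- _"] left_minus)
  show "Group.monoid (ring_of_type_algebra :: 'a ring)"
    by (rule monoidI) (auto simp: free_simps algebra_simps)
qed (auto simp: free_simps algebra_simps)

lemma free_minus: "\<ominus>\<^bsub>ring_of_type_algebra\<^esub> a = - (a::'a::ring_1)"
proof -
  interpret ring "ring_of_type_algebra :: 'a ring" by (rule free_ring)
  show ?thesis by (rule minus_equality) (simp_all add: free_simps)
qed

context
  fixes F :: "('x, 'k::field) free_alg set"
begin

abbreviation (input) I where "I \<equiv> Idl\<^bsub>free_algebra\<^esub> F"

lemma Idl_ideal: "ideal I free_algebra"
  by (rule ring.genideal_ideal[OF free_ring]) (simp add: free_simps)

lemma Idl_mem: "f \<in> F \<Longrightarrow> f \<in> I"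
  using ring.genideal_self[OF free_ring, of F] by (auto simp: free_simps)

lemma Idl_add: "f \<in> I \<Longrightarrow> g \<in> I \<Longrightarrow> f + g \<in> I" and Idl_uminus: "f \<in> I \<Longrightarrow> - f \<in> I"
  and Idl_mult: "f \<in> I \<Longrightarrow> a * f * b \<in> I" and Idl_zero: "0 \<in> I"
proof -
  interpret ideal I free_algebra by (rule Idl_ideal)
  show "f \<in> I \<Longrightarrow> g \<in> I \<Longrightarrow> f + g \<in> I" using additive_subgroup.a_closed[OF additive_subgroup_axioms, of f g] by (simp add: free_simps)
  show "f \<in> I \<Longrightarrow> - f \<in> I" using additive_subgroup.a_inv_closed[OF additive_subgroup_axioms, of f] by (simp add: free_minus)
  show "0 \<in> I" using additive_subgroup.zero_closed[OF additive_subgroup_axioms] by (simp add: free_simps)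
  show "f \<in> I \<Longrightarrow> a * f * b \<in> I"
    using I_l_closed[of f a] I_r_closed[of "a * f" b] by (simp add: free_simps)
qed

lemma Idl_diff: "f \<in> I \<Longrightarrow> g \<in> I \<Longrightarrow> f - g \<in> I"
  using Idl_add[of f "- g"] Idl_uminus[of g] by simp

text \<open>The elements annihilated by all two-sided translates of the functional form an ideal;
  once it contains the generators it contains \<open>I\<close>. This is the device for showing that
  an element lies outside an ideal.\<close>

lemma Idl_lf:
  assumes F: "\<And>f u v. f \<in> F \<Longrightarrow> lf (\<lambda>w. \<chi> (u @ w @ v)) f = 0" and f: "f \<in> I"
  shows "lf \<chi> f = 0"
proof -
  let ?T = "{f. \<forall>u v. lf (\<lambda>w. \<chi> (u @ w @ v)) f = 0}"
  have l: "lf (\<lambda>w. \<chi> (u @ w @ v)) (x * f) = 0" if "f \<in> ?T" for x f u v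
  proof -
    have "lf (\<lambda>w. \<chi> (u @ p @ w @ v)) f = 0" for p
      using that[unfolded mem_Collect_eq, THEN spec, of "u @ p", THEN spec, of v] by simp
    thus ?thesis by (induct x rule: free_induct) (simp_all add: lf_mult_left distrib_right)
  qed
  have r: "lf (\<lambda>w. \<chi> (u @ w @ v)) (f * x) = 0" if "f \<in> ?T" for x f u v
  proof -
    have "lf (\<lambda>w. \<chi> (u @ w @ p @ v)) f = 0" for p
      using that[unfolded mem_Collect_eq, THEN spec, of u, THEN spec, of "p @ v"] by simp
    thus ?thesis by (induct x rule: free_induct) (simp_all add: lf_mult_right distrib_left)
  qed
  interpret ring "free_algebra :: ('x, 'k) free_alg ring" by (rule free_ring)
  have "ideal ?T free_algebra"
  proof (rule idealI[OF free_ring])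
    show "subgroup ?T (add_monoid free_algebra)"
    proof (rule add.subgroupI)
      show "?T \<noteq> {}" using lf_zero by blast
      fix f assume f: "f \<in> ?T"
      have "lf \<psi> (- f) = - lf \<psi> f" for \<psi> :: "'x list \<Rightarrow> 'k" using lf_diff[of \<psi> 0 f] by simp
      thus "\<ominus>\<^bsub>free_algebra\<^esub> f \<in> ?T" using f by (simp add: free_minus)
      fix g assume "g \<in> ?T"
      thus "f \<oplus>\<^bsub>free_algebra\<^esub> g \<in> ?T" using f by (simp add: free_simps)
    qed (simp add: free_simps)
  qed (use l r in \<open>auto simp: free_simps\<close>)
  moreover have "F \<subseteq> ?T" using F by auto
  ultimately have "I \<subseteq> ?T" by (auto simp: genideal_def)
  hence "lf (\<lambda>w. \<chi> ([] @ w @ [])) f = 0" using f by blast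
  thus ?thesis by simp
qed

end

subsection \<open>Groebner bases and skew-polynomial type\<close>

locale enum_qbset = qbset r for r :: "'x::finite quad_map" +
  fixes xs :: "'x list"
  assumes enum: "enumeration xs"
begin

definition idx :: "'x \<Rightarrow> nat" where "idx x = (SOME i. i < length xs \<and> xs ! i = x)"
abbreviation lt :: "'x \<Rightarrow> 'x \<Rightarrow> bool" where "lt x y \<equiv> idx x < idx y"
abbreviation dl :: "'x list \<Rightarrow> 'x list \<Rightarrow> bool" where "dl u v \<equiv> (u, v) \<in> deglex xs"

lemma idx: "idx x < length xs" "xs ! idx x = x"
proof -
  have "\<exists>i. i < length xs \<and> xs ! i = x" using enum unfolding enumeration_def by (metis UNIV_I in_set_conv_nth)
  hence "idx x < length xs \<and> xs ! idx x = x" unfolding idx_def by (rule someI_ex)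
  thus "idx x < length xs" "xs ! idx x = x" by auto
qed

lemma idx_nth: "i < length xs \<Longrightarrow> idx (xs ! i) = i"
  using enum idx[of "xs ! i"] by (simp add: enumeration_def nth_eq_iff_index_eq)

lemma idx_inj: "idx x = idx y \<longleftrightarrow> x = y"
  by (metis idx(2))

lemma lt_total: "x \<noteq> y \<Longrightarrow> lt x y \<or> lt y x"
  using idx_inj[of x y] by linarith

lemma deglex_eq: "deglex xs = lenlex {(x, y). lt x y}"
proof -
  have "{(xs ! i, xs ! j) |i j. i < j \<and> j < length xs} = {(x, y). lt x y}"
  proof (rule Set.set_eqI, rule HOL.iffI)
    fix p assume "p \<in> {(x, y). lt x y}"
    thus "p \<in> {(xs ! i, xs ! j) |i j. i < j \<and> j < length xs}" using idx by (cases p) (auto, metis)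
  qed (auto simp: idx_nth)
  thus ?thesis by (simp add: deglex_def)
qed

lemma dl_irrefl: "\<not> dl w w"
  unfolding deglex_eq by (rule lenlex_irreflexive) simp

lemma dl_trans: "dl u v \<Longrightarrow> dl v w \<Longrightarrow> dl u w"
  unfolding deglex_eq by (erule lenlex_trans) (auto intro: transI)

lemma dl_total: "u \<noteq> v \<Longrightarrow> dl u v \<or> dl v u"
proof -
  have "total {(x, y). lt x y}" using lt_total by (auto simp: total_on_def)
  hence "total (lenlex {(x, y). lt x y})" by (rule total_lenlex)
  thus "u \<noteq> v \<Longrightarrow> dl u v \<or> dl v u" unfolding deglex_eq total_on_def by blast
qed

lemma dl_wf: "wf (deglex xs)"
proof -
  have "{(x, y). lt x y} = inv_image less_than idx" by (auto simp: inv_image_def)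
  thus ?thesis unfolding deglex_eq by (intro wf_lenlex) simp
qed

lemma dl_replace: "lt p' p \<Longrightarrow> length v' = length v \<Longrightarrow> dl (u @ p' # v') (u @ p # v)"
  unfolding deglex_eq lenlex_conv lex_conv by auto

text \<open>The weakly ascending words are the normal words for leading monomials that run through
  all descending pairs. Their uniqueness within a class is the confluence expressed by a Groebner
  basis.\<close>

definition asc :: "'x list \<Rightarrow> bool" where
  "asc w \<longleftrightarrow> (\<forall>u p q v. w = u @ [p, q] @ v \<longrightarrow> \<not> lt q p)"

definition skewrel :: bool where
  "skewrel \<longleftrightarrow> (\<forall>x y. lt y x \<longrightarrow> lt (L x y) (Li y x) \<and> lt (L x y) x)"

definition unique_asc :: bool where
  "unique_asc \<longleftrightarrow> (\<forall>u v. asc u \<longrightarrow> asc v \<longrightarrow> u ~~ v \<longrightarrow> u = v)"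

lemma asc_exists: assumes skewrel shows "\<exists>w'. w ~~ w' \<and> asc w' \<and> (w' = w \<or> dl w' w)"
proof (induct w rule: wf_induct_rule[OF dl_wf])
  case (1 w)
  show ?case
  proof (cases "asc w")
    case True thus ?thesis using word_cong.refl by blast
  next
    case False
    then obtain u p q v where w: "w = u @ [p, q] @ v" "lt q p" by (auto simp: asc_def)
    let ?w = "u @ [L p q, Li q p] @ v"
    have d: "dl ?w w" unfolding w using assms w(2) dl_replace[of "L p q" p] by (simp add: skewrel_def)
    have c: "w ~~ ?w" unfolding w by (rule step)
    show ?thesis using 1[OF d] c d word_cong.trans dl_trans by metis
  qed
qed

text \<open>Rewriting can be arranged so that a square survives: where a descent overlaps the square
  in one letter, a second relation restores a square by the cyclic conditions, and the word still
  becomes smaller. This is what makes \<open>xs\<close> square-free.\<close>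

lemma asc_double: assumes sk: skewrel shows "\<exists>w' u' y v'. u @ [x, x] @ v ~~ w' \<and> asc w' \<and> w' = u' @ [y, y] @ v'"
proof -
  have "\<forall>u x v. w = u @ [x, x] @ v \<longrightarrow> (\<exists>w' u' y v'. w ~~ w' \<and> asc w' \<and> w' = u' @ [y, y] @ v')" for w
  proof (induct w rule: wf_induct_rule[OF dl_wf])
    case (1 w)
    show ?case
    proof (intro allI impI)
      fix u x v assume w: "w = u @ [x, x] @ v"
      have red: "\<exists>w' u' y v'. w ~~ w' \<and> asc w' \<and> w' = u' @ [y, y] @ v'" if "dl (u' @ [y, y] @ v') w" "w ~~ u' @ [y, y] @ v'" for u' y v'
        using 1[OF that(1)] that(2) word_cong.trans by blast
      show "\<exists>w' u' y v'. w ~~ w' \<and> asc w' \<and> w' = u' @ [y, y] @ v'"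
      proof (cases "asc w")
        case True thus ?thesis using w word_cong.refl by blast
      next
        case False
        then obtain s p q t where s: "w = s @ [p, q] @ t" and pq: "lt q p" by (auto simp: asc_def)
        have sm: "lt (L p q) p" using sk pq by (simp add: skewrel_def)
        have "p \<noteq> q" using pq by auto
        have "(\<exists>c. u = s @ [p, q] @ c) \<or> (u = s @ [p] \<and> q = x) \<or> (s = u @ [x] \<and> p = x) \<or> (\<exists>c. s = u @ [x, x] @ c)"
        proof -
          have e: "u @ x # x # v = s @ p # q # t" using w s by simp
          thus ?thesis using \<open>p \<noteq> q\<close>
            by (auto simp: append_eq_append_conv2 append_eq_Cons_conv Cons_eq_append_conv)
        qed
        then consider c where "u = s @ [p, q] @ c" | "u = s @ [p]" "q = x" | "s = u @ [x]" "p = x"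
          | c where "s = u @ [x, x] @ c" by blast
        thus ?thesis
        proof cases
          case 1
          hence "w = s @ [p, q] @ c @ [x, x] @ v" by (simp add: w)
          thus ?thesis using red[of "s @ [L p q, Li q p] @ c" x v] dl_replace[OF sm, of "Li q p # c @ [x, x] @ v" "q # c @ [x, x] @ v" s]
              step[of s p q "c @ [x, x] @ v"] by simp
        next
          case 2
          \<comment> \<open>The word \<open>p x x\<close> becomes a square of \<open>L p x\<close>
            followed by one letter, since \<open>L ?b x = L p x\<close>.\<close>
          let ?b = "Li x p"
          have w2: "w = s @ [p, x] @ x # v" by (simp add: w 2)
          have "w ~~ s @ [L p x, ?b] @ x # v" unfolding w2 by (rule step)
          moreover have "(s @ [L p x]) @ [?b, x] @ v ~~ (s @ [L p x]) @ [L ?b x, Li x ?b] @ v" by (rule step)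
          ultimately have "w ~~ s @ [L p x, L p x] @ Li x ?b # v"
            by (simp add: cyclic) (erule (1) word_cong.trans)
          moreover have "dl (s @ [L p x, L p x] @ Li x ?b # v) w"
            unfolding w2 using dl_replace[of "L p x" p] sm 2 by simp
          ultimately show ?thesis using red by blast
        next
          case 3
          \<comment> \<open>The word \<open>x x q\<close> becomes one letter followed by a square of
            \<open>?b\<close>, since \<open>Li ?a x = ?b\<close>; the new first letter is below
            \<open>x\<close> by applying \<open>skewrel\<close> twice.\<close>
          let ?a = "L x q" and ?b = "Li q x"
          have t: "v = q # t" using w s 3 by simp
          have w3: "w = (u @ [x]) @ [x, q] @ t" by (simp add: w t)
          have "w ~~ (u @ [x]) @ [?a, ?b] @ t" unfolding w3 by (rule step)
          moreover have "u @ [x, ?a] @ ?b # t ~~ u @ [L x ?a, Li ?a x] @ ?b # t" by (rule step)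
          ultimately have c: "w ~~ (u @ [L x ?a]) @ [?b, ?b] @ t"
            by (simp add: cyclic') (erule (1) word_cong.trans)
          have "lt (L x ?a) x" using sk sm 3 by (simp add: skewrel_def)
          hence "dl ((u @ [L x ?a]) @ [?b, ?b] @ t) w" unfolding w3 using dl_replace[of "L x ?a" x] by simp
          thus ?thesis using red c by blast
        next
          case 4
          hence "w = u @ [x, x] @ c @ [p, q] @ t" by (simp add: s)
          thus ?thesis using red[of u x "c @ [L p q, Li q p] @ t"]
              dl_replace[OF sm, of "Li q p # t" "q # t" "u @ [x, x] @ c"] step[of "u @ [x, x] @ c" p q t] by simp
        qed
      qed
    qed
  qed
  thus ?thesis by blast
qed

lemma asc_xs: "asc xs" and xs_no_double: "xs \<noteq> u @ [y, y] @ v"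
proof -
  have "\<not> lt q p \<and> p \<noteq> q" if "xs = u @ [p, q] @ v" for u p q v
  proof -
    have "xs ! length u = p" "xs ! Suc (length u) = q" "Suc (length u) < length xs"
      using that by (simp_all add: nth_append)
    hence "idx p = length u" "idx q = Suc (length u)" using idx_nth[of "length u"] idx_nth[of "Suc (length u)"] by auto
    thus ?thesis by auto
  qed
  thus "asc xs" "xs \<noteq> u @ [y, y] @ v" unfolding asc_def by blast+
qed

text \<open>The enumeration \<open>xs\<close> is ascending without repeated neighbours. A square in
  its class would reduce to another ascending word with a square, against uniqueness; so
  \<open>xs\<close> is square-free of full length.\<close>

lemma skew_yb: assumes sk: skewrel and un: unique_asc shows yb
proof (rule yb_of_sqfree)
  show "sqfree xs" unfolding sqfree_def
  by (use asc_double sk un asc_xs word_cong.trans xs_no_double unique_asc_def in blast)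
  show "length xs = card (UNIV :: 'x set)" using enum by (metis distinct_card enumeration_def)
qed simp

section \<open>Leading monomials and Groebner bases\<close>

lemma leading:
  fixes f :: "('x, 'k::field) free_alg" assumes "f \<noteq> 0"
  shows "leading_monomial xs f \<in> Poly_Mapping.keys f \<and> (\<forall>u\<in>Poly_Mapping.keys f. u = leading_monomial xs f \<or> dl u (leading_monomial xs f))"
proof -
  have "\<exists>m\<in>K. \<forall>u\<in>K. u = m \<or> dl u m" if "finite K" "K \<noteq> {}" for K
    using that
  proof (induct K rule: finite_ne_induct)
    case (insert x K)
    then obtain m where "m \<in> K" "\<forall>u\<in>K. u = m \<or> dl u m" by blast
    thus ?case using dl_total[of x m] dl_trans by (metis insert_iff)
  qed simp
  from this[of "Poly_Mapping.keys f"] assms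
  obtain m where m: "m \<in> Poly_Mapping.keys f" "\<forall>u\<in>Poly_Mapping.keys f. u = m \<or> dl u m" by auto
  have "leading_monomial xs f = m" unfolding leading_monomial_def
    by (rule the_equality) (use m in blast, metis m dl_trans dl_irrefl)
  thus ?thesis using m by simp
qed

lemma leading_eq:
  assumes "m \<in> Poly_Mapping.keys f" "\<And>u. u \<in> Poly_Mapping.keys f \<Longrightarrow> u = m \<or> dl u m"
  shows "leading_monomial xs f = m"
proof -
  have "f \<noteq> 0" using assms(1) by auto
  thus ?thesis using leading[of f] assms dl_trans dl_irrefl by metis
qed

lemma keys_binomial: "u \<noteq> v \<Longrightarrow> Poly_Mapping.keys (word_monomial u - word_monomial v :: ('x, 'k::field) free_alg) = {u, v}"
  by (auto simp: word_monomial_def in_keys_iff lookup_minus lookup_single when_def split: if_splits)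

lemma leading_binomial:
  assumes "lt p' p"
  shows "leading_monomial xs (word_monomial [p, q] - word_monomial [p', q'] :: ('x, 'k::field) free_alg) = [p, q]"
proof (rule leading_eq)
  have k: "Poly_Mapping.keys (word_monomial [p, q] - word_monomial [p', q'] :: ('x, 'k) free_alg) = {[p, q], [p', q']}"
    using assms by (intro keys_binomial) auto
  show "[p, q] \<in> Poly_Mapping.keys (word_monomial [p, q] - word_monomial [p', q'] :: ('x, 'k) free_alg)" using k by simp
  fix u assume "u \<in> Poly_Mapping.keys (word_monomial [p, q] - word_monomial [p', q'] :: ('x, 'k) free_alg)"
  thus "u = [p, q] \<or> dl u [p, q]" using k dl_replace[OF assms, of "[q']" "[q]" "[]"] by auto
qed

lemma leading_uminus: "leading_monomial xs (- f) = leading_monomial xs f"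
proof -
  have "Poly_Mapping.keys (- f) = Poly_Mapping.keys f" by (auto simp: in_keys_iff)
  thus ?thesis by (simp add: leading_monomial_def)
qed

lemma cong_Idl:
  assumes "(relations0 r :: ('x, 'k::field) free_alg set) \<subseteq> Idl\<^bsub>free_algebra\<^esub> F" "u ~~ v"
  shows "word_monomial u - word_monomial v \<in> Idl\<^bsub>free_algebra\<^esub> F"
  using assms(2)
proof induct
  case (rel u v a b)
  have "word_monomial u - word_monomial v \<in> Idl\<^bsub>free_algebra\<^esub> F" using assms(1) rel by (auto simp: relations0_def)
  hence "word_monomial a * (word_monomial u - word_monomial v) * word_monomial b \<in> Idl\<^bsub>free_algebra\<^esub> F" by (rule Idl_mult)
  thus ?case by (simp add: algebra_simps monomial_mult)
next
  case (refl w) thus ?case by (simp add: Idl_zero)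
next
  case (sym u v) thus ?case using Idl_uminus by fastforce
next
  case (trans u v w) thus ?case using Idl_add by fastforce
qed

text \<open>The difference of two congruent ascending words lies in the ideal, but its leading
  monomial, being one of them, contains no descending pair.\<close>

lemma groebner_unique:
  fixes F :: "('x, 'k::field) free_alg set"
  assumes gb: "groebner_basis xs F" and F: "relations0 r \<subseteq> Idl\<^bsub>free_algebra\<^esub> F"
    and lead: "\<And>g. g \<in> F \<Longrightarrow> \<exists>p q. lt q p \<and> leading_monomial xs g = [p, q]"
  shows unique_asc
  unfolding unique_asc_def
proof (intro allI impI, rule ccontr)
  fix u v assume uv: "asc u" "asc v" "u ~~ v" "u \<noteq> v"
  let ?f = "word_monomial u - word_monomial v :: ('x, 'k) free_alg"
  have k: "Poly_Mapping.keys ?f = {u, v}" by (rule keys_binomial[OF uv(4)])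
  hence f0: "?f \<noteq> 0" by auto
  obtain g a b where g: "g \<in> F" "leading_monomial xs ?f = a @ leading_monomial xs g @ b"
    using gb cong_Idl[OF F uv(3)] f0 unfolding groebner_basis_def by blast
  obtain p q where pq: "lt q p" "leading_monomial xs g = [p, q]" using lead[OF g(1)] by blast
  have "leading_monomial xs ?f = u \<or> leading_monomial xs ?f = v" using leading[OF f0] k by auto
  thus False using uv(1,2) g(2) pq unfolding asc_def by metis
qed

text \<open>Suppose the leading monomial \<open>m\<close> of an ideal element is ascending. The
  indicator of its congruence class kills the ideal; but every other word of the class reduces to
  \<open>m\<close> and is therefore larger, so on \<open>f\<close> the indicator returns the
  coefficient of \<open>m\<close>.\<close>

lemma groebner_of_unique:
  fixes F :: "('x, 'k::field) free_alg set"
  assumes sk: skewrel and un: unique_asc and F: "F \<subseteq> relations0 r"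
    and lead: "\<And>p q. lt q p \<Longrightarrow> \<exists>g\<in>F. g \<noteq> 0 \<and> leading_monomial xs g = [p, q]"
  shows "groebner_basis xs F"
  unfolding groebner_basis_def
proof (intro ballI impI)
  fix f assume f: "f \<in> Idl\<^bsub>free_algebra\<^esub> F" "f \<noteq> 0"
  define m where "m = leading_monomial xs f"
  have m: "m \<in> Poly_Mapping.keys f" "\<And>u. u \<in> Poly_Mapping.keys f \<Longrightarrow> u = m \<or> dl u m"
    using leading[OF f(2)] by (auto simp: m_def)
  have "\<not> asc m"
  proof
    assume am: "asc m"
    define \<chi> :: "'x list \<Rightarrow> 'k" where "\<chi> w = (if w ~~ m then 1 else 0)" for w
    have "lf \<chi> f = 0"
    proof (rule Idl_lf[OF _ f(1)])
      fix g u v assume "g \<in> F"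
      then obtain p q where pq: "(p, q) \<in> relations r" "g = word_monomial p - word_monomial q"
        using F unfolding relations0_def by blast
      have "u @ p @ v ~~ u @ q @ v" using word_cong.rel[OF pq(1)] .
      hence "\<chi> (u @ p @ v) = \<chi> (u @ q @ v)" unfolding \<chi>_def using word_cong.trans word_cong.sym by metis
      thus "lf (\<lambda>w. \<chi> (u @ w @ v)) g = 0" by (simp add: pq(2))
    qed
    moreover have "lf \<chi> f = (\<Sum>w\<in>Poly_Mapping.keys f. if w = m then Poly_Mapping.lookup f m else 0)"
      unfolding lf_def
    proof (rule sum.cong[OF HOL.refl])
      fix w assume w: "w \<in> Poly_Mapping.keys f"
      have "\<not> w ~~ m" if wm: "w \<noteq> m"
      by (metis asc_exists sk word_cong.trans word_cong.sym un am m(2) w wm dl_trans dl_irrefl unique_asc_def)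
      thus "Poly_Mapping.lookup f w * \<chi> w = (if w = m then Poly_Mapping.lookup f m else 0)"
        by (auto simp: \<chi>_def word_cong.refl)
    qed
    ultimately show False using m(1) by (simp add: in_keys_iff)
  qed
  then obtain a p q b where "m = a @ [p, q] @ b" "lt q p" by (auto simp: asc_def)
  thus "\<exists>g\<in>F. g \<noteq> 0 \<and> (\<exists>a b. leading_monomial xs f = a @ leading_monomial xs g @ b)"
    using lead[of q p] unfolding m_def by metis
qed

section \<open>From the shape of the relations to the braid relation\<close>

definition shape :: "'x list set \<Rightarrow> bool" where
  "shape \<rho> \<longleftrightarrow> (\<exists>i j i' j'. i < j \<and> j < length xs \<and> i' < j' \<and> j' < length xs \<and>
     \<rho> = {[xs ! j, xs ! i], [xs ! i', xs ! j']} \<and> j > i')"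

lemma shapeD:
  assumes "shape {[x, y], [x', y']}"
  shows "lt y x \<and> lt x' y' \<and> lt x' x \<or> lt x y \<and> lt y' x' \<and> lt x x'"
proof -
  obtain i j i' j' where ij: "i < j" "j < length xs" "i' < j'" "j' < length xs" "j > i'"
    and e: "{[x, y], [x', y']} = {[xs ! j, xs ! i], [xs ! i', xs ! j']}"
    using assms unfolding shape_def by (elim exE conjE) (rule that)
  have id: "idx (xs ! i) = i" "idx (xs ! j) = j" "idx (xs ! i') = i'" "idx (xs ! j') = j'" using ij by (auto intro!: idx_nth)
  show ?thesis using e ij id by (auto simp: doubleton_eq_iff)
qed

lemma skewrel_of_shape: "(\<And>x y. x \<noteq> y \<Longrightarrow> shape {[x, y], [L x y, Li y x]}) \<Longrightarrow> skewrel"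
  unfolding skewrel_def using shapeD by (metis less_asym less_irrefl)

lemma relations0_mem: "x \<noteq> y \<Longrightarrow> word_monomial [x, y] - word_monomial [L x y, Li y x] \<in> relations0 r"
  unfolding relations0_def using relationsI by blast

lemma skew_type_imp: assumes "skew_polynomial_type TYPE('k::field) r xs" shows yb
proof -
  have gb: "groebner_basis xs (relations0 r :: ('x, 'k) free_alg set)"
    using assms unfolding skew_polynomial_type_def by (elim conjE)
  have "\<forall>\<rho>\<in>unordered_relations r. shape \<rho>"
    using assms unfolding skew_polynomial_type_def shape_def by (elim conjE)
  hence sh: "shape {[x, y], [L x y, Li y x]}" if "x \<noteq> y" for x y
    using relationsI[OF that] unfolding unordered_relations_def by blast
  have sk: skewrel by (rule skewrel_of_shape[OF sh])
  have "\<exists>p q. lt q p \<and> leading_monomial xs g = [p, q]" if g: "g \<in> (relations0 r :: ('x, 'k) free_alg set)" for g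
  proof -
    obtain u v where "(u, v) \<in> relations r" "g = word_monomial u - word_monomial v" using g unfolding relations0_def by blast
    then obtain x y where xy: "x \<noteq> y" "g = word_monomial [x, y] - word_monomial [L x y, Li y x]" by (metis relationsE)
    from shapeD[OF sh[OF xy(1)]] show ?thesis
    proof
      assume "lt y x \<and> lt (L x y) (Li y x) \<and> lt (L x y) x"
      thus ?thesis unfolding xy(2) using leading_binomial by blast
    next
      assume a: "lt x y \<and> lt (Li y x) (L x y) \<and> lt x (L x y)"
      have "g = - (word_monomial [L x y, Li y x] - word_monomial [x, y])" using xy by simp
      hence "leading_monomial xs g = [L x y, Li y x]" using a leading_uminus leading_binomial by metis
      thus ?thesis using a by blast
    qed
  qed
  moreover have "(relations0 r :: ('x, 'k) free_alg set) \<subseteq> Idl\<^bsub>free_algebra\<^esub> (relations0 r)" using Idl_mem by blast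
  ultimately have unique_asc using groebner_unique[OF gb] by blast
  thus ?thesis by (rule skew_yb[OF sk])
qed

end

lemma binomial_skew_imp:
  fixes r :: "'x::finite quad_map"
  assumes "qbset r" and bs: "binomial_skew_polynomial_ring TYPE('k::field) r" shows "qbset.yb r"
proof -
  interpret qbset r by fact
  obtain xs and F :: "('x, 'k) free_alg set" where enum: "enumeration xs" and F: "relations0 r = F \<union> uminus ` F"
    and sh: "\<forall>f\<in>F. \<exists>i j i' j'. i < j \<and> j < length xs \<and> i' < j' \<and> j' < length xs \<and>
            f = word_monomial [xs ! j, xs ! i] - word_monomial [xs ! i', xs ! j'] \<and> j > i'"
    and gb: "groebner_basis xs F"
    using bs unfolding binomial_skew_polynomial_ring_def by blast
  interpret enum_qbset r xs by unfold_locales (rule enum)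
  have neg: "Poly_Mapping.keys (- f) = Poly_Mapping.keys f" for f :: "('x, 'k) free_alg" by (auto simp: in_keys_iff)
  have sk: skewrel
  proof (rule skewrel_of_shape)
    fix x y :: 'x assume xy: "x \<noteq> y"
    let ?g = "word_monomial [x, y] - word_monomial [L x y, Li y x] :: ('x, 'k) free_alg"
    have ne: "[x, y] \<noteq> [L x y, Li y x]" using xy by (metis L_eq_self list.inject)
    \<comment> \<open>\<open>F\<close> holds at least one sign of each relation; which one is
      irrelevant for the set of keys.\<close>
    have "?g \<in> F \<or> - ?g \<in> F" using relations0_mem[OF xy, where 'a='k] unfolding F by force
    moreover have "Poly_Mapping.keys ?g = {[x, y], [L x y, Li y x]}" by (rule keys_binomial[OF ne])
    ultimately obtain f where f: "f \<in> F" "Poly_Mapping.keys f = {[x, y], [L x y, Li y x]}"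
      using neg[of ?g] by metis
    obtain i j i' j' where ij: "i < j" "j < length xs" "i' < j'" "j' < length xs"
      "f = word_monomial [xs ! j, xs ! i] - word_monomial [xs ! i', xs ! j']" "j > i'"
      using sh[THEN bspec, OF f(1)] by (elim exE conjE) (rule that)
    have "[xs ! j, xs ! i] \<noteq> [xs ! i', xs ! j']" using ij idx_nth[of j] idx_nth[of i'] by fastforce
    hence "Poly_Mapping.keys f = {[xs ! j, xs ! i], [xs ! i', xs ! j']}" unfolding ij(5) by (rule keys_binomial)
    thus "shape {[x, y], [L x y, Li y x]}" unfolding shape_def using ij f(2) by metis
  qed
  have "\<exists>p q. lt q p \<and> leading_monomial xs g = [p, q]" if g: "g \<in> F" for g
  proof -
    obtain i j i' j' where ij: "i < j" "j < length xs" "i' < j'" "j' < length xs"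
      "g = word_monomial [xs ! j, xs ! i] - word_monomial [xs ! i', xs ! j']" "j > i'"
      using sh[THEN bspec, OF g] by (elim exE conjE) (rule that)
    have "lt (xs ! i) (xs ! j)" "lt (xs ! i') (xs ! j)" using ij idx_nth[of i] idx_nth[of j] idx_nth[of i'] by simp_all
    thus ?thesis unfolding ij(5) using leading_binomial by blast
  qed
  moreover have "(relations0 r :: ('x, 'k) free_alg set) \<subseteq> Idl\<^bsub>free_algebra\<^esub> F" unfolding F using Idl_mem Idl_uminus by blast
  ultimately have unique_asc using groebner_unique[OF gb] by blast
  thus ?thesis by (rule skew_yb[OF sk])
qed

subsection \<open>Solutions are of skew-polynomial type\<close>

locale ordered_ybset = fin_ybset r + enum_qbset r xs for r :: "'x::finite quad_map" and xs +
  assumes good: "good xs"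
begin

lemma asc_step: "lt p q \<Longrightarrow> lt (Li q p) (L p q) \<and> lt p (L p q)"
proof -
  assume "lt p q"
  then obtain k l where "l < k" "k < length xs" "idx p < k" "L p q = xs ! k" "Li q p = xs ! l"
    using good idx(1)[of q] idx(2)[of p] idx(2)[of q] unfolding good_def by metis
  thus ?thesis using idx_nth[of k] idx_nth[of l] by simp
qed

text \<open>The map \<open>r\<close> sends ascending pairs injectively to descending pairs, hence bijectively.\<close>

lemma skewrel: skewrel
proof -
  define U where "U = {(x, y). lt x y}"
  define D where "D = {(x, y). lt y x}"
  have "inj r" by (rule inj_on_inverseI[of _ r]) (rule rr)
  hence "card (r ` U) = card U" by (simp add: card_image inj_on_subset)
  also have "U = prod.swap ` D" by (auto simp: U_def D_def image_iff)
  hence "card U = card D" by (simp add: card_image)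
  finally have "card (r ` U) = card D" .
  moreover have "r ` U \<subseteq> D" using asc_step by (auto simp: U_def D_def r_eq)
  ultimately have rU: "r ` U = D" by (intro card_subset_eq) simp_all
  show ?thesis unfolding skewrel_def
  proof (intro allI impI)
    fix x y assume "lt y x"
    hence "(x, y) \<in> r ` U" unfolding rU by (simp add: D_def)
    then obtain p q where pq: "lt p q" "x = L p q" "y = Li q p" by (auto simp: U_def r_eq)
    thus "lt (L x y) (Li y x) \<and> lt (L x y) x" using involution(1)[of p q] involution(2)[of q p] asc_step[OF pq(1)] by simp
  qed
qed

lemma asc_mset: assumes "asc u" "asc v" "mset u = mset v" shows "u = v"
proof -
  have "sorted (map idx w)" if "asc w" for w
    unfolding sorted_iff_nth_Suc
  proof (intro allI impI)
    fix i assume i: "Suc i < length (map idx w)"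
    hence "w = take i w @ [w ! i, w ! Suc i] @ drop (Suc (Suc i)) w"
      by (simp add: Cons_nth_drop_Suc)
    hence "\<not> lt (w ! Suc i) (w ! i)" using that unfolding asc_def by blast
    thus "map idx w ! i \<le> map idx w ! Suc i" using i by simp
  qed
  hence "map idx u = map idx v" using assms by (metis mset_map properties_for_sort)
  thus ?thesis using idx_inj by (metis injI map_injective)
qed

text \<open>Ascending words of length \<open>m\<close> are counted by multisets, as are the classes.\<close>

lemma unique_asc: unique_asc
  unfolding unique_asc_def
proof (intro allI impI)
  fix u v assume uv: "asc u" "asc v" "u ~~ v"
  define m where "m = length u"
  define W where "W = {w. asc w \<and> length w = m}"
  define C where "C = cnt ` {w. length w = m}"
  have fin: "finite {w :: 'x list. length w = m}"
    using finite_lists_length_eq[of "UNIV :: 'x set" m] by simp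
  have fW: "finite W" by (rule finite_subset[OF _ fin]) (auto simp: W_def)
  have "C \<subseteq> cnt ` W"
  proof
    fix f assume "f \<in> C"
    then obtain w where w: "f = cnt w" "length w = m" by (auto simp: C_def)
    obtain w' where w': "w ~~ w'" "asc w'" using asc_exists[OF skewrel] by blast
    thus "f \<in> cnt ` W" using w cong_cnt[OF w'(1)] cong_length[OF w'(1)] by (auto simp: W_def)
  qed
  hence CW: "C = cnt ` W" by (auto simp: C_def W_def)
  \<comment> \<open>Every function with total \<open>m\<close> is the head count of some word of
    length \<open>m\<close>, and an ascending word is determined by its multiset of letters, so
    \<open>W\<close> is no larger than \<open>C\<close>. As \<open>cnt\<close> maps \<open>W\<close>
    onto \<open>C\<close>, it is injective on \<open>W\<close>.\<close>
  have "(\<lambda>w. count (mset w)) ` W \<subseteq> C"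
  proof
    fix f assume "f \<in> (\<lambda>w. count (mset w)) ` W"
    then obtain w where w: "f = count (mset w)" "length w = m" by (auto simp: W_def)
    obtain w' where w': "cnt w' = f" using cnt_surj by blast
    have "sum (count (mset w)) UNIV = size (mset w)"
      unfolding size_multiset_overloaded_eq by (rule sum.mono_neutral_right) (auto simp: not_in_iff)
    hence "length w' = m" using cnt_sum[of w'] w w' by simp
    thus "f \<in> C" using w' by (auto simp: C_def)
  qed
  moreover have "inj_on (\<lambda>w. count (mset w)) W"
    by (rule inj_onI) (auto simp: W_def count_inject intro: asc_mset)
  moreover have "finite C" unfolding C_def using fin by blast
  ultimately have "card W \<le> card (cnt ` W)" unfolding CW[symmetric] by (intro card_inj_on_le)
  hence "inj_on cnt W" using card_image_le[OF fW, of cnt] by (intro eq_card_imp_inj_on[OF fW]) simp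
  thus "u = v" using uv cong_length[OF uv(3)] cong_cnt[OF uv(3)] by (auto simp: inj_on_def W_def m_def)
qed

lemma length_xs: "length xs = card (UNIV :: 'x set)"
  using enum by (metis distinct_card enumeration_def)

lemma xs_delta: "xs ~~ delta"
proof -
  have "sqfree xs"
  proof (rule ccontr)
    assume "\<not> sqfree xs"
    then obtain u x v where c: "xs ~~ u @ [x, x] @ v" unfolding sqfree_def by blast
    obtain w' u' y v' where w': "u @ [x, x] @ v ~~ w'" "asc w'" "w' = u' @ [y, y] @ v'"
      using asc_double[OF skewrel] by blast
    have "xs = w'" using unique_asc asc_xs w'(2) word_cong.trans[OF c w'(1)] unfolding unique_asc_def by blast
    thus False using xs_no_double w'(3) by blast
  qed
  thus ?thesis using sqfree_full length_xs cnt_delta by (intro cnt_inj) simp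
qed

text \<open>Any word of the class reduces downwards to an ascending word, and the only ascending
  word there is \<open>xs\<close>.\<close>

lemma regular: "regular_presentation r xs (cl delta)"
  unfolding regular_presentation_def
proof (intro conjI ballI)
  show "cl delta = cl xs" using xs_delta by (simp add: word_class_eq_iff word_cong.sym)
  show "square_free_elem (cl delta)" by (simp add: square_free_class sqfree_delta)
  fix w assume "w \<in> word_orbit r xs"
  hence c: "xs ~~ w" by (simp add: word_orbit_eq)
  obtain w' where w': "w ~~ w'" "asc w'" "w' = w \<or> dl w' w" using asc_exists[OF skewrel] by blast
  have "xs = w'" using unique_asc asc_xs w'(2) word_cong.trans[OF c w'(1)] unfolding unique_asc_def by blast
  thus "w = xs \<or> dl xs w" using w'(3) by auto
qed (rule enum)

text \<open>One index for each unordered relation: its descending side.\<close>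

definition P :: "('x \<times> 'x) set" where "P = {(p, q). lt q p}"

lemma card_P: "card P = length xs choose 2"
proof -
  have "bij_betw (\<lambda>(p, q). {p, q}) P {B. B \<subseteq> UNIV \<and> card B = 2}"
    unfolding bij_betw_def
  proof
    show "inj_on (\<lambda>(p, q). {p, q}) P" by (auto simp: inj_on_def P_def doubleton_eq_iff)
    show "(\<lambda>(p, q). {p, q}) ` P = {B. B \<subseteq> UNIV \<and> card B = 2}"
    proof (rule Set.set_eqI, rule HOL.iffI)
      fix B :: "'x set" assume "B \<in> {B. B \<subseteq> UNIV \<and> card B = 2}"
      then obtain x y where xy: "B = {x, y}" "x \<noteq> y" by (auto simp: card_2_iff)
      hence "(x, y) \<in> P \<or> (y, x) \<in> P" using lt_total[OF xy(2)] by (auto simp: P_def)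
      thus "B \<in> (\<lambda>(p, q). {p, q}) ` P" using xy by (auto simp: image_iff insert_commute)
    qed (auto simp: P_def card_insert_if)
  qed
  hence "card P = card {B. B \<subseteq> (UNIV :: 'x set) \<and> card B = 2}" by (rule bij_betw_same_card)
  thus ?thesis by (simp only: n_subsets[OF finite_UNIV] length_xs)
qed

lemma pair_P: assumes "x \<noteq> y" obtains p q where "(p, q) \<in> P" "(x, y) = (p, q) \<or> (x, y) = (L p q, Li q p)"
proof (cases "lt y x")
  case True thus thesis using that[of x y] by (simp add: P_def)
next
  case False
  hence "lt x y" using lt_total[OF assms] by blast
  thus thesis using that[of "L x y" "Li y x"] asc_step[of x y] involution(1)[of x y] involution(2)[of y x] by (simp add: P_def)
qed

lemma P_lt: "(p, q) \<in> P \<Longrightarrow> lt q p \<and> lt (L p q) (Li q p) \<and> lt (L p q) p \<and> p \<noteq> q"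
  using skewrel by (auto simp: P_def skewrel_def)

lemma P_unique:
  assumes "(p, q) \<in> P" "(p', q') \<in> P" "[x, y] \<in> {[p, q], [L p q, Li q p]}" "[x, y] \<in> {[p', q'], [L p' q', Li q' p']}"
  shows "(p, q) = (p', q')"
proof -
  have "(p, q) = (if lt y x then (x, y) else (L x y, Li y x))"
    if "(p, q) \<in> P" "[x, y] \<in> {[p, q], [L p q, Li q p]}" for p q
    using that P_lt[OF that(1)] involution(1)[of p q] involution(2)[of q p] by auto
  from this[OF assms(1,3)] this[OF assms(2,4)] show ?thesis by simp
qed

lemma P_shape: assumes "(p, q) \<in> P"
  shows "\<exists>i j i' j'. i < j \<and> j < length xs \<and> i' < j' \<and> j' < length xs \<and> p = xs ! j \<and> q = xs ! i \<and>
    L p q = xs ! i' \<and> Li q p = xs ! j' \<and> j > i'"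
  using P_lt[OF assms] idx by (intro exI[of _ "idx q"] exI[of _ "idx p"] exI[of _ "idx (L p q)"] exI[of _ "idx (Li q p)"]) simp

lemma unordered_eq: "unordered_relations r = (\<lambda>(p, q). {[p, q], [L p q, Li q p]}) ` P"
proof (rule Set.set_eqI, rule HOL.iffI)
  fix \<rho> assume "\<rho> \<in> unordered_relations r"
  then obtain u v where uv: "\<rho> = {u, v}" "(u, v) \<in> relations r" unfolding unordered_relations_def by blast
  from uv(2) obtain x y where xy: "u = [x, y]" "v = [L x y, Li y x]" "x \<noteq> y" by (rule relationsE)
  obtain p q where pq: "(p, q) \<in> P" "(x, y) = (p, q) \<or> (x, y) = (L p q, Li q p)" by (rule pair_P[OF xy(3)])
  have "\<rho> = {[p, q], [L p q, Li q p]}" using pq(2) involution(1)[of p q] involution(2)[of q p] by (auto simp: uv xy)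
  thus "\<rho> \<in> (\<lambda>(p, q). {[p, q], [L p q, Li q p]}) ` P" using pq(1) by (intro image_eqI[where x="(p, q)"]) auto
next
  fix \<rho> assume "\<rho> \<in> (\<lambda>(p, q). {[p, q], [L p q, Li q p]}) ` P"
  then obtain p q where pq: "(p, q) \<in> P" "\<rho> = {[p, q], [L p q, Li q p]}" by auto
  thus "\<rho> \<in> unordered_relations r" unfolding unordered_relations_def using relationsI P_lt[OF pq(1)] by blast
qed

lemma skew_type: "skew_polynomial_type TYPE('k::field) r xs"
  unfolding skew_polynomial_type_def
proof (intro conjI allI impI ballI)
  show "card (unordered_relations r) = length xs choose 2"
  proof -
    have "inj_on (\<lambda>(p, q). {[p, q], [L p q, Li q p]}) P"
    proof (rule inj_onI, clarify)
      fix p q p' q' assume "(p, q) \<in> P" "(p', q') \<in> P" and e: "{[p, q], [L p q, Li q p]} = {[p', q'], [L p' q', Li q' p']}"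
      have "[p, q] \<in> {[p', q'], [L p' q', Li q' p']}" unfolding e[symmetric] by simp
      hence "(p, q) = (p', q')" by (intro P_unique[OF \<open>(p, q) \<in> P\<close> \<open>(p', q') \<in> P\<close>, of p q]) simp_all
      thus "p = p' \<and> q = q'" by simp
    qed
    thus ?thesis by (simp add: unordered_eq card_image card_P)
  qed
next
  fix \<rho> assume "\<rho> \<in> unordered_relations r"
  then obtain p q where pq: "(p, q) \<in> P" "\<rho> = {[p, q], [L p q, Li q p]}" unfolding unordered_eq by auto
  from P_shape[OF pq(1)] show "\<exists>i j i' j'. i < j \<and> j < length xs \<and> i' < j' \<and> j' < length xs \<and>
        \<rho> = {[xs ! j, xs ! i], [xs ! i', xs ! j']} \<and> j > i'" unfolding pq(2) by metis
next
  fix x y :: 'x assume "x \<noteq> y"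
  then obtain p q where pq: "(p, q) \<in> P" "(x, y) = (p, q) \<or> (x, y) = (L p q, Li q p)" by (rule pair_P)
  show "\<exists>!\<rho>. \<rho> \<in> unordered_relations r \<and> [x, y] \<in> \<rho>"
  proof (rule ex1I[of _ "{[p, q], [L p q, Li q p]}"])
    show "{[p, q], [L p q, Li q p]} \<in> unordered_relations r \<and> [x, y] \<in> {[p, q], [L p q, Li q p]}"
      unfolding unordered_eq using pq by auto
    fix \<rho> assume "\<rho> \<in> unordered_relations r \<and> [x, y] \<in> \<rho>"
    then obtain p' q' where p': "(p', q') \<in> P" "\<rho> = {[p', q'], [L p' q', Li q' p']}" "[x, y] \<in> \<rho>" unfolding unordered_eq by auto
    have "(p, q) = (p', q')" by (rule P_unique[OF pq(1) p'(1), of x y]) (use pq p' in auto)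
    thus "\<rho> = {[p, q], [L p q, Li q p]}" using p' by simp
  qed
next
  fix x \<rho> assume "\<rho> \<in> unordered_relations r"
  then obtain p q where pq: "(p, q) \<in> P" "\<rho> = {[p, q], [L p q, Li q p]}" unfolding unordered_eq by auto
  show "[x, x] \<notin> \<rho>" using P_lt[OF pq(1)] by (auto simp: pq(2))
next
  show "groebner_basis xs (relations0 r :: ('x, 'k) free_alg set)"
  proof (rule groebner_of_unique[OF skewrel unique_asc])
    fix p q assume lt: "lt q p"
    hence "(p, q) \<in> P" by (simp add: P_def)
    hence ne: "p \<noteq> q" "[p, q] \<noteq> [L p q, Li q p]" "lt (L p q) p" using P_lt by (auto, metis L_eq_self)
    let ?g = "word_monomial [p, q] - word_monomial [L p q, Li q p] :: ('x, 'k) free_alg"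
    have "Poly_Mapping.keys ?g = {[p, q], [L p q, Li q p]}" by (rule keys_binomial[OF ne(2)])
    hence "?g \<noteq> 0" by (metis insert_not_empty keys_zero)
    thus "\<exists>g\<in>(relations0 r :: ('x, 'k) free_alg set). g \<noteq> 0 \<and> leading_monomial xs g = [p, q]"
      using relations0_mem[OF ne(1), where 'a='k] leading_binomial[OF ne(3)] by blast
  qed simp
qed (rule enum)

lemma binomial_skew: "binomial_skew_polynomial_ring TYPE('k::field) r"
proof -
  define g :: "'x \<times> 'x \<Rightarrow> ('x, 'k) free_alg" where
    "g = (\<lambda>(p, q). word_monomial [p, q] - word_monomial [L p q, Li q p])"
  have kg: "Poly_Mapping.keys (g (p, q)) = {[p, q], [L p q, Li q p]}" if "(p, q) \<in> P" for p q
    unfolding g_def prod.case by (rule keys_binomial) (use P_lt[OF that] in auto)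
  have r0: "relations0 r = g ` P \<union> uminus ` g ` P"
  proof (rule Set.set_eqI, rule HOL.iffI)
    fix f :: "('x, 'k) free_alg" assume "f \<in> relations0 r"
    then obtain u v where uv: "f = word_monomial u - word_monomial v" "(u, v) \<in> relations r" unfolding relations0_def by blast
    from uv(2) obtain x y where xy: "u = [x, y]" "v = [L x y, Li y x]" "x \<noteq> y" by (rule relationsE)
    obtain p q where pq: "(p, q) \<in> P" "(x, y) = (p, q) \<or> (x, y) = (L p q, Li q p)" by (rule pair_P[OF xy(3)])
    have "f = g (p, q) \<or> f = - g (p, q)" using pq(2) involution(1)[of p q] involution(2)[of q p] by (auto simp: uv xy g_def)
    thus "f \<in> g ` P \<union> uminus ` g ` P" using pq(1) by blast
  next
    fix f :: "('x, 'k) free_alg" assume "f \<in> g ` P \<union> uminus ` g ` P"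
    then obtain p q where pq: "(p, q) \<in> P" "f = g (p, q) \<or> f = - g (p, q)" by auto
    have "L p q \<noteq> Li q p" using P_lt[OF pq(1)] by auto
    hence "word_monomial [L p q, Li q p] - word_monomial [p, q] \<in> (relations0 r :: ('x, 'k) free_alg set)"
      using relations0_mem[of "L p q" "Li q p"] involution(1)[of p q] involution(2)[of q p] P_lt[OF pq(1)] by auto
    moreover have "g (p, q) \<in> relations0 r" unfolding g_def prod.case using P_lt[OF pq(1)] by (intro relations0_mem) simp
    ultimately show "f \<in> relations0 r" using pq(2) by (auto simp: g_def)
  qed
  have ginj: "(p, q) = (p', q')" if "(p, q) \<in> P" "(p', q') \<in> P" "g (p, q) = g (p', q')" for p q p' q'
  proof (rule P_unique[OF that(1,2), of p q])
    show "[p, q] \<in> {[p', q'], [L p' q', Li q' p']}" using kg[OF that(1)] kg[OF that(2)] that(3) by (metis insertI1)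
  qed simp
  show ?thesis unfolding binomial_skew_polynomial_ring_def
  proof (intro exI[of _ xs] exI[of _ "g ` P"] conjI ballI allI impI)
    show "card (g ` P) = length xs choose 2"
      unfolding card_P[symmetric] by (rule card_image, rule inj_onI) (use ginj in auto)
  next
    fix f assume "f \<in> g ` P"
    then obtain p q where pq: "(p, q) \<in> P" "f = g (p, q)" by auto
    from P_shape[OF pq(1)] show "\<exists>i j i' j'. i < j \<and> j < length xs \<and> i' < j' \<and> j' < length xs \<and>
            f = word_monomial [xs ! j, xs ! i] - word_monomial [xs ! i', xs ! j'] \<and> j > i'"
      unfolding pq(2) g_def prod.case by metis
  next
    fix x y :: 'x assume "x \<noteq> y"
    then obtain p q where pq: "(p, q) \<in> P" "(x, y) = (p, q) \<or> (x, y) = (L p q, Li q p)" by (rule pair_P)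
    show "\<exists>!f. f \<in> g ` P \<and> [x, y] \<in> Poly_Mapping.keys f"
    proof (rule ex1I[of _ "g (p, q)"])
      show "g (p, q) \<in> g ` P \<and> [x, y] \<in> Poly_Mapping.keys (g (p, q))" using pq kg by auto
      fix f assume f: "f \<in> g ` P \<and> [x, y] \<in> Poly_Mapping.keys f"
      then obtain p' q' where p': "(p', q') \<in> P" "f = g (p', q')" by auto
      have "(p, q) = (p', q')" by (rule P_unique[OF pq(1) p'(1), of x y]) (use pq f p' kg[OF p'(1)] in auto)
      thus "f = g (p, q)" using p' by simp
    qed
  next
    fix x f assume "f \<in> g ` P"
    then obtain p q where pq: "(p, q) \<in> P" "f = g (p, q)" by auto
    show "[x, x] \<notin> Poly_Mapping.keys f" using P_lt[OF pq(1)] unfolding pq(2) kg[OF pq(1)] by auto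
  next
    show "groebner_basis xs (g ` P)"
    proof (rule groebner_of_unique[OF skewrel unique_asc])
      show "g ` P \<subseteq> relations0 r" unfolding r0 by blast
      fix p q assume lt: "lt q p"
      hence pq: "(p, q) \<in> P" by (simp add: P_def)
      have "g (p, q) \<noteq> 0" using kg[OF pq] by (metis insert_not_empty keys_zero)
      moreover have "leading_monomial xs (g (p, q)) = [p, q]"
        unfolding g_def prod.case by (rule leading_binomial) (use P_lt[OF pq] in simp)
      ultimately show "\<exists>h\<in>g ` P. h \<noteq> 0 \<and> leading_monomial xs h = [p, q]" using pq by blast
    qed
  qed (rule enum, rule r0)
qed

end

subsection \<open>The Koszul dual\<close>

context
  fixes F :: "('x, 'k::field) free_alg set"
begin

abbreviation (input) qp where "qp \<equiv> quotient_proj F"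

lemma quotient_ring: "ring (quotient_algebra F)"
  unfolding quotient_algebra_def by (rule ideal.quotient_is_ring[OF Idl_ideal])

lemma qp_eq: "qp f = qp g \<longleftrightarrow> f - g \<in> Idl\<^bsub>free_algebra\<^esub> F"
proof -
  have m: "h \<in> qp f \<longleftrightarrow> h - f \<in> Idl\<^bsub>free_algebra\<^esub> F" for h f
  proof -
    have "h \<in> qp f \<longleftrightarrow> (\<exists>i\<in>Idl\<^bsub>free_algebra\<^esub> F. h = i + f)"
      by (auto simp: quotient_proj_def a_r_coset_def' free_simps)
    thus ?thesis by (metis add_diff_cancel_right' diff_add_cancel)
  qed
  show ?thesis
  proof
    assume "qp f = qp g"
    thus "f - g \<in> Idl\<^bsub>free_algebra\<^esub> F" using m[of f f] m[of f g] Idl_zero[of F] by simp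
  next
    assume fg: "f - g \<in> Idl\<^bsub>free_algebra\<^esub> F"
    have "h - f \<in> Idl\<^bsub>free_algebra\<^esub> F \<longleftrightarrow> h - g \<in> Idl\<^bsub>free_algebra\<^esub> F" for h
      using Idl_add[of "h - f" F "f - g"] Idl_diff[of "h - g" F "f - g"] fg by auto
    thus "qp f = qp g" using m by blast
  qed
qed

lemma qp_hom: "qp f \<otimes>\<^bsub>quotient_algebra F\<^esub> qp g = qp (f * g)" "qp f \<oplus>\<^bsub>quotient_algebra F\<^esub> qp g = qp (f + g)"
  "\<zero>\<^bsub>quotient_algebra F\<^esub> = qp 0" "qp f \<in> carrier (quotient_algebra F)"
proof -
  interpret ideal "Idl\<^bsub>free_algebra\<^esub> F" free_algebra by (rule Idl_ideal)
  have h: "qp \<in> Ring.ring_hom free_algebra (quotient_algebra F)"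
    using rcos_ring_hom unfolding quotient_proj_def quotient_algebra_def .
  show "qp f \<otimes>\<^bsub>quotient_algebra F\<^esub> qp g = qp (f * g)" "qp f \<oplus>\<^bsub>quotient_algebra F\<^esub> qp g = qp (f + g)"
    "qp f \<in> carrier (quotient_algebra F)"
    using ring_hom_mult[OF h, of f g] ring_hom_add[OF h, of f g] ring_hom_closed[OF h, of f] by (simp_all add: free_simps)
  show "\<zero>\<^bsub>quotient_algebra F\<^esub> = qp 0"
    using ring_hom_zero[OF h free_ring quotient_ring] by (simp add: free_simps)
qed

end

section \<open>Signed functionals dual to the square-free monomials\<close>

context fin_ybset
begin

text \<open>An arbitrary numbering of the letters, needed only to define signs: \<open>isgn\<close>
  is the sign of a list of distinct letters relative to it, with values in the field, where 1 and -1
  may coincide.\<close>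

definition code :: "'x \<Rightarrow> nat" where "code = (SOME f. inj f)"
definition sg :: "'x \<Rightarrow> 'x \<Rightarrow> 'k::field" where "sg x y = (if code x < code y then 1 else - 1)"
primrec isgn :: "'x list \<Rightarrow> 'k::field" where
  "isgn [] = 1" | "isgn (x # xs) = prod_list (map (sg x) xs) * isgn xs"

lemma sg_swap: "x \<noteq> y \<Longrightarrow> sg x y = - (sg y x :: 'k::field)"
proof -
  have "\<exists>f :: 'x \<Rightarrow> nat. inj f" using finite_imp_inj_to_nat_seg[OF finite[of "UNIV :: 'x set"]] by blast
  hence "inj code" unfolding code_def by (rule someI_ex)
  thus "x \<noteq> y \<Longrightarrow> sg x y = - (sg y x :: 'k)" by (auto simp: sg_def inj_def)
qed

lemma isgn_swap: "x \<noteq> y \<Longrightarrow> isgn (u @ [x, y] @ v) = - (isgn (u @ [y, x] @ v) :: 'k::field)"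
  by (induct u) (simp_all add: sg_swap[of x y] mult_ac)

lemma isgn_square: "isgn u * isgn u = (1 :: 'k::field)"
proof (induct u)
  case (Cons x u)
  have "prod_list (map (sg x) v) * prod_list (map (sg x) v) = (1 :: 'k)" for v
    by (induct v) (simp_all add: sg_def mult_ac)
  moreover have "isgn (x # u) * isgn (x # u) = (prod_list (map (sg x) u) * prod_list (map (sg x) u)) * (isgn u * isgn u :: 'k)"
    by (simp add: mult_ac)
  ultimately show ?case using Cons by simp
qed simp

definition ind :: "'x set \<Rightarrow> 'x \<Rightarrow> nat" where "ind U x = (if x \<in> U then 1 else 0)"
definition rep :: "'x set \<Rightarrow> 'x list" where "rep U = (SOME w. cnt w = ind U)"
text \<open>Square-free classes correspond to the sets of their heads. Up to sign
  \<open>chi U\<close> is the coordinate of the monomial belonging to \<open>U\<close> in the Koszul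
  dual; the sign of the list of heads follows the sign in the Koszul relations.\<close>

definition chi :: "'x set \<Rightarrow> 'x list \<Rightarrow> 'k::field" where
  "chi U w = (if cnt w = ind U then isgn (heads w) else 0)"

lemma cnt_rep: "cnt (rep U) = ind U"
  unfolding rep_def by (rule someI_ex[OF cnt_surj])

lemma ind_inj: "ind U = ind V \<longleftrightarrow> U = V"
  by (auto simp: ind_def fun_eq_iff split: if_splits)

lemma sqfree_ind: "sqfree w \<longleftrightarrow> (\<exists>U. cnt w = ind U)"
proof
  assume "sqfree w"
  hence "cnt w = ind {x. cnt w x = 1}" by (auto simp: sqfree_iff ind_def fun_eq_iff le_Suc_eq)
  thus "\<exists>U. cnt w = ind U" ..
qed (auto simp: sqfree_iff ind_def)

text \<open>A defining relation interchanges two neighbours in the list of heads.\<close>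

lemma isgn_step:
  assumes "x \<noteq> y" shows "isgn (heads (u @ [x, y] @ v)) = - (isgn (heads (u @ [L x y, Li y x] @ v)) :: 'k::field)"
proof -
  have "Lw (u @ [x, y]) = Lw (u @ [L x y, Li y x])" using step[of u x y "[]"] by (intro cong_Lw) simp
  hence e: "map (Lw (u @ [L x y, Li y x])) (heads v) = map (Lw (u @ [x, y])) (heads v)" by simp
  have h1: "heads (u @ [x, y] @ v) = heads u @ [Lw u x, Lw u (L x y)] @ map (Lw (u @ [x, y])) (heads v)"
    unfolding heads_append[of u "[x, y] @ v"] heads_append[of "[x, y]" v] by simp
  have h2: "heads (u @ [L x y, Li y x] @ v) = heads u @ [Lw u (L x y), Lw u x] @ map (Lw (u @ [x, y])) (heads v)"
    unfolding heads_append[of u "[L x y, Li y x] @ v"] heads_append[of "[L x y, Li y x]" v] e[symmetric]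
    by (simp add: involution)
  have "x \<noteq> L x y" using assms L_eq_self[of x y] by metis
  thus ?thesis unfolding h1 h2 by (intro isgn_swap) simp
qed

abbreviation KI :: "('x, 'k::field) free_alg set" where "KI \<equiv> Idl\<^bsub>free_algebra\<^esub> (koszul_relations r)"

lemma chi_KI: assumes "f \<in> KI" shows "lf (chi U) f = (0 :: 'k::field)"
proof (rule Idl_lf[OF _ assms])
  fix f :: "('x, 'k) free_alg" and u v assume "f \<in> koszul_relations r"
  then consider p q where "(p, q) \<in> relations r" "f = word_monomial p + word_monomial q" | x where "f = word_monomial [x, x]"
    unfolding koszul_relations_def by blast
  thus "lf (\<lambda>w. chi U (u @ w @ v)) f = 0"
  proof cases
    case 1
    from 1(1) obtain x y where xy: "p = [x, y]" "q = [L x y, Li y x]" "x \<noteq> y" by (rule relationsE)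
    have c: "cnt (u @ p @ v) = cnt (u @ q @ v)" unfolding xy by (rule cong_cnt[OF step])
    have "isgn (heads (u @ p @ v)) = - (isgn (heads (u @ q @ v)) :: 'k)" unfolding xy by (rule isgn_step[OF xy(3)])
    thus ?thesis unfolding 1 by (simp add: chi_def c)
  next
    case 2
    have "cnt (u @ [x, x] @ v) \<noteq> ind U"
    proof
      assume e: "cnt (u @ [x, x] @ v) = ind U"
      have "cnt (u @ [x, x] @ v) (Lw u x) \<ge> 2" by (simp add: cnt_append)
      thus False unfolding e by (simp add: ind_def split: if_splits)
    qed
    thus ?thesis unfolding 2 by (simp add: chi_def)
  qed
qed

lemma cong_KI: assumes "u ~~ v" shows "\<exists>c::'k::field. word_monomial u - Poly_Mapping.single v c \<in> KI"
proof -
  have mem: "word_monomial a * f * word_monomial b \<in> KI" if "f \<in> koszul_relations r" for a b and f :: "('x, 'k) free_alg"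
    using that by (intro Idl_mult Idl_mem)
  have "(word_monomial u - word_monomial v :: ('x, 'k) free_alg) \<in> KI \<or> (word_monomial u + word_monomial v :: ('x, 'k) free_alg) \<in> KI"
    using assms
  proof induct
    case (rel u v a b)
    hence "word_monomial u + word_monomial v \<in> (koszul_relations r :: ('x, 'k) free_alg set)" by (auto simp: koszul_relations_def)
    from mem[OF this, of a b] show ?case by (simp add: algebra_simps monomial_mult)
  next
    case (refl w) thus ?case by (simp add: Idl_zero)
  next
    case (sym u v) thus ?case using Idl_uminus by (fastforce simp: add.commute)
  next
    case (trans u v w)
    have e: "word_monomial u + word_monomial w = (word_monomial u - word_monomial v) + (word_monomial v + word_monomial w :: ('x, 'k) free_alg)"
      "word_monomial u + word_monomial w = (word_monomial u + word_monomial v) - (word_monomial v - word_monomial w :: ('x, 'k) free_alg)"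
      "word_monomial u - word_monomial w = (word_monomial u - word_monomial v) + (word_monomial v - word_monomial w :: ('x, 'k) free_alg)"
      "word_monomial u - word_monomial w = (word_monomial u + word_monomial v) - (word_monomial v + word_monomial w :: ('x, 'k) free_alg)"
      by simp_all
    show ?case using trans(2,4) Idl_add Idl_diff e by metis
  qed
  thus ?thesis
  proof
    assume "(word_monomial u - word_monomial v :: ('x, 'k) free_alg) \<in> KI"
    thus ?thesis unfolding word_monomial_def by blast
  next
    assume "(word_monomial u + word_monomial v :: ('x, 'k) free_alg) \<in> KI"
    hence "word_monomial u - Poly_Mapping.single v (- 1 :: 'k) \<in> KI"
      by (simp add: word_monomial_def single_uminus)
    thus ?thesis by blast
  qed
qed

lemma chi_rep: "chi V (rep U) * chi V (rep U) = (if U = V then 1 else (0 :: 'k::field))"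
  by (simp add: chi_def cnt_rep ind_inj isgn_square)

text \<open>Modulo the ideal every element is a combination of the monomials \<open>rep U\<close>,
  and \<open>chi V\<close> vanishes on all of these except \<open>rep V\<close>. So the functionals
  determine the ideal, and the \<open>rep U\<close> form a basis of the quotient.\<close>

lemma KI_iff: "f \<in> KI \<longleftrightarrow> (\<forall>U. lf (chi U) f = (0 :: 'k::field))"
proof
  assume z: "\<forall>U. lf (chi U) f = (0 :: 'k)"
  have "\<exists>c :: 'x set \<Rightarrow> 'k. f - (\<Sum>U\<in>UNIV. Poly_Mapping.single (rep U) (c U)) \<in> KI"
  proof (induct f rule: free_induct)
    case zero
    show ?case by (intro exI[of _ "\<lambda>_. 0"]) (simp add: Idl_zero)
  next
    case (single w c)
    have sc: "Poly_Mapping.single w c = Poly_Mapping.single [] c * word_monomial w * 1"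
      by (simp add: word_monomial_def mult_single plus_list_def)
    show ?case
    proof (cases "sqfree w")
      case True
      then obtain U where U: "w ~~ rep U" using cnt_rep cnt_inj sqfree_ind by metis
      obtain d :: 'k where d: "word_monomial w - Poly_Mapping.single (rep U) d \<in> KI" using cong_KI[OF U] by blast
      have "Poly_Mapping.single [] c * (word_monomial w - Poly_Mapping.single (rep U) d) * 1 \<in> KI" by (rule Idl_mult[OF d])
      hence k: "Poly_Mapping.single w c - Poly_Mapping.single (rep U) (c * d) \<in> KI"
        by (simp add: word_monomial_def mult_single plus_list_def algebra_simps)
      have "(\<Sum>V\<in>UNIV. Poly_Mapping.single (rep V) (if V = U then c * d else 0)) = (\<Sum>V\<in>UNIV. if V = U then Poly_Mapping.single (rep U) (c * d) else 0)"
        by (rule sum.cong) auto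
      thus ?thesis using k by (intro exI[of _ "\<lambda>V. if V = U then c * d else 0"]) simp
    next
      case False
      then obtain u x v where uxv: "w ~~ u @ [x, x] @ v" unfolding sqfree_def by blast
      obtain d :: 'k where d: "word_monomial w - Poly_Mapping.single (u @ [x, x] @ v) d \<in> KI" using cong_KI[OF uxv] by blast
      have "word_monomial [x, x] \<in> (koszul_relations r :: ('x, 'k) free_alg set)" by (auto simp: koszul_relations_def)
      hence "Poly_Mapping.single u d * word_monomial [x, x] * word_monomial v \<in> KI" by (intro Idl_mult Idl_mem)
      hence "Poly_Mapping.single (u @ [x, x] @ v) d \<in> KI" by (simp add: word_monomial_def mult_single plus_list_def)
      from Idl_add[OF d this] have "word_monomial w \<in> (KI :: ('x, 'k) free_alg set)" by simp
      hence "Poly_Mapping.single w c \<in> KI" unfolding sc by (rule Idl_mult)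
      thus ?thesis by (intro exI[of _ "\<lambda>_. 0"]) simp
    qed
  next
    case (add f g)
    then obtain c d where cd: "f - (\<Sum>U\<in>UNIV. Poly_Mapping.single (rep U) (c U)) \<in> KI"
      "g - (\<Sum>U\<in>UNIV. Poly_Mapping.single (rep U) (d U)) \<in> KI" by blast
    show ?case using Idl_add[OF cd] by (intro exI[of _ "\<lambda>U. c U + d U"]) (simp add: single_add sum.distrib algebra_simps)
  qed
  then obtain c :: "'x set \<Rightarrow> 'k" where c: "f - (\<Sum>U\<in>UNIV. Poly_Mapping.single (rep U) (c U)) \<in> KI" by blast
  have lfsum: "lf \<chi> (\<Sum>U\<in>K. h U) = (\<Sum>U\<in>K. lf \<chi> (h U))" if "finite K" for \<chi> :: "'x list \<Rightarrow> 'k" and h :: "'x set \<Rightarrow> ('x, 'k) free_alg" and K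
    using that by induct simp_all
  have "c V = 0" for V
  proof -
    have "0 = lf (chi V) f - (\<Sum>U\<in>UNIV. c U * chi V (rep U))" using chi_KI[OF c, of V] by (simp add: lfsum)
    also have "(\<Sum>U\<in>UNIV. c U * chi V (rep U)) = (\<Sum>U\<in>UNIV. if U = V then c V * chi V (rep V) else 0)"
      by (rule sum.cong) (auto simp: chi_def cnt_rep ind_inj)
    finally have "c V * chi V (rep V) = 0" using z by simp
    moreover have "chi V (rep V) \<noteq> (0 :: 'k)" using chi_rep[of V V, where 'k='k] by auto
    ultimately show ?thesis by simp
  qed
  thus "f \<in> KI" using c by simp
qed (use chi_KI in blast)

text \<open>Under a relation inside \<open>w\<close> the signs of the heads of \<open>w\<close> and
  of \<open>u @ w @ v\<close> change together, so their product is constant on the class.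
  Multiplication by fixed words thus turns \<open>chi V\<close> into a nonzero multiple of
  \<open>chi U\<close>.\<close>

lemma chi_context:
  assumes w: "cnt w = ind U" and ext: "\<And>w'. cnt (u @ w' @ v) = ind V \<Longrightarrow> length w' = length w \<Longrightarrow> w' ~~ w"
    and full: "cnt (u @ w @ v) = ind V"
  shows "\<exists>\<kappa>::'k::field. \<kappa> \<noteq> 0 \<and> (\<forall>w'. length w' = length w \<longrightarrow> chi V (u @ w' @ v) = \<kappa> * chi U w')"
proof -
  define \<kappa> :: 'k where "\<kappa> = isgn (heads (u @ w @ v)) * isgn (heads w)"
  have inv: "isgn (heads (u @ w' @ v)) * isgn (heads w') = \<kappa>" if "w' ~~ w" for w'
    unfolding \<kappa>_def
  proof (rule invariant[of "\<lambda>w. isgn (heads (u @ w @ v)) * isgn (heads w)", OF _ that])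
    fix a b x y
    show "isgn (heads (u @ (a @ [x, y] @ b) @ v)) * isgn (heads (a @ [x, y] @ b))
       = (isgn (heads (u @ (a @ [L x y, Li y x] @ b) @ v)) * isgn (heads (a @ [L x y, Li y x] @ b)) :: 'k)"
    proof (cases "x = y")
      case False
      thus ?thesis using isgn_step[OF False, of "u @ a" "b @ v", where 'k='k] isgn_step[OF False, of a b, where 'k='k] by simp
    qed simp
  qed
  have "\<kappa> * \<kappa> = (isgn (heads (u @ w @ v)) * isgn (heads (u @ w @ v))) * (isgn (heads w) * isgn (heads w))"
    by (simp add: \<kappa>_def mult_ac)
  hence "\<kappa> \<noteq> 0" by (auto simp: isgn_square)
  moreover have "chi V (u @ w' @ v) = \<kappa> * chi U w'" if l: "length w' = length w" for w'
  proof (cases "w' ~~ w")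
    case True
    have c: "cnt (u @ w' @ v) = ind V" using full cong_cnt[OF word_cong_context[OF True, of u v]] by simp
    have c': "cnt w' = ind U" using w cong_cnt[OF True] by simp
    have "isgn (heads (u @ w' @ v)) = isgn (heads (u @ w' @ v)) * (isgn (heads w') * isgn (heads w') :: 'k)" by (simp add: isgn_square)
    also have "\<dots> = \<kappa> * isgn (heads w')" using inv[OF True] by (simp add: mult.assoc[symmetric])
    finally show ?thesis by (simp add: chi_def c c')
  next
    case False
    hence "cnt (u @ w' @ v) \<noteq> ind V" "cnt w' \<noteq> ind U" using ext l w cnt_inj by metis+
    thus ?thesis by (simp add: chi_def)
  qed
  ultimately show ?thesis by blast
qed

lemma chi_length: assumes "chi U w \<noteq> (0 :: 'k::field)" shows "length w = card U"
proof -
  have "cnt w = ind U" using assms by (auto simp: chi_def split: if_splits)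
  hence "length w = sum (ind U) UNIV" using cnt_sum[of w] by simp
  thus ?thesis by (simp add: ind_def sum.If_cases)
qed

lemma delta_split: "\<exists>v. delta ~~ rep U @ v" "\<exists>u. delta ~~ u @ rep U"
proof -
  have s: "sqfree (rep U)" using sqfree_ind cnt_rep by blast
  thus "\<exists>v. delta ~~ rep U @ v"
    using left_divides_delta[of "rep U"] by (simp add: left_divides_cl left_divides_iff)
  show "\<exists>u. delta ~~ u @ rep U" using s right_divides_delta[of "rep U"] by (simp add: right_divides_cl)
qed

lemma cnt_UNIV: "cnt w = ind UNIV \<longleftrightarrow> w ~~ delta"
proof -
  have "ind UNIV = (\<lambda>_ :: 'x. 1)" by (rule ext) (simp add: ind_def)
  thus ?thesis by (simp add: cong_iff cnt_delta)
qed

section \<open>The socle and the Frobenius pairing\<close>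

definition hom_deg :: "nat \<Rightarrow> ('x, 'k::field) free_alg set" where
  "hom_deg i = {f. \<forall>w\<in>Poly_Mapping.keys f. length w = i}"

lemma lf_hom: assumes "f \<in> hom_deg i" "\<And>w. length w = i \<Longrightarrow> \<chi> w = c * \<psi> w" shows "lf \<chi> f = c * (lf \<psi> f :: 'k::field)"
  unfolding lf_def sum_distrib_left using assms by (intro sum.cong) (auto simp: hom_deg_def)

lemma chi_hom: assumes "f \<in> hom_deg i" "i \<noteq> card U" shows "lf (chi U) f = (0 :: 'k::field)"
proof -
  have "lf (chi U) f = 0 * lf (\<lambda>_. 0) f"
  proof (rule lf_hom[OF assms(1)])
    fix w :: "'x list" assume "length w = i"
    thus "chi U w = (0 :: 'k) * 0" using chi_length[of U w, where 'k='k] assms(2) by auto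
  qed
  thus ?thesis by simp
qed

text \<open>If \<open>chi U\<close> does not vanish on \<open>f\<close>, the complement
  \<open>v\<close> of \<open>rep U\<close> in \<open>delta\<close> detects it:
  \<open>chi UNIV\<close> on \<open>f * word_monomial v\<close> is a nonzero multiple of
  \<open>chi U\<close> on \<open>f\<close>.\<close>

lemma nondegenerate_left:
  fixes f :: "('x, 'k::field) free_alg"
  assumes f: "f \<in> hom_deg j" and z: "\<And>g. g \<in> hom_deg (card (UNIV :: 'x set) - j) \<Longrightarrow> f * g \<in> KI"
  shows "f \<in> KI"
proof (rule ccontr)
  assume "f \<notin> KI"
  then obtain U where U: "lf (chi U) f \<noteq> 0" using KI_iff by blast
  hence j: "j = card U" using chi_hom[OF f] by blast
  obtain v where v: "delta ~~ rep U @ v" using delta_split by blast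
  have lr: "length (rep U) = card U" using chi_rep[of U U, where 'k='k] by (intro chi_length[where 'k='k]) auto
  have lv: "length v = card (UNIV :: 'x set) - j" using cong_length[OF v] by (simp add: length_delta lr j)
  have "\<exists>\<kappa>::'k. \<kappa> \<noteq> 0 \<and> (\<forall>w'. length w' = length (rep U) \<longrightarrow> chi UNIV ([] @ w' @ v) = \<kappa> * chi U w')"
  proof (rule chi_context[OF cnt_rep])
    show "cnt ([] @ rep U @ v) = ind UNIV" using word_cong.sym[OF v] by (simp add: cnt_UNIV)
    fix w' assume "cnt ([] @ w' @ v) = ind UNIV"
    hence "w' @ v ~~ rep U @ v" using v word_cong.trans by (simp add: cnt_UNIV) blast
    thus "w' ~~ rep U" by (rule right_cancel)
  qed
  then obtain \<kappa> :: 'k where \<kappa>: "\<kappa> \<noteq> 0" "\<And>w'. length w' = j \<Longrightarrow> chi UNIV (w' @ v) = \<kappa> * chi U w'" by (auto simp: lr j)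
  have "lf (chi UNIV) (f * word_monomial v) = lf (\<lambda>w. chi UNIV (w @ v)) f" by (simp add: word_monomial_def lf_mult_right)
  also have "\<dots> = \<kappa> * lf (chi U) f" by (rule lf_hom[OF f]) (rule \<kappa>(2))
  finally have "f * word_monomial v \<notin> KI" using \<kappa>(1) U chi_KI[of "f * word_monomial v" UNIV] by auto
  moreover have "word_monomial v \<in> (hom_deg (card (UNIV :: 'x set) - j) :: ('x, 'k) free_alg set)"
    using lv by (simp add: hom_deg_def word_monomial_def)
  ultimately show False using z by blast
qed

lemma nondegenerate_right:
  fixes f :: "('x, 'k::field) free_alg"
  assumes f: "f \<in> hom_deg i" and z: "\<And>g. g \<in> hom_deg (card (UNIV :: 'x set) - i) \<Longrightarrow> g * f \<in> KI"
  shows "f \<in> KI"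
proof (rule ccontr)
  assume "f \<notin> KI"
  then obtain U where U: "lf (chi U) f \<noteq> 0" using KI_iff by blast
  hence j: "i = card U" using chi_hom[OF f] by blast
  obtain u where u: "delta ~~ u @ rep U" using delta_split by blast
  have lr: "length (rep U) = card U" using chi_rep[of U U, where 'k='k] by (intro chi_length[where 'k='k]) auto
  have lu: "length u = card (UNIV :: 'x set) - i" using cong_length[OF u] by (simp add: length_delta lr j)
  have "\<exists>\<kappa>::'k. \<kappa> \<noteq> 0 \<and> (\<forall>w'. length w' = length (rep U) \<longrightarrow> chi UNIV (u @ w' @ []) = \<kappa> * chi U w')"
  proof (rule chi_context[OF cnt_rep])
    show "cnt (u @ rep U @ []) = ind UNIV" using word_cong.sym[OF u] by (simp add: cnt_UNIV)
    fix w' assume "cnt (u @ w' @ []) = ind UNIV"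
    hence "u @ w' ~~ u @ rep U" using u word_cong.trans by (simp add: cnt_UNIV) blast
    thus "w' ~~ rep U" by (rule left_cancel)
  qed
  then obtain \<kappa> :: 'k where \<kappa>: "\<kappa> \<noteq> 0" "\<And>w'. length w' = i \<Longrightarrow> chi UNIV (u @ w') = \<kappa> * chi U w'" by (auto simp: lr j)
  have "lf (chi UNIV) (word_monomial u * f) = lf (\<lambda>w. chi UNIV (u @ w)) f" by (simp add: word_monomial_def lf_mult_left)
  also have "\<dots> = \<kappa> * lf (chi U) f" by (rule lf_hom[OF f]) (rule \<kappa>(2))
  finally have "word_monomial u * f \<notin> KI" using \<kappa>(1) U chi_KI[of "word_monomial u * f" UNIV] by auto
  moreover have "word_monomial u \<in> (hom_deg (card (UNIV :: 'x set) - i) :: ('x, 'k) free_alg set)"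
    using lu by (simp add: hom_deg_def word_monomial_def)
  ultimately show False using z by blast
qed

text \<open>In top degree only \<open>chi UNIV\<close> can be nonzero, and the coefficient
  \<open>?c\<close> is chosen to match it; the sign is its own inverse.\<close>

lemma socle:
  fixes f :: "('x, 'k::field) free_alg"
  assumes "w ~~ delta" "f \<in> hom_deg (card (UNIV :: 'x set))"
  shows "\<exists>c. f - Poly_Mapping.single w c \<in> KI"
proof -
  have cw: "cnt w = ind UNIV" using assms(1) by (simp add: cnt_UNIV)
  let ?c = "lf (chi UNIV) f * isgn (heads w)"
  have "lf (chi U) (f - Poly_Mapping.single w ?c) = 0" for U
  proof (cases "U = UNIV")
    case True
    have "?c * isgn (heads w) = lf (chi UNIV) f" by (simp add: mult.assoc isgn_square)
    thus ?thesis using True cw by (simp add: chi_def)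
  next
    case False
    hence "card U \<noteq> card (UNIV :: 'x set)" by (metis card_subset_eq finite_UNIV subset_UNIV)
    thus ?thesis using chi_hom[OF assms(2), of U] cw False by (simp add: chi_def ind_inj)
  qed
  thus ?thesis using KI_iff by blast
qed

lemma socle_span:
  fixes w assumes w: "w ~~ delta"
  defines "F \<equiv> koszul_relations r :: ('x, 'k::field) free_alg set"
  shows "quotient_component F (card (UNIV :: 'x set))
     = ring.line_extension (koszul_dual r) (quotient_scalars F) (quotient_proj F (word_monomial w)) {\<zero>\<^bsub>koszul_dual r\<^esub>}"
    and "quotient_proj F (word_monomial w) \<noteq> \<zero>\<^bsub>koszul_dual r\<^esub>"
proof -
  interpret Q: ring "quotient_algebra F" by (rule quotient_ring)
  have lw: "length w = card (UNIV :: 'x set)" using cong_length[OF w] by (simp add: length_delta)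
  have le: "Q.line_extension (quotient_scalars F) (quotient_proj F (word_monomial w)) {\<zero>\<^bsub>quotient_algebra F\<^esub>}
     = range (\<lambda>c. quotient_proj F (Poly_Mapping.single w c))"
    unfolding Q.line_extension_def set_add_def' r_coset_def quotient_scalars_def qp_hom(3)
    by (auto simp: qp_hom(1,2) word_monomial_def mult_single plus_list_def)
  have "quotient_component F (card (UNIV :: 'x set)) = range (\<lambda>c. quotient_proj F (Poly_Mapping.single w c))"
  proof (rule Set.set_eqI, rule HOL.iffI)
    fix a assume "a \<in> quotient_component F (card (UNIV :: 'x set))"
    then obtain f where f: "a = quotient_proj F f" "f \<in> hom_deg (card (UNIV :: 'x set))"
      unfolding quotient_component_def hom_deg_def by blast
    obtain c where "f - Poly_Mapping.single w c \<in> KI" using socle[OF w f(2)] by blast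
    thus "a \<in> range (\<lambda>c. quotient_proj F (Poly_Mapping.single w c))" unfolding f(1) using qp_eq F_def by blast
  next
    fix a assume "a \<in> range (\<lambda>c. quotient_proj F (Poly_Mapping.single w c))"
    then obtain c where a: "a = quotient_proj F (Poly_Mapping.single w c)" by blast
    have "Poly_Mapping.single w c \<in> {f. \<forall>w\<in>Poly_Mapping.keys f. length w = card (UNIV :: 'x set)}" using lw by simp
    thus "a \<in> quotient_component F (card (UNIV :: 'x set))" unfolding quotient_component_def a by (rule imageI)
  qed
  thus "quotient_component F (card (UNIV :: 'x set))
     = ring.line_extension (koszul_dual r) (quotient_scalars F) (quotient_proj F (word_monomial w)) {\<zero>\<^bsub>koszul_dual r\<^esub>}"
    using le by (simp add: F_def)
  have "cnt w = ind UNIV" using w by (simp add: cnt_UNIV)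
  hence "chi UNIV w \<noteq> (0 :: 'k)" using isgn_square[of "heads w", where 'k='k] by (auto simp: chi_def)
  hence "(word_monomial w :: ('x, 'k) free_alg) \<notin> KI" using chi_KI[of "word_monomial w" UNIV] by auto
  thus "quotient_proj F (word_monomial w) \<noteq> \<zero>\<^bsub>koszul_dual r\<^esub>"
    unfolding F_def qp_hom(3) qp_eq by simp
qed

lemma frobenius: "koszul_dual_frobenius TYPE('k::field) r (card (UNIV :: 'x set))"
  unfolding koszul_dual_frobenius_def Let_def frobenius_graded_def
proof (intro conjI allI impI)
  let ?F = "koszul_relations r :: ('x, 'k) free_alg set"
  let ?n = "card (UNIV :: 'x set)"
  interpret Q: ring "quotient_algebra ?F" by (rule quotient_ring)
  have comp: "a \<in> quotient_component ?F i \<longleftrightarrow> (\<exists>f\<in>hom_deg i. a = quotient_proj ?F f)" for a i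
    by (auto simp: quotient_component_def hom_deg_def)
  have zero: "quotient_proj ?F f = \<zero>\<^bsub>quotient_algebra ?F\<^esub> \<longleftrightarrow> f \<in> KI" for f
    unfolding qp_hom(3) qp_eq by simp
  have "Q.dimension (Suc 0) (quotient_scalars ?F) (Q.line_extension (quotient_scalars ?F) (quotient_proj ?F (word_monomial delta)) {\<zero>\<^bsub>quotient_algebra ?F\<^esub>})"
    by (rule Q.Suc_dim[OF qp_hom(4) _ Q.zero_dim]) (use socle_span(2)[OF word_cong.refl, where 'k='k] in simp)
  thus "Q.dimension 1 (quotient_scalars ?F) (quotient_component ?F ?n)"
    using socle_span(1)[OF word_cong.refl, where 'k='k] by simp
  show "quotient_component ?F i = {\<zero>\<^bsub>quotient_algebra ?F\<^esub>}" if "?n < i" for i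
  proof -
    have "f \<in> KI" if f: "f \<in> hom_deg i" for f :: "('x, 'k) free_alg"
      using chi_hom[OF f] card_mono[of "UNIV :: 'x set"] \<open>?n < i\<close> unfolding KI_iff by (metis finite_UNIV leD subset_UNIV)
    moreover have "(0 :: ('x, 'k) free_alg) \<in> hom_deg i" by (simp add: hom_deg_def)
    ultimately show ?thesis using comp zero by blast
  qed
  fix j assume j: "j \<le> ?n"
  show "\<forall>a\<in>quotient_component ?F j. (\<forall>b\<in>quotient_component ?F (?n - j). a \<otimes>\<^bsub>quotient_algebra ?F\<^esub> b = \<zero>\<^bsub>quotient_algebra ?F\<^esub>) \<longrightarrow> a = \<zero>\<^bsub>quotient_algebra ?F\<^esub>"
  proof (intro ballI impI)
    fix a assume "a \<in> quotient_component ?F j"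
      and z: "\<forall>b\<in>quotient_component ?F (?n - j). a \<otimes>\<^bsub>quotient_algebra ?F\<^esub> b = \<zero>\<^bsub>quotient_algebra ?F\<^esub>"
    then obtain f where f: "f \<in> hom_deg j" "a = quotient_proj ?F f" using comp by blast
    have "f * g \<in> KI" if "g \<in> hom_deg (?n - j)" for g
      using z that comp unfolding f(2) by (metis qp_hom(1) zero)
    thus "a = \<zero>\<^bsub>quotient_algebra ?F\<^esub>" unfolding f(2) zero using nondegenerate_left[OF f(1)] by blast
  qed
  show "\<forall>b\<in>quotient_component ?F (?n - j). (\<forall>a\<in>quotient_component ?F j. a \<otimes>\<^bsub>quotient_algebra ?F\<^esub> b = \<zero>\<^bsub>quotient_algebra ?F\<^esub>) \<longrightarrow> b = \<zero>\<^bsub>quotient_algebra ?F\<^esub>"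
  proof (intro ballI impI)
    fix b assume "b \<in> quotient_component ?F (?n - j)"
      and z: "\<forall>a\<in>quotient_component ?F j. a \<otimes>\<^bsub>quotient_algebra ?F\<^esub> b = \<zero>\<^bsub>quotient_algebra ?F\<^esub>"
    then obtain f where f: "f \<in> hom_deg (?n - j)" "b = quotient_proj ?F f" using comp by blast
    have "g * f \<in> KI" if "g \<in> hom_deg (?n - (?n - j))" for g
      using z that comp j unfolding f(2) by (metis qp_hom(1) zero diff_diff_cancel)
    thus "b = \<zero>\<^bsub>quotient_algebra ?F\<^esub>" unfolding f(2) zero using nondegenerate_right[OF f(1)] by blast
  qed
qed

lemma principal: "principal_monomial TYPE('k::field) r (cl delta)"
  unfolding principal_monomial_def Let_def
proof (intro conjI ballI)
  let ?F = "koszul_relations r :: ('x, 'k) free_alg set"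
  interpret Q: ring "quotient_algebra ?F" by (rule quotient_ring)
  show "square_free_elem (cl delta)" by (simp add: square_free_class sqfree_delta)
  have "length ` cl delta = (\<lambda>_. card (UNIV :: 'x set)) ` cl delta"
    by (rule image_cong[OF HOL.refl]) (metis cong_length length_delta word_class_mem)
  also have "\<dots> = {card (UNIV :: 'x set)}"
    by (rule image_constant[of delta]) (simp add: word_cong.refl)
  finally have "length ` cl delta = {card (UNIV :: 'x set)}" .
  thus "S_length (cl delta) = card (UNIV :: 'x set)" by (simp add: S_length_def)
  fix w assume "w \<in> cl delta"
  hence "w ~~ delta" by (simp add: word_cong.sym)
  thus "Q.Span (quotient_scalars ?F) [quotient_proj ?F (word_monomial w)] = quotient_component ?F (card (UNIV :: 'x set))"
    using socle_span(1)[of w, where 'k='k] by simp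
qed simp

end

text \<open>The common source for the Garside and the quantum condition: each contains a regular
  presentation, which is a square-free word with one letter for each element of X.\<close>

lemma (in qbset) regular_presentation_yb:
  assumes "finite (UNIV :: 'x set)" "regular_presentation r xs a" shows yb
proof (rule yb_of_sqfree[OF assms(1)])
  show "sqfree xs" using assms(2) by (auto simp: regular_presentation_def square_free_class)
  show "length xs = card (UNIV :: 'x set)"
    using assms(2) by (metis distinct_card enumeration_def regular_presentation_def)
qed

lemma (in ordered_ybset) regular_garside: "regular_garside_monoid r"
  unfolding regular_garside_monoid_def
proof (intro bexI[of _ "cl delta"] conjI ballI impI)
  show "garside_monoid S (cl delta)" by (rule garside)
  show "\<exists>xs. regular_presentation r xs (cl delta)" using regular by blast
  fix a assume a: "a \<in> carrier S" "square_free_elem a \<and> S_length a \<le> card (UNIV :: 'x set)"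
  obtain w where w: "a = cl w" using a(1) by (rule presented_carrierE)
  hence "sqfree w" using a(2) by (simp add: square_free_class)
  thus "left_divides S a (cl delta)" "right_divides S a (cl delta)"
    by (simp_all add: w left_divides_delta right_divides_delta)
qed simp

theorem theorem1p14:
  fixes r :: "'x::finite \<times> 'x \<Rightarrow> 'x \<times> 'x"
  assumes "quantum_binomial_set r" and "lri r"
  shows "(regular_garside_monoid r \<longleftrightarrow> regular_quantum_monoid TYPE('k::field) r) \<and>
         (regular_quantum_monoid TYPE('k) r \<longleftrightarrow> (\<exists>xs. skew_polynomial_type TYPE('k) r xs)) \<and>
         ((\<exists>xs. skew_polynomial_type TYPE('k) r xs) \<longleftrightarrow> binomial_skew_polynomial_ring TYPE('k) r) \<and>
         (binomial_skew_polynomial_ring TYPE('k) r \<longleftrightarrow> yang_baxter r) \<and>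
         (regular_garside_monoid r \<or> regular_quantum_monoid TYPE('k) r \<or>
          (\<exists>xs. skew_polynomial_type TYPE('k) r xs) \<or> binomial_skew_polynomial_ring TYPE('k) r \<or>
          yang_baxter r \<longrightarrow>
          (\<exists>\<Delta>\<in>carrier (S_monoid r).
             comprehensive_garside_monoid (S_monoid r) \<Delta> \<and>
             group_of_fractions (S_monoid r) (G_group r) (S_to_G r) \<and>
             (\<forall>(H :: 'h monoid) j. group_of_fractions (S_monoid r) H j \<longrightarrow>
                (\<exists>\<phi>\<in>iso H (G_group r). \<forall>a\<in>carrier (S_monoid r). \<phi> (j a) = S_to_G r a)) \<and>
             garside_group (S_monoid r) \<Delta> (G_group r) (S_to_G r)))"
proof -
  interpret qbset r by unfold_locales (rule assms)+
  have "yb" if "regular_garside_monoid r"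
    using that regular_presentation_yb[OF finite] unfolding regular_garside_monoid_def by blast
  moreover have "yb" if "regular_quantum_monoid TYPE('k) r"
    using that regular_presentation_yb[OF finite] unfolding regular_quantum_monoid_def by blast
  moreover have "yb" if ex: "\<exists>xs. skew_polynomial_type TYPE('k) r xs"
  proof -
    obtain xs where sk: "skew_polynomial_type TYPE('k) r xs" using ex ..
    interpret enum_qbset r xs
      using sk by unfold_locales (simp add: skew_polynomial_type_def)
    show ?thesis by (rule skew_type_imp[OF sk])
  qed
  moreover have "yb" if "binomial_skew_polynomial_ring TYPE('k) r"
    by (rule binomial_skew_imp[OF qbset_axioms that])
  moreover have "regular_garside_monoid r \<and> regular_quantum_monoid TYPE('k) r \<and>
      (\<exists>xs. skew_polynomial_type TYPE('k) r xs) \<and> binomial_skew_polynomial_ring TYPE('k) r \<and>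
      (\<exists>\<Delta>\<in>carrier (S_monoid r).
             comprehensive_garside_monoid (S_monoid r) \<Delta> \<and>
             group_of_fractions (S_monoid r) (G_group r) (S_to_G r) \<and>
             (\<forall>(H :: 'h monoid) j. group_of_fractions (S_monoid r) H j \<longrightarrow>
                (\<exists>\<phi>\<in>iso H (G_group r). \<forall>a\<in>carrier (S_monoid r). \<phi> (j a) = S_to_G r a)) \<and>
             garside_group (S_monoid r) \<Delta> (G_group r) (S_to_G r))" if yb: yb
  proof -
    interpret fin_ybset r by unfold_locales (rule yb)
    \<comment> \<open>The full set is invariant under all \<open>L x\<close>, so a compatible
      enumeration exists; the same one serves regularity and both skew-polynomial
      conditions.\<close>
    obtain xs where xs: "good xs" "set xs = UNIV" using good_exists[of UNIV] by auto
    interpret ordered_ybset r xs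
      using xs by unfold_locales (auto simp: enumeration_def good_def)
    have "regular_quantum_monoid TYPE('k) r"
      unfolding regular_quantum_monoid_def using frobenius principal regular by blast
    moreover have "\<exists>\<Delta>\<in>carrier S. comprehensive_garside_monoid S \<Delta> \<and> group_of_fractions S (G_group r) (S_to_G r) \<and>
        (\<forall>(H :: 'h monoid) j. group_of_fractions S H j \<longrightarrow> (\<exists>\<phi>\<in>iso H (G_group r). \<forall>a\<in>carrier S. \<phi> (j a) = S_to_G r a)) \<and>
        garside_group S \<Delta> (G_group r) (S_to_G r)"
      unfolding comprehensive_garside_monoid_def garside_group_def
      using garside comprehensive fractions fractions_unique
      by (intro bexI[of _ "cl delta"] conjI allI impI) simp_all
    ultimately show ?thesis using regular_garside skew_type binomial_skew by blast
  qed
  ultimately show ?thesis unfolding yang_baxter_iff by blast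
qed

end
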